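(* Suppose that $-1\le\sigma<\frac bq$, where $\sigma=\frac bq\big(l-1+\frac{p-1}{h-1}\big)-\frac aq$. Suppose that there is an integer $L$ with $0\le L\le\min\{N-M,2M-1\}$ such that $\Lambda_K\equiv0$ for all $K<L$ and $\Lambda_L\not\equiv0$, and that there is $\varphi_0\in\mathbb R$ with $\Lambda_L(0,\varphi_0)=0$ and $\lambda_L:=\partial_\varphi\Lambda_L(0,\varphi_0)\neq0$. Then, for sufficiently large $n\ge L$, the truncated system $$\frac{d\varrho}{d\tau}=\sum_{K=L}^n\tau^{-\frac{M+K}N}\Lambda_K(\varrho,\varphi),\qquad \frac{d\varphi}{d\tau}=\sum_{K=0}^n\tau^{-\frac{M+K}N}\Omega_K(\varrho,\varphi)$$ has a particular solution $\varrho_\ast(\tau),\varphi_\ast(\tau)$ with asymptotic expansion of the form $$\varrho(\tau)=\sum_{K=0}^\infty\varrho_K\tau^{-\frac{M+K}N},\qquad \varphi(\tau)=\varphi_0+\sum_{K=1}^\infty\varphi_K\tau^{-\frac KN},\qquad \tau\to\infty,$$ where $\varrho_K,\varphi_K$ are constants.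
   Context: Setting. $h\ge2$, $a,b,q$ are integers with $1\le a,b\le q$; $l,p$ are integers with $0\le l\le p\le 2h-1$; $s>0$; $S(t)=st^{1+b/q}$; $H(x,y)=\frac{y^2}{2}+U(x)$, $U(x)=\frac{x^{2h}}{2h}+\sum_{i=1}^{2h-1}u_ix^i$ with real constants $u_i$. The functions $f(x,y,S,t)$, $g(x,y,S,t)$ are infinitely differentiable for $(x,y,S)\in\mathbb R^3$, $t>0$, $2\pi$-periodic in $S$, and have power-law asymptotics as $t\to\infty$: $f=\sum_{k\ge0}t^{-k/q}f_k(x,y,S)$, $g=\sum_{k\ge0}t^{-k/q}g_k(x,y,S)$ with $f_k=\sum_{i=0}^p\sum_{j=0}^{l-1}A_{k,i,j}(S)x^iy^j$, $g_k=\sum_{i=0}^p\sum_{j=0}^{l}B_{k,i,j}(S)x^iy^j$, where $A_{k,i,j},B_{k,i,j}$ are $2\pi$-periodic and vanish identically if $i+j>p$. The perturbed system is $\dot x=\partial_yH+t^{-a/q}f(x,y,S(t),t)$, $\dot y=-\partial_xH+t^{-a/q}g(x,y,S(t),t)$. Energy-angle variables. $E_0>0$ is such that for all $E>E_0$ the level lines $\{H=E\}$ are closed curves containing no fixed points of $\dot x=\partial_yH$, $\dot y=-\partial_xH$. For $E>E_0$ let $x_0(t,E),y_0(t,E)$ be the corresponding periodic solution (depending smoothly on $E$), $T(E)$ its period, $\omega(E)=2\pi/T(E)$, $X(\phi,E)=x_0(\phi/\omega(E),E)$, $Y(\phi,E)=y_0(\phi/\omega(E),E)$. The initial phase of the family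 is chosen so that, as $E\to\infty$, $X=E^{\frac1{2h}}\sum_{j\ge0}E^{-\frac j{2h}}X_j(\phi)$, $Y=E^{\frac12}\sum_{j\ge0}E^{-\frac j{2h}}Y_j(\phi)$, $\omega=E^{\frac{h-1}{2h}}\sum_{j\ge0}E^{-\frac j{2h}}\omega_j$ with $2\pi$-periodic $X_j,Y_j$ and constants $\omega_j$, $\omega_0=2\pi/\kappa$, $\kappa=\sqrt2(2h)^{\frac1{2h}}\int_{-1}^1\frac{d\varsigma}{\sqrt{1-\varsigma^{2h}}}$. With $X=X(\phi,I)$, $Y=Y(\phi,I)$ put $F(I,\phi,S,t)=f(X,Y,S,t)U'(X)+g(X,Y,S,t)Y$, $G(I,\phi,S,t)=\omega(I)\big(f(X,Y,S,t)\partial_EY-g(X,Y,S,t)\partial_EX\big)$. Rescaled variables. $\varkappa$ is a fixed positive integer. $E_1\ge E_0$ is such that $\omega'(E)>0$ for $E\ge E_1$, and $I_\ast(t)\ge E_1$ is the smooth solution, defined for $t\ge t_1$ with some $t_1>0$, of $\omega(I_\ast(t))=\varkappa^{-1}S'(t)$. Constants: $\vartheta=s(1+\frac bq)$, $\mu=\frac12(\frac bq-\sigma)>0$, $\nu=1+2\mu+\sigma=1+\frac bq$, $M=2\mu q(h-1)$, $N=2\nu q(h-1)$ (integers). The variables $r,\theta,\tau$ are defined by $x=X(\phi,I)$, $y=Y(\phi,I)$, $I=I_\ast(t)(1+t^{-\mu}r)^{2h}$, $\phi=\theta+\varkappa^{-1}S(t)$, $\tau=t^\nu/\nu$; $\zeta(\tau)=S(t)=\vartheta\tau$.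 They satisfy $\frac{dr}{d\tau}=\tau^{-\frac MN}\mathcal A(r,\theta,\zeta(\tau),\tau)$, $\frac{d\theta}{d\tau}=\tau^{-\frac MN}\mathcal B(r,\theta,\zeta(\tau),\tau)$, where, with $t=(\nu\tau)^{1/\nu}$, $I=I_\ast(t)(1+t^{-\mu}r)^{2h}$, $\phi=\theta+\varkappa^{-1}\zeta$, $$\tau^{-\frac MN}\mathcal A=t^{1-\nu+\mu}\Big[\frac{t^{-a/q}F(I,\phi,\zeta,t)}{2hI_\ast(t)(1+t^{-\mu}r)^{2h-1}}-\frac{I_\ast'(t)}{2hI_\ast(t)}(1+t^{-\mu}r)+\mu t^{-\mu-1}r\Big],$$ $$\tau^{-\frac MN}\mathcal B=t^{1-\nu}\big[\omega(I)-\omega(I_\ast(t))+t^{-a/q}G(I,\phi,\zeta,t)\big].$$ Inserting the asymptotic series of $f,g,X,Y,\omega,I_\ast$ gives, as $\tau\to\infty$ uniformly for bounded $r$ and $\theta\in\mathbb R$, $\mathcal A=\sum_{K\ge0}\tau^{-\frac KN}\mathcal A_K(r,\theta,\zeta)$, $\mathcal B=\sum_{K\ge0}\tau^{-\frac KN}\mathcal B_K(r,\theta,\zeta)$, with $\mathcal A_K,\mathcal B_K$ polynomial in $r$, $2\pi$-periodic in $\theta$, $2\pi\varkappa$-periodic in $\zeta$. Averaging. The functions $\Lambda_K(r,\theta),\Omega_K(r,\theta),\rho_K(r,\theta,\zeta),\psi_K(r,\theta,\zeta)$, $K\ge0$ (smooth, $2\pi$-periodic in $\theta$; $\rho_K,\psi_K$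 being $2\pi\varkappa$-periodic in $\zeta$ with zero mean over $\zeta$) are the uniquely determined ones such that, with $R_\infty=r+\sum_{K\ge0}\tau^{-\frac{M+K}N}\rho_K$, $\Psi_\infty=\theta+\sum_{K\ge0}\tau^{-\frac{M+K}N}\psi_K$, one has, as formal series in powers of $\tau^{-1/N}$ (right-hand sides Taylor-expanded about $(r,\theta)$), $$\Big(\tau^{-\frac MN}(\mathcal A\partial_r+\mathcal B\partial_\theta)+\partial_\tau+\vartheta\partial_\zeta\Big)\begin{pmatrix}R_\infty\\ \Psi_\infty\end{pmatrix}=\sum_{K\ge0}\tau^{-\frac{M+K}N}\begin{pmatrix}\Lambda_K(R_\infty,\Psi_\infty)\\ \Omega_K(R_\infty,\Psi_\infty)\end{pmatrix}.$$ In the claim these functions are evaluated at $(\varrho,\varphi)$ in place of $(r,\theta)$; the truncated system is considered for $\tau>\tau_0$ with some $\tau_0>0$. *)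

theory Defs
  imports "HOL-Analysis.Analysis" "HOL-Computational_Algebra.Formal_Power_Series"
begin

section \<open>Smoothness and asymptotic expansions\<close>

text \<open>Used only for open sets \<open>S\<close>.\<close>

fun ck_on :: "nat \<Rightarrow> 'a::real_normed_vector set \<Rightarrow> ('a \<Rightarrow> 'b::real_normed_vector) \<Rightarrow> bool" where
  "ck_on 0 S f \<longleftrightarrow> continuous_on S f"
| "ck_on (Suc k) S f \<longleftrightarrow>
     (\<forall>x\<in>S. f differentiable (at x)) \<and> (\<forall>v. ck_on k S (\<lambda>x. frechet_derivative f (at x) v))"

definition smooth_on :: "'a::real_normed_vector set \<Rightarrow> ('a \<Rightarrow> 'b::real_normed_vector) \<Rightarrow> bool" where
  "smooth_on S f \<longleftrightarrow> (\<forall>k. ck_on k S f)"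

text \<open>
  \<open>F x\<close> is asymptotic to \<open>\<Sum>k. c k x\<^sup>\<alpha>\<^sup>-\<^sup>k\<^sup>/\<^sup>d\<close> as \<open>x\<close> tends to infinity, in the sense of
  Poincare; in the second definition the estimates are uniform in the parameter \<open>z \<in> P\<close>.
\<close>

definition power_expansion ::
  "real \<Rightarrow> real \<Rightarrow> (real \<Rightarrow> real) \<Rightarrow> (nat \<Rightarrow> real) \<Rightarrow> bool" where
  "power_expansion \<alpha> d F c \<longleftrightarrow>
     (\<forall>n. \<exists>C. \<forall>\<^sub>F x in at_top.
        \<bar>F x - (\<Sum>k<n. c k * x powr (\<alpha> - real k / d))\<bar> \<le> C * x powr (\<alpha> - real n / d))"

definition uniform_power_expansion ::
  "real \<Rightarrow> real \<Rightarrow> 'p set \<Rightarrow> ('p \<Rightarrow> real \<Rightarrow> real) \<Rightarrow> (nat \<Rightarrow> 'p \<Rightarrow> real) \<Rightarrow> bool" where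
  "uniform_power_expansion \<alpha> d P F c \<longleftrightarrow>
     (\<forall>n. \<exists>C. \<forall>\<^sub>F x in at_top. \<forall>z\<in>P.
        \<bar>F z x - (\<Sum>k<n. c k z * x powr (\<alpha> - real k / d))\<bar> \<le> C * x powr (\<alpha> - real n / d))"

text \<open>
  Functions of \<open>(x, y, S, t)\<close>, expanded in powers of \<open>t\<^sup>-\<^sup>1\<^sup>/\<^sup>q\<close>.  The expansion is going to be
  evaluated at points \<open>(x, y)\<close> that grow like powers of \<open>t\<close>; therefore the remainders are
  \<open>O(t\<^sup>-\<^sup>n\<^sup>/\<^sup>q)\<close> uniformly in \<open>S\<close> and up to a weight of polynomial growth in \<open>(x, y)\<close>, whose
  degree \<open>m\<close> is arbitrary but does not depend on \<open>n\<close>.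
\<close>

definition force_expansion ::
  "nat \<Rightarrow> (real \<Rightarrow> real \<Rightarrow> real \<Rightarrow> real \<Rightarrow> real) \<Rightarrow> (nat \<Rightarrow> real \<Rightarrow> real \<Rightarrow> real \<Rightarrow> real) \<Rightarrow> bool" where
  "force_expansion q f c \<longleftrightarrow>
     (\<exists>m::nat. uniform_power_expansion 0 (real q) UNIV
        (\<lambda>(x, y, S) t. f x y S t / (1 + \<bar>x\<bar> + \<bar>y\<bar>) ^ m)
        (\<lambda>k (x, y, S). c k x y S / (1 + \<bar>x\<bar> + \<bar>y\<bar>) ^ m))"


section \<open>The perturbed Hamiltonian system\<close>

definition potential :: "nat \<Rightarrow> (nat \<Rightarrow> real) \<Rightarrow> real \<Rightarrow> real" where
  "potential h u x = x ^ (2 * h) / (2 * real h) + (\<Sum>i = 1..2 * h - 1. u i * x ^ i)"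

definition hamiltonian :: "nat \<Rightarrow> (nat \<Rightarrow> real) \<Rightarrow> real \<Rightarrow> real \<Rightarrow> real" where
  "hamiltonian h u x y = y\<^sup>2 / 2 + potential h u x"

text \<open>
  The system is \<open>x' = \<partial>\<^sub>yH + t\<^sup>-\<^sup>a\<^sup>/\<^sup>q f(x, y, S(t), t)\<close>, \<open>y' = -\<partial>\<^sub>xH + t\<^sup>-\<^sup>a\<^sup>/\<^sup>q g(x, y, S(t), t)\<close>.
\<close>

locale perturbed_oscillator =
  fixes h a b q l p :: nat
    and s \<sigma> :: real
    and u :: "nat \<Rightarrow> real"
    and f g :: "real \<Rightarrow> real \<Rightarrow> real \<Rightarrow> real \<Rightarrow> real"
    and A B :: "nat \<Rightarrow> nat \<Rightarrow> nat \<Rightarrow> real \<Rightarrow> real"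
  assumes h_ge_2: "2 \<le> h"
    and a_bounds: "1 \<le> a" "a \<le> q"
    and b_bounds: "1 \<le> b" "b \<le> q"
    and l_le_p: "l \<le> p"
    and p_le: "p \<le> 2 * h - 1"
    and s_pos: "0 < s"
    and sigma_eq:
      "\<sigma> = real b / real q * (real l - 1 + (real p - 1) / (real h - 1)) - real a / real q"
    and f_smooth: "smooth_on (UNIV \<times> UNIV \<times> UNIV \<times> {0<..}) (\<lambda>(x, y, S, t). f x y S t)"
    and g_smooth: "smooth_on (UNIV \<times> UNIV \<times> UNIV \<times> {0<..}) (\<lambda>(x, y, S, t). g x y S t)"
    and f_periodic: "\<And>x y S t. 0 < t \<Longrightarrow> f x y (S + 2 * pi) t = f x y S t"
    and g_periodic: "\<And>x y S t. 0 < t \<Longrightarrow> g x y (S + 2 * pi) t = g x y S t"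
    and f_expansion:
      "force_expansion q f (\<lambda>k x y S. \<Sum>i\<le>p. \<Sum>j<l. A k i j S * x ^ i * y ^ j)"
    and g_expansion:
      "force_expansion q g (\<lambda>k x y S. \<Sum>i\<le>p. \<Sum>j\<le>l. B k i j S * x ^ i * y ^ j)"
    and A_periodic: "\<And>k i j S. A k i j (S + 2 * pi) = A k i j S"
    and B_periodic: "\<And>k i j S. B k i j (S + 2 * pi) = B k i j S"
    and A_vanish: "\<And>k i j S. p < i + j \<Longrightarrow> A k i j S = 0"
    and B_vanish: "\<And>k i j S. p < i + j \<Longrightarrow> B k i j S = 0"
begin

abbreviation "U \<equiv> potential h u"
abbreviation "H \<equiv> hamiltonian h u"
abbreviation "Hx x y \<equiv> deriv (\<lambda>x'. H x' y) x"
abbreviation "Hy x y \<equiv> deriv (\<lambda>y'. H x y') y"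

definition phase :: "real \<Rightarrow> real" where
  "phase t = s * t powr (1 + real b / real q)"

definition vartheta :: real where
  "vartheta = s * (1 + real b / real q)"

definition mu :: real where
  "mu = (real b / real q - \<sigma>) / 2"

definition nu :: real where
  "nu = 1 + 2 * mu + \<sigma>"

end


section \<open>Energy-angle variables\<close>

locale energy_angle_family = perturbed_oscillator +
  fixes E\<^sub>0 :: real
    and x\<^sub>0 y\<^sub>0 :: "real \<Rightarrow> real \<Rightarrow> real"
    and T :: "real \<Rightarrow> real"
  assumes E0_pos: "0 < E\<^sub>0"
    and level_closed_curve: "\<And>E. E\<^sub>0 < E \<Longrightarrow>
      \<exists>\<gamma>. simple_path \<gamma> \<and> pathfinish \<gamma> = pathstart \<gamma> \<and> path_image \<gamma> = {(x, y). H x y = E}"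
    and level_no_fixed_point: "\<And>E x y. E\<^sub>0 < E \<Longrightarrow> H x y = E \<Longrightarrow> \<not> (Hy x y = 0 \<and> - Hx x y = 0)"
    and x0_ode: "\<And>t E. E\<^sub>0 < E \<Longrightarrow>
      ((\<lambda>t. x\<^sub>0 t E) has_real_derivative Hy (x\<^sub>0 t E) (y\<^sub>0 t E)) (at t)"
    and y0_ode: "\<And>t E. E\<^sub>0 < E \<Longrightarrow>
      ((\<lambda>t. y\<^sub>0 t E) has_real_derivative - Hx (x\<^sub>0 t E) (y\<^sub>0 t E)) (at t)"
    and xy0_level: "\<And>t E. E\<^sub>0 < E \<Longrightarrow> H (x\<^sub>0 t E) (y\<^sub>0 t E) = E"
    and T_pos: "\<And>E. E\<^sub>0 < E \<Longrightarrow> 0 < T E"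
    and T_period: "\<And>t E. E\<^sub>0 < E \<Longrightarrow> x\<^sub>0 (t + T E) E = x\<^sub>0 t E \<and> y\<^sub>0 (t + T E) E = y\<^sub>0 t E"
    and T_least: "\<And>T' E. E\<^sub>0 < E \<Longrightarrow> 0 < T' \<Longrightarrow> T' < T E \<Longrightarrow>
      \<exists>t. \<not> (x\<^sub>0 (t + T') E = x\<^sub>0 t E \<and> y\<^sub>0 (t + T') E = y\<^sub>0 t E)"
    and x0_smooth: "smooth_on (UNIV \<times> {E\<^sub>0<..}) (\<lambda>(t, E). x\<^sub>0 t E)"
    and y0_smooth: "smooth_on (UNIV \<times> {E\<^sub>0<..}) (\<lambda>(t, E). y\<^sub>0 t E)"
    and T_smooth: "smooth_on {E\<^sub>0<..} T"
begin

definition omega :: "real \<Rightarrow> real" where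
  "omega E = 2 * pi / T E"

definition X :: "real \<Rightarrow> real \<Rightarrow> real" where
  "X \<phi> E = x\<^sub>0 (\<phi> / omega E) E"

definition Y :: "real \<Rightarrow> real \<Rightarrow> real" where
  "Y \<phi> E = y\<^sub>0 (\<phi> / omega E) E"

text \<open>Here \<open>I\<close> is the energy and \<open>\<phi>\<close> the angle.\<close>

definition F :: "real \<Rightarrow> real \<Rightarrow> real \<Rightarrow> real \<Rightarrow> real" where
  "F I \<phi> S t = f (X \<phi> I) (Y \<phi> I) S t * deriv U (X \<phi> I) + g (X \<phi> I) (Y \<phi> I) S t * Y \<phi> I"

definition G :: "real \<Rightarrow> real \<Rightarrow> real \<Rightarrow> real \<Rightarrow> real" where
  "G I \<phi> S t = omega I *
     (f (X \<phi> I) (Y \<phi> I) S t * deriv (\<lambda>E. Y \<phi> E) I - g (X \<phi> I) (Y \<phi> I) S t * deriv (\<lambda>E. X \<phi> E) I)"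

end

text \<open>
  The choice of the initial phase of the family: the expansions of \<open>X\<close> and \<open>Y\<close> hold uniformly
  in the angle and may be differentiated term by term with respect to the energy.
\<close>

locale energy_angle_variables = energy_angle_family +
  fixes Xc Yc :: "nat \<Rightarrow> real \<Rightarrow> real"
    and \<omega>c :: "nat \<Rightarrow> real"
  assumes Xc_periodic: "\<And>j \<phi>. Xc j (\<phi> + 2 * pi) = Xc j \<phi>"
    and Yc_periodic: "\<And>j \<phi>. Yc j (\<phi> + 2 * pi) = Yc j \<phi>"
    and X_expansion:
      "uniform_power_expansion (1 / (2 * real h)) (2 * real h) UNIV X Xc"
    and Y_expansion:
      "uniform_power_expansion (1 / 2) (2 * real h) UNIV Y Yc"
    and dX_expansion:
      "uniform_power_expansion (1 / (2 * real h) - 1) (2 * real h) UNIV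
         (\<lambda>\<phi>. deriv (\<lambda>E. X \<phi> E)) (\<lambda>j \<phi>. (1 / (2 * real h) - real j / (2 * real h)) * Xc j \<phi>)"
    and dY_expansion:
      "uniform_power_expansion (1 / 2 - 1) (2 * real h) UNIV
         (\<lambda>\<phi>. deriv (\<lambda>E. Y \<phi> E)) (\<lambda>j \<phi>. (1 / 2 - real j / (2 * real h)) * Yc j \<phi>)"
    and omega_expansion:
      "power_expansion ((real h - 1) / (2 * real h)) (2 * real h) omega \<omega>c"
    and omega_leading:
      "\<omega>c 0 = 2 * pi / (sqrt 2 * (2 * real h) powr (1 / (2 * real h)) *
         integral {-1..1} (\<lambda>\<xi>. 1 / sqrt (1 - \<xi> ^ (2 * h))))"


section \<open>Rescaled variables near the resonant energy\<close>

locale resonant_energy = energy_angle_variables +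
  fixes \<kappa> :: nat
    and E\<^sub>1 t\<^sub>1 :: real
    and I\<^sub>r\<^sub>e\<^sub>s :: "real \<Rightarrow> real"
  assumes kappa_pos: "0 < \<kappa>"
    and E1_ge: "E\<^sub>0 \<le> E\<^sub>1"
    \<comment> \<open>The guard \<open>E\<^sub>0 < E\<close> only matters if \<open>E\<^sub>1 = E\<^sub>0\<close>, as the frequency is undefined at \<open>E\<^sub>0\<close>.\<close>
    and omega_deriv_pos: "\<And>E. E\<^sub>1 \<le> E \<Longrightarrow> E\<^sub>0 < E \<Longrightarrow> 0 < deriv omega E"
    and t1_pos: "0 < t\<^sub>1"
    and I_ge: "\<And>t. t\<^sub>1 \<le> t \<Longrightarrow> E\<^sub>1 \<le> I\<^sub>r\<^sub>e\<^sub>s t"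
    and I_resonance: "\<And>t. t\<^sub>1 \<le> t \<Longrightarrow> omega (I\<^sub>r\<^sub>e\<^sub>s t) = deriv phase t / real \<kappa>"
    and I_continuous: "continuous_on {t\<^sub>1..} I\<^sub>r\<^sub>e\<^sub>s"
    and I_smooth: "smooth_on {t\<^sub>1<..} I\<^sub>r\<^sub>e\<^sub>s"
begin

definition time :: "real \<Rightarrow> real" where
  "time \<tau> = (nu * \<tau>) powr (1 / nu)"

definition energy :: "real \<Rightarrow> real \<Rightarrow> real" where
  "energy r t = I\<^sub>r\<^sub>e\<^sub>s t * (1 + t powr (- mu) * r) ^ (2 * h)"

definition angle :: "real \<Rightarrow> real \<Rightarrow> real" where
  "angle \<theta> \<zeta> = \<theta> + \<zeta> / real \<kappa>"

text \<open>
  The right-hand sides of the system for \<open>(r, \<theta>)\<close> in the time \<open>\<tau>\<close>, before the factor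
  \<open>\<tau>\<^sup>-\<^sup>M\<^sup>/\<^sup>N\<close> is split off.
\<close>

definition r_rate :: "real \<Rightarrow> real \<Rightarrow> real \<Rightarrow> real \<Rightarrow> real" where
  "r_rate r \<theta> \<zeta> \<tau> = (let t = time \<tau> in t powr (1 - nu + mu) *
     (t powr (- real a / real q) * F (energy r t) (angle \<theta> \<zeta>) \<zeta> t /
        (2 * real h * I\<^sub>r\<^sub>e\<^sub>s t * (1 + t powr (- mu) * r) ^ (2 * h - 1))
      - deriv I\<^sub>r\<^sub>e\<^sub>s t / (2 * real h * I\<^sub>r\<^sub>e\<^sub>s t) * (1 + t powr (- mu) * r)
      + mu * t powr (- mu - 1) * r))"

definition theta_rate :: "real \<Rightarrow> real \<Rightarrow> real \<Rightarrow> real \<Rightarrow> real" where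
  "theta_rate r \<theta> \<zeta> \<tau> = (let t = time \<tau> in t powr (1 - nu) *
     (omega (energy r t) - omega (I\<^sub>r\<^sub>e\<^sub>s t)
      + t powr (- real a / real q) * G (energy r t) (angle \<theta> \<zeta>) \<zeta> t))"

end

text \<open>
  \<open>\<A>c\<close> and \<open>\<B>c\<close> are the coefficients of the expansions of \<open>\<tau>\<^sup>M\<^sup>/\<^sup>N r_rate\<close> and
  \<open>\<tau>\<^sup>M\<^sup>/\<^sup>N theta_rate\<close> in powers of \<open>\<tau>\<^sup>-\<^sup>1\<^sup>/\<^sup>N\<close>; these expansions determine them uniquely.
  The right-hand sides of the equations for \<open>M\<close> and \<open>N\<close> are always integers.
\<close>

locale rescaled_system = resonant_energy +
  fixes M N :: nat
    and \<A>c \<B>c :: "nat \<Rightarrow> real \<Rightarrow> real \<Rightarrow> real \<Rightarrow> real"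
  assumes M_eq: "real M = 2 * mu * real q * (real h - 1)"
    and N_eq: "real N = 2 * nu * real q * (real h - 1)"
    and A_expansion: "\<And>R. 0 < R \<Longrightarrow>
      uniform_power_expansion 0 (real N) ({-R..R} \<times> UNIV \<times> UNIV)
        (\<lambda>(r, \<theta>, \<zeta>) \<tau>. \<tau> powr (real M / real N) * r_rate r \<theta> \<zeta> \<tau>)
        (\<lambda>K (r, \<theta>, \<zeta>). \<A>c K r \<theta> \<zeta>)"
    and B_expansion: "\<And>R. 0 < R \<Longrightarrow>
      uniform_power_expansion 0 (real N) ({-R..R} \<times> UNIV \<times> UNIV)
        (\<lambda>(r, \<theta>, \<zeta>) \<tau>. \<tau> powr (real M / real N) * theta_rate r \<theta> \<zeta> \<tau>)
        (\<lambda>K (r, \<theta>, \<zeta>). \<B>c K r \<theta> \<zeta>)"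
    and Ac_polynomial: "\<And>K. \<exists>d c. \<forall>r \<theta> \<zeta>. \<A>c K r \<theta> \<zeta> = (\<Sum>i\<le>(d::nat). c i \<theta> \<zeta> * r ^ i)"
    and Bc_polynomial: "\<And>K. \<exists>d c. \<forall>r \<theta> \<zeta>. \<B>c K r \<theta> \<zeta> = (\<Sum>i\<le>(d::nat). c i \<theta> \<zeta> * r ^ i)"
    and Ac_periodic: "\<And>K r \<theta> \<zeta>. \<A>c K r (\<theta> + 2 * pi) \<zeta> = \<A>c K r \<theta> \<zeta>"
      "\<And>K r \<theta> \<zeta>. \<A>c K r \<theta> (\<zeta> + 2 * pi * real \<kappa>) = \<A>c K r \<theta> \<zeta>"
    and Bc_periodic: "\<And>K r \<theta> \<zeta>. \<B>c K r (\<theta> + 2 * pi) \<zeta> = \<B>c K r \<theta> \<zeta>"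
      "\<And>K r \<theta> \<zeta>. \<B>c K r \<theta> (\<zeta> + 2 * pi * real \<kappa>) = \<B>c K r \<theta> \<zeta>"


section \<open>Averaging\<close>

text \<open>
  Formal series in \<open>z = \<tau>\<^sup>-\<^sup>1\<^sup>/\<^sup>N\<close> are represented, for each fixed point \<open>(r, \<theta>, \<zeta>)\<close>, by real
  formal power series in \<open>z\<close>.
\<close>

definition partial_derivative :: "nat \<Rightarrow> nat \<Rightarrow> (real \<Rightarrow> real \<Rightarrow> real) \<Rightarrow> real \<Rightarrow> real \<Rightarrow> real" where
  "partial_derivative i j f r \<theta> = (deriv ^^ i) (\<lambda>r'. (deriv ^^ j) (\<lambda>\<theta>'. f r' \<theta>') \<theta>) r"

text \<open>
  The Taylor expansion of \<open>f (r + v) (\<theta> + w)\<close> about \<open>(r, \<theta>)\<close>, where \<open>v\<close>, \<open>w\<close> have zero constant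
  term: \<open>v\<^sup>iw\<^sup>j\<close> contributes to the coefficient of \<open>z\<^sup>m\<close> only if \<open>i + j \<le> m\<close>.
\<close>

definition taylor_fps ::
  "(real \<Rightarrow> real \<Rightarrow> real) \<Rightarrow> real \<Rightarrow> real \<Rightarrow> real fps \<Rightarrow> real fps \<Rightarrow> real fps" where
  "taylor_fps f r \<theta> v w = Abs_fps (\<lambda>m. \<Sum>i\<le>m. \<Sum>j\<le>m - i.
     partial_derivative i j f r \<theta> / (fact i * fact j) * fps_nth (v ^ i * w ^ j) m)"

context rescaled_system
begin

text \<open>The series \<open>\<Sum>K. \<tau>\<^sup>-\<^sup>(\<^sup>M\<^sup>+\<^sup>K\<^sup>)\<^sup>/\<^sup>N c K\<close>.\<close>

definition shifted_series :: "(nat \<Rightarrow> real) \<Rightarrow> real fps" where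
  "shifted_series c = fps_X ^ M * Abs_fps c"

text \<open>
  The operator \<open>\<tau>\<^sup>-\<^sup>M\<^sup>/\<^sup>N (\<A>\<partial>\<^sub>r + \<B>\<partial>\<^sub>\<theta>) + \<partial>\<^sub>\<tau> + \<vartheta>\<partial>\<^sub>\<zeta>\<close> applied to
  \<open>\<Sum>K. \<tau>\<^sup>-\<^sup>(\<^sup>M\<^sup>+\<^sup>K\<^sup>)\<^sup>/\<^sup>N c K r \<theta> \<zeta>\<close>.  In the variable \<open>z\<close> one has \<open>\<partial>\<^sub>\<tau> = - (1/N) z\<^sup>N\<^sup>+\<^sup>1 d/dz\<close>.
\<close>

definition drift :: "(nat \<Rightarrow> real \<Rightarrow> real \<Rightarrow> real \<Rightarrow> real) \<Rightarrow> real \<Rightarrow> real \<Rightarrow> real \<Rightarrow> real fps" where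
  "drift c r \<theta> \<zeta> =
     shifted_series (\<lambda>K. \<A>c K r \<theta> \<zeta>) * shifted_series (\<lambda>K. deriv (\<lambda>r'. c K r' \<theta> \<zeta>) r)
     + shifted_series (\<lambda>K. \<B>c K r \<theta> \<zeta>) * shifted_series (\<lambda>K. deriv (\<lambda>\<theta>'. c K r \<theta>' \<zeta>) \<theta>)
     - fps_const (1 / real N) * fps_X ^ (N + 1) * fps_deriv (shifted_series (\<lambda>K. c K r \<theta> \<zeta>))
     + fps_const vartheta * shifted_series (\<lambda>K. deriv (\<lambda>\<zeta>'. c K r \<theta> \<zeta>') \<zeta>)"

text \<open>
  The series \<open>\<Sum>K. \<tau>\<^sup>-\<^sup>(\<^sup>M\<^sup>+\<^sup>K\<^sup>)\<^sup>/\<^sup>N \<Lambda> K (r + v) (\<theta> + w)\<close>; the terms with \<open>K > m\<close> do not contribute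
  to the coefficient of \<open>z\<^sup>m\<close>.
\<close>

definition averaged_series ::
  "(nat \<Rightarrow> real \<Rightarrow> real \<Rightarrow> real) \<Rightarrow> real \<Rightarrow> real \<Rightarrow> real fps \<Rightarrow> real fps \<Rightarrow> real fps" where
  "averaged_series \<Lambda> r \<theta> v w =
     Abs_fps (\<lambda>m. \<Sum>K\<le>m. fps_nth (fps_X ^ (M + K) * taylor_fps (\<Lambda> K) r \<theta> v w) m)"

end

locale averaged_system = rescaled_system +
  fixes \<Lambda> \<Omega> :: "nat \<Rightarrow> real \<Rightarrow> real \<Rightarrow> real"
    and \<rho> \<psi> :: "nat \<Rightarrow> real \<Rightarrow> real \<Rightarrow> real \<Rightarrow> real"
  assumes Lambda_smooth: "\<And>K. smooth_on UNIV (\<lambda>(r, \<theta>). \<Lambda> K r \<theta>)"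
    and Omega_smooth: "\<And>K. smooth_on UNIV (\<lambda>(r, \<theta>). \<Omega> K r \<theta>)"
    and rho_smooth: "\<And>K. smooth_on UNIV (\<lambda>(r, \<theta>, \<zeta>). \<rho> K r \<theta> \<zeta>)"
    and psi_smooth: "\<And>K. smooth_on UNIV (\<lambda>(r, \<theta>, \<zeta>). \<psi> K r \<theta> \<zeta>)"
    and Lambda_periodic: "\<And>K r \<theta>. \<Lambda> K r (\<theta> + 2 * pi) = \<Lambda> K r \<theta>"
    and Omega_periodic: "\<And>K r \<theta>. \<Omega> K r (\<theta> + 2 * pi) = \<Omega> K r \<theta>"
    and rho_periodic: "\<And>K r \<theta> \<zeta>. \<rho> K r (\<theta> + 2 * pi) \<zeta> = \<rho> K r \<theta> \<zeta>"
      "\<And>K r \<theta> \<zeta>. \<rho> K r \<theta> (\<zeta> + 2 * pi * real \<kappa>) = \<rho> K r \<theta> \<zeta>"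
    and psi_periodic: "\<And>K r \<theta> \<zeta>. \<psi> K r (\<theta> + 2 * pi) \<zeta> = \<psi> K r \<theta> \<zeta>"
      "\<And>K r \<theta> \<zeta>. \<psi> K r \<theta> (\<zeta> + 2 * pi * real \<kappa>) = \<psi> K r \<theta> \<zeta>"
    and rho_zero_mean: "\<And>K r \<theta>. integral {0..2 * pi * real \<kappa>} (\<lambda>\<zeta>. \<rho> K r \<theta> \<zeta>) = 0"
    and psi_zero_mean: "\<And>K r \<theta>. integral {0..2 * pi * real \<kappa>} (\<lambda>\<zeta>. \<psi> K r \<theta> \<zeta>) = 0"
    and averaging_r: "\<And>r \<theta> \<zeta>.
      shifted_series (\<lambda>K. \<A>c K r \<theta> \<zeta>) + drift \<rho> r \<theta> \<zeta> =
      averaged_series \<Lambda> r \<theta> (shifted_series (\<lambda>K. \<rho> K r \<theta> \<zeta>)) (shifted_series (\<lambda>K. \<psi> K r \<theta> \<zeta>))"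
    and averaging_theta: "\<And>r \<theta> \<zeta>.
      shifted_series (\<lambda>K. \<B>c K r \<theta> \<zeta>) + drift \<psi> r \<theta> \<zeta> =
      averaged_series \<Omega> r \<theta> (shifted_series (\<lambda>K. \<rho> K r \<theta> \<zeta>)) (shifted_series (\<lambda>K. \<psi> K r \<theta> \<zeta>))"

end

theory Submission
  imports Defs "HOL-Library.Landau_Symbols"
begin

text \<open>
  In the variable \<open>z = \<tau>\<^sup>-\<^sup>1\<^sup>/\<^sup>N\<close> the truncated system has a formal power series solution: because
  \<open>\<Omega>\<^sub>0 = \<eta> r\<close> with \<open>\<eta> > 0\<close> and \<open>\<lambda>\<^sub>L \<noteq> 0\<close>, each new coefficient of \<open>\<rho>\<close> is determined by the second
  equation and each new coefficient of \<open>\<phi>\<close> by the first one.  The deviation of a true solution from a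
  long partial sum satisfies a planar system whose linear part has small trace and discriminant close
  to \<open>\<lambda>\<^sub>L \<eta> z\<^sup>2\<^sup>M\<^sup>+\<^sup>L\<close>.  It is therefore of saddle or of center type, can be diagonalized or rotated
  away, and the deviation is obtained as a fixed point of an integral operator in a space of functions
  of order \<open>\<tau>\<^sup>-\<^sup>k\<close>; exponents of size \<open>O(1/\<tau>)\<close> do no harm if \<open>k\<close> is large.  The facts about \<open>\<Lambda>\<^sub>0\<close>
  and \<open>\<Omega>\<^sub>K\<close>, \<open>K < M\<close>, follow from the asymptotics of the rates at fixed \<open>(r, \<theta>, \<zeta>)\<close>: up to the order
  \<open>z\<^sup>2\<^sup>M\<close> the averaging equation only contains \<open>\<zeta>\<close>-derivatives, whose mean vanishes.
\<close>

section \<open>Diagonal systems with a dichotomy\<close>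

text \<open>The two components of a deviation live on different scales: the off-diagonal entries of
  the linearization have orders \<open>z^(M+L)\<close> and \<open>z^M\<close>. Rescaling one
  component makes both entries equal to \<open>del\<close> up to sign, and the derivative of the
  rescaling costs only O(1/\<tau>). Exponents of that size produce mere powers of \<tau>, which a
  long enough partial sum outruns. An exponent decaying more slowly than 1/\<tau> has a definite
  sign, and the boundary condition is put at infinity or at a finite point accordingly. In the
  center case both exponents are the half trace \<open>tr\<close>; being smooth in \<open>z\<close>,
  it is classified by its first nonzero Taylor coefficient. The condition \<open>L < 2 * M\<close>
  enters because the diagonal entries have order at least min(M + max(1, L), 2M), and the square of
  half their difference must stay below the discriminant, of order 2M + L. The contraction gives one
  solution near one partial sum; that the same solution also follows all longer sums is a separate a
  posteriori estimate with a truncated weight.\<close>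

lemma increment_le_of_deriv_le:
  fixes G B :: "real \<Rightarrow> real"
  assumes "s \<le> t"
    and G: "\<And>x. s \<le> x \<Longrightarrow> x \<le> t \<Longrightarrow> (G has_real_derivative G' x) (at x)"
    and B: "\<And>x. s \<le> x \<Longrightarrow> x \<le> t \<Longrightarrow> (B has_real_derivative B' x) (at x)"
    and le: "\<And>x. s \<le> x \<Longrightarrow> x \<le> t \<Longrightarrow> \<bar>G' x\<bar> \<le> B' x"
  shows "\<bar>G t - G s\<bar> \<le> B t - B s"
proof -
  have "B s - G s \<le> B t - G t"
  proof (rule DERIV_nonneg_imp_nondecreasing[OF \<open>s \<le> t\<close>])
    fix x assume x: "s \<le> x" "x \<le> t"
    show "\<exists>y. ((\<lambda>x. B x - G x) has_real_derivative y) (at x) \<and> 0 \<le> y"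
      using DERIV_diff[OF B[OF x] G[OF x]] le[OF x] by (intro exI[of _ "B' x - G' x"]) auto
  qed
  moreover have "B s + G s \<le> B t + G t"
  proof (rule DERIV_nonneg_imp_nondecreasing[OF \<open>s \<le> t\<close>])
    fix x assume x: "s \<le> x" "x \<le> t"
    show "\<exists>y. ((\<lambda>x. B x + G x) has_real_derivative y) (at x) \<and> 0 \<le> y"
      using DERIV_add[OF B[OF x] G[OF x]] le[OF x] by (intro exI[of _ "B' x + G' x"]) auto
  qed
  ultimately show ?thesis by linarith
qed

text \<open>The intervals with centre \<open>G x\<close> and radius \<open>B x\<close> intersect
  pairwise, since increments of \<open>G\<close> are bounded by decrements of \<open>B\<close>; a
  point common to all is the supremum of their left ends. When \<open>B\<close> tends to 0 this
  plays the role of an integral up to infinity together with its error bound.\<close>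

lemma limit_of_deriv_le:
  fixes G B :: "real \<Rightarrow> real"
  assumes G: "\<And>x. a \<le> x \<Longrightarrow> (G has_real_derivative G' x) (at x)"
    and B: "\<And>x. a \<le> x \<Longrightarrow> (B has_real_derivative B' x) (at x)"
    and le: "\<And>x. a \<le> x \<Longrightarrow> \<bar>G' x\<bar> \<le> - B' x"
    and B0: "\<And>x. a \<le> x \<Longrightarrow> 0 \<le> B x"
  shows "\<exists>c. \<forall>x\<ge>a. \<bar>G x - c\<bar> \<le> B x"
proof -
  have inc: "\<bar>G t - G s\<bar> \<le> B s - B t" if "a \<le> s" "s \<le> t" for s t
    using increment_le_of_deriv_le[OF \<open>s \<le> t\<close>, of G G' "\<lambda>x. - B x" "\<lambda>x. - B' x"]
      DERIV_minus[OF B] G le that by auto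
  have cross: "G t - B t \<le> G s + B s" if "a \<le> s" "a \<le> t" for s t
    using inc[of s t] inc[of t s] B0[of s] B0[of t] that by (cases "s \<le> t") auto
  define c where "c = (SUP x\<in>{a..}. G x - B x)"
  have bdd: "bdd_above ((\<lambda>x. G x - B x) ` {a..})"
    using cross[of a] by (intro bdd_aboveI2[of _ _ "G a + B a"]) auto
  have lower: "G x - B x \<le> c" if "a \<le> x" for x
    unfolding c_def using that by (intro cSUP_upper bdd) auto
  have upper: "c \<le> G x + B x" if "a \<le> x" for x
    unfolding c_def using that cross by (intro cSUP_least) auto
  have "\<bar>G x - c\<bar> \<le> B x" if "a \<le> x" for x
    using lower[OF that] upper[OF that] by linarith
  then show ?thesis by blast
qed

text \<open>\<open>P + C ln\<close> is nondecreasing, so the integrating factor grows at most like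
  the power \<open>C\<close>. This is how an exponent bounded below by -C/x becomes a harmless
  power.\<close>

lemma exp_growth_lower:
  fixes P \<alpha> :: "real \<Rightarrow> real"
  assumes "0 < s" "s \<le> t"
    and P: "\<And>x. s \<le> x \<Longrightarrow> x \<le> t \<Longrightarrow> (P has_real_derivative \<alpha> x) (at x)"
    and rate: "\<And>x. s \<le> x \<Longrightarrow> x \<le> t \<Longrightarrow> - C / x \<le> \<alpha> x"
  shows "exp (- P t) \<le> exp (- P s) * (t / s) powr C"
proof -
  have "P s + C * ln s \<le> P t + C * ln t"
  proof (rule DERIV_nonneg_imp_nondecreasing[OF \<open>s \<le> t\<close>])
    fix x assume x: "s \<le> x" "x \<le> t"
    show "\<exists>y. ((\<lambda>x. P x + C * ln x) has_real_derivative y) (at x) \<and> 0 \<le> y"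
      using x assms by (intro exI[of _ "\<alpha> x + C * (1 / x)"])
        (auto intro!: derivative_eq_intros P simp: dest: rate)
  qed
  then have "- P t \<le> - P s + C * ln (t / s)"
    using assms by (simp add: ln_div algebra_simps)
  then show ?thesis
    using assms by (simp add: powr_def flip: exp_add)
qed

lemma exp_growth_upper:
  fixes P \<alpha> :: "real \<Rightarrow> real"
  assumes "0 < s" "s \<le> t"
    and P: "\<And>x. s \<le> x \<Longrightarrow> x \<le> t \<Longrightarrow> (P has_real_derivative \<alpha> x) (at x)"
    and rate: "\<And>x. s \<le> x \<Longrightarrow> x \<le> t \<Longrightarrow> \<alpha> x \<le> - K / x"
  shows "exp (- P s) \<le> exp (- P t) * (s / t) powr K"
proof -
  have "exp (- (- P t)) \<le> exp (- (- P s)) * (t / s) powr (- K)"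
    by (rule exp_growth_lower[where \<alpha> = "\<lambda>x. - \<alpha> x"])
      (use assms in \<open>auto intro!: derivative_eq_intros dest: rate simp: le_minus_iff\<close>)
  moreover have "(t / s) powr (- K) = (s / t) powr K"
    using assms by (simp add: powr_minus powr_divide field_simps)
  ultimately have "exp (P t) \<le> exp (P s) * (s / t) powr K" by simp
  then have "exp (P t) * exp (- P s) * exp (- P t) \<le> exp (P s) * (s / t) powr K * exp (- P s) * exp (- P t)"
    by (intro mult_right_mono) auto
  then show ?thesis by (simp add: exp_minus field_simps)
qed

lemma integrating_factor_deriv:
  fixes y P :: "real \<Rightarrow> real"
  assumes "(y has_real_derivative \<alpha> * y x + h) (at x)" "(P has_real_derivative \<alpha>) (at x)"
  shows "((\<lambda>x. exp (- P x) * y x) has_real_derivative exp (- P x) * h) (at x)"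
  using assms by (auto intro!: derivative_eq_intros simp: algebra_simps)

text \<open>All integrands below are majorized by a power of \<open>x / s\<close> divided by
  \<open>x\<close>; this explicit antiderivative takes the place of integration.\<close>

lemma has_real_derivative_powr_ratio:
  fixes x s c e :: real
  assumes "0 < x" "0 < s" "e \<noteq> 0"
  shows "((\<lambda>x. c / e * (x / s) powr e) has_real_derivative c * (x / s) powr e / x) (at x)"
proof -
  have "((\<lambda>x. c / e * (x / s) powr e) has_real_derivative c / e * (e * (x / s) powr (e - 1) * (1 / s))) (at x)"
    using assms by (auto intro!: derivative_eq_intros)
  moreover have "c / e * (e * (x / s) powr (e - 1) * (1 / s)) = c * (x / s) powr e / x"
    using assms by (simp add: powr_diff)
  ultimately show ?thesis by metis
qed

lemma unstable_bound:
  fixes y P \<alpha> h W :: "real \<Rightarrow> real"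
  assumes "0 < a" "C < k" "0 \<le> H"
    and y: "\<And>x. a \<le> x \<Longrightarrow> (y has_real_derivative \<alpha> x * y x + h x) (at x)"
    and P: "\<And>x. a \<le> x \<Longrightarrow> (P has_real_derivative \<alpha> x) (at x)"
    and rate: "\<And>x. a \<le> x \<Longrightarrow> - C / x \<le> \<alpha> x"
    and W_pos: "\<And>x. a \<le> x \<Longrightarrow> 0 < W x"
    and W: "\<And>s t. a \<le> s \<Longrightarrow> s \<le> t \<Longrightarrow> W s * (t / s) powr k \<le> W t"
    and h: "\<And>x. a \<le> x \<Longrightarrow> \<bar>h x\<bar> \<le> H / (x * W x)"
    and decay: "((\<lambda>x. exp (- P x) * y x) \<longlongrightarrow> 0) at_top"
    and s: "a \<le> s"
  shows "\<bar>y s\<bar> * W s \<le> H / (k - C)"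
proof -
  \<comment> \<open>Chosen so that the derivative of \<open>B\<close> is the majorant of the
    integrand; \<open>B\<close> is nonpositive because C < k.\<close>
  define c where "c = exp (- P s) * (H / W s)"
  define B where "B t = c / (C - k) * (t / s) powr (C - k)" for t
  have s0: "0 < s" using s \<open>0 < a\<close> by linarith
  have c0: "0 \<le> c" using \<open>0 \<le> H\<close> W_pos[OF s] by (simp add: c_def)
  have inc: "\<bar>exp (- P t) * y t - exp (- P s) * y s\<bar> \<le> B t - B s" if t: "s \<le> t" for t
  proof (rule increment_le_of_deriv_le[OF t])
    fix x assume x: "s \<le> x" "x \<le> t"
    then have x0: "0 < x" and xa: "a \<le> x" using s0 s by auto
    show "((\<lambda>x. exp (- P x) * y x) has_real_derivative exp (- P x) * h x) (at x)"
      by (rule integrating_factor_deriv[OF y P]) (use xa in auto)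
    show "(B has_real_derivative c * (x / s) powr (C - k) / x) (at x)"
      unfolding B_def using x0 s0 \<open>C < k\<close> by (intro has_real_derivative_powr_ratio) auto
    have "exp (- P x) \<le> exp (- P s) * (x / s) powr C"
      by (rule exp_growth_lower[OF s0 x(1) P rate]) (use s in auto)
    moreover have "\<bar>h x\<bar> \<le> H / (x * (W s * (x / s) powr k))"
      by (rule order_trans[OF h[OF xa]])
        (use W[OF s x(1)] x0 W_pos[OF s] W_pos[OF xa] \<open>0 \<le> H\<close> s0 in
          \<open>auto intro!: divide_left_mono mult_left_mono mult_pos_pos\<close>)
    ultimately have "\<bar>exp (- P x) * h x\<bar> \<le>
        exp (- P s) * (x / s) powr C * (H / (x * (W s * (x / s) powr k)))"
      unfolding abs_mult by (intro mult_mono) auto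
    also have "\<dots> = c * (x / s) powr (C - k) / x"
      unfolding c_def powr_diff by (simp add: mult_ac)
    finally show "\<bar>exp (- P x) * h x\<bar> \<le> c * (x / s) powr (C - k) / x" .
  qed
  \<comment> \<open>As t grows, the boundary term at t disappears by \<open>decay\<close>, and
    \<open>B t\<close> may be dropped as it is nonpositive; only \<open>- B s\<close> is
    left.\<close>
  have lim: "((\<lambda>t. \<bar>exp (- P t) * y t\<bar> - B s) \<longlongrightarrow> 0 - B s) at_top"
    using tendsto_rabs[OF decay] by (intro tendsto_diff) auto
  have "\<forall>\<^sub>F t in at_top. \<bar>exp (- P s) * y s\<bar> \<le> \<bar>exp (- P t) * y t\<bar> - B s"
    using eventually_ge_at_top[of s]
  proof eventually_elim
    case (elim t)
    have "B t \<le> 0" using c0 \<open>C < k\<close> by (auto simp: B_def intro!: mult_nonpos_nonneg divide_nonneg_neg)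
    then show ?case using inc[OF elim] by linarith
  qed
  from tendsto_lowerbound[OF lim this] have "\<bar>exp (- P s) * y s\<bar> \<le> - B s" by simp
  moreover have "- B s = exp (- P s) * (H / W s / (k - C))"
    using s0 minus_divide_right[of c "C - k"] by (simp add: B_def c_def)
  ultimately have "exp (- P s) * \<bar>y s\<bar> \<le> exp (- P s) * (H / W s / (k - C))"
    by (simp add: abs_mult)
  then have "\<bar>y s\<bar> \<le> H / W s / (k - C)" by (simp only: mult_le_cancel_left_pos exp_gt_zero)
  then have "\<bar>y s\<bar> * W s \<le> H / W s / (k - C) * W s"
    using W_pos[OF s] by (intro mult_right_mono) auto
  then show ?thesis using W_pos[OF s] by simp
qed

text \<open>Variation of constants from the initial point \<open>a\<close>. The integrating factor
  supplies (x/t)^K and the weight costs at most (t/x)^k, whence 1/(K - k). The initial value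
  survives with the factor (a/t)^K, which the growth of \<open>W\<close> cannot undo as k <
  K.\<close>

lemma stable_bound:
  fixes y P \<alpha> h W :: "real \<Rightarrow> real"
  assumes "0 < a" "k < K" "0 \<le> H"
    and y: "\<And>x. a \<le> x \<Longrightarrow> (y has_real_derivative \<alpha> x * y x + h x) (at x)"
    and P: "\<And>x. a \<le> x \<Longrightarrow> (P has_real_derivative \<alpha> x) (at x)"
    and rate: "\<And>x. a \<le> x \<Longrightarrow> \<alpha> x \<le> - K / x"
    and W_pos: "\<And>x. a \<le> x \<Longrightarrow> 0 < W x"
    and W: "\<And>s t. a \<le> s \<Longrightarrow> s \<le> t \<Longrightarrow> W t \<le> W s * (t / s) powr k"
    and h: "\<And>x. a \<le> x \<Longrightarrow> \<bar>h x\<bar> \<le> H / (x * W x)"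
    and t: "a \<le> t"
  shows "\<bar>y t\<bar> * W t \<le> \<bar>y a\<bar> * W a + H / (K - k)"
proof -
  define c where "c = exp (- P t) * (H / W t)"
  define B where "B s = c / (K - k) * (s / t) powr (K - k)" for s
  have t0: "0 < t" using t \<open>0 < a\<close> by linarith
  have c0: "0 \<le> c" using \<open>0 \<le> H\<close> W_pos[OF t] by (simp add: c_def)
  have inc: "\<bar>exp (- P t) * y t - exp (- P a) * y a\<bar> \<le> B t - B a"
  proof (rule increment_le_of_deriv_le[OF t])
    fix x assume x: "a \<le> x" "x \<le> t"
    then have x0: "0 < x" using \<open>0 < a\<close> by auto
    show "((\<lambda>x. exp (- P x) * y x) has_real_derivative exp (- P x) * h x) (at x)"
      by (rule integrating_factor_deriv[OF y P]) (use x in auto)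
    show "(B has_real_derivative c * (x / t) powr (K - k) / x) (at x)"
      unfolding B_def using x0 t0 \<open>k < K\<close> by (intro has_real_derivative_powr_ratio) auto
    have "exp (- P x) \<le> exp (- P t) * (x / t) powr K"
      by (rule exp_growth_upper[OF x0 x(2) P rate]) (use x in auto)
    moreover have "\<bar>h x\<bar> \<le> H / (x * (W t * (x / t) powr k))"
    proof (rule order_trans[OF h[OF x(1)]])
      have "W t * (x / t) powr k \<le> W x * (t / x) powr k * (x / t) powr k"
        using W[OF x] by (intro mult_right_mono) auto
      also have "\<dots> = W x" using x0 t0 by (simp add: powr_divide)
      finally show "H / (x * W x) \<le> H / (x * (W t * (x / t) powr k))"
        using x0 t0 W_pos[OF t] W_pos[OF x(1)] \<open>0 \<le> H\<close>
        by (auto intro!: divide_left_mono mult_left_mono mult_pos_pos)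
    qed
    ultimately have "\<bar>exp (- P x) * h x\<bar> \<le>
        exp (- P t) * (x / t) powr K * (H / (x * (W t * (x / t) powr k)))"
      unfolding abs_mult by (intro mult_mono) auto
    also have "\<dots> = c * (x / t) powr (K - k) / x"
      unfolding c_def powr_diff by (simp add: mult_ac)
    finally show "\<bar>exp (- P x) * h x\<bar> \<le> c * (x / t) powr (K - k) / x" .
  qed
  have "0 \<le> B a" using c0 \<open>k < K\<close> by (simp add: B_def)
  have "exp (- P t) * \<bar>y t\<bar> \<le> exp (- P a) * \<bar>y a\<bar> + B t"
  proof -
    have "\<bar>exp (- P t) * y t\<bar> \<le> \<bar>exp (- P a) * y a\<bar> + B t"
      using inc \<open>0 \<le> B a\<close> by linarith
    then show ?thesis by (simp add: abs_mult)
  qed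
  also have "exp (- P a) * \<bar>y a\<bar> \<le> exp (- P t) * (a / t) powr K * \<bar>y a\<bar>"
    by (intro mult_right_mono exp_growth_upper[OF \<open>0 < a\<close> t P rate]) auto
  also have "B t = exp (- P t) * (H / W t / (K - k))"
    using t0 by (simp add: B_def c_def)
  finally have "exp (- P t) * \<bar>y t\<bar> \<le> exp (- P t) * ((a / t) powr K * \<bar>y a\<bar> + H / W t / (K - k))"
    by (simp add: algebra_simps)
  then have "\<bar>y t\<bar> \<le> (a / t) powr K * \<bar>y a\<bar> + H / W t / (K - k)"
    by simp
  then have "\<bar>y t\<bar> * W t \<le> ((a / t) powr K * \<bar>y a\<bar> + H / W t / (K - k)) * W t"
    using W_pos[OF t] by (intro mult_right_mono) auto
  also have "\<dots> = (a / t) powr K * \<bar>y a\<bar> * W t + H / (K - k)"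
    using W_pos[OF t] by (simp add: distrib_right)
  also have "(a / t) powr K * \<bar>y a\<bar> * W t \<le> (a / t) powr k * \<bar>y a\<bar> * (W a * (t / a) powr k)"
    using W[OF order_refl t] W_pos[OF t] t0 \<open>0 < a\<close> t \<open>k < K\<close>
    by (intro mult_mono) (auto intro!: powr_mono')
  also have "\<dots> = \<bar>y a\<bar> * W a"
    using t0 \<open>0 < a\<close> by (simp add: powr_divide)
  finally show ?thesis by simp
qed

text \<open>The integrating factor is O(x^C), so a solution of order x^(-k) with k > C satisfies the
  boundary condition at infinity by itself. Thus a priori decay can replace that condition.\<close>

lemma unstable_decay:
  fixes y P \<alpha> :: "real \<Rightarrow> real"
  assumes "0 < a" "C < k"
    and P: "\<And>x. a \<le> x \<Longrightarrow> (P has_real_derivative \<alpha> x) (at x)"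
    and rate: "\<And>x. a \<le> x \<Longrightarrow> - C / x \<le> \<alpha> x"
    and y: "\<And>x. a \<le> x \<Longrightarrow> \<bar>y x\<bar> \<le> D * x powr (- k)"
  shows "((\<lambda>x. exp (- P x) * y x) \<longlongrightarrow> 0) at_top"
proof (rule Lim_null_comparison)
  show "((\<lambda>t. exp (- P a) * (1 / a) powr C * D * t powr (C - k)) \<longlongrightarrow> 0) at_top"
    by (rule tendsto_mult_right_zero) (use \<open>C < k\<close> in \<open>auto intro!: tendsto_neg_powr filterlim_ident\<close>)
  show "\<forall>\<^sub>F t in at_top. norm (exp (- P t) * y t) \<le> exp (- P a) * (1 / a) powr C * D * t powr (C - k)"
    using eventually_ge_at_top[of a]
  proof eventually_elim
    case (elim t)
    then have t0: "0 < t" using \<open>0 < a\<close> by auto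
    have "exp (- P t) \<le> exp (- P a) * (t / a) powr C"
      by (rule exp_growth_lower[OF \<open>0 < a\<close> elim P rate]) auto
    then have "\<bar>exp (- P t) * y t\<bar> \<le> exp (- P a) * (t / a) powr C * (D * t powr (- k))"
      unfolding abs_mult using y[OF elim] by (intro mult_mono) auto
    also have "\<dots> = exp (- P a) * (1 / a) powr C * D * t powr (C - k)"
      using t0 \<open>0 < a\<close> by (simp add: powr_diff powr_minus powr_divide field_simps)
    finally show ?case by simp
  qed
qed

lemma antiderivative_greaterThan:
  fixes f :: "real \<Rightarrow> real"
  assumes "continuous_on {b<..} f"
  shows "\<exists>F. \<forall>x>b. (F has_real_derivative f x) (at x)"
proof -
  have "\<exists>F. \<forall>x. ereal b < x \<longrightarrow> x < \<infinity> \<longrightarrow> (F has_vector_derivative f x) (at x)"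
  proof (rule einterval_antiderivative)
    show "isCont f x" if "ereal b < ereal x" "ereal x < \<infinity>" for x
      using assms that by (auto simp: continuous_on_eq_continuous_at)
  qed simp
  then show ?thesis by (auto simp: has_real_derivative_iff_has_vector_derivative)
qed

text \<open>The solution is exp(P) times the antiderivative of exp(- P) h that vanishes at infinity;
  \<open>C < k\<close> makes the limit \<open>l\<close> exist. Only the constant of integration is
  fixed at infinity, so the equation holds on all of (b, \<infinity>) although the bounds start at
  \<open>a\<close>.\<close>

lemma unstable_solution:
  fixes \<alpha> h P :: "real \<Rightarrow> real"
  assumes "0 \<le> b" "b < a" "C < k" "0 \<le> H"
    and h_cont: "continuous_on {b<..} h"
    and P: "\<And>x. b < x \<Longrightarrow> (P has_real_derivative \<alpha> x) (at x)"
    and rate: "\<And>x. a \<le> x \<Longrightarrow> - C / x \<le> \<alpha> x"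
    and h: "\<And>x. a \<le> x \<Longrightarrow> \<bar>h x\<bar> \<le> H / (x * x powr k)"
  shows "\<exists>y. (\<forall>x>b. (y has_real_derivative \<alpha> x * y x + h x) (at x)) \<and>
    ((\<lambda>x. exp (- P x) * y x) \<longlongrightarrow> 0) at_top"
proof -
  have a0: "0 < a" using assms by linarith
  have "continuous_on {b<..} P"
    by (rule DERIV_continuous_on) (use P in \<open>auto intro: has_field_derivative_at_within\<close>)
  then have "continuous_on {b<..} (\<lambda>x. exp (- P x) * h x)"
    by (intro continuous_intros h_cont)
  then obtain G where G: "\<And>x. b < x \<Longrightarrow> (G has_real_derivative exp (- P x) * h x) (at x)"
    using antiderivative_greaterThan by blast
  define c where "c = exp (- P a) * (H / a powr k)"
  define B where "B x = (- c) / (C - k) * (x / a) powr (C - k)" for x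
  have "\<exists>l. \<forall>x\<ge>a. \<bar>G x - l\<bar> \<le> B x"
  proof (rule limit_of_deriv_le)
    fix x assume x: "a \<le> x"
    then have x0: "0 < x" using a0 by linarith
    show "(G has_real_derivative exp (- P x) * h x) (at x)" using G x assms by auto
    show "(B has_real_derivative - (c * (x / a) powr (C - k) / x)) (at x)"
      unfolding B_def using has_real_derivative_powr_ratio[OF x0 a0, of "C - k" "- c"] \<open>C < k\<close> by simp
    have "exp (- P x) \<le> exp (- P a) * (x / a) powr C"
      by (rule exp_growth_lower[OF a0 x P rate]) (use assms in auto)
    then have "\<bar>exp (- P x) * h x\<bar> \<le> exp (- P a) * (x / a) powr C * (H / (x * x powr k))"
      unfolding abs_mult using h[OF x] by (intro mult_mono) auto
    also have "\<dots> = c * (x / a) powr (C - k) / x"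
      unfolding c_def using x0 a0 by (simp add: powr_diff powr_divide mult_ac)
    finally show "\<bar>exp (- P x) * h x\<bar> \<le> - (- (c * (x / a) powr (C - k) / x))" by simp
    have "0 \<le> c" using \<open>0 \<le> H\<close> by (simp add: c_def)
    then show "0 \<le> B x"
      using \<open>C < k\<close> unfolding B_def by (intro mult_nonneg_nonneg divide_nonpos_neg) auto
  qed
  then obtain l where l: "\<And>x. a \<le> x \<Longrightarrow> \<bar>G x - l\<bar> \<le> B x" by blast
  define y where "y x = exp (P x) * (G x - l)" for x
  have "(y has_real_derivative \<alpha> x * y x + h x) (at x)" if "b < x" for x
    unfolding y_def using P[OF that] G[OF that]
    by (auto intro!: derivative_eq_intros simp: algebra_simps simp flip: exp_add)
  moreover have "((\<lambda>x. exp (- P x) * y x) \<longlongrightarrow> 0) at_top"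
  proof (rule Lim_null_comparison)
    have "filterlim (\<lambda>x::real. x / a) at_top at_top"
      using a0 by (intro filterlim_tendsto_pos_mult_at_top[where f = "\<lambda>x. 1 / a" and c = "1 / a",
        simplified]) (auto intro: filterlim_ident)
    then show "(B \<longlongrightarrow> 0) at_top"
      unfolding B_def using \<open>C < k\<close>
      by (intro tendsto_mult_right_zero tendsto_neg_powr) auto
    show "\<forall>\<^sub>F x in at_top. norm (exp (- P x) * y x) \<le> B x"
      using eventually_ge_at_top[of a]
      by eventually_elim (use l in \<open>auto simp: y_def simp flip: exp_add mult.assoc\<close>)
  qed
  ultimately show ?thesis by blast
qed

lemma stable_solution:
  fixes \<alpha> h P :: "real \<Rightarrow> real"
  assumes h_cont: "continuous_on {b<..} h"
    and P: "\<And>x. b < x \<Longrightarrow> (P has_real_derivative \<alpha> x) (at x)"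
  shows "\<exists>y. (\<forall>x>b. (y has_real_derivative \<alpha> x * y x + h x) (at x)) \<and> y a = 0"
proof -
  have "continuous_on {b<..} P"
    by (rule DERIV_continuous_on) (use P in \<open>auto intro: has_field_derivative_at_within\<close>)
  then have "continuous_on {b<..} (\<lambda>x. exp (- P x) * h x)"
    by (intro continuous_intros h_cont)
  then obtain G where G: "\<And>x. b < x \<Longrightarrow> (G has_real_derivative exp (- P x) * h x) (at x)"
    using antiderivative_greaterThan by blast
  define y where "y x = exp (P x) * (G x - G a)" for x
  have "(y has_real_derivative \<alpha> x * y x + h x) (at x)" if "b < x" for x
    unfolding y_def using P[OF that] G[OF that]
    by (auto intro!: derivative_eq_intros simp: algebra_simps simp flip: exp_add)
  moreover have "y a = 0" by (simp add: y_def)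
  ultimately show ?thesis by blast
qed

section \<open>Nonlinear perturbations: existence by contraction and improvement of decay\<close>

lemma norm_le_card_mult:
  fixes x :: "real ^ 'n"
  assumes "\<And>i. \<bar>x $ i\<bar> \<le> c"
  shows "norm x \<le> real CARD('n) * c"
  using norm_le_l1_cart[of x] sum_bounded_above[of UNIV "\<lambda>i. \<bar>x $ i\<bar>" c] assms by simp

text \<open>A fixed point in the unit ball of bounded continuous functions, where w = x^(-k) \<xi>.
  Given \<xi>, each coordinate solves a scalar linear equation whose right side is \<open>g\<close>
  at that point. The estimates for the two types of exponents bound the solution operator, and gaps
  \<open>k - C\<^sub>0\<close> and \<open>K - k\<close> that are large against the Lipschitz
  constant make it a contraction with factor 1/2.\<close>

lemma decaying_solution:
  fixes \<alpha> :: "'n::finite \<Rightarrow> real \<Rightarrow> real" and g :: "real \<Rightarrow> real ^ 'n \<Rightarrow> real ^ 'n"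
  assumes b: "0 \<le> b" "b < a" and k: "C\<^sub>0 < k" "k < K" and C: "0 \<le> C"
    and \<alpha>_cont: "\<And>i. continuous_on {b<..} (\<alpha> i)"
    and g_cont: "continuous_on ({b<..} \<times> UNIV) (\<lambda>(x, y). g x y)"
    and rate: "\<And>i. (\<forall>x\<ge>a. - C\<^sub>0 / x \<le> \<alpha> i x) \<or> (\<forall>x\<ge>a. \<alpha> i x \<le> - K / x)"
    and small: "real CARD('n) * ((C + 1) / (k - C\<^sub>0)) \<le> 1 / 2" "real CARD('n) * ((C + 1) / (K - k)) \<le> 1 / 2"
    and lip: "\<And>x u v. a \<le> x \<Longrightarrow> norm u \<le> x powr (- k) \<Longrightarrow> norm v \<le> x powr (- k) \<Longrightarrow>
      norm (g x u - g x v) \<le> C / x * norm (u - v)"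
    and zero: "\<And>x. a \<le> x \<Longrightarrow> norm (g x 0) \<le> x powr (- k) / x"
  shows "\<exists>w. \<forall>x>a. norm (w x) \<le> x powr (- k) \<and>
    (\<forall>i. ((\<lambda>x. w x $ i) has_real_derivative \<alpha> i x * w x $ i + g x (w x) $ i) (at x))"
proof -
  have a0: "0 < a" using b by linarith
  have "\<exists>P. \<forall>i. \<forall>x>b. (P i has_real_derivative \<alpha> i x) (at x)"
    by (intro choice allI antiderivative_greaterThan \<alpha>_cont)
  then obtain P where P: "\<And>i x. b < x \<Longrightarrow> (P i has_real_derivative \<alpha> i x) (at x)" by blast
  define U where "U i \<longleftrightarrow> (\<forall>x\<ge>a. - C\<^sub>0 / x \<le> \<alpha> i x)" for i
  have S: "\<alpha> i x \<le> - K / x" if "\<not> U i" "a \<le> x" for i x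
    using rate[of i] that by (auto simp: U_def)
  \<comment> \<open>\<open>C + 1\<close> bounds the right side: \<open>C\<close> comes from the
    Lipschitz estimate on the unit ball and 1 from \<open>g\<close> at 0. So \<open>q\<close> bounds
    each coordinate of the image, and the number of coordinates enters when passing to the
    norm.\<close>
  define q where "q = max ((C + 1) / (k - C\<^sub>0)) ((C + 1) / (K - k))"
  have q: "real CARD('n) * q \<le> 1 / 2" using small by (auto simp: q_def max_def)
  have q0: "0 \<le> q" using k C by (simp add: q_def le_max_iff_disj)
  \<comment> \<open>Both boundary conditions are linear and homogeneous, so they pass to
    differences; the contraction estimate is then the bound for a single solution, applied to a
    difference.\<close>
  define bc where "bc i y \<longleftrightarrow> (if U i then ((\<lambda>x. exp (- P i x) * y x) \<longlongrightarrow> 0) at_top else y a = 0)"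
    for i and y :: "real \<Rightarrow> real"
  have bound: "\<bar>y x\<bar> \<le> H / (C + 1) * q * x powr (- k)"
    if y: "\<And>x. b < x \<Longrightarrow> (y has_real_derivative \<alpha> i x * y x + h x) (at x)"
      and "bc i y" and h: "\<And>x. a \<le> x \<Longrightarrow> \<bar>h x\<bar> \<le> H / (x * x powr k)" and "0 \<le> H" and "a \<le> x"
    for y h i H x
  proof -
    have W1: "s powr k * (t / s) powr k \<le> t powr k" if "a \<le> s" "s \<le> t" for s t
      using that a0 by (simp add: powr_divide)
    have W2: "t powr k \<le> s powr k * (t / s) powr k" if "a \<le> s" "s \<le> t" for s t
      using that a0 by (simp add: powr_divide)
    have "\<bar>y x\<bar> * x powr k \<le> H / (C + 1) * q"
    proof (cases "U i")
      case True
      have "\<bar>y x\<bar> * x powr k \<le> H / (k - C\<^sub>0)"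
        by (rule unstable_bound[OF a0 k(1) \<open>0 \<le> H\<close>, of y "\<alpha> i" h "P i"])
          (use True \<open>bc i y\<close> y P b a0 W1 h \<open>a \<le> x\<close> in \<open>auto simp: U_def bc_def\<close>)
      also have "\<dots> = H / (C + 1) * ((C + 1) / (k - C\<^sub>0))" using C by simp
      also have "\<dots> \<le> H / (C + 1) * q"
        using C \<open>0 \<le> H\<close> by (intro mult_left_mono) (auto simp: q_def)
      finally show ?thesis .
    next
      case False
      have "\<bar>y x\<bar> * x powr k \<le> \<bar>y a\<bar> * a powr k + H / (K - k)"
        by (rule stable_bound[OF a0 k(2) \<open>0 \<le> H\<close>, of y "\<alpha> i" h "P i"])
          (use S[OF False] y P b a0 W2 h \<open>a \<le> x\<close> in auto)
      also have "\<dots> = H / (C + 1) * ((C + 1) / (K - k))"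
        using C False \<open>bc i y\<close> by (simp add: bc_def)
      also have "\<dots> \<le> H / (C + 1) * q"
        using C \<open>0 \<le> H\<close> by (intro mult_left_mono) (auto simp: q_def)
      finally show ?thesis .
    qed
    then have "\<bar>y x\<bar> * x powr k * x powr (- k) \<le> H / (C + 1) * q * x powr (- k)"
      by (intro mult_right_mono) auto
    then show ?thesis
      using a0 \<open>a \<le> x\<close> by (simp add: mult.assoc flip: powr_add)
  qed
  \<comment> \<open>The nonlinearity frozen at the candidate x^(-k) \<xi>. The bound by 1/(x * x
    powr k) combines the Lipschitz rate C/x with the rescaling.\<close>
  define h where "h \<xi> x = g x (x powr (- k) *\<^sub>R apply_bcontfun \<xi> x)" for \<xi> :: "real \<Rightarrow>\<^sub>C (real ^ 'n)" and x
  have h_cont: "continuous_on {b<..} (\<lambda>x. h \<xi> x $ i)" for \<xi> i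
  proof -
    have "continuous_on {b<..} (\<lambda>x. (case (x, x powr (- k) *\<^sub>R apply_bcontfun \<xi> x) of (x, y) \<Rightarrow> g x y) $ i)"
      by (intro continuous_intros continuous_on_compose2[OF g_cont]) (use b in auto)
    then show ?thesis by (simp add: h_def)
  qed
  have h_lip: "norm (h \<xi> x - h \<eta> x) \<le> C * norm (\<xi> - \<eta>) / (x * x powr k)"
    if "norm \<xi> \<le> 1" "norm \<eta> \<le> 1" "a \<le> x" for \<xi> \<eta> x
  proof -
    have "norm (x powr (- k) *\<^sub>R apply_bcontfun \<zeta> x) \<le> x powr (- k)" if "norm \<zeta> \<le> 1" for \<zeta> :: "real \<Rightarrow>\<^sub>C (real ^ 'n)"
      using mult_left_mono[of "norm (apply_bcontfun \<zeta> x)" 1 "x powr (- k)"] norm_bounded[of \<zeta> x] that by simp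
    then have "norm (h \<xi> x - h \<eta> x)
        \<le> C / x * norm (x powr (- k) *\<^sub>R apply_bcontfun \<xi> x - x powr (- k) *\<^sub>R apply_bcontfun \<eta> x)"
      unfolding h_def using that by (intro lip) auto
    also have "\<dots> = C / x * (x powr (- k) * norm (apply_bcontfun (\<xi> - \<eta>) x))"
      by (simp flip: scaleR_diff_right)
    also have "\<dots> \<le> C / x * (x powr (- k) * norm (\<xi> - \<eta>))"
      using C a0 that norm_bounded[of "\<xi> - \<eta>" x] by (intro mult_left_mono) auto
    finally show ?thesis by (simp add: powr_minus field_simps)
  qed
  have h_bound: "norm (h \<xi> x) \<le> (C + 1) / (x * x powr k)" if "norm \<xi> \<le> 1" "a \<le> x" for \<xi> x
  proof -
    have "norm (h \<xi> x) \<le> norm (h \<xi> x - h 0 x) + norm (g x 0)"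
      using norm_triangle_ineq[of "h \<xi> x - h 0 x" "h 0 x"] by (simp add: h_def)
    also have "\<dots> \<le> C * norm \<xi> / (x * x powr k) + x powr (- k) / x"
      using h_lip[of \<xi> 0 x] zero that by (intro add_mono) auto
    also have "\<dots> \<le> C * 1 / (x * x powr k) + x powr (- k) / x"
      using C a0 that by (intro add_mono divide_right_mono mult_left_mono) auto
    finally show ?thesis by (simp add: powr_minus field_simps add_divide_distrib)
  qed
  \<comment> \<open>The guard makes the choice of a solution total; outside the unit ball the chosen
    function is arbitrary.\<close>
  have y_ex: "\<exists>y. norm \<xi> \<le> 1 \<longrightarrow> (\<forall>x>b. (y has_real_derivative \<alpha> i x * y x + h \<xi> x $ i) (at x)) \<and> bc i y" for \<xi> i
  proof (cases "norm \<xi> \<le> 1")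
    case True
    have hb: "\<bar>h \<xi> x $ i\<bar> \<le> (C + 1) / (x * x powr k)" if "a \<le> x" for x
      using component_le_norm_cart[of "h \<xi> x" i] h_bound[OF True that] by linarith
    show ?thesis
    proof (cases "U i")
      case U: True
      show ?thesis
        using unstable_solution[OF b k(1) _ h_cont[of \<xi> i] P[where i = i], of "C + 1"] U hb C by (auto simp: U_def bc_def)
    next
      case False
      then show ?thesis
        using stable_solution[OF h_cont[of \<xi> i] P[where i = i], of a] by (auto simp: bc_def)
    qed
  qed auto
  define y where "y \<xi> i = (SOME y. norm \<xi> \<le> 1 \<longrightarrow>
    (\<forall>x>b. (y has_real_derivative \<alpha> i x * y x + h \<xi> x $ i) (at x)) \<and> bc i y)" for \<xi> i
  have y: "(y \<xi> i has_real_derivative \<alpha> i x * y \<xi> i x + h \<xi> x $ i) (at x)"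
    if "norm \<xi> \<le> 1" "b < x" for \<xi> i x
    using someI_ex[OF y_ex[of \<xi> i]] that unfolding y_def[symmetric] by auto
  have y_bc: "bc i (y \<xi> i)" if "norm \<xi> \<le> 1" for \<xi> i
    using someI_ex[OF y_ex[of \<xi> i]] that unfolding y_def[symmetric] by auto
  \<comment> \<open>With \<open>max a x\<close> the rescaled solution is continued by a constant to
    the left of \<open>a\<close>, which makes it a bounded continuous function on the whole
    line.\<close>
  define z where "z \<xi> x = (\<chi> i. max a x powr k * y \<xi> i (max a x))" for \<xi> x
  have z_bound: "norm (z \<xi> x) \<le> 1 / 2" if "norm \<xi> \<le> 1" for \<xi> x
  proof -
    have z_le: "\<bar>z \<xi> x $ i\<bar> \<le> q" for i
    proof -
      have "\<bar>y \<xi> i (max a x)\<bar> \<le> (C + 1) / (C + 1) * q * max a x powr (- k)"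
      proof (rule bound[OF y[OF \<open>norm \<xi> \<le> 1\<close>] y_bc[OF that]])
        show "\<bar>h \<xi> x $ i\<bar> \<le> (C + 1) / (x * x powr k)" if "a \<le> x" for x
          using component_le_norm_cart[of "h \<xi> x" i] h_bound[OF \<open>norm \<xi> \<le> 1\<close> that] by linarith
      qed (use C in auto)
      then have "max a x powr k * \<bar>y \<xi> i (max a x)\<bar> \<le> max a x powr k * (q * max a x powr (- k))"
        using C by (intro mult_left_mono) auto
      also have "\<dots> = q" using a0 by (simp add: powr_minus)
      finally show ?thesis by (simp add: z_def abs_mult)
    qed
    show ?thesis using norm_le_card_mult[OF z_le] q by linarith
  qed
  have z_cont: "continuous_on UNIV (z \<xi>)" if "norm \<xi> \<le> 1" for \<xi>
  proof -
    have "continuous_on {b<..} (y \<xi> i)" for i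
      by (rule DERIV_continuous_on) (use y[OF \<open>norm \<xi> \<le> 1\<close>] in \<open>auto intro: has_field_derivative_at_within\<close>)
    then have "continuous_on UNIV (\<lambda>x. y \<xi> i (max a x))" for i
      by (rule continuous_on_compose2) (use b in \<open>auto intro!: continuous_intros\<close>)
    then show ?thesis
      unfolding z_def using a0 by (intro continuous_intros continuous_on_vec_lambda) auto
  qed
  have z_bcont: "z \<xi> \<in> bcontfun" if "norm \<xi> \<le> 1" for \<xi>
    by (rule bcontfun_normI[OF z_cont[OF that] z_bound[OF that]])
  define F where "F \<xi> = Bcontfun (z \<xi>)" for \<xi>
  have F_apply: "apply_bcontfun (F \<xi>) = z \<xi>" if "norm \<xi> \<le> 1" for \<xi>
    unfolding F_def by (rule Bcontfun_inverse[OF z_bcont[OF that]])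
  have "\<exists>!\<xi>. \<xi> \<in> cball 0 1 \<and> F \<xi> = \<xi>"
  proof (rule Banach_fix)
    show "complete (cball 0 1 :: (real \<Rightarrow>\<^sub>C (real ^ 'n)) set)" by (simp add: complete_eq_closed)
    show "F ` cball 0 1 \<subseteq> cball 0 1"
    proof
      fix \<eta> assume "\<eta> \<in> F ` cball 0 1"
      then obtain \<xi> where \<xi>: "norm \<xi> \<le> 1" "\<eta> = F \<xi>" by auto
      have "norm (F \<xi>) \<le> 1"
      proof (rule norm_bound)
        show "norm (apply_bcontfun (F \<xi>) x) \<le> 1" for x
          using z_bound[OF \<xi>(1), of x] by (simp add: F_apply[OF \<xi>(1)])
      qed
      then show "\<eta> \<in> cball 0 1" using \<xi> by simp
    qed
    show "dist (F \<xi>) (F \<eta>) \<le> 1 / 2 * dist \<xi> \<eta>" if "\<xi> \<in> cball 0 1" "\<eta> \<in> cball 0 1" for \<xi> \<eta>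
    proof -
      have n: "norm \<xi> \<le> 1" "norm \<eta> \<le> 1" using that by auto
      have comp: "\<bar>(z \<xi> x - z \<eta> x) $ i\<bar> \<le> q * norm (\<xi> - \<eta>)" for x i
      proof -
        have "\<bar>y \<xi> i (max a x) - y \<eta> i (max a x)\<bar>
            \<le> (C * norm (\<xi> - \<eta>)) / (C + 1) * q * max a x powr (- k)"
        proof (rule bound)
          show "((\<lambda>x. y \<xi> i x - y \<eta> i x) has_real_derivative
              \<alpha> i x * (y \<xi> i x - y \<eta> i x) + (h \<xi> x $ i - h \<eta> x $ i)) (at x)" if "b < x" for x
            using DERIV_diff[OF y[OF n(1) that] y[OF n(2) that], of i i] by (simp add: algebra_simps)
          show "bc i (\<lambda>x. y \<xi> i x - y \<eta> i x)"
          proof (cases "U i")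
            case True
            then have "((\<lambda>x. exp (- P i x) * y \<xi> i x - exp (- P i x) * y \<eta> i x) \<longlongrightarrow> 0 - 0) at_top"
              using y_bc[OF n(1), of i] y_bc[OF n(2), of i] by (intro tendsto_diff) (auto simp: bc_def)
            then show ?thesis using True by (simp add: bc_def right_diff_distrib)
          next
            case False
            then show ?thesis using y_bc[OF n(1), of i] y_bc[OF n(2), of i] by (auto simp: bc_def)
          qed
          show "\<bar>h \<xi> x $ i - h \<eta> x $ i\<bar> \<le> C * norm (\<xi> - \<eta>) / (x * x powr k)" if "a \<le> x" for x
            using component_le_norm_cart[of "h \<xi> x - h \<eta> x" i] h_lip[OF n that] by simp
        qed (use C in auto)
        then have "max a x powr k * \<bar>y \<xi> i (max a x) - y \<eta> i (max a x)\<bar>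
            \<le> max a x powr k * ((C * norm (\<xi> - \<eta>)) / (C + 1) * q * max a x powr (- k))"
          by (intro mult_left_mono) auto
        also have "\<dots> = C / (C + 1) * (q * norm (\<xi> - \<eta>))"
          using a0 by (simp add: powr_minus)
        also have "\<dots> \<le> 1 * (q * norm (\<xi> - \<eta>))"
          using C q0 by (intro mult_right_mono) auto
        finally show ?thesis by (simp add: z_def abs_mult flip: right_diff_distrib)
      qed
      have "dist (F \<xi>) (F \<eta>) = norm (F \<xi> - F \<eta>)" by (simp add: dist_norm)
      also have "\<dots> \<le> real CARD('n) * (q * norm (\<xi> - \<eta>))"
      proof (rule norm_bound)
        fix x
        show "norm (apply_bcontfun (F \<xi> - F \<eta>) x) \<le> real CARD('n) * (q * norm (\<xi> - \<eta>))"
          using norm_le_card_mult[OF comp] by (simp add: F_apply n)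
      qed
      also have "\<dots> \<le> 1 / 2 * norm (\<xi> - \<eta>)"
        using mult_right_mono[OF q, of "norm (\<xi> - \<eta>)"] by (simp add: mult.assoc)
      finally show ?thesis by (simp add: dist_norm)
    qed
  qed auto
  then obtain \<xi> where \<xi>: "norm \<xi> \<le> 1" "F \<xi> = \<xi>" by auto
  define w where "w x = (\<chi> i. y \<xi> i x)" for x
  \<comment> \<open>Beyond \<open>a\<close> the constant continuation is invisible, and the fixed
    point equation says that \<open>w\<close> is its own candidate.\<close>
  have w: "w x = x powr (- k) *\<^sub>R apply_bcontfun \<xi> x" if "a < x" for x
  proof -
    have "apply_bcontfun \<xi> x = z \<xi> x" using F_apply[OF \<xi>(1)] \<xi>(2) by simp
    then show ?thesis
      using that a0 by (simp add: z_def w_def vec_eq_iff powr_minus)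
  qed
  show ?thesis
  proof (intro exI[of _ w] allI impI conjI)
    fix x assume x: "a < x"
    show "norm (w x) \<le> x powr (- k)"
      unfolding w[OF x] using mult_left_mono[of "norm (apply_bcontfun \<xi> x)" 1 "x powr (- k)"] norm_bounded[of \<xi> x] \<xi>(1)
      by simp
    fix i
    show "((\<lambda>x. w x $ i) has_real_derivative \<alpha> i x * w x $ i + g x (w x) $ i) (at x)"
    proof -
      have "h \<xi> x = g x (w x)" by (simp add: h_def w[OF x])
      moreover have "(\<lambda>x. w x $ i) = y \<xi> i" by (auto simp: w_def)
      then have "w x $ i = y \<xi> i x" by metis
      ultimately show ?thesis
        using y[OF \<xi>(1), of x i] x b \<open>(\<lambda>x. w x $ i) = y \<xi> i\<close> by simp
    qed
  qed
qed

text \<open>The weight \<open>W\<close> is x^m up to a point \<open>t\<close> and continues as a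
  multiple of x^k. Its supremum \<open>Q\<close> against \<open>norm (w x)\<close> is finite by the
  decay already known, so the linear estimates can be closed on it and give Q <= B + (Q + 1)/2. The
  resulting bound 2B + 1 does not depend on \<open>t\<close>; evaluating at \<open>t\<close> gives
  order m.\<close>

lemma decay_improvement:
  fixes \<alpha> :: "'n::finite \<Rightarrow> real \<Rightarrow> real" and w h :: "real \<Rightarrow> real ^ 'n"
  assumes a0: "0 < a" and k: "C\<^sub>0 < k" "k \<le> m" "m < K" and C: "0 \<le> C"
    and rate: "\<And>i. (\<forall>x\<ge>a. - C\<^sub>0 / x \<le> \<alpha> i x) \<or> (\<forall>x\<ge>a. \<alpha> i x \<le> - K / x)"
    and P: "\<And>i x. a \<le> x \<Longrightarrow> (P i has_real_derivative \<alpha> i x) (at x)"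
    and small: "real CARD('n) * ((C + 1) / (k - C\<^sub>0)) \<le> 1 / 2" "real CARD('n) * ((C + 1) / (K - m)) \<le> 1 / 2"
    and w: "\<And>i x. a \<le> x \<Longrightarrow> ((\<lambda>x. w x $ i) has_real_derivative \<alpha> i x * w x $ i + h x $ i) (at x)"
    and h: "\<And>x. a \<le> x \<Longrightarrow> norm (h x) \<le> C / x * norm (w x) + x powr (- m) / x"
    and decay: "\<And>x. a \<le> x \<Longrightarrow> norm (w x) \<le> D * x powr (- k)"
  shows "\<exists>B. \<forall>x\<ge>a. norm (w x) \<le> B * x powr (- m)"
proof -
  define B where "B = real CARD('n) * (norm (w a) * a powr m)"
  have bound: "norm (w t) * t powr m \<le> 2 * B + 1" if t: "a \<le> t" for t
  proof -
    define W where "W x = x powr k * (min x t) powr (m - k)" for x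
    define Q where "Q = (SUP x\<in>{a..}. norm (w x) * W x)"
    have t0: "0 < t" using a0 t by linarith
    have W_pos: "0 < W x" if "a \<le> x" for x using that a0 t0 by (simp add: W_def min_def)
    have W_le: "W x \<le> x powr m" if "a \<le> x" for x
    proof -
      have "W x \<le> x powr k * x powr (m - k)"
        unfolding W_def using that a0 t0 k by (intro mult_left_mono powr_mono2) auto
      then show ?thesis by (simp flip: powr_add)
    qed
    \<comment> \<open>Unstable coordinates need a weight growing at least like the power k, stable
      ones a weight growing at most like the power m; the interpolating weight does both.\<close>
    have W1: "W s * (r / s) powr k \<le> W r" if "a \<le> s" "s \<le> r" for s r
    proof -
      have "W s * (r / s) powr k = r powr k * (min s t) powr (m - k)"
        using that a0 by (simp add: W_def powr_divide)
      also have "\<dots> \<le> W r"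
        unfolding W_def using that a0 t0 k by (intro mult_left_mono powr_mono2) auto
      finally show ?thesis .
    qed
    have W2: "W r \<le> W s * (r / s) powr m" if "a \<le> s" "s \<le> r" for s r
    proof -
      have s0: "0 < s" using that a0 by linarith
      have "min r t \<le> min s t * (r / s)"
        using that s0 t0 mult_right_mono[of s r t] by (auto simp: min_def field_simps)
      then have "W r \<le> r powr k * (min s t * (r / s)) powr (m - k)"
        unfolding W_def using that s0 t0 k by (intro mult_left_mono powr_mono2) auto
      also have "\<dots> = r powr k * (min s t) powr (m - k) * (r / s) powr (m - k)"
        using s0 t0 that powr_mult[of "min s t" "r / s" "m - k"] by simp
      also have "\<dots> = W s * (r / s) powr k * (r / s) powr (m - k)"
        using s0 t0 that by (simp add: W_def powr_divide)
      also have "\<dots> = W s * (r / s) powr m"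
        by (simp only: mult.assoc flip: powr_add) simp
      finally show ?thesis .
    qed
    have D: "0 \<le> D"
    proof -
      have "0 \<le> D * a powr (- k)" using decay[of a] norm_ge_zero[of "w a"] by linarith
      then show ?thesis using a0 by (simp add: zero_le_mult_iff)
    qed
    have bdd: "bdd_above ((\<lambda>x. norm (w x) * W x) ` {a..})"
    proof (rule bdd_aboveI2)
      fix x assume "x \<in> {a..}"
      then have x: "a \<le> x" "0 < x" using a0 by auto
      have "norm (w x) * W x \<le> (D * x powr (- k)) * (x powr k * t powr (m - k))"
        unfolding W_def using x decay[OF x(1)] t0 k D
        by (intro mult_mono mult_left_mono powr_mono2) auto
      also have "\<dots> = D * t powr (m - k)" using x by (simp add: powr_minus)
      finally show "norm (w x) * W x \<le> D * t powr (m - k)" .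
    qed
    have Q: "norm (w x) * W x \<le> Q" if "a \<le> x" for x
      unfolding Q_def using that by (intro cSUP_upper bdd) auto
    have "0 \<le> norm (w a) * W a" using W_pos[of a] by simp
    then have Q0: "0 \<le> Q" using Q[of a] by linarith
    have hb: "\<bar>h x $ i\<bar> \<le> (C * Q + 1) / (x * W x)" if "a \<le> x" for x i
    proof -
      have x0: "0 < x" using that a0 by linarith
      have "\<bar>h x $ i\<bar> \<le> C / x * norm (w x) + x powr (- m) / x"
        using component_le_norm_cart[of "h x" i] h[OF that] by linarith
      also have "\<dots> \<le> C / x * (Q / W x) + (1 / W x) / x"
        using Q[OF that] W_le[OF that] W_pos[OF that] x0 C that
        by (intro add_mono mult_left_mono divide_right_mono)
          (auto simp: powr_minus field_simps)
      also have "\<dots> = (C * Q + 1) / (x * W x)"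
        using x0 W_pos[OF that] by (simp add: field_simps)
      finally show ?thesis .
    qed
    define c where "c = max ((C * Q + 1) / (k - C\<^sub>0)) ((C * Q + 1) / (K - m))"
    have CQ: "(C * Q + 1) / d \<le> (Q + 1) * ((C + 1) / d)" if "0 < d" for d
      using that C Q0 by (simp add: field_simps)
    \<comment> \<open>The smallness of the solution operator is spent here: half of \<open>Q\<close>
      remains on the other side to absorb the feedback.\<close>
    have c_le: "real CARD('n) * c \<le> (Q + 1) / 2"
    proof -
      have "real CARD('n) * ((C * Q + 1) / d) \<le> (Q + 1) / 2"
        if "real CARD('n) * ((C + 1) / d) \<le> 1 / 2" "0 < d" for d
      proof -
        have "real CARD('n) * ((C * Q + 1) / d) \<le> real CARD('n) * ((Q + 1) * ((C + 1) / d))"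
          by (intro mult_left_mono CQ that) auto
        also have "\<dots> = (Q + 1) * (real CARD('n) * ((C + 1) / d))" by (simp only: mult_ac)
        also have "\<dots> \<le> (Q + 1) * (1 / 2)" using that Q0 by (intro mult_left_mono) auto
        finally show ?thesis by simp
      qed
      from this[OF small(1)] this[OF small(2)] k show ?thesis by (auto simp: c_def max_def)
    qed
    have comp: "\<bar>w x $ i\<bar> * W x \<le> norm (w a) * W a + c" if x: "a \<le> x" for x i
    proof -
      have wa: "\<bar>w a $ i\<bar> * W a \<le> norm (w a) * W a"
        using component_le_norm_cart[of "w a" i] W_pos[of a] by (intro mult_right_mono) auto
      have H0: "0 \<le> C * Q + 1" using C Q0 by simp
      from rate[of i] show ?thesis
      proof
        assume U: "\<forall>x\<ge>a. - C\<^sub>0 / x \<le> \<alpha> i x"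
        have "((\<lambda>x. exp (- P i x) * w x $ i) \<longlongrightarrow> 0) at_top"
        proof (rule unstable_decay[OF a0 k(1) P])
          show "\<bar>w x $ i\<bar> \<le> D * x powr (- k)" if "a \<le> x" for x
            using component_le_norm_cart[of "w x" i] decay[OF that] by linarith
        qed (use U in auto)
        then have "\<bar>w x $ i\<bar> * W x \<le> (C * Q + 1) / (k - C\<^sub>0)"
          using unstable_bound[OF a0 k(1) H0 w P _ W_pos W1 hb _ x] U by blast
        moreover have "0 \<le> norm (w a) * W a" using W_pos[of a] by simp
        ultimately show ?thesis unfolding c_def by linarith
      next
        assume S: "\<forall>x\<ge>a. \<alpha> i x \<le> - K / x"
        then have "\<bar>w x $ i\<bar> * W x \<le> \<bar>w a $ i\<bar> * W a + (C * Q + 1) / (K - m)"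
          using stable_bound[OF a0 k(3) H0 w P _ W_pos W2 hb x] by blast
        then show ?thesis using wa unfolding c_def by linarith
      qed
    qed
    have total: "norm (w x) * W x \<le> B + (Q + 1) / 2" if x: "a \<le> x" for x
    proof -
      have Wa: "W a = a powr m"
        unfolding W_def using t a0 by (simp add: min_def flip: powr_add)
      have "norm (W x *\<^sub>R w x) \<le> real CARD('n) * (norm (w a) * W a + c)"
        by (rule norm_le_card_mult) (use comp[OF x] W_pos[OF x] in \<open>simp add: abs_mult mult.commute\<close>)
      also have "\<dots> = B + real CARD('n) * c" by (simp add: B_def Wa distrib_left)
      finally have "norm (w x) * W x \<le> B + real CARD('n) * c"
        using W_pos[OF x] by (simp add: mult.commute)
      then show ?thesis using c_le by linarith
    qed
    then have "Q \<le> B + (Q + 1) / 2" unfolding Q_def by (intro cSUP_least) auto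
    then have "Q \<le> 2 * B + 1" by (simp add: field_simps)
    moreover have "W t = t powr m" using t0 by (simp add: W_def flip: powr_add)
    ultimately show ?thesis using Q[OF t] by simp
  qed
  show ?thesis
  proof (intro exI[of _ "2 * B + 1"] allI impI)
    fix x assume x: "a \<le> x"
    then have "norm (w x) * x powr m * x powr (- m) \<le> (2 * B + 1) * x powr (- m)"
      by (intro mult_right_mono bound) auto
    then show "norm (w x) \<le> (2 * B + 1) * x powr (- m)"
      using a0 x by (simp add: mult.assoc flip: powr_add)
  qed
qed

text \<open>
  In the first case the homogeneous equation \<open>y' = \<alpha> y\<close> decays at most like a fixed power, and a rapidly
  decaying solution of the inhomogeneous one is found by integration from infinity; in the second
  case it decays faster than any power, and one integrates from an initial point.
\<close>

definition dichotomic :: "(real \<Rightarrow> real) \<Rightarrow> bool" where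
  "dichotomic \<alpha> \<longleftrightarrow> (\<exists>C. \<forall>\<^sub>F x in at_top. - C / x \<le> \<alpha> x) \<or> (\<forall>K. \<forall>\<^sub>F x in at_top. \<alpha> x \<le> - K / x)"

text \<open>The solution is built near one \<open>Y k\<close>, with \<open>k\<close> large against
  \<open>C\<^sub>0\<close> and the Lipschitz constant. For m > k its distance to \<open>Y m\<close>
  is O(x^(-k)) to begin with and solves an equation with residual O(x^(-m-1)), so the decay improves
  to order m; for m <= k one compares with \<open>Y k\<close>.\<close>

theorem diagonal_system_solution:
  fixes \<alpha> :: "'n::finite \<Rightarrow> real \<Rightarrow> real" and g :: "real \<Rightarrow> real ^ 'n \<Rightarrow> real ^ 'n"
    and Y Y' :: "nat \<Rightarrow> real \<Rightarrow> real ^ 'n"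
  assumes b: "1 \<le> b" and C: "0 \<le> C"
    and \<alpha>_cont: "\<And>i. continuous_on {b<..} (\<alpha> i)"
    and g_cont: "continuous_on ({b<..} \<times> UNIV) (\<lambda>(x, y). g x y)"
    and Y'_cont: "\<And>k. continuous_on {b<..} (Y' k)"
    and dich: "\<And>i. dichotomic (\<alpha> i)"
    and lip: "\<And>x u v. b < x \<Longrightarrow> norm u \<le> (A + 1) / x \<Longrightarrow> norm v \<le> (A + 1) / x \<Longrightarrow>
      norm (g x u - g x v) \<le> C / x * norm (u - v)"
    and Y: "\<And>k i x. b < x \<Longrightarrow> ((\<lambda>x. Y k x $ i) has_real_derivative Y' k x $ i) (at x)"
    and residual: "\<And>k. \<forall>\<^sub>F x in at_top.
      norm (\<chi> i. \<alpha> i x * Y k x $ i + g x (Y k x) $ i - Y' k x $ i) \<le> x powr (- real k) / x"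
    and Y_bound: "\<And>k. \<forall>\<^sub>F x in at_top. norm (Y k x) \<le> A / x"
    and Y_diff: "\<And>k m. k \<le> m \<Longrightarrow> \<forall>\<^sub>F x in at_top. norm (Y m x - Y k x) \<le> x powr (- real k)"
  shows "\<exists>y a. b \<le> a \<and> (\<forall>x>a. \<forall>i. ((\<lambda>x. y x $ i) has_real_derivative \<alpha> i x * y x $ i + g x (y x) $ i) (at x)) \<and>
    (\<forall>k. \<exists>B. \<forall>\<^sub>F x in at_top. norm (y x - Y k x) \<le> B * x powr (- real k))"
proof -
  have "\<exists>C\<ge>0. (\<forall>\<^sub>F x in at_top. - C / x \<le> \<alpha> i x) \<or> (\<forall>K. \<forall>\<^sub>F x in at_top. \<alpha> i x \<le> - K / x)" for i
  proof (cases "\<exists>C. \<forall>\<^sub>F x in at_top. - C / x \<le> \<alpha> i x")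
    case True
    then obtain C where "\<forall>\<^sub>F x in at_top. - C / x \<le> \<alpha> i x" by blast
    then have "\<forall>\<^sub>F x in at_top. - \<bar>C\<bar> / x \<le> \<alpha> i x"
      using eventually_gt_at_top[of 0]
    proof eventually_elim
      case (elim x)
      have "- \<bar>C\<bar> / x \<le> - C / x" using elim by (intro divide_right_mono) auto
      then show ?case using elim by linarith
    qed
    then show ?thesis by (intro exI[of _ "\<bar>C\<bar>"]) auto
  next
    case False
    then show ?thesis using dich[of i] unfolding dichotomic_def by (intro exI[of _ 0]) auto
  qed
  then obtain c where c: "\<And>i. 0 \<le> c i"
    and c': "\<And>i. (\<forall>\<^sub>F x in at_top. - c i / x \<le> \<alpha> i x) \<or> (\<forall>K. \<forall>\<^sub>F x in at_top. \<alpha> i x \<le> - K / x)"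
    by metis
  define C\<^sub>0 where "C\<^sub>0 = (\<Sum>i\<in>UNIV. c i)"
  have C0: "0 \<le> C\<^sub>0" unfolding C\<^sub>0_def by (intro sum_nonneg) (auto simp: c)
  \<comment> \<open>\<open>C\<^sub>0\<close> serves all coordinates and all \<open>K\<close>; only
    the starting point moves with \<open>K\<close>. This permits a different \<open>K\<close> for
    every order \<open>m\<close>.\<close>
  have rate_ev: "\<exists>a\<ge>b. \<forall>i. (\<forall>x\<ge>a. - C\<^sub>0 / x \<le> \<alpha> i x) \<or> (\<forall>x\<ge>a. \<alpha> i x \<le> - K / x)" for K
  proof -
    have "\<exists>a. (\<forall>x\<ge>a. - C\<^sub>0 / x \<le> \<alpha> i x) \<or> (\<forall>x\<ge>a. \<alpha> i x \<le> - K / x)" for i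
      using c'[of i]
    proof
      assume "\<forall>\<^sub>F x in at_top. - c i / x \<le> \<alpha> i x"
      then have "\<forall>\<^sub>F x in at_top. - C\<^sub>0 / x \<le> \<alpha> i x"
        using eventually_gt_at_top[of 0]
      proof eventually_elim
        case (elim x)
        have "c i \<le> C\<^sub>0" unfolding C\<^sub>0_def by (rule member_le_sum) (auto simp: c)
        then have "- C\<^sub>0 / x \<le> - c i / x" using elim by (intro divide_right_mono) auto
        then show ?case using elim by linarith
      qed
      then show ?thesis unfolding eventually_at_top_linorder by blast
    next
      assume "\<forall>K. \<forall>\<^sub>F x in at_top. \<alpha> i x \<le> - K / x"
      then show ?thesis unfolding eventually_at_top_linorder by blast
    qed
    then obtain a where a: "\<And>i. (\<forall>x\<ge>a i. - C\<^sub>0 / x \<le> \<alpha> i x) \<or> (\<forall>x\<ge>a i. \<alpha> i x \<le> - K / x)" by metis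
    define a' where "a' = Max (insert b (range a))"
    have "b \<le> a'" unfolding a'_def by (rule Max_ge) auto
    moreover have "a i \<le> a'" for i unfolding a'_def by (rule Max_ge) auto
    ultimately show ?thesis
      using a by (intro exI[of _ a']) (meson order_trans)
  qed
  have "\<exists>P. \<forall>i. \<forall>x>b. (P i has_real_derivative \<alpha> i x) (at x)"
    by (intro choice allI antiderivative_greaterThan \<alpha>_cont)
  then obtain P where P: "\<And>i x. b < x \<Longrightarrow> (P i has_real_derivative \<alpha> i x) (at x)" by blast
  \<comment> \<open>A gap of at least \<open>d\<close> between the exponents gives the solution
    operator norm at most 1/2.\<close>
  define d where "d = 2 * real CARD('n) * (C + 1)"
  have d0: "0 < d" using C by (simp add: d_def)
  have small: "real CARD('n) * ((C + 1) / e) \<le> 1 / 2" if "d \<le> e" for e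
    using that d0 by (simp add: d_def field_simps)
  define k where "k = nat \<lceil>C\<^sub>0 + d\<rceil> + 1"
  have k: "C\<^sub>0 + d \<le> real k" "1 \<le> k" unfolding k_def by linarith+
  obtain a\<^sub>1 where a1: "b \<le> a\<^sub>1"
    and rate1: "\<And>i. (\<forall>x\<ge>a\<^sub>1. - C\<^sub>0 / x \<le> \<alpha> i x) \<or> (\<forall>x\<ge>a\<^sub>1. \<alpha> i x \<le> - (k + d) / x)"
    using rate_ev by blast
  obtain a\<^sub>2 where a2: "\<And>x. a\<^sub>2 \<le> x \<Longrightarrow> norm (\<chi> i. \<alpha> i x * Y k x $ i + g x (Y k x) $ i - Y' k x $ i) \<le> x powr (- real k) / x"
      "\<And>x. a\<^sub>2 \<le> x \<Longrightarrow> norm (Y k x) \<le> A / x"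
    using eventually_conj[OF residual[of k] Y_bound[of k]] unfolding eventually_at_top_linorder by blast
  define a where "a = max a\<^sub>1 a\<^sub>2 + 1"
  have a: "b < a" "1 < a" "a\<^sub>1 \<le> a" "a\<^sub>2 \<le> a" using a1 b by (auto simp: a_def)
  have powr_le: "x powr (- real k) \<le> 1 / x" if "1 \<le> x" for x
    using powr_mono[of "- real k" "- 1" x] k that by (simp add: powr_minus inverse_eq_divide)
  define G where "G x w = (\<chi> i. \<alpha> i x * Y k x $ i + g x (Y k x + w) $ i - Y' k x $ i)" for x w
  have G_diff: "G x u - G x v = g x (Y k x + u) - g x (Y k x + v)" for x u v
    by (simp add: G_def vec_eq_iff)
  \<comment> \<open>As k >= 1, a deviation of size x^(-k) keeps \<open>Y k\<close> within the ball
    of radius (A + 1)/x on which \<open>lip\<close> holds.\<close>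
  have near: "norm (Y k x + u) \<le> (A + 1) / x" if "a \<le> x" "norm u \<le> x powr (- real k)" for x u
    using norm_triangle_ineq[of "Y k x" u] a2(2)[of x] powr_le[of x] that a by (simp add: add_divide_distrib)
  have "\<exists>w. \<forall>x>a. norm (w x) \<le> x powr (- real k) \<and>
    (\<forall>i. ((\<lambda>x. w x $ i) has_real_derivative \<alpha> i x * w x $ i + G x (w x) $ i) (at x))"
  proof (rule decaying_solution)
    show "0 \<le> b" "b < a" "C\<^sub>0 < real k" "real k < real k + d" "0 \<le> C"
      using b a k d0 C by auto
    show "real CARD('n) * ((C + 1) / (real k - C\<^sub>0)) \<le> 1 / 2" "real CARD('n) * ((C + 1) / (real k + d - real k)) \<le> 1 / 2"
      by (rule small, use k in simp)+
    show "continuous_on {b<..} (\<alpha> i)" for i by (rule \<alpha>_cont)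
    show "(\<forall>x\<ge>a. - C\<^sub>0 / x \<le> \<alpha> i x) \<or> (\<forall>x\<ge>a. \<alpha> i x \<le> - (real k + d) / x)" for i
      using rate1[of i] a by (meson order_trans)
    show "norm (G x u - G x v) \<le> C / x * norm (u - v)"
      if "a \<le> x" "norm u \<le> x powr (- real k)" "norm v \<le> x powr (- real k)" for x u v
      using lip[of x "Y k x + u" "Y k x + v"] near that a by (simp add: G_diff)
    show "norm (G x 0) \<le> x powr (- real k) / x" if "a \<le> x" for x
      using a2(1)[of x] that a by (simp add: G_def)
    have Y_cont: "continuous_on {b<..} (\<lambda>x. Y k x $ i)" for i
      by (rule DERIV_continuous_on) (use Y in \<open>auto intro: has_field_derivative_at_within\<close>)
    have "continuous_on {b<..} (\<lambda>x. \<chi> i. Y k x $ i)"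
      by (intro continuous_on_vec_lambda Y_cont)
    then have Y_cont': "continuous_on {b<..} (Y k)" by simp
    have fst_cont: "continuous_on ({b<..} \<times> UNIV) (\<lambda>p. f (fst p))" if "continuous_on {b<..} f"
      for f :: "real \<Rightarrow> 'z::topological_space"
      by (rule continuous_on_compose2[OF that]) (auto intro!: continuous_intros)
    have "continuous_on ({b<..} \<times> UNIV) (\<lambda>p. (case (fst p, Y k (fst p) + snd p) of (x, y) \<Rightarrow> g x y))"
      by (rule continuous_on_compose2[OF g_cont])
        (auto intro!: continuous_intros fst_cont[OF Y_cont'])
    then have g_cont': "continuous_on ({b<..} \<times> UNIV) (\<lambda>p. g (fst p) (Y k (fst p) + snd p))"
      by simp
    show "continuous_on ({b<..} \<times> UNIV) (\<lambda>(x, y). G x y)"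
      unfolding G_def case_prod_beta
      by (intro continuous_on_vec_lambda continuous_intros g_cont' fst_cont[OF \<alpha>_cont] fst_cont[OF Y_cont]
          fst_cont[OF Y'_cont])
  qed
  then obtain w where w_le: "\<And>x. a < x \<Longrightarrow> norm (w x) \<le> x powr (- real k)"
    and w: "\<And>x i. a < x \<Longrightarrow> ((\<lambda>x. w x $ i) has_real_derivative \<alpha> i x * w x $ i + G x (w x) $ i) (at x)"
    by blast
  define y where "y x = Y k x + w x" for x
  have y: "((\<lambda>x. y x $ i) has_real_derivative \<alpha> i x * y x $ i + g x (y x) $ i) (at x)" if "a < x" for x i
    using DERIV_add[OF Y[of x k i] w[OF that, of i]] that a
    by (simp add: y_def G_def algebra_simps)
  have asymp: "\<exists>B. \<forall>\<^sub>F x in at_top. norm (y x - Y m x) \<le> B * x powr (- real m)" for m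
  proof (cases "m \<le> k")
    case True
    have "\<forall>\<^sub>F x in at_top. norm (y x - Y m x) \<le> 2 * x powr (- real m)"
      using Y_diff[OF True] eventually_gt_at_top[of a]
    proof eventually_elim
      case (elim x)
      have "norm (w x) \<le> x powr (- real m)"
        using w_le[OF elim(2)] powr_mono[of "- real k" "- real m" x] True elim(2) a by linarith
      then show ?case
        using norm_triangle_ineq[of "Y k x - Y m x" "w x"] elim(1) by (simp add: y_def algebra_simps)
    qed
    then show ?thesis by blast
  next
    case False
    then have km: "k \<le> m" by simp
    obtain a\<^sub>3 where a3: "b \<le> a\<^sub>3"
      and rate3: "\<And>i. (\<forall>x\<ge>a\<^sub>3. - C\<^sub>0 / x \<le> \<alpha> i x) \<or> (\<forall>x\<ge>a\<^sub>3. \<alpha> i x \<le> - (m + d) / x)"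
      using rate_ev by blast
    obtain a\<^sub>4 where a4: "\<And>x. a\<^sub>4 \<le> x \<Longrightarrow> norm (\<chi> i. \<alpha> i x * Y m x $ i + g x (Y m x) $ i - Y' m x $ i) \<le> x powr (- real m) / x"
        "\<And>x. a\<^sub>4 \<le> x \<Longrightarrow> norm (Y m x) \<le> A / x" "\<And>x. a\<^sub>4 \<le> x \<Longrightarrow> norm (Y m x - Y k x) \<le> x powr (- real k)"
      using eventually_conj[OF residual[of m] eventually_conj[OF Y_bound[of m] Y_diff[OF km]]]
      unfolding eventually_at_top_linorder by blast
    define a' where "a' = max a (max a\<^sub>3 a\<^sub>4) + 1"
    have a': "a < a'" "b < a'" "1 < a'" "a\<^sub>3 \<le> a'" "a\<^sub>4 \<le> a'" using a by (auto simp: a'_def)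
    \<comment> \<open>The right side of the linear equation for the distance to \<open>Y m\<close>:
      a Lipschitz difference plus the residual of \<open>Y m\<close>.\<close>
    define h where "h x = g x (y x) - g x (Y m x) +
      (\<chi> i. \<alpha> i x * Y m x $ i + g x (Y m x) $ i - Y' m x $ i)" for x
    have "\<exists>B. \<forall>x\<ge>a'. norm (y x - Y m x) \<le> B * x powr (- real m)"
    proof (rule decay_improvement[where h = h and P = P and D = 2 and k = k and K = "m + d" and C = C
          and \<alpha> = \<alpha> and C\<^sub>0 = C\<^sub>0])
      show "0 < a'" "C\<^sub>0 < real k" "real k \<le> real m" "real m < real m + d" "0 \<le> C"
        using a' k d0 C km by auto
      show "real CARD('n) * ((C + 1) / (real k - C\<^sub>0)) \<le> 1 / 2" "real CARD('n) * ((C + 1) / (real m + d - real m)) \<le> 1 / 2"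
        by (rule small, use k in simp)+
      show "(\<forall>x\<ge>a'. - C\<^sub>0 / x \<le> \<alpha> i x) \<or> (\<forall>x\<ge>a'. \<alpha> i x \<le> - (real m + d) / x)" for i
        using rate3[of i] a' by (meson order_trans)
      show "(P i has_real_derivative \<alpha> i x) (at x)" if "a' \<le> x" for i x
        using P a' that by auto
      show "((\<lambda>x. (y x - Y m x) $ i) has_real_derivative \<alpha> i x * (y x - Y m x) $ i + h x $ i) (at x)"
        if "a' \<le> x" for x i
        using DERIV_diff[OF y[of x i] Y[of x m i]] that a' by (simp add: h_def algebra_simps)
      show "norm (y x - Y m x) \<le> 2 * x powr (- real k)" if "a' \<le> x" for x
        using norm_triangle_ineq4[of "w x" "Y m x - Y k x"] w_le[of x] a4(3)[of x] that a'
        by (simp add: y_def algebra_simps)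
      show "norm (h x) \<le> C / x * norm (y x - Y m x) + x powr (- real m) / x" if "a' \<le> x" for x
      proof -
        have "norm (y x) \<le> (A + 1) / x"
          unfolding y_def using near[of x "w x"] w_le[of x] that a' by auto
        moreover have "norm (Y m x) \<le> (A + 1) / x"
          using a4(2)[of x] that a' by (auto simp: add_divide_distrib intro: order_trans)
        ultimately have "norm (g x (y x) - g x (Y m x)) \<le> C / x * norm (y x - Y m x)"
          using lip that a' by auto
        then show ?thesis
          unfolding h_def using norm_triangle_ineq[of "g x (y x) - g x (Y m x)"] a4(1)[of x] that a'
          by (meson add_mono order_trans)
      qed
    qed
    then show ?thesis unfolding eventually_at_top_linorder by blast
  qed
  show ?thesis
    using y asymp a by (intro exI[of _ y] exI[of _ a]) auto
qed

section \<open>Planar systems with a scaled linear part\<close>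

text \<open>One spare power of \<open>x\<close> buys an arbitrarily small constant.\<close>

lemma bigo_powr_eventually_le:
  fixes f :: "real \<Rightarrow> real"
  assumes "f \<in> O(\<lambda>x. x powr (- real (Suc k)))" "0 < c"
  shows "\<forall>\<^sub>F x in at_top. \<bar>f x\<bar> \<le> c * x powr (- real k)"
proof -
  obtain B where B: "\<forall>\<^sub>F x in at_top. norm (f x) \<le> B * norm (x powr (- real (Suc k)))"
    using landau_o.bigE[OF assms(1)] by blast
  show ?thesis
    using B eventually_ge_at_top[of "max 1 (\<bar>B\<bar> / c)"]
  proof eventually_elim
    case (elim x)
    then have x: "1 \<le> x" "\<bar>B\<bar> / c \<le> x" by auto
    have "\<bar>f x\<bar> \<le> \<bar>B\<bar> * x powr (- real (Suc k))"
      using elim(1) mult_right_mono[OF abs_ge_self[of B], of "x powr (- real (Suc k))"] by simp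
    also have "\<bar>B\<bar> \<le> c * x" using x(2) \<open>0 < c\<close> by (simp add: field_simps)
    then have "\<bar>B\<bar> * x powr (- real (Suc k)) \<le> c * x * x powr (- real (Suc k))"
      by (intro mult_right_mono) auto
    also have "\<dots> = c * (x powr 1 * x powr (- real (Suc k)))" using x(1) by simp
    also have "\<dots> = c * x powr (- real k)" by (simp only: powr_add[symmetric]) simp
    finally show ?case .
  qed
qed

lemma norm_vec2_le: "norm (y :: real ^ 2) \<le> \<bar>y $ 1\<bar> + \<bar>y $ 2\<bar>"
  using norm_le_l1_cart[of y] by (simp add: UNIV_2)

text \<open>
  The matrices \<open>(qa, qb; qc, qd)\<close> and \<open>(ra, rb; rc, rd)\<close> are inverse to each other and decouple the
  linear part: \<open>v \<plusminus> p\<close> in the saddle case, and in the center case the rotation by an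
  antiderivative of \<open>\<delta>\<close>.
\<close>

lemma planar_reduction:
  fixes qa qb qc qd ra rb rc rd \<beta> \<gamma> :: "real \<Rightarrow> real"
    and Dv Dp :: "real \<Rightarrow> real \<Rightarrow> real \<Rightarrow> real"
    and gv gp :: "real \<Rightarrow> real \<times> real \<Rightarrow> real" and V P V' P' :: "nat \<Rightarrow> real \<Rightarrow> real"
  assumes b: "1 \<le> b" and C: "0 \<le> C"
    and cont: "continuous_on {b<..} qa" "continuous_on {b<..} qb" "continuous_on {b<..} qc" "continuous_on {b<..} qd"
      "continuous_on {b<..} ra" "continuous_on {b<..} rb" "continuous_on {b<..} rc" "continuous_on {b<..} rd"
      "continuous_on {b<..} \<beta>" "continuous_on {b<..} \<gamma>"
    and bounded: "\<And>x. \<bar>qa x\<bar> \<le> 1" "\<And>x. \<bar>qb x\<bar> \<le> 1" "\<And>x. \<bar>qc x\<bar> \<le> 1" "\<And>x. \<bar>qd x\<bar> \<le> 1"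
      "\<And>x. \<bar>ra x\<bar> \<le> 1" "\<And>x. \<bar>rb x\<bar> \<le> 1" "\<And>x. \<bar>rc x\<bar> \<le> 1" "\<And>x. \<bar>rd x\<bar> \<le> 1"
    and inv: "\<And>x v p. ra x * (qa x * v + qb x * p) + rb x * (qc x * v + qd x * p) = v"
      "\<And>x v p. rc x * (qa x * v + qb x * p) + rd x * (qc x * v + qd x * p) = p"
    and fwd: "\<And>v p w z x. b < x \<Longrightarrow> (v has_real_derivative Dv x (v x) (p x) + w) (at x) \<Longrightarrow>
      (p has_real_derivative Dp x (v x) (p x) + z) (at x) \<Longrightarrow>
      ((\<lambda>x. qa x * v x + qb x * p x) has_real_derivative
         \<beta> x * (qa x * v x + qb x * p x) + (qa x * w + qb x * z)) (at x) \<and>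
      ((\<lambda>x. qc x * v x + qd x * p x) has_real_derivative
         \<gamma> x * (qc x * v x + qd x * p x) + (qc x * w + qd x * z)) (at x)"
    and bwd: "\<And>y1 y2 w z x. b < x \<Longrightarrow> (y1 has_real_derivative \<beta> x * y1 x + (qa x * w + qb x * z)) (at x) \<Longrightarrow>
      (y2 has_real_derivative \<gamma> x * y2 x + (qc x * w + qd x * z)) (at x) \<Longrightarrow>
      ((\<lambda>x. ra x * y1 x + rb x * y2 x) has_real_derivative
         Dv x (ra x * y1 x + rb x * y2 x) (rc x * y1 x + rd x * y2 x) + w) (at x) \<and>
      ((\<lambda>x. rc x * y1 x + rd x * y2 x) has_real_derivative
         Dp x (ra x * y1 x + rb x * y2 x) (rc x * y1 x + rd x * y2 x) + z) (at x)"
    and g_cont: "continuous_on ({b<..} \<times> UNIV) (\<lambda>(x, y). gv x y)" "continuous_on ({b<..} \<times> UNIV) (\<lambda>(x, y). gp x y)"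
    and dich: "dichotomic \<beta>" "dichotomic \<gamma>"
    and lip: "\<And>x v p v' p'. b < x \<Longrightarrow> \<bar>v\<bar> \<le> 4 / x \<Longrightarrow> \<bar>p\<bar> \<le> 4 / x \<Longrightarrow> \<bar>v'\<bar> \<le> 4 / x \<Longrightarrow> \<bar>p'\<bar> \<le> 4 / x \<Longrightarrow>
      \<bar>gv x (v, p) - gv x (v', p')\<bar> \<le> C / x * (\<bar>v - v'\<bar> + \<bar>p - p'\<bar>) \<and>
      \<bar>gp x (v, p) - gp x (v', p')\<bar> \<le> C / x * (\<bar>v - v'\<bar> + \<bar>p - p'\<bar>)"
    and VP: "\<And>k x. b < x \<Longrightarrow> (V k has_real_derivative Dv x (V k x) (P k x) + V' k x) (at x)"
      "\<And>k x. b < x \<Longrightarrow> (P k has_real_derivative Dp x (V k x) (P k x) + P' k x) (at x)"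
    and VP'_cont: "\<And>k. continuous_on {b<..} (V' k)" "\<And>k. continuous_on {b<..} (P' k)"
    and residual: "\<And>k. (\<lambda>x. gv x (V k x, P k x) - V' k x) \<in> O(\<lambda>x. x powr (- real (Suc (Suc k))))"
      "\<And>k. (\<lambda>x. gp x (V k x, P k x) - P' k x) \<in> O(\<lambda>x. x powr (- real (Suc (Suc k))))"
    and small: "\<And>k. V k \<in> O(\<lambda>x. x powr (- real 2))" "\<And>k. P k \<in> O(\<lambda>x. x powr (- real 2))"
    and diff: "\<And>k m. k \<le> m \<Longrightarrow> (\<lambda>x. V m x - V k x) \<in> O(\<lambda>x. x powr (- real (Suc k)))"
      "\<And>k m. k \<le> m \<Longrightarrow> (\<lambda>x. P m x - P k x) \<in> O(\<lambda>x. x powr (- real (Suc k)))"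
  shows "\<exists>v p a. b \<le> a \<and> (\<forall>x>a. (v has_real_derivative Dv x (v x) (p x) + gv x (v x, p x)) (at x) \<and>
      (p has_real_derivative Dp x (v x) (p x) + gp x (v x, p x)) (at x)) \<and>
    (\<forall>k. (\<lambda>x. v x - V k x) \<in> O(\<lambda>x. x powr (- real k)) \<and> (\<lambda>x. p x - P k x) \<in> O(\<lambda>x. x powr (- real k)))"
proof -
  define \<alpha> :: "2 \<Rightarrow> real \<Rightarrow> real" where "\<alpha> i = (if i = 1 then \<beta> else \<gamma>)" for i
  define tov where "tov x y = (ra x * y $ 1 + rb x * y $ 2, rc x * y $ 1 + rd x * y $ 2)" for x and y :: "real ^ 2"
  define toy :: "real \<Rightarrow> real \<Rightarrow> real \<Rightarrow> real ^ 2" where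
    "toy x v p = (\<chi> i. if i = 1 then qa x * v + qb x * p else qc x * v + qd x * p)" for x v p
  define g where "g x y = toy x (gv x (tov x y)) (gp x (tov x y))" for x y
  define Y where "Y k x = toy x (V k x) (P k x)" for k x
  \<comment> \<open>By \<open>fwd\<close> this is the derivative of \<open>Y\<close>. Writing it
    through the decoupled equation leaves exactly the transformed residual in \<open>e\<close>
    below.\<close>
  define Y' :: "nat \<Rightarrow> real \<Rightarrow> real ^ 2" where
    "Y' k x = (\<chi> i. \<alpha> i x * Y k x $ i + toy x (V' k x) (P' k x) $ i)" for k x
  have toy_norm: "norm (toy x v p) \<le> 2 * (\<bar>v\<bar> + \<bar>p\<bar>)" for x v p
  proof -
    have le: "\<bar>q * w\<bar> \<le> \<bar>w\<bar>" if "\<bar>q\<bar> \<le> 1" for q w :: real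
      using mult_right_mono[OF that, of "\<bar>w\<bar>"] by (simp add: abs_mult)
    have "\<bar>qa x * v + qb x * p\<bar> \<le> \<bar>v\<bar> + \<bar>p\<bar>" "\<bar>qc x * v + qd x * p\<bar> \<le> \<bar>v\<bar> + \<bar>p\<bar>"
      using abs_triangle_ineq[of "qa x * v" "qb x * p"] le[OF bounded(1), of x v] le[OF bounded(2), of x p]
        abs_triangle_ineq[of "qc x * v" "qd x * p"] le[OF bounded(3), of x v] le[OF bounded(4), of x p]
      by linarith+
    then show ?thesis using norm_vec2_le[of "toy x v p"] by (simp add: toy_def)
  qed
  have tov_norm: "\<bar>fst (tov x y)\<bar> \<le> 2 * norm y" "\<bar>snd (tov x y)\<bar> \<le> 2 * norm y" for x y
  proof -
    have le: "\<bar>q * y $ i\<bar> \<le> norm y" if "\<bar>q\<bar> \<le> 1" for q i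
      using mult_mono[OF that component_le_norm_cart[of y i]] by (simp add: abs_mult)
    show "\<bar>fst (tov x y)\<bar> \<le> 2 * norm y" "\<bar>snd (tov x y)\<bar> \<le> 2 * norm y"
      using abs_triangle_ineq[of "ra x * y $ 1" "rb x * y $ 2"] le[OF bounded(5), of x 1] le[OF bounded(6), of x 2]
        abs_triangle_ineq[of "rc x * y $ 1" "rd x * y $ 2"] le[OF bounded(7), of x 1] le[OF bounded(8), of x 2]
      by (simp_all add: tov_def)
  qed
  have tov_toy: "tov x (toy x v p) = (v, p)" for x v p
    by (simp add: tov_def toy_def inv)
  have tov_diff: "tov x y - tov x z = tov x (y - z)" for x y z
    by (simp add: tov_def algebra_simps)
  have toy_diff: "toy x v p - toy x v' p' = toy x (v - v') (p - p')" for x v p v' p'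
    by (simp add: toy_def vec_eq_iff algebra_simps)
  have "\<exists>y a. b \<le> a \<and> (\<forall>x>a. \<forall>i. ((\<lambda>x. y x $ i) has_real_derivative \<alpha> i x * y x $ i + g x (y x) $ i) (at x)) \<and>
    (\<forall>k. \<exists>B. \<forall>\<^sub>F x in at_top. norm (y x - Y k x) \<le> B * x powr (- real k))"
  \<comment> \<open>16 = 2 * 2 * 4: the factor of \<open>toy_norm\<close>, the two remainders, and
    two coordinates of \<open>tov\<close> that are each at most twice the norm. With
    \<open>A = 1\<close> the radius 2/x becomes 4/x in the old coordinates, the range of
    \<open>lip\<close>.\<close>
  proof (rule diagonal_system_solution[where A = 1 and C = "16 * C"])
    show "1 \<le> b" "0 \<le> 16 * C" using b C by auto
    show \<alpha>_cont: "continuous_on {b<..} (\<alpha> i)" for i using cont by (simp add: \<alpha>_def)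
    have q_cont: "continuous_on ({b<..} \<times> S) (\<lambda>p. f (fst p))" if "continuous_on {b<..} f"
      for f :: "real \<Rightarrow> real" and S :: "(real ^ 2) set"
      by (rule continuous_on_compose2[OF that]) (auto intro!: continuous_intros)
    have tov_cont: "continuous_on ({b<..} \<times> UNIV) (\<lambda>p. tov (fst p) (snd p))"
      unfolding tov_def by (intro continuous_intros q_cont cont)
    have gc: "continuous_on ({b<..} \<times> UNIV) (\<lambda>p. h (fst p) (tov (fst p) (snd p)))"
      if "continuous_on ({b<..} \<times> UNIV) (\<lambda>(x, y). h x y)" for h :: "real \<Rightarrow> real \<times> real \<Rightarrow> real"
    proof -
      have "continuous_on ({b<..} \<times> UNIV) (\<lambda>p. case (fst p, tov (fst p) (snd p)) of (x, y) \<Rightarrow> h x y)"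
        by (rule continuous_on_compose2[OF that]) (auto intro!: continuous_intros tov_cont)
      then show ?thesis by simp
    qed
    have toy_cont: "continuous_on A (\<lambda>t. toy (e t) (v t) (p t) $ i)"
      if "continuous_on A (\<lambda>t. qa (e t))" "continuous_on A (\<lambda>t. qb (e t))" "continuous_on A (\<lambda>t. qc (e t))"
        "continuous_on A (\<lambda>t. qd (e t))" "continuous_on A v" "continuous_on A p"
      for A :: "'z::topological_space set" and e v p i
      using that unfolding toy_def by (cases "i = 1") (auto intro!: continuous_intros)
    have toy_cont': "continuous_on A (\<lambda>t. toy (e t) (v t) (p t))"
      if "continuous_on A (\<lambda>t. qa (e t))" "continuous_on A (\<lambda>t. qb (e t))" "continuous_on A (\<lambda>t. qc (e t))"
        "continuous_on A (\<lambda>t. qd (e t))" "continuous_on A v" "continuous_on A p"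
      for A :: "'z::topological_space set" and e v p
    proof -
      have "continuous_on A (\<lambda>t. \<chi> i. toy (e t) (v t) (p t) $ i)"
        by (intro continuous_on_vec_lambda toy_cont that)
      then show ?thesis by simp
    qed
    show "continuous_on ({b<..} \<times> UNIV) (\<lambda>(x, y). g x y)"
      unfolding g_def case_prod_beta by (intro toy_cont' q_cont cont gc g_cont)
    have V_cont: "continuous_on {b<..} (V k)" for k
      by (rule DERIV_continuous_on) (rule has_field_derivative_at_within[OF VP(1)], simp)
    have P_cont: "continuous_on {b<..} (P k)" for k
      by (rule DERIV_continuous_on) (rule has_field_derivative_at_within[OF VP(2)], simp)
    show "continuous_on {b<..} (Y' k)" for k
      unfolding Y'_def Y_def
      by (intro continuous_on_vec_lambda continuous_on_add continuous_on_mult \<alpha>_cont toy_cont cont V_cont P_cont VP'_cont)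
    show "dichotomic (\<alpha> i)" for i using dich by (simp add: \<alpha>_def)
    show "norm (g x u - g x w) \<le> 16 * C / x * norm (u - w)"
      if x: "b < x" and u: "norm u \<le> (1 + 1) / x" and w: "norm w \<le> (1 + 1) / x" for x u w
    proof -
      have x0: "0 < x" using x b by linarith
      obtain v p v' p' where vp: "tov x u = (v, p)" "tov x w = (v', p')" by (meson surj_pair)
      have "\<bar>v\<bar> \<le> 4 / x" "\<bar>p\<bar> \<le> 4 / x" "\<bar>v'\<bar> \<le> 4 / x" "\<bar>p'\<bar> \<le> 4 / x"
        using tov_norm[of x u] tov_norm[of x w] u w by (auto simp: vp)
      note l = lip[OF x this]
      have d: "\<bar>v - v'\<bar> \<le> 2 * norm (u - w)" "\<bar>p - p'\<bar> \<le> 2 * norm (u - w)"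
        using tov_norm[of x "u - w"] unfolding tov_diff[symmetric] vp by auto
      have "norm (g x u - g x w) \<le> 2 * (\<bar>gv x (v, p) - gv x (v', p')\<bar> + \<bar>gp x (v, p) - gp x (v', p')\<bar>)"
        unfolding g_def vp toy_diff by (rule toy_norm)
      also have "\<dots> \<le> 2 * (C / x * (\<bar>v - v'\<bar> + \<bar>p - p'\<bar>) + C / x * (\<bar>v - v'\<bar> + \<bar>p - p'\<bar>))"
        using l by (intro mult_left_mono add_mono) auto
      also have "\<dots> = 4 * (C / x) * (\<bar>v - v'\<bar> + \<bar>p - p'\<bar>)" by simp
      also have "\<dots> \<le> 4 * (C / x) * (2 * norm (u - w) + 2 * norm (u - w))"
        using d C x0 by (intro mult_left_mono add_mono) auto
      finally show ?thesis by simp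
    qed
    show "((\<lambda>x. Y k x $ i) has_real_derivative Y' k x $ i) (at x)" if "b < x" for k i x
      using fwd[OF that VP(1)[OF that, of k] VP(2)[OF that, of k]]
      by (cases "i = 1") (auto simp: Y_def Y'_def toy_def \<alpha>_def)
    show "\<forall>\<^sub>F x in at_top. norm (\<chi> i. \<alpha> i x * Y k x $ i + g x (Y k x) $ i - Y' k x $ i) \<le> x powr (- real k) / x" for k
    proof -
      have e: "(\<chi> i. \<alpha> i x * Y k x $ i + g x (Y k x) $ i - Y' k x $ i) =
          toy x (gv x (V k x, P k x) - V' k x) (gp x (V k x, P k x) - P' k x)" for x
        unfolding toy_diff[symmetric] by (simp add: vec_eq_iff Y'_def g_def Y_def tov_toy)
      \<comment> \<open>A quarter offsets the factor 2 of \<open>toy_norm\<close> and the sum of two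
        components.\<close>
      have q: "0 < (1 / 4 :: real)" by simp
      show ?thesis
        using bigo_powr_eventually_le[OF residual(1) q, of k] bigo_powr_eventually_le[OF residual(2) q, of k]
          eventually_gt_at_top[of 0]
      proof eventually_elim
        case (elim x)
        have "norm (toy x (gv x (V k x, P k x) - V' k x) (gp x (V k x, P k x) - P' k x))
            \<le> 2 * (1 / 4 * x powr (- real (Suc k)) + 1 / 4 * x powr (- real (Suc k)))"
          using elim by (intro order_trans[OF toy_norm] mult_left_mono add_mono) auto
        also have "\<dots> = x powr (- real k + - 1)" by (simp add: add.commute)
        also have "\<dots> = x powr (- real k) / x"
          unfolding powr_add using elim by (simp add: powr_minus field_simps)
        finally show ?case unfolding e .
      qed
    qed
    show "\<forall>\<^sub>F x in at_top. norm (Y k x) \<le> 1 / x" for k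
    proof -
      have q: "0 < (1 / 4 :: real)" by simp
      have s: "V k \<in> O(\<lambda>x. x powr (- real (Suc 1)))" "P k \<in> O(\<lambda>x. x powr (- real (Suc 1)))"
        using small[of k] by (simp_all add: numeral_2_eq_2)
      show ?thesis
        using bigo_powr_eventually_le[OF s(1) q] bigo_powr_eventually_le[OF s(2) q] eventually_gt_at_top[of 0]
      proof eventually_elim
        case (elim x)
        have "norm (Y k x) \<le> 2 * (1 / 4 * x powr (- real 1) + 1 / 4 * x powr (- real 1))"
          unfolding Y_def using elim by (intro order_trans[OF toy_norm] mult_left_mono add_mono) auto
        also have "\<dots> = 1 / x" using elim by (simp add: powr_minus field_simps)
        finally show ?case .
      qed
    qed
    show "\<forall>\<^sub>F x in at_top. norm (Y m x - Y k x) \<le> x powr (- real k)" if "k \<le> m" for k m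
    proof -
      have q: "0 < (1 / 4 :: real)" by simp
      show ?thesis
        using bigo_powr_eventually_le[OF diff(1)[OF that] q] bigo_powr_eventually_le[OF diff(2)[OF that] q]
      proof eventually_elim
        case (elim x)
        have "norm (Y m x - Y k x) \<le> 2 * (1 / 4 * x powr (- real k) + 1 / 4 * x powr (- real k))"
          unfolding Y_def toy_diff using elim by (intro order_trans[OF toy_norm] mult_left_mono add_mono) auto
        then show ?case by simp
      qed
    qed
  qed
  then obtain y a where a: "b \<le> a"
    and y: "\<And>x i. a < x \<Longrightarrow> ((\<lambda>x. y x $ i) has_real_derivative \<alpha> i x * y x $ i + g x (y x) $ i) (at x)"
    and asymp: "\<And>k. \<exists>B. \<forall>\<^sub>F x in at_top. norm (y x - Y k x) \<le> B * x powr (- real k)"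
    by blast
  define v p where "v x = fst (tov x (y x))" and "p x = snd (tov x (y x))" for x
  have vp: "tov x (y x) = (v x, p x)" for x by (simp add: v_def p_def)
  have v_eq: "v = (\<lambda>x. ra x * y x $ 1 + rb x * y x $ 2)" "p = (\<lambda>x. rc x * y x $ 1 + rd x * y x $ 2)"
    by (simp_all add: v_def p_def tov_def fun_eq_iff)
  have "(v has_real_derivative Dv x (v x) (p x) + gv x (v x, p x)) (at x) \<and>
      (p has_real_derivative Dp x (v x) (p x) + gp x (v x, p x)) (at x)" if x: "a < x" for x
  proof -
    have bx: "b < x" using x a by linarith
    have g1: "g x (y x) $ 1 = qa x * gv x (v x, p x) + qb x * gp x (v x, p x)"
      "g x (y x) $ 2 = qc x * gv x (v x, p x) + qd x * gp x (v x, p x)"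
      by (simp_all add: g_def vp toy_def)
    show ?thesis
      using bwd[OF bx, of "\<lambda>x. y x $ 1" "gv x (v x, p x)" "gp x (v x, p x)" "\<lambda>x. y x $ 2"]
        y[OF x, of 1] y[OF x, of 2] unfolding g1 v_eq by (simp add: \<alpha>_def)
  qed
  moreover have "(\<lambda>x. v x - V k x) \<in> O(\<lambda>x. x powr (- real k)) \<and> (\<lambda>x. p x - P k x) \<in> O(\<lambda>x. x powr (- real k))" for k
  proof -
    obtain B where B: "\<forall>\<^sub>F x in at_top. norm (y x - Y k x) \<le> B * x powr (- real k)" using asymp by blast
    have e: "(v x - V k x, p x - P k x) = tov x (y x - Y k x)" for x
      unfolding tov_diff[symmetric] vp Y_def tov_toy by simp
    have "\<forall>\<^sub>F x in at_top. norm (v x - V k x) \<le> 2 * B * norm (x powr (- real k))"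
      using B
    proof eventually_elim
      case (elim x)
      then show ?case using tov_norm(1)[of x "y x - Y k x"] by (simp flip: e)
    qed
    moreover have "\<forall>\<^sub>F x in at_top. norm (p x - P k x) \<le> 2 * B * norm (x powr (- real k))"
      using B
    proof eventually_elim
      case (elim x)
      then show ?case using tov_norm(2)[of x "y x - Y k x"] by (simp flip: e)
    qed
    ultimately show ?thesis by (auto intro: bigoI)
  qed
  ultimately show ?thesis using a by blast
qed

text \<open>For \<epsilon> = 1 the eigenvectors (1, 1) and (1, -1) do not depend on x, so the
  exponents are exactly m + \<delta> and m - \<delta>. For \<epsilon> = -1 the matrix generates
  rotations, and turning by the accumulated angle leaves \<open>m\<close> in both coordinates
  however fast the rotation is; therefore the condition there concerns \<open>m\<close>
  alone.\<close>

theorem planar_system_solution: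
  fixes m \<delta> :: "real \<Rightarrow> real" and \<epsilon> :: real
    and gv gp :: "real \<Rightarrow> real \<times> real \<Rightarrow> real" and V P V' P' :: "nat \<Rightarrow> real \<Rightarrow> real"
  assumes b: "1 \<le> b" and C: "0 \<le> C"
    and cont: "continuous_on {b<..} m" "continuous_on {b<..} \<delta>"
    and type: "\<epsilon> = 1 \<and> dichotomic (\<lambda>x. m x + \<delta> x) \<and> dichotomic (\<lambda>x. m x - \<delta> x) \<or> \<epsilon> = - 1 \<and> dichotomic m"
    and g_cont: "continuous_on ({b<..} \<times> UNIV) (\<lambda>(x, y). gv x y)" "continuous_on ({b<..} \<times> UNIV) (\<lambda>(x, y). gp x y)"
    and lip: "\<And>x v p v' p'. b < x \<Longrightarrow> \<bar>v\<bar> \<le> 4 / x \<Longrightarrow> \<bar>p\<bar> \<le> 4 / x \<Longrightarrow> \<bar>v'\<bar> \<le> 4 / x \<Longrightarrow> \<bar>p'\<bar> \<le> 4 / x \<Longrightarrow>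
      \<bar>gv x (v, p) - gv x (v', p')\<bar> \<le> C / x * (\<bar>v - v'\<bar> + \<bar>p - p'\<bar>) \<and>
      \<bar>gp x (v, p) - gp x (v', p')\<bar> \<le> C / x * (\<bar>v - v'\<bar> + \<bar>p - p'\<bar>)"
    and VP: "\<And>k x. b < x \<Longrightarrow> (V k has_real_derivative m x * V k x + \<delta> x * P k x + V' k x) (at x)"
      "\<And>k x. b < x \<Longrightarrow> (P k has_real_derivative m x * P k x + \<epsilon> * \<delta> x * V k x + P' k x) (at x)"
    and VP'_cont: "\<And>k. continuous_on {b<..} (V' k)" "\<And>k. continuous_on {b<..} (P' k)"
    and residual: "\<And>k. (\<lambda>x. gv x (V k x, P k x) - V' k x) \<in> O(\<lambda>x. x powr (- real (Suc (Suc k))))"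
      "\<And>k. (\<lambda>x. gp x (V k x, P k x) - P' k x) \<in> O(\<lambda>x. x powr (- real (Suc (Suc k))))"
    and small: "\<And>k. V k \<in> O(\<lambda>x. x powr (- real 2))" "\<And>k. P k \<in> O(\<lambda>x. x powr (- real 2))"
    and diff: "\<And>k m. k \<le> m \<Longrightarrow> (\<lambda>x. V m x - V k x) \<in> O(\<lambda>x. x powr (- real (Suc k)))"
      "\<And>k m. k \<le> m \<Longrightarrow> (\<lambda>x. P m x - P k x) \<in> O(\<lambda>x. x powr (- real (Suc k)))"
  shows "\<exists>v p a. b \<le> a \<and>
    (\<forall>x>a. (v has_real_derivative m x * v x + \<delta> x * p x + gv x (v x, p x)) (at x) \<and>
      (p has_real_derivative m x * p x + \<epsilon> * \<delta> x * v x + gp x (v x, p x)) (at x)) \<and>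
    (\<forall>k. (\<lambda>x. v x - V k x) \<in> O(\<lambda>x. x powr (- real k)) \<and> (\<lambda>x. p x - P k x) \<in> O(\<lambda>x. x powr (- real k)))"
  using type
proof
  assume type: "\<epsilon> = 1 \<and> dichotomic (\<lambda>x. m x + \<delta> x) \<and> dichotomic (\<lambda>x. m x - \<delta> x)"
  show ?thesis
  proof (rule planar_reduction[where Dv = "\<lambda>x v p. m x * v + \<delta> x * p" and Dp = "\<lambda>x v p. m x * p + \<epsilon> * \<delta> x * v"
      and \<beta> = "\<lambda>x. m x + \<delta> x" and \<gamma> = "\<lambda>x. m x - \<delta> x"
      and qa = "\<lambda>_. 1" and qb = "\<lambda>_. 1" and qc = "\<lambda>_. 1" and qd = "\<lambda>_. -1"
      and ra = "\<lambda>_. 1/2" and rb = "\<lambda>_. 1/2" and rc = "\<lambda>_. 1/2" and rd = "\<lambda>_. - 1/2" and b = b and C = C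
      and V = V and P = P and V' = V' and P' = P' and gv = gv and gp = gp])
    fix v p :: real
    show "1 / 2 * (1 * v + 1 * p) + 1 / 2 * (1 * v + - 1 * p) = v"
      "1 / 2 * (1 * v + 1 * p) + - 1 / 2 * (1 * v + - 1 * p) = p"
      by (simp_all add: field_simps)
  next
    fix v p :: "real \<Rightarrow> real" and w z x
    assume 1: "(v has_real_derivative m x * v x + \<delta> x * p x + w) (at x)"
      "(p has_real_derivative m x * p x + \<epsilon> * \<delta> x * v x + z) (at x)"
    show "((\<lambda>x. 1 * v x + 1 * p x) has_real_derivative (m x + \<delta> x) * (1 * v x + 1 * p x) + (1 * w + 1 * z)) (at x) \<and>
      ((\<lambda>x. 1 * v x + - 1 * p x) has_real_derivative (m x - \<delta> x) * (1 * v x + - 1 * p x) + (1 * w + - 1 * z)) (at x)"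
      using DERIV_add[OF 1] DERIV_diff[OF 1] type by (simp add: algebra_simps)
  next
    fix y1 y2 :: "real \<Rightarrow> real" and w z x
    assume 1: "(y1 has_real_derivative (m x + \<delta> x) * y1 x + (1 * w + 1 * z)) (at x)"
      "(y2 has_real_derivative (m x - \<delta> x) * y2 x + (1 * w + - 1 * z)) (at x)"
    show "((\<lambda>x. 1 / 2 * y1 x + 1 / 2 * y2 x) has_real_derivative
          m x * (1 / 2 * y1 x + 1 / 2 * y2 x) + \<delta> x * (1 / 2 * y1 x + - 1 / 2 * y2 x) + w) (at x) \<and>
      ((\<lambda>x. 1 / 2 * y1 x + - 1 / 2 * y2 x) has_real_derivative
          m x * (1 / 2 * y1 x + - 1 / 2 * y2 x) + \<epsilon> * \<delta> x * (1 / 2 * y1 x + 1 / 2 * y2 x) + z) (at x)"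
      using type by (auto intro!: derivative_eq_intros 1 simp: field_simps)
  qed (use assms type in \<open>auto intro!: continuous_intros\<close>)
next
  assume type: "\<epsilon> = - 1 \<and> dichotomic m"
  obtain \<theta> where \<theta>: "\<And>x. b < x \<Longrightarrow> (\<theta> has_real_derivative \<delta> x) (at x)"
    using antiderivative_greaterThan[OF cont(2)] by blast
  have \<theta>_cont: "continuous_on {b<..} \<theta>"
    by (rule DERIV_continuous_on) (use \<theta> in \<open>auto intro: has_field_derivative_at_within\<close>)
  \<comment> \<open>Pythagoras in the nested form that \<open>algebra_simps\<close>
    produces.\<close>
  have sc: "cos y * (cos y * c) + sin y * (sin y * c) = c" "sin y * (sin y * c) + cos y * (cos y * c) = c" for y c :: real
    using sin_cos_squared_add3[of y] by (simp_all flip: mult.assoc distrib_right add: add.commute)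
  show ?thesis
  proof (rule planar_reduction[where Dv = "\<lambda>x v p. m x * v + \<delta> x * p" and Dp = "\<lambda>x v p. m x * p + \<epsilon> * \<delta> x * v"
      and \<beta> = m and \<gamma> = m
      and qa = "\<lambda>x. cos (\<theta> x)" and qb = "\<lambda>x. - sin (\<theta> x)" and qc = "\<lambda>x. sin (\<theta> x)" and qd = "\<lambda>x. cos (\<theta> x)"
      and ra = "\<lambda>x. cos (\<theta> x)" and rb = "\<lambda>x. sin (\<theta> x)" and rc = "\<lambda>x. - sin (\<theta> x)" and rd = "\<lambda>x. cos (\<theta> x)"
      and b = b and C = C and V = V and P = P and V' = V' and P' = P' and gv = gv and gp = gp])
    fix x v p :: real
    show "cos (\<theta> x) * (cos (\<theta> x) * v + - sin (\<theta> x) * p) + sin (\<theta> x) * (sin (\<theta> x) * v + cos (\<theta> x) * p) = v"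
      using sc(1)[of "\<theta> x" v] by (simp add: algebra_simps)
    show "- sin (\<theta> x) * (cos (\<theta> x) * v + - sin (\<theta> x) * p) + cos (\<theta> x) * (sin (\<theta> x) * v + cos (\<theta> x) * p) = p"
      using sc(2)[of "\<theta> x" p] by (simp add: algebra_simps)
  next
    fix v p :: "real \<Rightarrow> real" and w z x
    assume x: "b < x" and 1: "(v has_real_derivative m x * v x + \<delta> x * p x + w) (at x)"
      "(p has_real_derivative m x * p x + \<epsilon> * \<delta> x * v x + z) (at x)"
    show "((\<lambda>x. cos (\<theta> x) * v x + - sin (\<theta> x) * p x) has_real_derivative
          m x * (cos (\<theta> x) * v x + - sin (\<theta> x) * p x) + (cos (\<theta> x) * w + - sin (\<theta> x) * z)) (at x) \<and>
      ((\<lambda>x. sin (\<theta> x) * v x + cos (\<theta> x) * p x) has_real_derivative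
          m x * (sin (\<theta> x) * v x + cos (\<theta> x) * p x) + (sin (\<theta> x) * w + cos (\<theta> x) * z)) (at x)"
      using type by (auto intro!: derivative_eq_intros 1 \<theta>[OF x] simp: algebra_simps)
  next
    fix y1 y2 :: "real \<Rightarrow> real" and w z x
    assume x: "b < x" and 1: "(y1 has_real_derivative m x * y1 x + (cos (\<theta> x) * w + - sin (\<theta> x) * z)) (at x)"
      "(y2 has_real_derivative m x * y2 x + (sin (\<theta> x) * w + cos (\<theta> x) * z)) (at x)"
    show "((\<lambda>x. cos (\<theta> x) * y1 x + sin (\<theta> x) * y2 x) has_real_derivative
          m x * (cos (\<theta> x) * y1 x + sin (\<theta> x) * y2 x) + \<delta> x * (- sin (\<theta> x) * y1 x + cos (\<theta> x) * y2 x) + w) (at x) \<and>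
      ((\<lambda>x. - sin (\<theta> x) * y1 x + cos (\<theta> x) * y2 x) has_real_derivative
          m x * (- sin (\<theta> x) * y1 x + cos (\<theta> x) * y2 x) + \<epsilon> * \<delta> x * (cos (\<theta> x) * y1 x + sin (\<theta> x) * y2 x) + z) (at x)"
      using type sc(1)[of "\<theta> x" w] sc(2)[of "\<theta> x" z]
      by (auto intro!: derivative_eq_intros 1 \<theta>[OF x] simp: algebra_simps)
  qed (use assms type in \<open>auto intro!: continuous_intros \<theta>_cont\<close>)
qed

section \<open>Smooth functions and remainders\<close>

text \<open>The derivative is an existential witness, so the closure properties are inductions with
  the ordinary derivative rules. The whole line is required, in particular a neighbourhood of z = 0,
  because Taylor expansion at 0 is the purpose.\<close>

primrec differentiable_times :: "nat \<Rightarrow> (real \<Rightarrow> real) \<Rightarrow> bool" where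
  "differentiable_times 0 f \<longleftrightarrow> True"
| "differentiable_times (Suc n) f \<longleftrightarrow>
     (\<exists>f'. (\<forall>x. (f has_real_derivative f' x) (at x)) \<and> differentiable_times n f')"

lemma differentiable_times_Suc_imp: "differentiable_times (Suc n) f \<Longrightarrow> differentiable_times n f"
proof (induction n arbitrary: f)
  case (Suc n)
  then obtain f' where "\<forall>x. (f has_real_derivative f' x) (at x)" "differentiable_times (Suc n) f'"
    unfolding differentiable_times.simps(2)[of "Suc n"] by blast
  with Suc.IH[of f'] show ?case unfolding differentiable_times.simps(2)[of n] by blast
qed simp

lemma differentiable_times_const: "differentiable_times n (\<lambda>_. c)"
proof (induction n arbitrary: c)
  case (Suc n)
  show ?case
    unfolding differentiable_times.simps by (rule exI[of _ "\<lambda>_. 0"]) (auto intro: Suc)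
qed simp

lemma differentiable_times_ident: "differentiable_times n (\<lambda>x. x)"
proof (cases n)
  case (Suc n)
  show ?thesis
    unfolding Suc differentiable_times.simps
    by (rule exI[of _ "\<lambda>_. 1"]) (auto intro: differentiable_times_const)
qed simp

lemma differentiable_times_add:
  "differentiable_times n f \<Longrightarrow> differentiable_times n g \<Longrightarrow> differentiable_times n (\<lambda>x. f x + g x)"
proof (induction n arbitrary: f g)
  case (Suc n)
  then obtain f' g' where "\<forall>x. (f has_real_derivative f' x) (at x)" "differentiable_times n f'"
    "\<forall>x. (g has_real_derivative g' x) (at x)" "differentiable_times n g'" by auto
  then show ?case
    unfolding differentiable_times.simps
    by (intro exI[of _ "\<lambda>x. f' x + g' x"]) (auto intro: Suc.IH intro!: derivative_eq_intros)
qed simp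

lemma differentiable_times_mult:
  "differentiable_times n f \<Longrightarrow> differentiable_times n g \<Longrightarrow> differentiable_times n (\<lambda>x. f x * g x)"
proof (induction n arbitrary: f g)
  case (Suc n)
  then obtain f' g' where f': "\<forall>x. (f has_real_derivative f' x) (at x)" "differentiable_times n f'"
    and g': "\<forall>x. (g has_real_derivative g' x) (at x)" "differentiable_times n g'" by auto
  have "differentiable_times n (\<lambda>x. f' x * g x + g' x * f x)"
    by (intro differentiable_times_add Suc.IH f'(2) g'(2) Suc.prems[THEN differentiable_times_Suc_imp])
  moreover have "\<forall>x. ((\<lambda>x. f x * g x) has_real_derivative f' x * g x + g' x * f x) (at x)"
    using f'(1) g'(1) by (intro allI DERIV_mult) auto
  ultimately show ?case unfolding differentiable_times.simps by (intro exI conjI)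
qed simp

definition smooth_real :: "(real \<Rightarrow> real) \<Rightarrow> bool" where
  "smooth_real f \<longleftrightarrow> (\<forall>n. differentiable_times n f)"

named_theorems smooth_intros

lemma smooth_real_const [smooth_intros]: "smooth_real (\<lambda>_. c)"
  and smooth_real_ident [smooth_intros]: "smooth_real (\<lambda>x. x)"
  and smooth_real_add [smooth_intros]: "smooth_real f \<Longrightarrow> smooth_real g \<Longrightarrow> smooth_real (\<lambda>x. f x + g x)"
  and smooth_real_mult [smooth_intros]: "smooth_real f \<Longrightarrow> smooth_real g \<Longrightarrow> smooth_real (\<lambda>x. f x * g x)"
  unfolding smooth_real_def
  using differentiable_times_const differentiable_times_ident differentiable_times_add differentiable_times_mult
  by blast+

lemma smooth_real_uminus [smooth_intros]: "smooth_real f \<Longrightarrow> smooth_real (\<lambda>x. - f x)"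
  using smooth_real_mult[OF smooth_real_const[of "- 1"], of f] by simp

lemma smooth_real_diff [smooth_intros]: "smooth_real f \<Longrightarrow> smooth_real g \<Longrightarrow> smooth_real (\<lambda>x. f x - g x)"
  using smooth_real_add[OF _ smooth_real_uminus, of f g] by simp

lemma smooth_real_divide [smooth_intros]: "smooth_real f \<Longrightarrow> smooth_real (\<lambda>x. f x / c)"
  using smooth_real_mult[OF _ smooth_real_const[of "1 / c"], of f] by simp

lemma smooth_real_power [smooth_intros]: "smooth_real f \<Longrightarrow> smooth_real (\<lambda>x. f x ^ k)"
  by (induction k) (auto intro: smooth_intros)

lemma smooth_real_sum [smooth_intros]:
  "(\<And>i. i \<in> A \<Longrightarrow> smooth_real (f i)) \<Longrightarrow> smooth_real (\<lambda>x. \<Sum>i\<in>A. f i x)"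
  by (induction A rule: infinite_finite_induct) (auto intro: smooth_intros)

lemma smooth_real_has_deriv:
  assumes "smooth_real f"
  shows "(f has_real_derivative deriv f x) (at x)"
proof -
  have "differentiable_times (Suc 0) f" using assms unfolding smooth_real_def by blast
  then obtain f' where "\<forall>x. (f has_real_derivative f' x) (at x)" by auto
  then show ?thesis using DERIV_imp_deriv[of f "f' x" x] by simp
qed

lemma smooth_real_deriv [smooth_intros]:
  assumes "smooth_real f"
  shows "smooth_real (deriv f)"
  unfolding smooth_real_def
proof
  fix n
  have "differentiable_times (Suc n) f" using assms unfolding smooth_real_def by blast
  then obtain f' where f': "\<forall>x. (f has_real_derivative f' x) (at x)" "differentiable_times n f'" by auto
  then have "deriv f = f'" by (auto dest: DERIV_imp_deriv)
  with f' show "differentiable_times n (deriv f)" by simp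
qed

lemma smooth_real_funpow_deriv: "smooth_real f \<Longrightarrow> smooth_real ((deriv ^^ n) f)"
  by (induction n) (auto intro: smooth_intros)

lemma smooth_real_isCont: "smooth_real f \<Longrightarrow> isCont f x"
  using smooth_real_has_deriv DERIV_isCont by blast

lemma smooth_real_tendsto: "smooth_real f \<Longrightarrow> (f \<longlongrightarrow> f 0) (at_right 0)"
  using smooth_real_isCont[of f 0] unfolding isCont_def by (rule filterlim_mono) (auto simp: at_within_le_at)

section \<open>Orders in z and Taylor expansion at 0\<close>

lemma bigo_at_right_0_power_mono:
  assumes "f \<in> O[at_right (0::real)](\<lambda>z. z ^ m)" "n \<le> m"
  shows "(f :: real \<Rightarrow> real) \<in> O[at_right 0](\<lambda>z. z ^ n)"
proof (rule landau_o.big_trans[OF assms(1)])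
  show "(\<lambda>z::real. z ^ m) \<in> O[at_right 0](\<lambda>z. z ^ n)"
  proof (rule bigoI[of _ 1])
    have "\<forall>\<^sub>F z in at_right (0::real). z \<in> {0<..<1}"
      by (rule eventually_at_right_real) auto
    then show "\<forall>\<^sub>F z in at_right (0::real). norm (z ^ m) \<le> 1 * norm (z ^ n)"
      by eventually_elim (use \<open>n \<le> m\<close> in \<open>auto intro!: power_decreasing\<close>)
  qed
qed

lemma smooth_real_bigo_1: "smooth_real f \<Longrightarrow> f \<in> O[at_right 0](\<lambda>_. 1)"
  by (rule bigoI_tendsto[where c = "f 0"]) (auto intro: smooth_real_tendsto)

text \<open>Maclaurin's formula with Lagrange remainder; compactness of [-1, 1] bounds the n-th
  derivative.\<close>

lemma smooth_real_taylor:
  assumes "smooth_real f"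
  shows "(\<lambda>z. f z - (\<Sum>i<n. (deriv ^^ i) f 0 / fact i * z ^ i)) \<in> O[at_right 0](\<lambda>z. z ^ n)"
proof -
  have "compact {-1..1::real}" by simp
  then have "compact ((deriv ^^ n) f ` {-1..1})"
    by (intro compact_continuous_image continuous_at_imp_continuous_on ballI)
      (auto intro: smooth_real_isCont smooth_real_funpow_deriv assms)
  then obtain C where "\<forall>y \<in> (deriv ^^ n) f ` {-1..1}. norm y \<le> C"
    using compact_imp_bounded bounded_iff by metis
  then have C: "\<bar>(deriv ^^ n) f t\<bar> \<le> C" if "t \<in> {-1..1}" for t
    using that by simp
  have "norm (f z - (\<Sum>i<n. (deriv ^^ i) f 0 / fact i * z ^ i)) \<le> C / fact n * norm (z ^ n)"
    if z: "z \<in> {0<..<1}" for z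
  proof -
    have D: "((deriv ^^ m) f has_real_derivative (deriv ^^ Suc m) f x) (at x)" for m x
      using smooth_real_has_deriv[OF smooth_real_funpow_deriv[OF assms, of m]] by simp
    obtain t where t: "\<bar>t\<bar> \<le> \<bar>z\<bar>"
      "f z = (\<Sum>m<n. (deriv ^^ m) f 0 / fact m * z ^ m) + (deriv ^^ n) f t / fact n * z ^ n"
      using Maclaurin_all_le[of "\<lambda>m. (deriv ^^ m) f" f z n] D by auto
    then have "norm (f z - (\<Sum>i<n. (deriv ^^ i) f 0 / fact i * z ^ i)) = \<bar>(deriv ^^ n) f t\<bar> / fact n * norm (z ^ n)"
      by (simp add: abs_mult)
    also have "\<dots> \<le> C / fact n * norm (z ^ n)"
      using t z by (intro mult_right_mono divide_right_mono C) auto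
    finally show ?thesis .
  qed
  then show ?thesis
    by (intro bigoI[of _ "C / fact n"] eventually_mono[OF eventually_at_right_real[of 0 1]]) auto
qed

text \<open>Divide by z^n and let z tend to 0. This is the uniqueness of Taylor
  coefficients.\<close>

lemma bigo_power_Suc_zero:
  assumes "(\<lambda>z::real. c * z ^ n) \<in> O[at_right 0](\<lambda>z. z ^ Suc n)"
  shows "c = (0::real)"
proof -
  obtain C where C: "\<forall>\<^sub>F z in at_right (0::real). norm (c * z ^ n) \<le> C * norm (z ^ Suc n)"
    using assms by (elim landau_o.bigE) auto
  have "\<forall>\<^sub>F z in at_right (0::real). \<bar>c\<bar> \<le> C * z"
    using C eventually_at_right_less[of "0::real"]
  proof eventually_elim
    case (elim z)
    then have "z ^ n * \<bar>c\<bar> \<le> z ^ n * (C * z)" by (simp add: abs_mult algebra_simps)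
    then show ?case using elim by simp
  qed
  moreover have "((\<lambda>z::real. C * z) \<longlongrightarrow> C * 0) (at_right 0)"
    by (intro tendsto_intros)
  ultimately have "\<bar>c\<bar> \<le> C * 0" by (intro tendsto_lowerbound) auto
  then show ?thesis by simp
qed

text \<open>Induction on i: once the lower coefficients vanish, the Taylor polynomial is its i-th
  monomial alone, which is then O(z^(i+1)).\<close>

lemma smooth_real_bigo_imp_deriv_0:
  assumes f: "smooth_real f" "f \<in> O[at_right 0](\<lambda>z. z ^ n)" and "i < n"
  shows "(deriv ^^ i) f 0 = 0"
  using \<open>i < n\<close>
proof (induction i rule: less_induct)
  case (less i)
  have "(\<Sum>j<Suc i. (deriv ^^ j) f 0 / fact j * z ^ j) = (deriv ^^ i) f 0 / fact i * z ^ i" for z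
    using less by (simp add: sum.neutral)
  then have lead: "(\<lambda>z. f z - (deriv ^^ i) f 0 / fact i * z ^ i) \<in> O[at_right 0](\<lambda>z. z ^ Suc i)"
    using smooth_real_taylor[OF f(1), of "Suc i"] by simp
  have "f \<in> O[at_right 0](\<lambda>z. z ^ Suc i)"
    using less.prems by (intro bigo_at_right_0_power_mono[OF f(2)]) auto
  then have "(\<lambda>z. f z - (f z - (deriv ^^ i) f 0 / fact i * z ^ i)) \<in> O[at_right 0](\<lambda>z. z ^ Suc i)"
    by (rule sum_in_bigo(2)) (rule lead)
  then show ?case using bigo_power_Suc_zero[of "(deriv ^^ i) f 0 / fact i" i] by simp
qed

text \<open>Supplies the number that has to be cancelled at each order of the formal
  solution.\<close>

lemma smooth_real_leading_term:
  assumes f: "smooth_real f" "f \<in> O[at_right 0](\<lambda>z. z ^ n)"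
  shows "\<exists>c. (\<lambda>z. f z - c * z ^ n) \<in> O[at_right 0](\<lambda>z. z ^ Suc n)"
proof -
  have "(\<Sum>j<Suc n. (deriv ^^ j) f 0 / fact j * z ^ j) = (deriv ^^ n) f 0 / fact n * z ^ n" for z
    using smooth_real_bigo_imp_deriv_0[OF f] by (simp add: sum.neutral)
  then show ?thesis
    using smooth_real_taylor[OF f(1), of "Suc n"] by (intro exI[of _ "(deriv ^^ n) f 0 / fact n"]) simp
qed

text \<open>Orders cannot be differentiated in general. For smooth functions they can, since the
  order is encoded in vanishing Taylor coefficients and these shift by one under
  \<open>deriv\<close>.\<close>

lemma smooth_real_deriv_bigo:
  assumes f: "smooth_real f" "f \<in> O[at_right 0](\<lambda>z. z ^ Suc n)"
  shows "deriv f \<in> O[at_right 0](\<lambda>z. z ^ n)"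
proof -
  have "(deriv ^^ i) (deriv f) 0 = 0" if "i < n" for i
    using smooth_real_bigo_imp_deriv_0[OF f, of "Suc i"] that
    by (simp add: funpow_swap1)
  then have "(\<Sum>i<n. (deriv ^^ i) (deriv f) 0 / fact i * z ^ i) = 0" for z
    by (simp add: sum.neutral)
  then show ?thesis using smooth_real_taylor[OF smooth_real_deriv[OF f(1)], of n] by simp
qed


section \<open>Partial derivatives and remainder estimates in two variables\<close>

abbreviation partial1 :: "(real \<times> real \<Rightarrow> real) \<Rightarrow> real \<times> real \<Rightarrow> real" where
  "partial1 f p \<equiv> frechet_derivative f (at p) (1, 0)"

abbreviation partial2 :: "(real \<times> real \<Rightarrow> real) \<Rightarrow> real \<times> real \<Rightarrow> real" where
  "partial2 f p \<equiv> frechet_derivative f (at p) (0, 1)"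

lemma smooth_on_frechet_derivative:
  assumes "smooth_on S f"
  shows "smooth_on S (\<lambda>p. frechet_derivative f (at p) v)"
  unfolding smooth_on_def
proof
  fix k
  have "ck_on (Suc k) S f" using assms unfolding smooth_on_def by blast
  then show "ck_on k S (\<lambda>p. frechet_derivative f (at p) v)" by simp
qed

lemma smooth_on_UNIV_has_derivative:
  assumes "smooth_on UNIV f"
  shows "(f has_derivative frechet_derivative f (at p)) (at p)"
proof -
  have "ck_on (Suc 0) UNIV f" using assms unfolding smooth_on_def by blast
  then show ?thesis by (simp add: frechet_derivative_works)
qed

lemma smooth_on_imp_continuous_on:
  assumes "smooth_on S f"
  shows "continuous_on S f"
proof -
  have "ck_on 0 S f" using assms unfolding smooth_on_def by blast
  then show ?thesis by simp
qed

lemma frechet_derivative_partials: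
  fixes f :: "real \<times> real \<Rightarrow> real"
  assumes "smooth_on UNIV f"
  shows "frechet_derivative f (at p) h = fst h * partial1 f p + snd h * partial2 f p"
proof -
  have lin: "linear (frechet_derivative f (at p))"
    using smooth_on_UNIV_has_derivative[OF assms] has_derivative_linear by blast
  have "h = fst h *\<^sub>R (1, 0) + snd h *\<^sub>R (0, 1)" by (simp add: prod_eq_iff)
  then have "frechet_derivative f (at p) h =
      frechet_derivative f (at p) (fst h *\<^sub>R (1, 0) + snd h *\<^sub>R (0, 1))" by (rule arg_cong)
  then show ?thesis by (simp only: linear_add[OF lin] linear_scale[OF lin] real_scaleR_def)
qed

lemma smooth_on_UNIV_has_derivative_partials:
  fixes f :: "real \<times> real \<Rightarrow> real"
  assumes "smooth_on UNIV f"
  shows "(f has_derivative (\<lambda>h. fst h * partial1 f p + snd h * partial2 f p)) (at p)"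
  using smooth_on_UNIV_has_derivative[OF assms, of p]
  by (simp add: frechet_derivative_partials[OF assms, symmetric] eta_contract_eq)

lemma smooth_on_compose_deriv:
  fixes f :: "real \<times> real \<Rightarrow> real"
  assumes f: "smooth_on UNIV f" and "(P has_real_derivative P') (at x within S)" "(Q has_real_derivative Q') (at x within S)"
  shows "((\<lambda>x. f (P x, Q x)) has_real_derivative
    partial1 f (P x, Q x) * P' + partial2 f (P x, Q x) * Q') (at x within S)"
proof -
  have "((\<lambda>x. (P x, Q x)) has_derivative (\<lambda>h. (P' * h, Q' * h))) (at x within S)"
    using assms(2,3) by (intro has_derivative_Pair) (auto simp: has_field_derivative_def)
  from has_derivative_compose[OF this smooth_on_UNIV_has_derivative_partials[OF f]]
  show ?thesis
    unfolding has_field_derivative_def by (rule has_derivative_eq_rhs) (auto simp: algebra_simps)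
qed

lemma differentiable_times_compose2:
  fixes f :: "real \<times> real \<Rightarrow> real"
  assumes "smooth_on UNIV f" "differentiable_times n P" "differentiable_times n Q"
  shows "differentiable_times n (\<lambda>x. f (P x, Q x))"
  using assms
proof (induction n arbitrary: f)
  case (Suc n)
  obtain P' Q' where P': "\<forall>x. (P has_real_derivative P' x) (at x)" "differentiable_times n P'"
    and Q': "\<forall>x. (Q has_real_derivative Q' x) (at x)" "differentiable_times n Q'"
    using Suc.prems by auto
  have "differentiable_times n (\<lambda>x. partial1 f (P x, Q x) * P' x + partial2 f (P x, Q x) * Q' x)"
    by (intro differentiable_times_add differentiable_times_mult Suc.IH smooth_on_frechet_derivative
        P'(2) Q'(2) Suc.prems(1) Suc.prems(2,3)[THEN differentiable_times_Suc_imp])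
  moreover have "\<forall>x. ((\<lambda>x. f (P x, Q x)) has_real_derivative
      partial1 f (P x, Q x) * P' x + partial2 f (P x, Q x) * Q' x) (at x)"
    using P' Q' Suc.prems(1) by (auto intro: smooth_on_compose_deriv)
  ultimately show ?case unfolding differentiable_times.simps by (intro exI conjI)
qed simp

lemma smooth_real_compose2:
  fixes f :: "real \<times> real \<Rightarrow> real"
  shows "smooth_on UNIV f \<Longrightarrow> smooth_real P \<Longrightarrow> smooth_real Q \<Longrightarrow> smooth_real (\<lambda>x. f (P x, Q x))"
  unfolding smooth_real_def by (auto intro: differentiable_times_compose2)

lemma smooth_on_lipschitz:
  fixes f :: "real \<times> real \<Rightarrow> real"
  assumes f: "smooth_on UNIV f"
  shows "\<exists>C\<ge>0. \<forall>p q. norm p \<le> B \<longrightarrow> norm q \<le> B \<longrightarrow> \<bar>f p - f q\<bar> \<le> C * norm (p - q)"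
proof -
  have bd: "\<exists>C. \<forall>p\<in>cball 0 B. \<bar>frechet_derivative f (at p) v\<bar> \<le> C" for v
  proof -
    have "compact ((\<lambda>p. frechet_derivative f (at p) v) ` cball 0 B)"
      by (intro compact_continuous_image
          continuous_on_subset[OF smooth_on_imp_continuous_on[OF smooth_on_frechet_derivative[OF f]]]) auto
    then show ?thesis by (auto simp: bounded_iff dest!: compact_imp_bounded)
  qed
  obtain C1 C2 where C: "\<And>p. p \<in> cball 0 B \<Longrightarrow> \<bar>partial1 f p\<bar> \<le> C1"
      "\<And>p. p \<in> cball 0 B \<Longrightarrow> \<bar>partial2 f p\<bar> \<le> C2"
    using bd by metis
  have "\<bar>f p - f q\<bar> \<le> max 0 (C1 + C2) * norm (p - q)" if "norm p \<le> B" "norm q \<le> B" for p q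
  proof -
    have "norm (f p - f q) \<le> max 0 (C1 + C2) * norm (p - q)"
    proof (rule differentiable_bound[of "cball 0 B"])
      show "(f has_derivative frechet_derivative f (at x)) (at x within cball 0 B)" for x
        using smooth_on_UNIV_has_derivative[OF f] by (rule has_derivative_at_withinI)
      show "onorm (frechet_derivative f (at x)) \<le> max 0 (C1 + C2)" if x: "x \<in> cball 0 B" for x
      proof (rule onorm_bound)
        fix h :: "real \<times> real"
        have "norm (frechet_derivative f (at x) h) \<le> \<bar>fst h\<bar> * \<bar>partial1 f x\<bar> + \<bar>snd h\<bar> * \<bar>partial2 f x\<bar>"
          unfolding frechet_derivative_partials[OF f, of x h] by (simp flip: abs_mult)
        also have "\<dots> \<le> norm h * C1 + norm h * C2"
          using C[OF x] norm_fst_le[of "fst h" "snd h"] norm_snd_le[of "snd h" "fst h"] by (intro add_mono mult_mono) auto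
        also have "\<dots> \<le> max 0 (C1 + C2) * norm h"
          using mult_right_mono[of "C1 + C2" "max 0 (C1 + C2)" "norm h"] by (simp add: algebra_simps)
        finally show "norm (frechet_derivative f (at x) h) \<le> max 0 (C1 + C2) * norm h" .
      qed simp
    qed (use that in auto)
    then show ?thesis by simp
  qed
  then show ?thesis by (intro exI[of _ "max 0 (C1 + C2)"]) auto
qed

text \<open>The base point \<open>r\<close> is independent of the increment from \<open>q\<close> to
  \<open>p\<close>. In this two-point form the remainder at \<open>r\<close> has a Lipschitz
  constant proportional to the distance from \<open>r\<close>, as the contraction demands.\<close>

lemma smooth_on_linearization:
  fixes f :: "real \<times> real \<Rightarrow> real"
  assumes f: "smooth_on UNIV f"
  shows "\<exists>C\<ge>0. \<forall>p q r. norm p \<le> B \<longrightarrow> norm q \<le> B \<longrightarrow> norm r \<le> B \<longrightarrow>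
    \<bar>f p - f q - (partial1 f r * (fst p - fst q) + partial2 f r * (snd p - snd q))\<bar>
      \<le> C * (norm (p - r) + norm (q - r)) * norm (p - q)"
proof -
  \<comment> \<open>The segment from \<open>q\<close> to \<open>p\<close> runs in the ball around
    \<open>r\<close> of radius d <= 2B, which lies in the ball of radius 3B around 0.\<close>
  obtain C1 where C1: "0 \<le> C1" "\<And>p q. norm p \<le> 3 * B \<Longrightarrow> norm q \<le> 3 * B \<Longrightarrow> \<bar>partial1 f p - partial1 f q\<bar> \<le> C1 * norm (p - q)"
    using smooth_on_lipschitz[OF smooth_on_frechet_derivative[OF f]] by metis
  obtain C2 where C2: "0 \<le> C2" "\<And>p q. norm p \<le> 3 * B \<Longrightarrow> norm q \<le> 3 * B \<Longrightarrow> \<bar>partial2 f p - partial2 f q\<bar> \<le> C2 * norm (p - q)"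
    using smooth_on_lipschitz[OF smooth_on_frechet_derivative[OF f]] by metis
  have "\<bar>f p - f q - (partial1 f r * (fst p - fst q) + partial2 f r * (snd p - snd q))\<bar>
      \<le> (C1 + C2) * (norm (p - r) + norm (q - r)) * norm (p - q)"
    if B: "norm p \<le> B" "norm q \<le> B" "norm r \<le> B" for p q r
  proof -
    define d where "d = max (norm (p - r)) (norm (q - r))"
    have d: "d \<le> norm (p - r) + norm (q - r)" "0 \<le> d"
      unfolding d_def by (auto simp: le_max_iff_disj)
    have dB: "d \<le> 2 * B"
      using norm_triangle_ineq4[of p r] norm_triangle_ineq4[of q r] B unfolding d_def by linarith
    have "norm (f p - f q - frechet_derivative f (at r) (p - q)) \<le> norm (p - q) * ((C1 + C2) * d)"
    proof (rule differentiable_bound_linearization[where S = "cball r d"])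
      show "q + t *\<^sub>R (p - q) \<in> cball r d" if "t \<in> {0..1}" for t
      proof -
        have "(1 - t) *\<^sub>R q + t *\<^sub>R p \<in> cball r d"
          using that by (intro convexD[OF convex_cball]) (auto simp: d_def dist_norm norm_minus_commute)
        then show ?thesis by (simp add: algebra_simps)
      qed
      show "(f has_derivative frechet_derivative f (at x)) (at x within cball r d)" for x
        using smooth_on_UNIV_has_derivative[OF f] by (rule has_derivative_at_withinI)
      show "r \<in> cball r d" using d by simp
      show "onorm (frechet_derivative f (at x) - frechet_derivative f (at r)) \<le> (C1 + C2) * d"
        if x: "x \<in> cball r d" for x
        unfolding fun_diff_def
      proof (rule onorm_bound)
        fix h :: "real \<times> real"
        have xr: "norm (x - r) \<le> d" using x by (simp add: dist_norm norm_minus_commute)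
        have x3: "norm x \<le> 3 * B" using norm_triangle_sub[of x r] xr dB B by linarith
        have r3: "norm r \<le> 3 * B" using B norm_ge_zero[of r] by linarith
        have "\<bar>partial1 f x - partial1 f r\<bar> \<le> C1 * d"
          using C1(2)[OF x3 r3] mult_left_mono[OF xr C1(1)] by linarith
        moreover have "\<bar>partial2 f x - partial2 f r\<bar> \<le> C2 * d"
          using C2(2)[OF x3 r3] mult_left_mono[OF xr C2(1)] by linarith
        moreover have "frechet_derivative f (at x) h - frechet_derivative f (at r) h =
            fst h * (partial1 f x - partial1 f r) + snd h * (partial2 f x - partial2 f r)"
          by (simp add: frechet_derivative_partials[OF f, of _ h] algebra_simps)
        moreover have "norm (fst h * (partial1 f x - partial1 f r) + snd h * (partial2 f x - partial2 f r))
            \<le> \<bar>fst h\<bar> * \<bar>partial1 f x - partial1 f r\<bar> + \<bar>snd h\<bar> * \<bar>partial2 f x - partial2 f r\<bar>"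
          by (simp flip: abs_mult)
        moreover have "\<bar>fst h\<bar> * \<bar>partial1 f x - partial1 f r\<bar> + \<bar>snd h\<bar> * \<bar>partial2 f x - partial2 f r\<bar>
            \<le> norm h * (C1 * d) + norm h * (C2 * d)"
          using calculation(1,2) norm_fst_le[of "fst h" "snd h"] norm_snd_le[of "snd h" "fst h"] by (intro add_mono mult_mono) auto
        ultimately have "norm (frechet_derivative f (at x) h - frechet_derivative f (at r) h)
            \<le> norm h * (C1 * d) + norm h * (C2 * d)"
          by (simp only:)
        then show "norm (frechet_derivative f (at x) h - frechet_derivative f (at r) h) \<le> (C1 + C2) * d * norm h"
          by (simp only: algebra_simps)
      qed (use C1 C2 d in simp)
    qed
    also have "\<dots> \<le> norm (p - q) * ((C1 + C2) * (norm (p - r) + norm (q - r)))"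
      using C1 C2 d by (intro mult_left_mono) auto
    finally show ?thesis
      by (simp add: frechet_derivative_partials[OF f, of _ "p - q"] algebra_simps)
  qed
  then show ?thesis using C1 C2 by (intro exI[of _ "C1 + C2"]) auto
qed

text \<open>The second partial derivative vanishes on the line x = 0 as well, hence is O(x). In the
  application, the low coefficients of the phase equation see the angle only through the small
  amplitude.\<close>

lemma smooth_on_mixed_lipschitz:
  fixes f :: "real \<times> real \<Rightarrow> real"
  assumes f: "smooth_on UNIV f" and f0: "\<And>y. f (0, y) = 0"
  shows "\<exists>C\<ge>0. \<forall>x y y'. \<bar>x\<bar> \<le> B \<longrightarrow> \<bar>y\<bar> \<le> B \<longrightarrow> \<bar>y'\<bar> \<le> B \<longrightarrow>
    \<bar>f (x, y) - f (x, y')\<bar> \<le> C * \<bar>x\<bar> * \<bar>y - y'\<bar>"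
proof -
  obtain C where C: "0 \<le> C" "\<And>p q. norm p \<le> 2 * B \<Longrightarrow> norm q \<le> 2 * B \<Longrightarrow> \<bar>partial2 f p - partial2 f q\<bar> \<le> C * norm (p - q)"
    using smooth_on_lipschitz[OF smooth_on_frechet_derivative[OF f]] by metis
  have D: "((\<lambda>y. f (x, y)) has_real_derivative partial2 f (x, y)) (at y within S)" for x y S
    using smooth_on_compose_deriv[OF f, of "\<lambda>_. x" 0 y S "\<lambda>y. y" 1] by simp
  have D0: "partial2 f (0, y) = 0" for y
    using DERIV_unique[OF D[of 0 y UNIV]] f0 by simp
  have "\<bar>f (x, y) - f (x, y')\<bar> \<le> C * \<bar>x\<bar> * \<bar>y - y'\<bar>" if B: "\<bar>x\<bar> \<le> B" "\<bar>y\<bar> \<le> B" "\<bar>y'\<bar> \<le> B" for x y y'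
  proof -
    have "norm (f (x, y) - f (x, y')) \<le> C * \<bar>x\<bar> * norm (y - y')"
    proof (rule field_differentiable_bound[of "{-B..B}"])
      show "((\<lambda>y. f (x, y)) has_field_derivative partial2 f (x, z)) (at z within {- B..B})" for z
        by (rule D)
      show "norm (partial2 f (x, z)) \<le> C * \<bar>x\<bar>" if "z \<in> {-B..B}" for z
      proof -
        have "norm (x, z) \<le> 2 * B" "norm (0::real, z) \<le> 2 * B"
          using norm_Pair_le[of x z] norm_Pair_le[of "0::real" z] that B by auto
        from C(2)[OF this] show ?thesis by (simp add: D0)
      qed
    qed (use B in auto)
    then show ?thesis by simp
  qed
  then show ?thesis using C(1) by auto
qed

section \<open>The formal solution\<close>

lemma power_bigo_at_right_0:
  assumes "n \<le> m"
  shows "(\<lambda>z::real. z ^ m) \<in> O[at_right 0](\<lambda>z. z ^ n)"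
  using landau_o.big_refl assms by (rule bigo_at_right_0_power_mono)

lemma bigo_power_mult:
  fixes f g :: "real \<Rightarrow> real"
  assumes "f \<in> O[at_right 0](\<lambda>z. z ^ i)" "g \<in> O[at_right 0](\<lambda>z. z ^ j)" "k \<le> i + j"
  shows "(\<lambda>z. f z * g z) \<in> O[at_right 0](\<lambda>z. z ^ k)"
  using landau_o.big.mult[OF assms(1,2)] assms(3)
  unfolding power_add[symmetric] by (rule bigo_at_right_0_power_mono)

lemma bigo_power_cmult:
  fixes f :: "real \<Rightarrow> real"
  assumes "f \<in> O[at_right 0](\<lambda>z. z ^ i)"
  shows "(\<lambda>z. c * f z) \<in> O[at_right 0](\<lambda>z. z ^ i)"
proof (cases "c = 0")
  case False
  then show ?thesis using assms by (simp only: landau_o.big.cmult_in_iff not_False_eq_True)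
qed simp

lemma bigo_const_cmult:
  fixes f :: "'a \<Rightarrow> real"
  assumes "\<forall>\<^sub>F x in F. \<bar>f x\<bar> \<le> C * (\<bar>g x\<bar> + \<bar>h x\<bar>)" "g \<in> O[F](k)" "h \<in> O[F](k)"
  shows "f \<in> O[F](k :: 'a \<Rightarrow> real)"
proof -
  have "(\<lambda>x. C * (\<bar>g x\<bar> + \<bar>h x\<bar>)) \<in> O[F](k)"
    using assms(2,3) by (cases "C = 0") (auto intro!: sum_in_bigo)
  moreover have "f \<in> O[F](\<lambda>x. C * (\<bar>g x\<bar> + \<bar>h x\<bar>))"
    using assms(1) by (intro landau_o.big_mono) (auto elim!: eventually_mono)
  ultimately show ?thesis using landau_o.big_trans by blast
qed

lemma bigo_1_bounded:
  fixes f :: "real \<Rightarrow> real"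
  assumes "f \<in> O[at_right 0](\<lambda>z. z ^ k)"
  shows "\<exists>B. \<forall>\<^sub>F z in at_right 0. \<bar>f z\<bar> \<le> B"
proof -
  obtain c where "\<forall>\<^sub>F z in at_right 0. norm (f z) \<le> c * norm (z ^ 0 :: real)"
    by (rule landau_o.bigE[OF bigo_at_right_0_power_mono[OF assms, of 0]]) auto
  then show ?thesis by (intro exI[of _ c]) simp
qed

lemma norm_Pair_le_of_abs:
  fixes x y :: real
  assumes "\<bar>x\<bar> \<le> B" "\<bar>y\<bar> \<le> B'"
  shows "norm (x, y) \<le> \<bar>B\<bar> + \<bar>B'\<bar>"
proof -
  have "\<bar>x\<bar> \<le> \<bar>B\<bar>" "\<bar>y\<bar> \<le> \<bar>B'\<bar>"
    using assms abs_ge_self order_trans by blast+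
  then show ?thesis using norm_Pair_le[of x y] unfolding real_norm_def by (meson add_mono order_trans)
qed

lemma compose_diff_bigo:
  fixes f :: "real \<times> real \<Rightarrow> real"
  assumes f: "smooth_on UNIV f"
    and bd: "P \<in> O[at_right 0](\<lambda>z. z ^ 0)" "Q \<in> O[at_right 0](\<lambda>z. z ^ 0)"
      "P' \<in> O[at_right 0](\<lambda>z. z ^ 0)" "Q' \<in> O[at_right 0](\<lambda>z. z ^ 0)"
    and d: "(\<lambda>z. P z - P' z) \<in> O[at_right 0](\<lambda>z. z ^ k)" "(\<lambda>z. Q z - Q' z) \<in> O[at_right 0](\<lambda>z. z ^ k)"
  shows "(\<lambda>z. f (P z, Q z) - f (P' z, Q' z)) \<in> O[at_right 0](\<lambda>z. z ^ k)"
proof -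
  obtain B1 B2 B3 B4 where B: "\<forall>\<^sub>F z in at_right 0. \<bar>P z\<bar> \<le> B1" "\<forall>\<^sub>F z in at_right 0. \<bar>Q z\<bar> \<le> B2"
    "\<forall>\<^sub>F z in at_right 0. \<bar>P' z\<bar> \<le> B3" "\<forall>\<^sub>F z in at_right 0. \<bar>Q' z\<bar> \<le> B4"
    using bd[THEN bigo_1_bounded] by blast
  define B where "B = \<bar>B1\<bar> + \<bar>B2\<bar> + \<bar>B3\<bar> + \<bar>B4\<bar>"
  obtain C where C: "0 \<le> C" "\<And>p q. norm p \<le> B \<Longrightarrow> norm q \<le> B \<Longrightarrow> \<bar>f p - f q\<bar> \<le> C * norm (p - q)"
    using smooth_on_lipschitz[OF f] by blast
  have "\<forall>\<^sub>F z in at_right 0. \<bar>f (P z, Q z) - f (P' z, Q' z)\<bar> \<le> C * (\<bar>P z - P' z\<bar> + \<bar>Q z - Q' z\<bar>)"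
    using B
  proof eventually_elim
    case (elim z)
    have "norm (P z, Q z) \<le> B" "norm (P' z, Q' z) \<le> B"
      using norm_Pair_le_of_abs[OF elim(1,2)] norm_Pair_le_of_abs[OF elim(3,4)] unfolding B_def by linarith+
    then have "\<bar>f (P z, Q z) - f (P' z, Q' z)\<bar> \<le> C * norm ((P z, Q z) - (P' z, Q' z))" by (rule C)
    also have "\<dots> \<le> C * (\<bar>P z - P' z\<bar> + \<bar>Q z - Q' z\<bar>)"
      using norm_Pair_le[of "P z - P' z" "Q z - Q' z"] C(1) by (intro mult_left_mono) auto
    finally show ?case .
  qed
  then show ?thesis using d by (rule bigo_const_cmult)
qed

text \<open>The linearization error is |d| times the distance of the arguments from (r1, r2), which
  is O(z); so it is one order smaller than \<open>d\<close>.\<close>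

lemma compose_linear_bigo:
  fixes f :: "real \<times> real \<Rightarrow> real"
  assumes f: "smooth_on UNIV f"
    and PQ: "(\<lambda>z. P z - r1) \<in> O[at_right 0](\<lambda>z. z ^ 1)" "(\<lambda>z. Q z - r2) \<in> O[at_right 0](\<lambda>z. z ^ 1)"
    and d: "d \<in> O[at_right 0](\<lambda>z. z ^ Suc k)"
  shows "(\<lambda>z. f (P z, Q z + d z) - f (P z, Q z) - partial2 f (r1, r2) * d z) \<in> O[at_right 0](\<lambda>z. z ^ Suc (Suc k))"
proof -
  obtain B1 B2 B3 where B: "\<forall>\<^sub>F z in at_right 0. \<bar>P z - r1\<bar> \<le> B1" "\<forall>\<^sub>F z in at_right 0. \<bar>Q z - r2\<bar> \<le> B2"
    "\<forall>\<^sub>F z in at_right 0. \<bar>d z\<bar> \<le> B3"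
    using PQ[THEN bigo_1_bounded] d[THEN bigo_1_bounded] by blast
  define b1 b2 b3 where "b1 = \<bar>B1\<bar> + \<bar>r1\<bar>" and "b2 = \<bar>B2\<bar> + \<bar>r2\<bar>" and "b3 = \<bar>B3\<bar>"
  have b: "0 \<le> b1" "0 \<le> b2" "0 \<le> b3" "\<bar>r1\<bar> \<le> b1" "\<bar>r2\<bar> \<le> b2"
    by (auto simp: b1_def b2_def b3_def)
  define B where "B = b1 + b2 + b3"
  obtain C where C: "0 \<le> C" "\<And>p q r. norm p \<le> B \<Longrightarrow> norm q \<le> B \<Longrightarrow> norm r \<le> B \<Longrightarrow>
    \<bar>f p - f q - (partial1 f r * (fst p - fst q) + partial2 f r * (snd p - snd q))\<bar>
      \<le> C * (norm (p - r) + norm (q - r)) * norm (p - q)"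
    using smooth_on_linearization[OF f] by blast
  define g where "g z = (2 * \<bar>P z - r1\<bar> + 2 * \<bar>Q z - r2\<bar> + \<bar>d z\<bar>) * \<bar>d z\<bar>" for z
  have g: "g \<in> O[at_right 0](\<lambda>z. z ^ Suc (Suc k))"
    unfolding g_def
  proof (rule bigo_power_mult)
    have "d \<in> O[at_right 0](\<lambda>z. z ^ 1)" by (rule bigo_at_right_0_power_mono[OF d]) simp
    then show "(\<lambda>z. 2 * \<bar>P z - r1\<bar> + 2 * \<bar>Q z - r2\<bar> + \<bar>d z\<bar>) \<in> O[at_right 0](\<lambda>z. z ^ 1)"
      using PQ by (intro sum_in_bigo) simp_all
    show "(\<lambda>z. \<bar>d z\<bar>) \<in> O[at_right 0](\<lambda>z. z ^ Suc k)" using d by simp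
  qed simp
  have "\<forall>\<^sub>F z in at_right 0.
      norm (f (P z, Q z + d z) - f (P z, Q z) - partial2 f (r1, r2) * d z) \<le> C * norm (g z)"
    using B
  proof eventually_elim
    case (elim z)
    have n: "norm (P z, Q z + d z) \<le> B" "norm (P z, Q z) \<le> B" "norm (r1, r2) \<le> B"
    proof -
      have P: "\<bar>P z\<bar> \<le> b1" and Q: "\<bar>Q z\<bar> \<le> b2" and d: "\<bar>d z\<bar> \<le> b3"
        using elim unfolding b1_def b2_def b3_def by linarith+
      then have Qd: "\<bar>Q z + d z\<bar> \<le> b2 + b3" by linarith
      have "norm (P z, Q z + d z) \<le> b1 + (b2 + b3)" "norm (P z, Q z) \<le> b1 + b2" "norm (r1, r2) \<le> b1 + b2"
        using norm_Pair_le_of_abs[OF P Qd] norm_Pair_le_of_abs[OF P Q] norm_Pair_le_of_abs[OF b(4,5)] b(1-3) by simp_all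
      then show "norm (P z, Q z + d z) \<le> B" "norm (P z, Q z) \<le> B" "norm (r1, r2) \<le> B"
        using b(1-3) by (simp_all add: B_def)
    qed
    have "\<bar>f (P z, Q z + d z) - f (P z, Q z) - partial2 f (r1, r2) * d z\<bar>
        \<le> C * (norm ((P z, Q z + d z) - (r1, r2)) + norm ((P z, Q z) - (r1, r2))) * norm ((P z, Q z + d z) - (P z, Q z))"
      using C(2)[OF n] by simp
    also have "\<dots> = C * (norm (P z - r1, Q z + d z - r2) + norm (P z - r1, Q z - r2)) * \<bar>d z\<bar>"
      by (simp add: norm_Pair)
    also have "\<dots> \<le> C * (2 * \<bar>P z - r1\<bar> + 2 * \<bar>Q z - r2\<bar> + \<bar>d z\<bar>) * \<bar>d z\<bar>"
    proof (intro mult_right_mono mult_left_mono C(1))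
      have "\<bar>Q z + d z - r2\<bar> \<le> \<bar>Q z - r2\<bar> + \<bar>d z\<bar>" by linarith
      then show "norm (P z - r1, Q z + d z - r2) + norm (P z - r1, Q z - r2)
          \<le> 2 * \<bar>P z - r1\<bar> + 2 * \<bar>Q z - r2\<bar> + \<bar>d z\<bar>"
        using norm_Pair_le[of "P z - r1" "Q z + d z - r2"] norm_Pair_le[of "P z - r1" "Q z - r2"] by simp
    qed simp
    also have "\<dots> = C * norm (g z)" by (simp add: g_def)
    finally show "norm (f (P z, Q z + d z) - f (P z, Q z) - partial2 f (r1, r2) * d z) \<le> C * norm (g z)"
      by simp
  qed
  from bigoI[OF this] g show ?thesis by (rule landau_o.big_trans)
qed

lemma compose_mixed_bigo:
  fixes f :: "real \<times> real \<Rightarrow> real"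
  assumes f: "smooth_on UNIV f" "\<And>y. f (0, y) = 0"
    and bd: "P \<in> O[at_right 0](\<lambda>z. z ^ m)" "Q \<in> O[at_right 0](\<lambda>z. z ^ 0)" "Q' \<in> O[at_right 0](\<lambda>z. z ^ 0)"
    and d: "(\<lambda>z. Q z - Q' z) \<in> O[at_right 0](\<lambda>z. z ^ k)"
  shows "(\<lambda>z. f (P z, Q z) - f (P z, Q' z)) \<in> O[at_right 0](\<lambda>z. z ^ (m + k))"
proof -
  obtain B1 B2 B3 where B: "\<forall>\<^sub>F z in at_right 0. \<bar>P z\<bar> \<le> B1" "\<forall>\<^sub>F z in at_right 0. \<bar>Q z\<bar> \<le> B2"
    "\<forall>\<^sub>F z in at_right 0. \<bar>Q' z\<bar> \<le> B3"
    using bd[THEN bigo_1_bounded] by blast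
  define B where "B = \<bar>B1\<bar> + \<bar>B2\<bar> + \<bar>B3\<bar>"
  obtain C where C: "0 \<le> C" "\<And>x y y'. \<bar>x\<bar> \<le> B \<Longrightarrow> \<bar>y\<bar> \<le> B \<Longrightarrow> \<bar>y'\<bar> \<le> B \<Longrightarrow>
    \<bar>f (x, y) - f (x, y')\<bar> \<le> C * \<bar>x\<bar> * \<bar>y - y'\<bar>"
    using smooth_on_mixed_lipschitz[OF f] by blast
  have "\<forall>\<^sub>F z in at_right 0. norm (f (P z, Q z) - f (P z, Q' z)) \<le> C * norm (P z * (Q z - Q' z))"
    using B
  proof eventually_elim
    case (elim z)
    then have "\<bar>P z\<bar> \<le> B" "\<bar>Q z\<bar> \<le> B" "\<bar>Q' z\<bar> \<le> B" unfolding B_def by linarith+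
    from C(2)[OF this] show ?case by (simp add: abs_mult mult.assoc)
  qed
  then have "(\<lambda>z. f (P z, Q z) - f (P z, Q' z)) \<in> O[at_right 0](\<lambda>z. P z * (Q z - Q' z))"
    by (rule bigoI)
  then show ?thesis
    using bigo_power_mult[OF bd(1) d order_refl] by (rule landau_o.big_trans)
qed

text \<open>What the construction uses of the averaging. \<open>om_0\<close> and
  \<open>lam_L_deriv\<close> make the two unknown coefficients of each order solvable, and
  \<open>om_low\<close> keeps a change of the angle out of the phase equation for long enough.
  \<open>M2_le\<close> and \<open>M_add_L_le\<close> push the time derivatives behind the terms that
  are solved for. \<open>L_less\<close> and \<open>lam_0\<close> keep the diagonal of the
  linearization small against its off-diagonal part.\<close>

locale truncated_system =
  fixes lam om :: "nat \<Rightarrow> real \<times> real \<Rightarrow> real" and L M N n :: nat and \<phi>\<^sub>0 \<eta> :: real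
  assumes lam_smooth: "\<And>K. smooth_on UNIV (lam K)"
    and om_smooth: "\<And>K. smooth_on UNIV (om K)"
    and M_pos: "1 \<le> M" and M_add_L_le: "M + L \<le> N" and M2_le: "2 * M \<le> N" and L_less: "L < 2 * M" and L_le_n: "L \<le> n"
    and lam_L_0: "lam L (0, \<phi>\<^sub>0) = 0" and lam_L_deriv: "partial2 (lam L) (0, \<phi>\<^sub>0) \<noteq> 0"
    and om_0: "\<And>r \<phi>. om 0 (r, \<phi>) = \<eta> * r" and eta_nz: "\<eta> \<noteq> 0"
    and om_low: "\<And>K \<phi>. K < M \<Longrightarrow> om K (0, \<phi>) = 0"
    and lam_0: "\<And>r \<phi>. L = 0 \<Longrightarrow> lam 0 (r, \<phi>) = lam 0 (0, \<phi>)"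
begin

definition rhs1 :: "real \<Rightarrow> real \<times> real \<Rightarrow> real" where
  "rhs1 z p = (\<Sum>K = L..n. z ^ (M + K) * lam K p)"

definition rhs2 :: "real \<Rightarrow> real \<times> real \<Rightarrow> real" where
  "rhs2 z p = (\<Sum>K = 0..n. z ^ (M + K) * om K p)"

text \<open>In the variable \<open>z = \<tau>\<^sup>-\<^sup>1\<^sup>/\<^sup>N\<close> one has \<open>d/d\<tau> = - (1/N) z\<^sup>N\<^sup>+\<^sup>1 d/dz\<close>.\<close>

definition defect1 :: "(real \<Rightarrow> real) \<Rightarrow> (real \<Rightarrow> real) \<Rightarrow> real \<Rightarrow> real" where
  "defect1 P Q z = rhs1 z (P z, Q z) + z ^ (N + 1) / real N * deriv P z"

definition defect2 :: "(real \<Rightarrow> real) \<Rightarrow> (real \<Rightarrow> real) \<Rightarrow> real \<Rightarrow> real" where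
  "defect2 P Q z = rhs2 z (P z, Q z) + z ^ (N + 1) / real N * deriv Q z"

lemma smooth_defects:
  assumes "smooth_real P" "smooth_real Q"
  shows "smooth_real (defect1 P Q)" "smooth_real (defect2 P Q)"
proof -
  have "smooth_real (\<lambda>z. \<Sum>K = L..n. z ^ (M + K) * lam K (P z, Q z))"
    by (intro smooth_real_sum smooth_real_mult smooth_real_power smooth_real_ident
        smooth_real_compose2[OF lam_smooth] assms)
  moreover have "smooth_real (\<lambda>z. z ^ (N + 1) / real N * deriv P z)"
    by (intro smooth_real_mult smooth_real_divide smooth_real_power smooth_real_ident smooth_real_deriv assms)
  ultimately show "smooth_real (defect1 P Q)"
    unfolding defect1_def[abs_def] rhs1_def by (rule smooth_real_add)
  have "smooth_real (\<lambda>z. \<Sum>K = 0..n. z ^ (M + K) * om K (P z, Q z))"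
    by (intro smooth_real_sum smooth_real_mult smooth_real_power smooth_real_ident
        smooth_real_compose2[OF om_smooth] assms)
  moreover have "smooth_real (\<lambda>z. z ^ (N + 1) / real N * deriv Q z)"
    by (intro smooth_real_mult smooth_real_divide smooth_real_power smooth_real_ident smooth_real_deriv assms)
  ultimately show "smooth_real (defect2 P Q)"
    unfolding defect2_def[abs_def] rhs2_def by (rule smooth_real_add)
qed

lemma N_pos: "0 < N" using M_pos M2_le by linarith

lemma deriv_add_monomial:
  assumes "smooth_real P"
  shows "deriv (\<lambda>z. P z + c * z ^ k) z = deriv P z + c * (real k * z ^ (k - 1))"
proof -
  have "((\<lambda>z. c * z ^ k) has_real_derivative c * (real k * z ^ (k - Suc 0))) (at z)"
    by (rule DERIV_cmult[OF DERIV_pow])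
  from DERIV_imp_deriv[OF DERIV_add[OF smooth_real_has_deriv[OF assms] this]] show ?thesis
    by (simp only: One_nat_def)
qed

lemma sum_power_mult_bigo:
  assumes "\<And>K. K \<in> A \<Longrightarrow> h K \<in> O[at_right 0](\<lambda>z. z ^ j)" "\<And>K. K \<in> A \<Longrightarrow> k \<le> M + K + j"
  shows "(\<lambda>z::real. \<Sum>K\<in>A. z ^ (M + K) * h K z :: real) \<in> O[at_right 0](\<lambda>z. z ^ k)"
proof (rule big_sum_in_bigo)
  fix K assume "K \<in> A"
  from bigo_power_mult[OF landau_o.big_refl assms[OF this]]
  show "(\<lambda>z. z ^ (M + K) * h K z) \<in> O[at_right 0](\<lambda>z. z ^ k)" .
qed

text \<open>Through \<open>om 0\<close> a term r z^(M+k) in P changes the second defect by \<eta> r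
  z^(2M+k), and every \<open>om K\<close> with K >= 1 acts at a higher order. The first defect
  changes by terms of order 2M + L + k, and N + M + k from the time derivative; both respect its
  present order, as M >= 1 and M + L <= N.\<close>

lemma defect_step1:
  assumes P: "smooth_real P" "P \<in> O[at_right 0](\<lambda>z. z ^ M)"
    and Q: "smooth_real Q" "(\<lambda>z. Q z - \<phi>\<^sub>0) \<in> O[at_right 0](\<lambda>z. z ^ 1)"
    and d1: "defect1 P Q \<in> O[at_right 0](\<lambda>z. z ^ (M + L + k + 1))"
    and d2: "defect2 P Q \<in> O[at_right 0](\<lambda>z. z ^ (2 * M + k))"
  shows "\<exists>r. defect1 (\<lambda>z. P z + r * z ^ (M + k)) Q \<in> O[at_right 0](\<lambda>z. z ^ (M + L + k + 1)) \<and>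
    defect2 (\<lambda>z. P z + r * z ^ (M + k)) Q \<in> O[at_right 0](\<lambda>z. z ^ (2 * M + k + 1))"
proof -
  obtain c where c: "(\<lambda>z. defect2 P Q z - c * z ^ (2 * M + k)) \<in> O[at_right 0](\<lambda>z. z ^ (2 * M + k + 1))"
    using smooth_real_leading_term[OF smooth_defects(2)[OF P(1) Q(1)] d2] by auto
  define r where "r = - c / \<eta>"
  define P' where "P' z = P z + r * z ^ (M + k)" for z
  have Q_bd: "Q \<in> O[at_right 0](\<lambda>z. z ^ 0)" using smooth_real_bigo_1[OF Q(1)] by simp
  have P_bd: "P \<in> O[at_right 0](\<lambda>z. z ^ 0)" using smooth_real_bigo_1[OF P(1)] by simp
  have "smooth_real P'" unfolding P'_def by (intro smooth_intros P)
  then have P'_bd: "P' \<in> O[at_right 0](\<lambda>z. z ^ 0)" using smooth_real_bigo_1 by simp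
  have PP: "(\<lambda>z. P' z - P z) \<in> O[at_right 0](\<lambda>z. z ^ (M + k))"
    unfolding P'_def by (simp add: bigo_power_cmult)
  have QQ: "(\<lambda>z. Q z - Q z) \<in> O[at_right 0](\<lambda>z. z ^ (M + k))" by simp
  note diff = compose_diff_bigo[OF _ P'_bd Q_bd P_bd Q_bd PP QQ]
  have "(\<lambda>z. defect1 P' Q z - defect1 P Q z) \<in> O[at_right 0](\<lambda>z. z ^ (M + L + k + 1))"
  proof -
    have "defect1 P' Q z - defect1 P Q z = (\<Sum>K = L..n. z ^ (M + K) * (lam K (P' z, Q z) - lam K (P z, Q z)))
        + z ^ (N + 1) * (r * real (M + k) / real N * z ^ (M + k - 1))" for z
      unfolding defect1_def rhs1_def P'_def deriv_add_monomial[OF P(1)]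
      by (simp add: algebra_simps sum_subtractf add_divide_distrib)
    moreover have "(\<lambda>z. \<Sum>K = L..n. z ^ (M + K) * (lam K (P' z, Q z) - lam K (P z, Q z)))
        \<in> O[at_right 0](\<lambda>z. z ^ (M + L + k + 1))"
      by (rule sum_power_mult_bigo[OF diff[OF lam_smooth]]) (use M_pos in auto)
    moreover have "(\<lambda>z. z ^ (N + 1) * (r * real (M + k) / real N * z ^ (M + k - 1))) \<in> O[at_right 0](\<lambda>z. z ^ (M + L + k + 1))"
      by (rule bigo_power_mult[of _ "N + 1" _ "M + k - 1"]) (use M_pos M_add_L_le in \<open>auto intro!: bigo_power_cmult\<close>)
    ultimately show ?thesis by (simp only: sum_in_bigo(1))
  qed
  from sum_in_bigo(1)[OF this d1] have 1: "defect1 P' Q \<in> O[at_right 0](\<lambda>z. z ^ (M + L + k + 1))"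
    by simp
  have "(\<lambda>z. defect2 P' Q z - defect2 P Q z + c * z ^ (2 * M + k)) \<in> O[at_right 0](\<lambda>z. z ^ (2 * M + k + 1))"
  proof -
    \<comment> \<open>The K = 0 term cancels \<open>c\<close> exactly because \<open>om 0\<close> is
      linear in r. \<open>Q\<close> is unchanged, so its time derivative drops out.\<close>
    have "defect2 P' Q z - defect2 P Q z + c * z ^ (2 * M + k)
        = (\<Sum>K = 1..n. z ^ (M + K) * (om K (P' z, Q z) - om K (P z, Q z)))" for z
    proof -
      have "defect2 P' Q z - defect2 P Q z = (\<Sum>K = 0..n. z ^ (M + K) * (om K (P' z, Q z) - om K (P z, Q z)))"
        unfolding defect2_def rhs2_def by (simp add: right_diff_distrib sum_subtractf)
      also have "\<dots> = z ^ M * (om 0 (P' z, Q z) - om 0 (P z, Q z)) +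
          (\<Sum>K = 1..n. z ^ (M + K) * (om K (P' z, Q z) - om K (P z, Q z)))"
        by (simp add: sum.atLeast_Suc_atMost)
      also have "z ^ M * (om 0 (P' z, Q z) - om 0 (P z, Q z)) = - c * z ^ (2 * M + k)"
        using eta_nz by (simp add: om_0 P'_def r_def algebra_simps power_add mult_2_right)
      finally show ?thesis by simp
    qed
    moreover have "(\<lambda>z. \<Sum>K = 1..n. z ^ (M + K) * (om K (P' z, Q z) - om K (P z, Q z)))
        \<in> O[at_right 0](\<lambda>z. z ^ (2 * M + k + 1))"
      by (rule sum_power_mult_bigo[OF diff[OF om_smooth]]) auto
    ultimately show ?thesis by simp
  qed
  from sum_in_bigo(1)[OF this c] have 2: "defect2 P' Q \<in> O[at_right 0](\<lambda>z. z ^ (2 * M + k + 1))"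
    by simp
  show ?thesis using 1 2 unfolding P'_def by blast
qed

text \<open>A term r z^(k+1) in Q changes the first defect by slope * r z^(M+L+k+1) plus higher
  orders. The second defect must keep what the preceding step gained: for K < M the mixed estimate
  contributes z^M because P = O(z^M), for K >= M the prefactor already contains it.\<close>

lemma defect_step2:
  assumes P: "smooth_real P" "P \<in> O[at_right 0](\<lambda>z. z ^ M)"
    and Q: "smooth_real Q" "(\<lambda>z. Q z - \<phi>\<^sub>0) \<in> O[at_right 0](\<lambda>z. z ^ 1)"
    and d1: "defect1 P Q \<in> O[at_right 0](\<lambda>z. z ^ (M + L + k + 1))"
    and d2: "defect2 P Q \<in> O[at_right 0](\<lambda>z. z ^ (2 * M + k + 1))"
  shows "\<exists>r. defect1 P (\<lambda>z. Q z + r * z ^ (k + 1)) \<in> O[at_right 0](\<lambda>z. z ^ (M + L + k + 2)) \<and>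
    defect2 P (\<lambda>z. Q z + r * z ^ (k + 1)) \<in> O[at_right 0](\<lambda>z. z ^ (2 * M + k + 1))"
proof -
  obtain c where c: "(\<lambda>z. defect1 P Q z - c * z ^ (M + L + k + 1)) \<in> O[at_right 0](\<lambda>z. z ^ (M + L + k + 2))"
    using smooth_real_leading_term[OF smooth_defects(1)[OF P(1) Q(1)] d1] by auto
  define slope where "slope = partial2 (lam L) (0, \<phi>\<^sub>0)"
  define r where "r = - c / slope"
  define Q' where "Q' z = Q z + r * z ^ (k + 1)" for z
  have Q_bd: "Q \<in> O[at_right 0](\<lambda>z. z ^ 0)" using smooth_real_bigo_1[OF Q(1)] by simp
  have P_bd: "P \<in> O[at_right 0](\<lambda>z. z ^ 0)" using smooth_real_bigo_1[OF P(1)] by simp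
  have "smooth_real Q'" unfolding Q'_def by (intro smooth_intros Q)
  then have Q'_bd: "Q' \<in> O[at_right 0](\<lambda>z. z ^ 0)" using smooth_real_bigo_1 by simp
  have QQ: "(\<lambda>z. Q' z - Q z) \<in> O[at_right 0](\<lambda>z. z ^ (k + 1))"
    unfolding Q'_def by (simp add: bigo_power_cmult)
  have PP: "(\<lambda>z. P z - P z) \<in> O[at_right 0](\<lambda>z. z ^ (k + 1))" by simp
  note diff = compose_diff_bigo[OF _ P_bd Q'_bd P_bd Q_bd PP QQ]
  have "(\<lambda>z. defect1 P Q' z - defect1 P Q z + c * z ^ (M + L + k + 1)) \<in> O[at_right 0](\<lambda>z. z ^ (M + L + k + 2))"
  proof -
    have "defect1 P Q' z - defect1 P Q z + c * z ^ (M + L + k + 1)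
        = (\<Sum>K = Suc L..n. z ^ (M + K) * (lam K (P z, Q' z) - lam K (P z, Q z)))
          + z ^ (M + L) * (lam L (P z, Q z + r * z ^ (k + 1)) - lam L (P z, Q z) - slope * (r * z ^ (k + 1)))" for z
    proof -
      have "defect1 P Q' z - defect1 P Q z = (\<Sum>K = L..n. z ^ (M + K) * (lam K (P z, Q' z) - lam K (P z, Q z)))"
        unfolding defect1_def rhs1_def by (simp add: right_diff_distrib sum_subtractf)
      also have "\<dots> = z ^ (M + L) * (lam L (P z, Q' z) - lam L (P z, Q z)) +
          (\<Sum>K = Suc L..n. z ^ (M + K) * (lam K (P z, Q' z) - lam K (P z, Q z)))"
        using L_le_n by (simp add: sum.atLeast_Suc_atMost)
      also have "z ^ (M + L) * (lam L (P z, Q' z) - lam L (P z, Q z)) =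
        z ^ (M + L) * (lam L (P z, Q z + r * z ^ (k + 1)) - lam L (P z, Q z) - slope * (r * z ^ (k + 1))) - c * z ^ (M + L + k + 1)"
        using lam_L_deriv by (simp add: Q'_def r_def slope_def algebra_simps power_add)
      finally show ?thesis by simp
    qed
    moreover have "(\<lambda>z. \<Sum>K = Suc L..n. z ^ (M + K) * (lam K (P z, Q' z) - lam K (P z, Q z)))
        \<in> O[at_right 0](\<lambda>z. z ^ (M + L + k + 2))"
      by (rule sum_power_mult_bigo[OF diff[OF lam_smooth]]) auto
    moreover have "(\<lambda>z. z ^ (M + L) * (lam L (P z, Q z + r * z ^ (k + 1)) - lam L (P z, Q z) - slope * (r * z ^ (k + 1))))
        \<in> O[at_right 0](\<lambda>z. z ^ (M + L + k + 2))"
    proof (rule bigo_power_mult[of _ "M + L" _ "Suc (Suc k)"])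
      show "(\<lambda>z. lam L (P z, Q z + r * z ^ (k + 1)) - lam L (P z, Q z) - slope * (r * z ^ (k + 1)))
          \<in> O[at_right 0](\<lambda>z. z ^ Suc (Suc k))"
        unfolding slope_def
      proof (rule compose_linear_bigo[OF lam_smooth])
        show "(\<lambda>z. P z - 0) \<in> O[at_right 0](\<lambda>z. z ^ 1)"
          using bigo_at_right_0_power_mono[OF P(2) M_pos] by simp
        show "(\<lambda>z. r * z ^ (k + 1)) \<in> O[at_right 0](\<lambda>z. z ^ Suc k)"
          by (rule bigo_power_cmult) simp
      qed (use Q in auto)
    qed auto
    ultimately show ?thesis by (simp only: sum_in_bigo(1))
  qed
  from sum_in_bigo(1)[OF this c] have 1: "defect1 P Q' \<in> O[at_right 0](\<lambda>z. z ^ (M + L + k + 2))"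
    by simp
  have "(\<lambda>z. defect2 P Q' z - defect2 P Q z) \<in> O[at_right 0](\<lambda>z. z ^ (2 * M + k + 1))"
  proof -
    have "defect2 P Q' z - defect2 P Q z = (\<Sum>K = 0..n. z ^ (M + K) * (om K (P z, Q' z) - om K (P z, Q z)))
        + z ^ (N + 1) * (r * real (k + 1) / real N * z ^ k)" for z
      unfolding defect2_def rhs2_def Q'_def deriv_add_monomial[OF Q(1)]
      by (simp add: algebra_simps sum_subtractf add_divide_distrib)
    moreover have "(\<lambda>z. \<Sum>K = 0..n. z ^ (M + K) * (om K (P z, Q' z) - om K (P z, Q z)))
        \<in> O[at_right 0](\<lambda>z. z ^ (2 * M + k + 1))"
    proof (rule big_sum_in_bigo)
      fix K
      show "(\<lambda>z. z ^ (M + K) * (om K (P z, Q' z) - om K (P z, Q z))) \<in> O[at_right 0](\<lambda>z. z ^ (2 * M + k + 1))"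
      proof (cases "K < M")
        case True
        show ?thesis
          by (rule bigo_power_mult[OF _ compose_mixed_bigo[OF om_smooth om_low[OF True] P(2) Q'_bd Q_bd QQ], of _ "M + K"])
            auto
      next
        case False
        then show ?thesis by (intro bigo_power_mult[OF _ diff[OF om_smooth], of _ "M + K"]) auto
      qed
    qed
    \<comment> \<open>The time derivative of the new term has order N + 1 + k, which is enough by 2M
      <= N.\<close>
    moreover have "(\<lambda>z. z ^ (N + 1) * (r * real (k + 1) / real N * z ^ k)) \<in> O[at_right 0](\<lambda>z. z ^ (2 * M + k + 1))"
    proof (rule bigo_power_mult[of _ "N + 1" _ k])
      show "(\<lambda>z::real. r * real (k + 1) / real N * z ^ k) \<in> O[at_right 0](\<lambda>z. z ^ k)"
        by (rule bigo_power_cmult) simp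
    qed (use M2_le in auto)
    ultimately show ?thesis by (simp only: sum_in_bigo(1))
  qed
  from sum_in_bigo(1)[OF this d2] have 2: "defect2 P Q' \<in> O[at_right 0](\<lambda>z. z ^ (2 * M + k + 1))"
    by simp
  show ?thesis using 1 2 unfolding Q'_def by blast
qed

text \<open>\<open>m\<close> counts coefficients: this sum ends with z^(M+m-1) and that for the
  angle with z^m, so the first neglected terms are z^(M+m) and z^(m+1).\<close>

definition approx1 :: "(nat \<Rightarrow> real) \<Rightarrow> nat \<Rightarrow> real \<Rightarrow> real" where
  "approx1 c m z = (\<Sum>k<m. c k * z ^ (M + k))"

definition approx2 :: "(nat \<Rightarrow> real) \<Rightarrow> nat \<Rightarrow> real \<Rightarrow> real" where
  "approx2 d m z = \<phi>\<^sub>0 + (\<Sum>k<m. d k * z ^ (k + 1))"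

lemma smooth_approx: "smooth_real (approx1 c m)" "smooth_real (approx2 c m)"
proof -
  show "smooth_real (approx1 c m)"
    unfolding approx1_def[abs_def]
    by (intro smooth_real_sum smooth_real_mult smooth_real_const smooth_real_power smooth_real_ident)
  show "smooth_real (approx2 c m)"
    unfolding approx2_def[abs_def]
    by (intro smooth_real_add smooth_real_sum smooth_real_mult smooth_real_const smooth_real_power smooth_real_ident)
qed

lemma approx1_diff_bigo:
  "k \<le> m \<Longrightarrow> (\<lambda>z. approx1 c m z - approx1 c k z) \<in> O[at_right 0](\<lambda>z. z ^ (M + k))"
proof -
  assume "k \<le> m"
  then have "approx1 c m z - approx1 c k z = (\<Sum>i = k..<m. c i * z ^ (M + i))" for z
    unfolding approx1_def lessThan_atLeast0 by (rule sum_diff_nat_ivl[of 0, simplified])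
  then show ?thesis
    by (auto intro!: big_sum_in_bigo bigo_power_cmult power_bigo_at_right_0)
qed

lemma approx2_diff_bigo:
  "k \<le> m \<Longrightarrow> (\<lambda>z. approx2 c m z - approx2 c k z) \<in> O[at_right 0](\<lambda>z. z ^ (k + 1))"
proof -
  assume "k \<le> m"
  then have "(\<Sum>i<m. c i * z ^ (i + 1)) - (\<Sum>i<k. c i * z ^ (i + 1)) = (\<Sum>i = k..<m. c i * z ^ (i + 1))" for z
    unfolding lessThan_atLeast0 by (rule sum_diff_nat_ivl[of 0, simplified])
  then have "approx2 c m z - approx2 c k z = (\<Sum>i = k..<m. c i * z ^ (i + 1))" for z
    unfolding approx2_def by simp
  then show ?thesis
    by (auto intro!: big_sum_in_bigo bigo_power_cmult power_bigo_at_right_0 simp del: power_Suc)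
qed

lemma approx1_bigo: "approx1 c m \<in> O[at_right 0](\<lambda>z. z ^ M)"
proof -
  have "approx1 c 0 = (\<lambda>_. 0)" by (simp add: approx1_def fun_eq_iff)
  then show ?thesis using approx1_diff_bigo[of 0 m c] by simp
qed

lemma approx2_bigo: "(\<lambda>z. approx2 c m z - \<phi>\<^sub>0) \<in> O[at_right 0](\<lambda>z. z ^ 1)"
proof -
  have "approx2 c 0 = (\<lambda>_. \<phi>\<^sub>0)" by (simp add: approx2_def fun_eq_iff)
  then show ?thesis using approx2_diff_bigo[of 0 m c] by simp
qed

text \<open>New coefficients depend on the earlier ones, hence dependent choice on pairs of
  sequences, with \<open>agree\<close> recording that earlier entries are kept. Each round cancels
  first the leading term of the second defect, then that of the first. The initial orders come from
  lam L (0, \<open>\<phi>\<^sub>0\<close>) = 0 and from the vanishing of \<open>om K\<close> at r =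
  0 for K < M.\<close>

theorem formal_solution:
  "\<exists>c d. \<forall>m. defect1 (approx1 c m) (approx2 d m) \<in> O[at_right 0](\<lambda>z. z ^ (M + L + m + 1)) \<and>
    defect2 (approx1 c m) (approx2 d m) \<in> O[at_right 0](\<lambda>z. z ^ (2 * M + m))"
proof -
  define ok where "ok m cd \<longleftrightarrow> defect1 (approx1 (fst cd) m) (approx2 (snd cd) m) \<in> O[at_right 0](\<lambda>z. z ^ (M + L + m + 1)) \<and>
    defect2 (approx1 (fst cd) m) (approx2 (snd cd) m) \<in> O[at_right 0](\<lambda>z. z ^ (2 * M + m))" for m and cd :: "(nat \<Rightarrow> real) \<times> (nat \<Rightarrow> real)"
  define agree where "agree m cd cd' \<longleftrightarrow> (\<forall>k<m. fst cd k = fst cd' k \<and> snd cd k = snd cd' k)"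
    for m and cd cd' :: "(nat \<Rightarrow> real) \<times> (nat \<Rightarrow> real)"
  have "\<exists>s. \<forall>m. ok m (s m) \<and> agree m (s m) (s (Suc m))"
  proof (rule dependent_nat_choice)
    have "(\<lambda>z. \<Sum>K = Suc L..n. z ^ (M + K) * lam K (0, \<phi>\<^sub>0)) \<in> O[at_right 0](\<lambda>z. z ^ (M + L + 1))"
      by (rule sum_power_mult_bigo[where j = 0]) auto
    then have 1: "defect1 (\<lambda>_. 0) (\<lambda>_. \<phi>\<^sub>0) \<in> O[at_right 0](\<lambda>z. z ^ (M + L + 1))"
      unfolding defect1_def[abs_def] rhs1_def using L_le_n by (simp add: sum.atLeast_Suc_atMost lam_L_0)
    have "(\<lambda>z. \<Sum>K = 0..n. z ^ (M + K) * om K (0, \<phi>\<^sub>0)) \<in> O[at_right 0](\<lambda>z. z ^ (2 * M))"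
    proof (rule big_sum_in_bigo)
      fix K
      show "(\<lambda>z. z ^ (M + K) * om K (0, \<phi>\<^sub>0)) \<in> O[at_right 0](\<lambda>z. z ^ (2 * M))"
        using om_low[of K] by (cases "K < M")
          (auto intro!: bigo_power_cmult power_bigo_at_right_0 simp: mult.commute[of _ "om _ _"])
    qed
    then have 2: "defect2 (\<lambda>_. 0) (\<lambda>_. \<phi>\<^sub>0) \<in> O[at_right 0](\<lambda>z. z ^ (2 * M))"
      unfolding defect2_def[abs_def] rhs2_def by simp
    have "ok 0 (\<lambda>_. 0, \<lambda>_. 0)"
      unfolding ok_def using 1 2 by (simp add: approx1_def[abs_def] approx2_def[abs_def])
    then show "\<exists>s. ok 0 s" by blast
  next
    fix s m assume "ok m s"
    obtain c d where s: "s = (c, d)" by (cases s)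
    have 1: "defect1 (approx1 c m) (approx2 d m) \<in> O[at_right 0](\<lambda>z. z ^ (M + L + m + 1))"
      and 2: "defect2 (approx1 c m) (approx2 d m) \<in> O[at_right 0](\<lambda>z. z ^ (2 * M + m))"
      using \<open>ok m s\<close> by (auto simp: s ok_def)
    from defect_step1[OF smooth_approx(1) approx1_bigo smooth_approx(2) approx2_bigo 1 2] obtain r where
      r: "defect1 (\<lambda>z. approx1 c m z + r * z ^ (M + m)) (approx2 d m) \<in> O[at_right 0](\<lambda>z. z ^ (M + L + m + 1))"
         "defect2 (\<lambda>z. approx1 c m z + r * z ^ (M + m)) (approx2 d m) \<in> O[at_right 0](\<lambda>z. z ^ (2 * M + m + 1))"
      by blast
    define c' where "c' = c(m := r)"
    have c': "(\<lambda>z. approx1 c m z + r * z ^ (M + m)) = approx1 c' (Suc m)"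
      by (rule ext) (simp add: approx1_def c'_def)
    from defect_step2[OF smooth_approx(1) approx1_bigo smooth_approx(2) approx2_bigo r[unfolded c']] obtain r' where
      r': "defect1 (approx1 c' (Suc m)) (\<lambda>z. approx2 d m z + r' * z ^ (m + 1)) \<in> O[at_right 0](\<lambda>z. z ^ (M + L + m + 2))"
         "defect2 (approx1 c' (Suc m)) (\<lambda>z. approx2 d m z + r' * z ^ (m + 1)) \<in> O[at_right 0](\<lambda>z. z ^ (2 * M + m + 1))"
      by blast
    define d' where "d' = d(m := r')"
    have d': "(\<lambda>z. approx2 d m z + r' * z ^ (m + 1)) = approx2 d' (Suc m)"
      by (rule ext) (simp add: approx2_def d'_def)
    have "ok (Suc m) (c', d')" using r'[unfolded d'] by (simp add: ok_def)
    moreover have "agree m s (c', d')" by (simp add: agree_def s c'_def d'_def)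
    ultimately show "\<exists>s'. ok (Suc m) s' \<and> agree m s s'" by blast
  qed
  then obtain s where s: "\<And>m. ok m (s m)" "\<And>m. agree m (s m) (s (Suc m))" by blast
  have stable: "agree k (s k) (s m)" if "k \<le> m" for k m
    using that
  proof (induction m rule: dec_induct)
    case (step m)
    then show ?case using s(2)[of m] by (auto simp: agree_def)
  qed (simp add: agree_def)
  \<comment> \<open>The diagonal of the stages: entry k is final from stage k + 1 on.\<close>
  define c d where "c k = fst (s (Suc k)) k" and "d k = snd (s (Suc k)) k" for k
  have "approx1 c m = approx1 (fst (s m)) m" "approx2 d m = approx2 (snd (s m)) m" for m
    using stable[of "Suc _" m]
    by (auto simp: approx1_def approx2_def c_def d_def agree_def fun_eq_iff intro!: sum.cong)
  then show ?thesis using s(1) by (intro exI[of _ c] exI[of _ d]) (auto simp: ok_def)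
qed

end

section \<open>From the formal to the exact solution\<close>

text \<open>For z < 1 all prefactors are at most z^M, so the linearization constants of the finitely
  many terms add up. Deviations range over the unit cube around a bounded base point, where uniform
  constants exist.\<close>

lemma sum_linearization:
  fixes f :: "nat \<Rightarrow> real \<times> real \<Rightarrow> real"
  assumes f: "\<And>K. smooth_on UNIV (f K)" and A: "finite A"
    and bd: "P \<in> O[at_right 0](\<lambda>z. z ^ 0)" "Q \<in> O[at_right 0](\<lambda>z. z ^ 0)"
  shows "\<exists>C\<ge>0. \<forall>\<^sub>F z in at_right 0. \<forall>u v u' v'. \<bar>u\<bar> \<le> 1 \<longrightarrow> \<bar>v\<bar> \<le> 1 \<longrightarrow> \<bar>u'\<bar> \<le> 1 \<longrightarrow> \<bar>v'\<bar> \<le> 1 \<longrightarrow>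
    \<bar>(\<Sum>K\<in>A. z ^ (M + K) * f K (P z + u, Q z + v)) - (\<Sum>K\<in>A. z ^ (M + K) * f K (P z + u', Q z + v'))
      - ((\<Sum>K\<in>A. z ^ (M + K) * partial1 (f K) (P z, Q z)) * (u - u')
        + (\<Sum>K\<in>A. z ^ (M + K) * partial2 (f K) (P z, Q z)) * (v - v'))\<bar>
    \<le> C * z ^ M * (\<bar>u\<bar> + \<bar>v\<bar> + \<bar>u'\<bar> + \<bar>v'\<bar>) * (\<bar>u - u'\<bar> + \<bar>v - v'\<bar>)"
proof -
  obtain B1 B2 where B: "\<forall>\<^sub>F z in at_right 0. \<bar>P z\<bar> \<le> B1" "\<forall>\<^sub>F z in at_right 0. \<bar>Q z\<bar> \<le> B2"
    using bd[THEN bigo_1_bounded] by blast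
  define b1 b2 where "b1 = \<bar>B1\<bar> + 1" and "b2 = \<bar>B2\<bar> + 1"
  have "\<exists>C\<ge>0. \<forall>p q r. norm p \<le> b1 + b2 \<longrightarrow> norm q \<le> b1 + b2 \<longrightarrow> norm r \<le> b1 + b2 \<longrightarrow>
    \<bar>f K p - f K q - (partial1 (f K) r * (fst p - fst q) + partial2 (f K) r * (snd p - snd q))\<bar>
      \<le> C * (norm (p - r) + norm (q - r)) * norm (p - q)" for K
    by (rule smooth_on_linearization[OF f])
  then obtain C where C0: "\<And>K. 0 \<le> C K"
    and C: "\<And>K p q r. norm p \<le> b1 + b2 \<Longrightarrow> norm q \<le> b1 + b2 \<Longrightarrow> norm r \<le> b1 + b2 \<Longrightarrow>
    \<bar>f K p - f K q - (partial1 (f K) r * (fst p - fst q) + partial2 (f K) r * (snd p - snd q))\<bar>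
      \<le> C K * (norm (p - r) + norm (q - r)) * norm (p - q)"
    by metis
  have z01: "\<forall>\<^sub>F z in at_right (0::real). z \<in> {0<..<1}" by (rule eventually_at_right_real) simp
  have "\<forall>\<^sub>F z in at_right 0. \<forall>u v u' v'. \<bar>u\<bar> \<le> 1 \<longrightarrow> \<bar>v\<bar> \<le> 1 \<longrightarrow> \<bar>u'\<bar> \<le> 1 \<longrightarrow> \<bar>v'\<bar> \<le> 1 \<longrightarrow>
    \<bar>(\<Sum>K\<in>A. z ^ (M + K) * f K (P z + u, Q z + v)) - (\<Sum>K\<in>A. z ^ (M + K) * f K (P z + u', Q z + v'))
      - ((\<Sum>K\<in>A. z ^ (M + K) * partial1 (f K) (P z, Q z)) * (u - u')
        + (\<Sum>K\<in>A. z ^ (M + K) * partial2 (f K) (P z, Q z)) * (v - v'))\<bar>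
    \<le> sum C A * z ^ M * (\<bar>u\<bar> + \<bar>v\<bar> + \<bar>u'\<bar> + \<bar>v'\<bar>) * (\<bar>u - u'\<bar> + \<bar>v - v'\<bar>)"
    using B z01
  proof eventually_elim
    case (elim z)
    show ?case
    proof (intro allI impI)
      fix u v u' v' :: real
      assume uv: "\<bar>u\<bar> \<le> 1" "\<bar>v\<bar> \<le> 1" "\<bar>u'\<bar> \<le> 1" "\<bar>v'\<bar> \<le> 1"
      define X where "X K = f K (P z + u, Q z + v) - f K (P z + u', Q z + v')
        - (partial1 (f K) (P z, Q z) * (u - u') + partial2 (f K) (P z, Q z) * (v - v'))" for K
      define D where "D = (\<bar>u\<bar> + \<bar>v\<bar> + \<bar>u'\<bar> + \<bar>v'\<bar>) * (\<bar>u - u'\<bar> + \<bar>v - v'\<bar>)"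
      have D0: "0 \<le> D" by (simp add: D_def)
      have near: "norm (P z + w, Q z + w') \<le> b1 + b2" if "\<bar>w\<bar> \<le> 1" "\<bar>w'\<bar> \<le> 1" for w w'
      proof -
        have "\<bar>P z + w\<bar> \<le> b1" using that(1) elim(1) unfolding b1_def by linarith
        moreover have "\<bar>Q z + w'\<bar> \<le> b2" using that(2) elim(2) unfolding b2_def by linarith
        ultimately show ?thesis using norm_Pair_le[of "P z + w" "Q z + w'"] by simp
      qed
      have X: "\<bar>X K\<bar> \<le> C K * D" for K
      proof -
        have "\<bar>X K\<bar> \<le> C K * (norm ((P z + u, Q z + v) - (P z, Q z)) + norm ((P z + u', Q z + v') - (P z, Q z)))
            * norm ((P z + u, Q z + v) - (P z + u', Q z + v'))"
          using C[of "(P z + u, Q z + v)" "(P z + u', Q z + v')" "(P z, Q z)" K] near[OF uv(1,2)] near[OF uv(3,4)] near[of 0 0]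
          by (simp add: X_def)
        also have "\<dots> = C K * (norm (u, v) + norm (u', v')) * norm (u - u', v - v')" by simp
        also have "\<dots> \<le> C K * ((\<bar>u\<bar> + \<bar>v\<bar>) + (\<bar>u'\<bar> + \<bar>v'\<bar>)) * (\<bar>u - u'\<bar> + \<bar>v - v'\<bar>)"
          using norm_Pair_le[of u v] norm_Pair_le[of u' v'] norm_Pair_le[of "u - u'" "v - v'"] C0[of K]
          by (intro mult_mono mult_left_mono add_mono mult_nonneg_nonneg add_nonneg_nonneg) simp_all
        also have "\<dots> = C K * D" by (simp add: D_def mult.assoc add.assoc)
        finally show ?thesis .
      qed
      have "(\<Sum>K\<in>A. z ^ (M + K) * f K (P z + u, Q z + v)) - (\<Sum>K\<in>A. z ^ (M + K) * f K (P z + u', Q z + v'))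
        - ((\<Sum>K\<in>A. z ^ (M + K) * partial1 (f K) (P z, Q z)) * (u - u')
          + (\<Sum>K\<in>A. z ^ (M + K) * partial2 (f K) (P z, Q z)) * (v - v')) = (\<Sum>K\<in>A. z ^ (M + K) * X K)"
        unfolding sum_distrib_right sum_subtractf[symmetric] sum.distrib[symmetric] X_def
        by (intro sum.cong refl) (simp add: algebra_simps)
      also have "\<bar>\<dots>\<bar> \<le> (\<Sum>K\<in>A. z ^ M * (C K * D))"
      proof (rule order_trans[OF sum_abs], rule sum_mono)
        fix K
        have "z ^ (M + K) \<le> z ^ M" using elim by (intro power_decreasing) auto
        then show "\<bar>z ^ (M + K) * X K\<bar> \<le> z ^ M * (C K * D)"
          unfolding abs_mult using X[of K] elim by (intro mult_mono) auto
      qed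
      also have "\<dots> = sum C A * z ^ M * (\<bar>u\<bar> + \<bar>v\<bar> + \<bar>u'\<bar> + \<bar>v'\<bar>) * (\<bar>u - u'\<bar> + \<bar>v - v'\<bar>)"
        unfolding D_def by (simp add: sum_distrib_left sum_distrib_right mult_ac)
      finally show "\<bar>(\<Sum>K\<in>A. z ^ (M + K) * f K (P z + u, Q z + v)) - (\<Sum>K\<in>A. z ^ (M + K) * f K (P z + u', Q z + v'))
        - ((\<Sum>K\<in>A. z ^ (M + K) * partial1 (f K) (P z, Q z)) * (u - u')
          + (\<Sum>K\<in>A. z ^ (M + K) * partial2 (f K) (P z, Q z)) * (v - v'))\<bar>
        \<le> sum C A * z ^ M * (\<bar>u\<bar> + \<bar>v\<bar> + \<bar>u'\<bar> + \<bar>v'\<bar>) * (\<bar>u - u'\<bar> + \<bar>v - v'\<bar>)" .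
    qed
  qed
  moreover have "0 \<le> sum C A" using C0 by (simp add: sum_nonneg)
  ultimately show ?thesis by blast
qed

lemma bigo_two_sided:
  fixes f :: "real \<Rightarrow> real"
  assumes "(\<lambda>z. f z - c * z ^ k) \<in> O[at_right 0](\<lambda>z. z ^ Suc k)" "0 < c"
  shows "\<forall>\<^sub>F z in at_right 0. c / 2 * z ^ k \<le> f z \<and> f z \<le> 2 * c * z ^ k"
proof -
  obtain C where C: "\<forall>\<^sub>F z in at_right 0. norm (f z - c * z ^ k) \<le> C * norm (z ^ Suc k)"
    using assms(1) by (rule landau_o.bigE)
  have lim: "((\<lambda>z::real. C * z) \<longlongrightarrow> C * 0) (at_right 0)" by (intro tendsto_intros)
  have "\<forall>\<^sub>F z in at_right 0. C * z < c / 2"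
    using order_tendstoD(2)[OF lim, of "c / 2"] \<open>0 < c\<close> by simp
  with C eventually_at_right_less[of "0::real"] show ?thesis
  proof eventually_elim
    case (elim z)
    have "\<bar>f z - c * z ^ k\<bar> \<le> C * z * z ^ k" using elim by (simp add: abs_mult mult.assoc)
    also have "\<dots> \<le> c / 2 * z ^ k" using elim by (intro mult_right_mono) auto
    finally have "\<bar>f z - c * z ^ k\<bar> \<le> c * z ^ k / 2" by simp
    moreover have "0 \<le> c * z ^ k" using elim \<open>0 < c\<close> by simp
    ultimately have "c * z ^ k / 2 \<le> f z" "f z \<le> 2 * (c * z ^ k)" unfolding abs_le_iff by linarith+
    then show ?case by simp
  qed
qed

section \<open>The dictionary between z and \<tau>\<close>

context truncated_system
begin

text \<open>Time derivative as an operator in z, so that smoothness and orders in z can be applied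
  to it.\<close>

definition dtau :: "(real \<Rightarrow> real) \<Rightarrow> real \<Rightarrow> real" where
  "dtau f z = - (z ^ (N + 1) / real N * deriv f z)"

definition scale :: "real \<Rightarrow> real" where
  "scale \<tau> = \<tau> powr (- 1 / real N)"

lemma scale_pos: "0 < \<tau> \<Longrightarrow> 0 < scale \<tau>"
  by (simp add: scale_def)

lemma scale_power: "0 < \<tau> \<Longrightarrow> scale \<tau> ^ k = \<tau> powr (- real k / real N)"
  unfolding scale_def by (simp add: powr_powr flip: powr_realpow)

text \<open>Rates of size 1/\<tau>, on which the dichotomy turns, are exactly those of order
  z^N.\<close>

lemma scale_power_N: "0 < \<tau> \<Longrightarrow> scale \<tau> ^ N = 1 / \<tau>"
  using N_pos by (simp add: scale_power powr_minus_divide)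

lemma filterlim_scale: "filterlim scale (at_right 0) at_top"
proof -
  have "(scale \<longlongrightarrow> 0) at_top"
    unfolding scale_def[abs_def] using N_pos by (intro tendsto_neg_powr filterlim_ident) simp
  moreover have "\<forall>\<^sub>F x in at_top. scale x \<in> {0<..} \<and> scale x \<noteq> 0"
    using eventually_gt_at_top[of 0] by eventually_elim (use scale_pos in force)
  ultimately show ?thesis by (simp add: filterlim_at)
qed

lemma bigo_scale:
  assumes "f \<in> O[at_right 0](\<lambda>z. z ^ k)"
  shows "(\<lambda>\<tau>. f (scale \<tau>)) \<in> O(\<lambda>\<tau>. \<tau> powr (- real k / real N))"
proof -
  have "(\<lambda>\<tau>. f (scale \<tau>)) \<in> O(\<lambda>\<tau>. scale \<tau> ^ k)"
    by (rule landau_o.big.compose[OF assms filterlim_scale])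
  also have "(\<lambda>\<tau>. scale \<tau> ^ k) \<in> \<Theta>(\<lambda>\<tau>. \<tau> powr (- real k / real N))"
    by (intro bigthetaI_cong eventually_mono[OF eventually_gt_at_top[of 0]] scale_power)
  finally show ?thesis .
qed

text \<open>Only Taylor coefficients of order below N matter. If all of them vanish, f = O(z^N) =
  O(1/\<tau>). Otherwise the first nonzero one has order i < N and a sign: if positive, f is
  eventually nonnegative; if negative, it beats K z^N for every K.\<close>

lemma smooth_real_dichotomic:
  assumes f: "smooth_real f"
  shows "dichotomic (\<lambda>x. f (scale x))"
proof -
  show ?thesis
  proof (cases "\<forall>i<N. (deriv ^^ i) f 0 = 0")
    case True
    then have "f \<in> O[at_right 0](\<lambda>z. z ^ N)"
      using smooth_real_taylor[OF f, of N] by (simp add: sum.neutral)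
    then obtain C where "\<forall>\<^sub>F z in at_right 0. norm (f z) \<le> C * norm (z ^ N)"
      by (rule landau_o.bigE)
    then have "\<forall>\<^sub>F x in at_top. norm (f (scale x)) \<le> C * norm (scale x ^ N)"
      by (rule eventually_compose_filterlim[OF _ filterlim_scale])
    then have "\<forall>\<^sub>F x in at_top. - C / x \<le> f (scale x)"
      using eventually_gt_at_top[of 0]
    proof eventually_elim
      case (elim x)
      then have "\<bar>f (scale x)\<bar> \<le> C / x" by (simp add: scale_power_N)
      then show ?case by linarith
    qed
    then show ?thesis unfolding dichotomic_def by blast
  next
    case False
    define i where "i = (LEAST i. (deriv ^^ i) f 0 \<noteq> 0)"
    define c where "c = (deriv ^^ i) f 0 / fact i"
    obtain j where j: "j < N" "(deriv ^^ j) f 0 \<noteq> 0" using False by blast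
    have i: "(deriv ^^ i) f 0 \<noteq> 0" unfolding i_def using j(2) by (rule LeastI)
    have "i \<le> j" unfolding i_def using j(2) by (rule Least_le)
    then have iN: "i < N" using j by linarith
    have c0: "c \<noteq> 0" using i by (simp add: c_def)
    have "(\<Sum>k<Suc i. (deriv ^^ k) f 0 / fact k * z ^ k) = c * z ^ i" for z
      using not_less_Least[of _ "\<lambda>i. (deriv ^^ i) f 0 \<noteq> 0"] unfolding i_def[symmetric]
      by (simp add: c_def sum.neutral)
    then have "(\<lambda>z. f z - c * z ^ i) \<in> O[at_right 0](\<lambda>z. z ^ Suc i)"
      using smooth_real_taylor[OF f, of "Suc i"] by simp
    then obtain C where C: "\<forall>\<^sub>F z in at_right 0. norm (f z - c * z ^ i) \<le> C * norm (z ^ Suc i)"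
      by (rule landau_o.bigE)
    have lim: "((\<lambda>z::real. C * z) \<longlongrightarrow> C * 0) (at_right 0)" by (intro tendsto_intros)
    have "\<forall>\<^sub>F z in at_right 0. C * z < \<bar>c\<bar> / 2"
      using order_tendstoD(2)[OF lim, of "\<bar>c\<bar> / 2"] c0 by simp
    with C eventually_at_right_less[of "0::real"]
    have lead: "\<forall>\<^sub>F z in at_right 0. \<bar>f z - c * z ^ i\<bar> \<le> \<bar>c\<bar> / 2 * z ^ i"
    proof eventually_elim
      case (elim z)
      have "\<bar>f z - c * z ^ i\<bar> \<le> C * z * z ^ i" using elim by (simp add: abs_mult mult.assoc)
      also have "\<dots> \<le> \<bar>c\<bar> / 2 * z ^ i" using elim by (intro mult_right_mono) auto
      finally show ?case .
    qed
    show ?thesis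
    proof (cases "0 < c")
      case True
      from lead eventually_at_right_less[of "0::real"] have "\<forall>\<^sub>F z in at_right 0. 0 \<le> f z"
      proof eventually_elim
        case (elim z)
        have "0 \<le> c / 2 * z ^ i" using True elim by simp
        moreover have "\<bar>f z - c * z ^ i\<bar> \<le> c / 2 * z ^ i" using elim True by simp
        then have "c * z ^ i - c / 2 * z ^ i \<le> f z" unfolding abs_le_iff by linarith
        ultimately show ?case by (simp add: algebra_simps)
      qed
      then have "\<forall>\<^sub>F x in at_top. 0 \<le> f (scale x)" by (rule eventually_compose_filterlim[OF _ filterlim_scale])
      then have "\<forall>\<^sub>F x in at_top. - 0 / x \<le> f (scale x)" by simp
      then show ?thesis unfolding dichotomic_def by blast
    next
      case False
      then have cn: "c < 0" using c0 by simp
      have "\<forall>\<^sub>F x in at_top. f (scale x) \<le> - K / x" for K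
      proof -
        have lim: "((\<lambda>z::real. \<bar>K\<bar> * z ^ (N - i)) \<longlongrightarrow> \<bar>K\<bar> * 0 ^ (N - i)) (at_right 0)"
          by (intro tendsto_intros)
        have "\<forall>\<^sub>F z in at_right 0. \<bar>K\<bar> * z ^ (N - i) < \<bar>c\<bar> / 2"
          using order_tendstoD(2)[OF lim, of "\<bar>c\<bar> / 2"] c0 iN by (simp add: power_0_left)
        with lead eventually_at_right_less[of "0::real"]
        have "\<forall>\<^sub>F z in at_right 0. f z \<le> - \<bar>K\<bar> * z ^ N"
        proof eventually_elim
          case (elim z)
          have "f z \<le> c * z ^ i + \<bar>c\<bar> / 2 * z ^ i" using elim unfolding abs_le_iff by linarith
          also have "\<dots> = - (\<bar>c\<bar> / 2 * z ^ i)" using cn by (simp add: algebra_simps)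
          also have "\<bar>K\<bar> * z ^ (N - i) * z ^ i \<le> \<bar>c\<bar> / 2 * z ^ i"
            using elim by (intro mult_right_mono) auto
          then have "- (\<bar>c\<bar> / 2 * z ^ i) \<le> - (\<bar>K\<bar> * z ^ (N - i) * z ^ i)" by simp
          also have "\<dots> = - \<bar>K\<bar> * z ^ N" using iN by (simp add: mult.assoc flip: power_add)
          finally show ?case .
        qed
        then have "\<forall>\<^sub>F x in at_top. f (scale x) \<le> - \<bar>K\<bar> * scale x ^ N"
          by (rule eventually_compose_filterlim[OF _ filterlim_scale])
        then show ?thesis
          using eventually_gt_at_top[of 0]
        proof eventually_elim
          case (elim x)
          have "- \<bar>K\<bar> / x \<le> - K / x" using elim by (intro divide_right_mono) auto
          then show ?case using elim by (simp add: scale_power_N)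
        qed
      qed
      then show ?thesis unfolding dichotomic_def by blast
    qed
  qed
qed

lemma scale_deriv:
  assumes "smooth_real f" "0 < \<tau>"
  shows "((\<lambda>\<tau>. f (scale \<tau>)) has_real_derivative dtau f (scale \<tau>)) (at \<tau>)"
proof -
  have "(scale has_real_derivative (- 1 / real N) * \<tau> powr (- 1 / real N - 1)) (at \<tau>)"
    unfolding scale_def[abs_def] using assms(2) by (intro has_real_derivative_powr)
  moreover have "\<tau> powr (- 1 / real N - 1) = scale \<tau> ^ (N + 1)"
    using assms(2) scale_power_N[OF assms(2)] by (simp add: powr_diff scale_def)
  ultimately have "(scale has_real_derivative - (scale \<tau> ^ (N + 1) / real N)) (at \<tau>)" by simp
  from DERIV_chain2[OF smooth_real_has_deriv[OF assms(1)] this] show ?thesis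
    by (simp add: dtau_def mult.commute)
qed

lemma smooth_dtau: "smooth_real f \<Longrightarrow> smooth_real (dtau f)"
  unfolding dtau_def[abs_def]
  by (intro smooth_real_uminus smooth_real_mult smooth_real_divide smooth_real_power smooth_real_ident smooth_real_deriv)

text \<open>Differentiation in time gains z^N = 1/\<tau> on any order, which is why a slowly moving
  coordinate system costs only O(1/\<tau>). For k = 0 the truncated exponent k - 1 is 0 and one
  power of z is left over.\<close>

lemma dtau_bigo:
  assumes "smooth_real f" "f \<in> O[at_right 0](\<lambda>z. z ^ k)"
  shows "dtau f \<in> O[at_right 0](\<lambda>z. z ^ (N + k))"
proof -
  have "deriv f \<in> O[at_right 0](\<lambda>z. z ^ (k - 1))"
  proof (cases k)
    case 0
    then show ?thesis using smooth_real_bigo_1[OF smooth_real_deriv[OF assms(1)]] by simp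
  next
    case (Suc i)
    then show ?thesis using smooth_real_deriv_bigo[OF assms(1)] assms(2) by simp
  qed
  then have "(\<lambda>z. z ^ (N + 1) * deriv f z) \<in> O[at_right 0](\<lambda>z. z ^ (N + k))"
    by (rule bigo_power_mult[OF landau_o.big_refl]) simp
  then have "(\<lambda>z. - (1 / real N) * (z ^ (N + 1) * deriv f z)) \<in> O[at_right 0](\<lambda>z. z ^ (N + k))"
    by (rule bigo_power_cmult)
  moreover have "- (1 / real N) * (z ^ (N + 1) * deriv f z) = dtau f z" for z
    by (simp add: dtau_def)
  ultimately show ?thesis by (simp only: )
qed

lemma partial1_om_0: "partial1 (om 0) p = \<eta>"
proof -
  have "((\<lambda>x. om 0 (x, snd p)) has_real_derivative partial1 (om 0) (fst p, snd p) * 1 + partial2 (om 0) (fst p, snd p) * 0) (at (fst p))"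
    by (rule smooth_on_compose_deriv[OF om_smooth]) (auto intro!: derivative_eq_intros)
  moreover have "((\<lambda>x. om 0 (x, snd p)) has_real_derivative \<eta>) (at (fst p))"
    unfolding om_0 by (auto intro!: derivative_eq_intros)
  ultimately show ?thesis using DERIV_unique by fastforce
qed

lemma partial1_lam_0: "L = 0 \<Longrightarrow> partial1 (lam 0) p = 0"
proof -
  assume L: "L = 0"
  have "((\<lambda>x. lam 0 (x, snd p)) has_real_derivative partial1 (lam 0) (fst p, snd p) * 1 + partial2 (lam 0) (fst p, snd p) * 0) (at (fst p))"
    by (rule smooth_on_compose_deriv[OF lam_smooth]) (auto intro!: derivative_eq_intros)
  moreover have "((\<lambda>x. lam 0 (x, snd p)) has_real_derivative 0) (at (fst p))"
  proof -
    have "(\<lambda>x. lam 0 (x, snd p)) = (\<lambda>_. lam 0 (0, snd p))" by (rule ext) (rule lam_0[OF L])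
    then show ?thesis by simp
  qed
  ultimately show ?thesis using DERIV_unique by fastforce
qed

lemma partial2_om_low: "K < M \<Longrightarrow> partial2 (om K) (0, y) = 0"
proof -
  assume K: "K < M"
  have "((\<lambda>y. om K (0, y)) has_real_derivative partial1 (om K) (0, y) * 0 + partial2 (om K) (0, y) * 1) (at y)"
    by (rule smooth_on_compose_deriv[OF om_smooth]) (auto intro!: derivative_eq_intros)
  moreover have "((\<lambda>y. om K (0, y)) has_real_derivative 0) (at y)"
    unfolding om_low[OF K] by simp
  ultimately show ?thesis using DERIV_unique by fastforce
qed

end

lemma bigo_eventually_le:
  fixes f :: "real \<Rightarrow> real"
  assumes "f \<in> O[at_right 0](\<lambda>z. z ^ k)"
  shows "\<exists>C\<ge>0. \<forall>\<^sub>F z in at_right 0. \<bar>f z\<bar> \<le> C * z ^ k"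
proof -
  obtain C where C: "\<forall>\<^sub>F z in at_right 0. norm (f z) \<le> C * norm (z ^ k)"
    using assms by (rule landau_o.bigE)
  from C eventually_at_right_less[of "0::real"] have "\<forall>\<^sub>F z in at_right 0. \<bar>f z\<bar> \<le> \<bar>C\<bar> * z ^ k"
  proof eventually_elim
    case (elim z)
    have "C * z ^ k \<le> \<bar>C\<bar> * z ^ k" using elim by (intro mult_right_mono) auto
    moreover have "\<bar>f z\<bar> \<le> C * z ^ k" using elim by simp
    ultimately show ?case by linarith
  qed
  then show ?thesis by (intro exI[of _ "\<bar>C\<bar>"]) simp
qed

lemma abs_divide_le:
  fixes f g A b h :: real
  assumes "\<bar>f\<bar> \<le> A * h" "b * h \<le> \<bar>g\<bar>" "0 < b" "0 < h" "0 \<le> A"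
  shows "\<bar>f / g\<bar> \<le> A / b"
proof -
  have "\<bar>f / g\<bar> = \<bar>f\<bar> / \<bar>g\<bar>" by simp
  also have "\<dots> \<le> (A * h) / (b * h)"
    using assms by (intro frac_le) auto
  finally show ?thesis using assms by simp
qed

section \<open>Linearization at a fixed partial sum and the size of its eigenvalues\<close>

locale formal_approximation = truncated_system +
  fixes rc pc :: "nat \<Rightarrow> real"
  assumes formal1: "\<And>m. defect1 (approx1 rc m) (approx2 pc m) \<in> O[at_right 0](\<lambda>z. z ^ (M + L + m + 1))"
    and formal2: "\<And>m. defect2 (approx1 rc m) (approx2 pc m) \<in> O[at_right 0](\<lambda>z. z ^ (2 * M + m))"
begin

text \<open>
  \<open>(ca, cb; cc, cd)\<close> is the linearization of the system at the partial sums \<open>P0\<close>, \<open>Q0\<close>, and \<open>tr \<plusminus> sqrt disc\<close> are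
  its eigenvalues.  Their type is decided by the leading coefficient \<open>slope * \<eta>\<close> of \<open>disc\<close>: a saddle for
  \<open>\<epsilon> = 1\<close>, a center for \<open>\<epsilon> = - 1\<close>.
\<close>

definition "P0 = approx1 rc (2 * N)"
definition "Q0 = approx2 pc (2 * N)"
definition "ca z = (\<Sum>K = L..n. z ^ (M + K) * partial1 (lam K) (P0 z, Q0 z))"
definition "cb z = (\<Sum>K = L..n. z ^ (M + K) * partial2 (lam K) (P0 z, Q0 z))"
definition "cc z = (\<Sum>K = 0..n. z ^ (M + K) * partial1 (om K) (P0 z, Q0 z))"
definition "cd z = (\<Sum>K = 0..n. z ^ (M + K) * partial2 (om K) (P0 z, Q0 z))"
definition "tr z = (ca z + cd z) / 2"
definition "al z = (ca z - cd z) / 2"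
definition "disc z = al z ^ 2 + cb z * cc z"
definition "slope = partial2 (lam L) (0, \<phi>\<^sub>0)"
definition "\<epsilon> = sgn (slope * \<eta>)"
definition "del z = sqrt (\<epsilon> * disc z)"
text \<open>The exact scale of \<open>del\<close>. A root is taken because 2M + L may be
  odd.\<close>

definition "width z = sqrt (z ^ (2 * M + L))"

lemma smooth_base: "smooth_real P0" "smooth_real Q0"
  by (simp_all add: P0_def Q0_def smooth_approx)

lemma smooth_coeffs: "smooth_real ca" "smooth_real cb" "smooth_real cc" "smooth_real cd"
  unfolding ca_def[abs_def] cb_def[abs_def] cc_def[abs_def] cd_def[abs_def]
  by (intro smooth_real_sum smooth_real_mult smooth_real_power smooth_real_ident smooth_base
      smooth_real_compose2[OF smooth_on_frechet_derivative[OF lam_smooth]]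
      smooth_real_compose2[OF smooth_on_frechet_derivative[OF om_smooth]])+

lemma smooth_derived: "smooth_real tr" "smooth_real al" "smooth_real disc"
proof -
  show "smooth_real tr" unfolding tr_def[abs_def] by (intro smooth_real_divide smooth_real_add smooth_coeffs)
  show al: "smooth_real al" unfolding al_def[abs_def] by (intro smooth_real_divide smooth_real_diff smooth_coeffs)
  show "smooth_real disc" unfolding disc_def[abs_def]
    by (intro smooth_real_add smooth_real_mult smooth_real_power al smooth_coeffs)
qed

lemma smooth_bounded: "smooth_real f \<Longrightarrow> f \<in> O[at_right 0](\<lambda>z. z ^ 0)"
  using smooth_real_bigo_1 by simp

lemma base_bigo: "P0 \<in> O[at_right 0](\<lambda>z. z ^ M)" "(\<lambda>z. Q0 z - \<phi>\<^sub>0) \<in> O[at_right 0](\<lambda>z. z ^ 1)"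
  by (simp_all only: P0_def Q0_def approx1_bigo approx2_bigo)

lemma compose_base_bigo:
  assumes f: "smooth_on UNIV f"
  shows "(\<lambda>z. f (P0 z, Q0 z)) \<in> O[at_right 0](\<lambda>z. z ^ 0)"
    and "(\<lambda>z. f (P0 z, Q0 z) - f (0, \<phi>\<^sub>0)) \<in> O[at_right 0](\<lambda>z. z ^ 1)"
    and "(\<lambda>z. f (P0 z, Q0 z) - f (0, Q0 z)) \<in> O[at_right 0](\<lambda>z. z ^ M)"
proof -
  show "(\<lambda>z. f (P0 z, Q0 z)) \<in> O[at_right 0](\<lambda>z. z ^ 0)"
    by (intro smooth_bounded smooth_real_compose2[OF f] smooth_base)
  have c: "(\<lambda>z. c) \<in> O[at_right 0](\<lambda>z. z ^ 0)" for c :: real by simp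
  show "(\<lambda>z. f (P0 z, Q0 z) - f (0, \<phi>\<^sub>0)) \<in> O[at_right 0](\<lambda>z. z ^ 1)"
    by (rule compose_diff_bigo[OF f smooth_bounded[OF smooth_base(1)] smooth_bounded[OF smooth_base(2)] c c _ base_bigo(2)])
      (use bigo_at_right_0_power_mono[OF base_bigo(1) M_pos] in simp)
  show "(\<lambda>z. f (P0 z, Q0 z) - f (0, Q0 z)) \<in> O[at_right 0](\<lambda>z. z ^ M)"
    by (rule compose_diff_bigo[OF f smooth_bounded[OF smooth_base(1)] smooth_bounded[OF smooth_base(2)] c smooth_bounded[OF smooth_base(2)]])
      (use base_bigo(1) in simp_all)
qed

lemma cb_leading: "(\<lambda>z. cb z - slope * z ^ (M + L)) \<in> O[at_right 0](\<lambda>z. z ^ Suc (M + L))"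
proof -
  have e: "cb z - slope * z ^ (M + L) = z ^ (M + L) * (partial2 (lam L) (P0 z, Q0 z) - partial2 (lam L) (0, \<phi>\<^sub>0)) +
      (\<Sum>K = Suc L..n. z ^ (M + K) * partial2 (lam K) (P0 z, Q0 z))" for z
    using L_le_n by (simp add: cb_def slope_def sum.atLeast_Suc_atMost algebra_simps)
  have "(\<lambda>z. z ^ (M + L) * (partial2 (lam L) (P0 z, Q0 z) - partial2 (lam L) (0, \<phi>\<^sub>0))) \<in> O[at_right 0](\<lambda>z. z ^ Suc (M + L))"
    by (rule bigo_power_mult[OF landau_o.big_refl compose_base_bigo(2)[OF smooth_on_frechet_derivative[OF lam_smooth]]]) simp
  moreover have "(\<lambda>z. \<Sum>K = Suc L..n. z ^ (M + K) * partial2 (lam K) (P0 z, Q0 z)) \<in> O[at_right 0](\<lambda>z. z ^ Suc (M + L))"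
    by (rule sum_power_mult_bigo[OF compose_base_bigo(1)[OF smooth_on_frechet_derivative[OF lam_smooth]]]) auto
  ultimately show ?thesis unfolding e by (rule sum_in_bigo(1))
qed

lemma cc_leading: "(\<lambda>z. cc z - \<eta> * z ^ M) \<in> O[at_right 0](\<lambda>z. z ^ Suc M)"
proof -
  have e: "cc z - \<eta> * z ^ M = (\<Sum>K = Suc 0..n. z ^ (M + K) * partial1 (om K) (P0 z, Q0 z))" for z
    by (simp add: cc_def sum.atLeast_Suc_atMost partial1_om_0)
  show ?thesis unfolding e
    by (rule sum_power_mult_bigo[OF compose_base_bigo(1)[OF smooth_on_frechet_derivative[OF om_smooth]]]) auto
qed

text \<open>If L = 0, the term K = 0 drops out since \<open>lam 0\<close> does not depend on r; thus
  the entry is always at least one order beyond z^M.\<close>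

lemma ca_bigo: "ca \<in> O[at_right 0](\<lambda>z. z ^ (M + max 1 L))"
proof -
  have "ca z = (\<Sum>K = max 1 L..n. z ^ (M + K) * partial1 (lam K) (P0 z, Q0 z))" for z
    unfolding ca_def using partial1_lam_0
    by (intro sum.mono_neutral_right) (auto simp: max_def not_less_eq_eq split: if_splits)
  then have "ca = (\<lambda>z. \<Sum>K = max 1 L..n. z ^ (M + K) * partial1 (lam K) (P0 z, Q0 z))" by blast
  then show ?thesis
    by (simp only:) (rule sum_power_mult_bigo[OF compose_base_bigo(1)[OF smooth_on_frechet_derivative[OF lam_smooth]]], auto)
qed

text \<open>For K < M the derivative in the angle vanishes on r = 0, and P0 = O(z^M) supplies what
  the prefactor z^(M+K) lacks.\<close>

lemma cd_bigo: "cd \<in> O[at_right 0](\<lambda>z. z ^ (2 * M))"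
  unfolding cd_def[abs_def]
proof (rule big_sum_in_bigo)
  fix K
  have sm: "smooth_on UNIV (partial2 (om K))" by (rule smooth_on_frechet_derivative[OF om_smooth])
  show "(\<lambda>z. z ^ (M + K) * partial2 (om K) (P0 z, Q0 z)) \<in> O[at_right 0](\<lambda>z. z ^ (2 * M))"
  proof (cases "K < M")
    case True
    have "(\<lambda>z. partial2 (om K) (P0 z, Q0 z)) \<in> O[at_right 0](\<lambda>z. z ^ M)"
      using compose_base_bigo(3)[OF sm] by (simp add: partial2_om_low[OF True])
    then show ?thesis by (rule bigo_power_mult[OF landau_o.big_refl]) simp
  next
    case False
    show ?thesis by (rule bigo_power_mult[OF landau_o.big_refl compose_base_bigo(1)[OF sm]]) (use False in simp)
  qed
qed

definition "error_order = min (M + max 1 L) (2 * M)"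

text \<open>Makes the square of \<open>al\<close> negligible in \<open>disc\<close>. For the order M
  + max 1 L this holds for every L, the 1 being decisive at L = 0; for the order 2M it is the
  condition L < 2M.\<close>

lemma error_order: "2 * M + L + 1 \<le> 2 * error_order" "M \<le> error_order"
  using L_less M_pos by (auto simp: error_order_def min_def max_def)

lemma tr_al_bigo: "tr \<in> O[at_right 0](\<lambda>z. z ^ error_order)" "al \<in> O[at_right 0](\<lambda>z. z ^ error_order)"
proof -
  have a: "ca \<in> O[at_right 0](\<lambda>z. z ^ error_order)" by (rule bigo_at_right_0_power_mono[OF ca_bigo]) (simp add: error_order_def)
  have d: "cd \<in> O[at_right 0](\<lambda>z. z ^ error_order)" by (rule bigo_at_right_0_power_mono[OF cd_bigo]) (simp add: error_order_def)
  show "tr \<in> O[at_right 0](\<lambda>z. z ^ error_order)"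
    using bigo_power_cmult[OF sum_in_bigo(1)[OF a d], of "1 / 2"] by (simp add: tr_def[abs_def])
  show "al \<in> O[at_right 0](\<lambda>z. z ^ error_order)"
    using bigo_power_cmult[OF sum_in_bigo(2)[OF a d], of "1 / 2"] by (simp add: al_def[abs_def])
qed

lemma disc_leading: "(\<lambda>z. disc z - slope * \<eta> * z ^ (2 * M + L)) \<in> O[at_right 0](\<lambda>z. z ^ Suc (2 * M + L))"
proof -
  have e: "disc z - slope * \<eta> * z ^ (2 * M + L) =
      al z * al z + ((cb z - slope * z ^ (M + L)) * cc z + slope * z ^ (M + L) * (cc z - \<eta> * z ^ M))" for z
    by (simp add: disc_def power2_eq_square algebra_simps power_add mult_2_right)
  have "(\<lambda>z. (cc z - \<eta> * z ^ M) + \<eta> * z ^ M) \<in> O[at_right 0](\<lambda>z. z ^ M)"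
    by (rule sum_in_bigo(1)[OF bigo_at_right_0_power_mono[OF cc_leading] bigo_power_cmult[OF landau_o.big_refl]]) simp
  then have cc: "cc \<in> O[at_right 0](\<lambda>z. z ^ M)" by simp
  have 1: "(\<lambda>z. al z * al z) \<in> O[at_right 0](\<lambda>z. z ^ Suc (2 * M + L))"
    by (rule bigo_power_mult[OF tr_al_bigo(2) tr_al_bigo(2)]) (use error_order in simp)
  have 2: "(\<lambda>z. (cb z - slope * z ^ (M + L)) * cc z) \<in> O[at_right 0](\<lambda>z. z ^ Suc (2 * M + L))"
    by (rule bigo_power_mult[OF cb_leading cc]) simp
  have 3: "(\<lambda>z. slope * z ^ (M + L) * (cc z - \<eta> * z ^ M)) \<in> O[at_right 0](\<lambda>z. z ^ Suc (2 * M + L))"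
    by (rule bigo_power_mult[OF bigo_power_cmult[OF landau_o.big_refl] cc_leading]) simp
  show ?thesis unfolding e by (intro sum_in_bigo(1) 1 2 3)
qed

lemma slope_nz: "slope \<noteq> 0" using lam_L_deriv by (simp add: slope_def)

lemma eps: "\<epsilon> = 1 \<or> \<epsilon> = - 1" "\<epsilon> * \<epsilon> = 1"
  using slope_nz eta_nz by (auto simp: \<epsilon>_def sgn_if)

lemma eps_disc_bounds:
  "\<forall>\<^sub>F z in at_right 0. \<bar>slope * \<eta>\<bar> / 2 * z ^ (2 * M + L) \<le> \<epsilon> * disc z \<and> \<epsilon> * disc z \<le> 2 * \<bar>slope * \<eta>\<bar> * z ^ (2 * M + L)"
proof (rule bigo_two_sided)
  have "\<epsilon> * (slope * \<eta>) = \<bar>slope * \<eta>\<bar>" 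
    using abs_sgn[of "slope * \<eta>"] by (simp only: \<epsilon>_def mult.commute)
  then show "(\<lambda>z. \<epsilon> * disc z - \<bar>slope * \<eta>\<bar> * z ^ (2 * M + L)) \<in> O[at_right 0](\<lambda>z. z ^ Suc (2 * M + L))"
    using bigo_power_cmult[OF disc_leading, of \<epsilon>] by (simp add: right_diff_distrib mult.assoc[symmetric])
  show "0 < \<bar>slope * \<eta>\<bar>" using slope_nz eta_nz by simp
qed

lemma cc_bounds: "\<forall>\<^sub>F z in at_right 0. \<bar>\<eta>\<bar> / 2 * z ^ M \<le> \<bar>cc z\<bar> \<and> \<bar>cc z\<bar> \<le> 2 * \<bar>\<eta>\<bar> * z ^ M"
proof -
  have e: "sgn \<eta> * \<eta> = \<bar>\<eta>\<bar>" by (simp add: abs_sgn mult.commute)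
  have "\<forall>\<^sub>F z in at_right 0. \<bar>\<eta>\<bar> / 2 * z ^ M \<le> sgn \<eta> * cc z \<and> sgn \<eta> * cc z \<le> 2 * \<bar>\<eta>\<bar> * z ^ M"
  proof (rule bigo_two_sided)
    show "(\<lambda>z. sgn \<eta> * cc z - \<bar>\<eta>\<bar> * z ^ M) \<in> O[at_right 0](\<lambda>z. z ^ Suc M)"
      using bigo_power_cmult[OF cc_leading, of "sgn \<eta>"] e by (simp add: right_diff_distrib mult.assoc[symmetric])
    show "0 < \<bar>\<eta>\<bar>" using eta_nz by simp
  qed
  with eventually_at_right_less[of "0::real"] show ?thesis
  proof eventually_elim
    case (elim z)
    have "0 < \<bar>\<eta>\<bar> / 2 * z ^ M" using elim eta_nz by simp
    then have "0 < sgn \<eta> * cc z" using elim by linarith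
    then have "\<bar>cc z\<bar> = sgn \<eta> * cc z" using eta_nz by (auto simp: sgn_if split: if_splits)
    then show ?case using elim by simp
  qed
qed

lemma width_compare:
  assumes "0 < z" "z < 1"
  shows "0 < width z" "2 * M + L \<le> 2 * j \<Longrightarrow> z ^ j \<le> width z" "width z \<le> z ^ M"
proof -
  show "0 < width z" using assms by (simp add: width_def)
  have sq: "z ^ j = sqrt (z ^ (2 * j))" for j
    using assms by (simp add: power_mult mult.commute[of 2] power2_eq_square real_sqrt_mult)
  show "z ^ j \<le> width z" if "2 * M + L \<le> 2 * j"
    unfolding width_def using assms that by (subst sq[of j]) (intro real_sqrt_le_mono power_decreasing; simp)
  show "width z \<le> z ^ M"
    unfolding width_def using assms by (subst sq[of M]) (intro real_sqrt_le_mono power_decreasing; simp)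
qed

text \<open>Normalized so that the roots of the two bounds on \<epsilon> disc are \<open>kap\<close>
  and \<open>2 * kap\<close> times \<open>width\<close>.\<close>

definition "kap = sqrt (\<bar>slope * \<eta>\<bar> / 2)"

lemma kap_pos: "0 < kap" using slope_nz eta_nz by (simp add: kap_def)

lemma del_bounds: "\<forall>\<^sub>F z in at_right 0. kap * width z \<le> del z \<and> del z \<le> 2 * kap * width z \<and> 0 < \<epsilon> * disc z"
  using eps_disc_bounds eventually_at_right_less[of "0::real"]
proof eventually_elim
  case (elim z)
  have "0 < \<bar>slope * \<eta>\<bar> / 2 * z ^ (2 * M + L)" using elim slope_nz eta_nz by simp
  then have "0 < \<epsilon> * disc z" using elim by linarith
  moreover have "kap * width z \<le> del z"
    unfolding kap_def width_def del_def real_sqrt_mult[symmetric] using elim by simp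
  moreover have "2 * kap = sqrt (2 * \<bar>slope * \<eta>\<bar>)"
    unfolding kap_def using real_sqrt_mult[of 4 "\<bar>slope * \<eta>\<bar> / 2"] by simp
  then have "del z \<le> 2 * kap * width z"
    unfolding width_def del_def using elim by (simp add: real_sqrt_mult[symmetric])
  ultimately show ?case by blast
qed

text \<open>Every quotient that occurs in the decoupled equations. All are bounded except
  \<open>cc / del\<close>, of order z^(-L/2): it only multiplies quantities that carry z^M, and L <
  2M compensates. The last three are relative rates of change of the moving coordinates, of size z^N
  = 1/\<tau>.\<close>

definition "tame C z \<longleftrightarrow> 0 < z \<and> z < 1 \<and> cc z \<noteq> 0 \<and> 0 < \<epsilon> * disc z \<and>
  \<bar>del z / cc z\<bar> \<le> C \<and> \<bar>al z / cc z\<bar> \<le> C \<and> \<bar>al z / del z\<bar> \<le> C \<and> \<bar>cc z / del z\<bar> * z ^ M \<le> C \<and>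
  \<bar>dtau cc z / cc z\<bar> \<le> C * z ^ N \<and> \<bar>dtau al z / del z\<bar> \<le> C * z ^ N \<and>
  \<bar>dtau disc z / (2 * disc z)\<bar> \<le> C * z ^ N"

lemma eventually_tame: "\<exists>C\<ge>0. \<forall>\<^sub>F z in at_right 0. tame C z"
proof -
  have disc: "disc \<in> O[at_right 0](\<lambda>z. z ^ (2 * M + L))"
  proof -
    have "(\<lambda>z. (disc z - slope * \<eta> * z ^ (2 * M + L)) + slope * \<eta> * z ^ (2 * M + L)) \<in> O[at_right 0](\<lambda>z. z ^ (2 * M + L))"
      by (rule sum_in_bigo(1)[OF bigo_at_right_0_power_mono[OF disc_leading] bigo_power_cmult[OF landau_o.big_refl]]) simp
    then show ?thesis by simp
  qed
  have cc: "cc \<in> O[at_right 0](\<lambda>z. z ^ M)"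
  proof -
    have "(\<lambda>z. (cc z - \<eta> * z ^ M) + \<eta> * z ^ M) \<in> O[at_right 0](\<lambda>z. z ^ M)"
      by (rule sum_in_bigo(1)[OF bigo_at_right_0_power_mono[OF cc_leading] bigo_power_cmult[OF landau_o.big_refl]]) simp
    then show ?thesis by simp
  qed
  obtain A1 where A1: "0 \<le> A1" "\<forall>\<^sub>F z in at_right 0. \<bar>al z\<bar> \<le> A1 * z ^ error_order"
    using bigo_eventually_le[OF tr_al_bigo(2)] by blast
  obtain A2 where A2: "0 \<le> A2" "\<forall>\<^sub>F z in at_right 0. \<bar>dtau cc z\<bar> \<le> A2 * z ^ (N + M)"
    using bigo_eventually_le[OF dtau_bigo[OF smooth_coeffs(3) cc]] by blast
  obtain A3 where A3: "0 \<le> A3" "\<forall>\<^sub>F z in at_right 0. \<bar>dtau al z\<bar> \<le> A3 * z ^ (N + error_order)"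
    using bigo_eventually_le[OF dtau_bigo[OF smooth_derived(2) tr_al_bigo(2)]] by blast
  obtain A4 where A4: "0 \<le> A4" "\<forall>\<^sub>F z in at_right 0. \<bar>dtau disc z\<bar> \<le> A4 * z ^ (N + (2 * M + L))"
    using bigo_eventually_le[OF dtau_bigo[OF smooth_derived(3) disc]] by blast
  \<comment> \<open>\<open>e\<close> and \<open>g\<close> are the lower constants of
    \<open>cc\<close> against z^M and of \<open>disc\<close> against z^(2M+L); the upper constant of
    \<open>cc\<close> is then \<open>4 * e\<close>.\<close>
  define e where "e = \<bar>\<eta>\<bar> / 2"
  define g where "g = \<bar>slope * \<eta>\<bar> / 2"
  have e0: "0 < e" "0 < g" using eta_nz slope_nz by (simp_all add: e_def g_def)
  define C where "C = max (2 * kap / e) (max (A1 / e) (max (A1 / kap) (max (4 * e / kap) (max (A2 / e) (max (A3 / kap) (A4 / g))))))"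
  have C: "2 * kap / e \<le> C" "A1 / e \<le> C" "A1 / kap \<le> C" "4 * e / kap \<le> C" "A2 / e \<le> C" "A3 / kap \<le> C" "A4 / g \<le> C"
    unfolding C_def by (auto simp: le_max_iff_disj)
  have "0 \<le> A1 / e" using A1(1) e0 by simp
  then have C0: "0 \<le> C" using C(2) by linarith
  have z01: "\<forall>\<^sub>F z in at_right (0::real). z \<in> {0<..<1}" by (rule eventually_at_right_real) simp
  have "\<forall>\<^sub>F z in at_right 0. tame C z"
    using A1(2) A2(2) A3(2) A4(2) del_bounds cc_bounds eps_disc_bounds z01
  proof eventually_elim
    case (elim z)
    then have z: "0 < z" "z < 1" by auto
    note w = width_compare[OF z]
    have p: "0 < z ^ k" for k using z by simp
    have d: "kap * width z \<le> \<bar>del z\<bar>" "\<bar>del z\<bar> \<le> 2 * kap * width z"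
      using elim(5) by (auto simp: del_def)
    have c: "e * z ^ M \<le> \<bar>cc z\<bar>" "\<bar>cc z\<bar> \<le> 4 * e * z ^ M" using elim(6) by (auto simp: e_def)
    have "0 < \<bar>cc z\<bar>" using c(1) mult_pos_pos[OF e0(1) p[of M]] by linarith
    then have ccnz: "cc z \<noteq> 0" by simp
    have dpos: "0 < \<epsilon> * disc z" using elim(5) by blast
    have zj: "z ^ error_order \<le> width z" using error_order by (intro w(2)) simp
    have zjM: "z ^ error_order \<le> z ^ M" using error_order z by (intro power_decreasing) auto
    have z2M: "z ^ (2 * M) \<le> width z" using L_less by (intro w(2)) simp
    have 1: "\<bar>del z / cc z\<bar> \<le> 2 * kap / e"
      by (rule abs_divide_le[of _ _ "z ^ M"])
        (use d c w kap_pos e0 p in \<open>auto intro: order_trans[OF _ mult_left_mono]\<close>)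
    have alM: "\<bar>al z\<bar> \<le> A1 * z ^ M" using elim(1) mult_left_mono[OF zjM A1(1)] by linarith
    have 2: "\<bar>al z / cc z\<bar> \<le> A1 / e"
      by (rule abs_divide_le[OF alM c(1)]) (use e0 A1 p in auto)
    have alw: "\<bar>al z\<bar> \<le> A1 * width z" using elim(1) mult_left_mono[OF zj A1(1)] by linarith
    have 3: "\<bar>al z / del z\<bar> \<le> A1 / kap"
      by (rule abs_divide_le[OF alw d(1)]) (use kap_pos A1 w in auto)
    have "\<bar>cc z * z ^ M\<bar> \<le> 4 * e * z ^ M * z ^ M"
      using c(2) z by (simp add: abs_mult)
    also have "\<dots> = 4 * e * z ^ (2 * M)" by (simp add: power_add mult_2 mult.assoc)
    also have "\<dots> \<le> 4 * e * width z" using z2M e0 by (intro mult_left_mono) auto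
    finally have 4: "\<bar>cc z * z ^ M / del z\<bar> \<le> 4 * e / kap"
      by (rule abs_divide_le[OF _ d(1)]) (use kap_pos e0 w in auto)
    have "\<bar>dtau cc z\<bar> \<le> A2 * z ^ N * z ^ M" using elim(2) by (simp add: power_add mult.assoc)
    then have 5: "\<bar>dtau cc z / cc z\<bar> \<le> A2 * z ^ N / e"
      by (rule abs_divide_le[OF _ c(1)]) (use e0 A2 p z in auto)
    have "\<bar>dtau al z\<bar> \<le> A3 * z ^ N * z ^ error_order" using elim(3) by (simp add: power_add mult.assoc)
    also have "\<dots> \<le> A3 * z ^ N * width z" using zj A3 z by (intro mult_left_mono) auto
    finally have 6: "\<bar>dtau al z / del z\<bar> \<le> A3 * z ^ N / kap"
      by (rule abs_divide_le[OF _ d(1)]) (use kap_pos A3 w z in auto)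
    have "\<bar>dtau disc z\<bar> \<le> A4 * z ^ N * z ^ (2 * M + L)" using elim(4) by (simp add: power_add mult.assoc)
    moreover have "g * z ^ (2 * M + L) \<le> \<bar>disc z\<bar>"
      using elim(7) eps by (auto simp: g_def)
    ultimately have 7: "\<bar>dtau disc z / disc z\<bar> \<le> A4 * z ^ N / g"
      by (rule abs_divide_le) (use e0 A4 p z in auto)
    have sc: "A * z ^ N / x \<le> C * z ^ N" if "A / x \<le> C" for A x
      using mult_right_mono[OF that, of "z ^ N"] z by simp
    have 8: "\<bar>dtau disc z / (2 * disc z)\<bar> \<le> \<bar>dtau disc z / disc z\<bar>"
    proof -
      define x where "x = dtau disc z / disc z"
      have "dtau disc z / (2 * disc z) = x / 2" by (simp add: x_def)
      then show ?thesis unfolding x_def[symmetric] by simp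
    qed
    show ?case
      unfolding tame_def
      using 1 2 3 4 5 6 7 8 C z ccnz dpos sc[OF C(5)] sc[OF C(6)] sc[OF C(7)]
      by (auto simp: abs_mult)
  qed
  then show ?thesis using C0 by blast
qed

end

section \<open>The decoupling transformation and its Lipschitz bounds\<close>

context formal_approximation
begin

text \<open>
  If \<open>u\<close>, \<open>v\<close> are the deviations from \<open>P0\<close>, \<open>Q0\<close>, then \<open>v\<close> and \<open>p = (cc u - al v) / del\<close> satisfy
  \<open>v' = tr v + del p + gv\<close> and \<open>p' = tr p + \<epsilon> del v + gp\<close>; \<open>lift\<close> recovers \<open>u\<close> from \<open>v\<close> and \<open>p\<close>.
\<close>

definition "rem1 z u v = rhs1 z (P0 z + u, Q0 z + v) - dtau P0 z - ca z * u - cb z * v"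
definition "rem2 z u v = rhs2 z (P0 z + u, Q0 z + v) - dtau Q0 z - cc z * u - cd z * v"
definition "lift z v p = (del z * p + al z * v) / cc z"
definition "gv z y = rem2 z (lift z (fst y) (snd y)) (fst y)"
definition "gp z y = cc z / del z * rem1 z (lift z (fst y) (snd y)) (fst y)
  - al z / del z * rem2 z (lift z (fst y) (snd y)) (fst y)
  + dtau cc z / cc z * (snd y + al z / del z * fst y) - dtau al z / del z * fst y
  - dtau disc z / (2 * disc z) * snd y"

lemma tame_nonzero: "tame C z \<Longrightarrow> 0 < z \<and> cc z \<noteq> 0 \<and> 0 < del z \<and> 0 < \<epsilon> * disc z \<and> disc z \<noteq> 0"
  by (auto simp: tame_def del_def)

lemma del_square: "tame C z \<Longrightarrow> del z * del z = \<epsilon> * disc z"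
  by (auto simp: tame_def del_def)

lemma lift_inverse:
  assumes "tame C z"
  shows "lift z v ((cc z * u - al z * v) / del z) = u" "(cc z * lift z v p - al z * v) / del z = p"
  using tame_nonzero[OF assms] by (simp_all add: lift_def)

lemma del_scale_deriv:
  assumes "0 < \<tau>" "tame C (scale \<tau>)"
  shows "((\<lambda>\<tau>. del (scale \<tau>)) has_real_derivative
    del (scale \<tau>) * (dtau disc (scale \<tau>) / (2 * disc (scale \<tau>)))) (at \<tau>)"
proof -
  let ?z = "scale \<tau>"
  note t = tame_nonzero[OF assms(2)]
  have "((\<lambda>\<tau>. \<epsilon> * disc (scale \<tau>)) has_real_derivative \<epsilon> * dtau disc ?z) (at \<tau>)"
    by (rule DERIV_cmult[OF scale_deriv[OF smooth_derived(3) assms(1)]])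
  from DERIV_chain2[OF DERIV_real_sqrt this] t
  have "((\<lambda>\<tau>. del (scale \<tau>)) has_real_derivative inverse (del ?z) / 2 * (\<epsilon> * dtau disc ?z)) (at \<tau>)"
    by (simp add: del_def[abs_def])
  moreover have "inverse (del ?z) / 2 * (\<epsilon> * dtau disc ?z) = del ?z * (dtau disc ?z / (2 * disc ?z))"
    using del_square[OF assms(2)] t by (simp add: field_simps)
  ultimately show ?thesis by (simp only:)
qed

text \<open>\<open>e1\<close> and \<open>e2\<close> stand for whatever the pair fails to satisfy.
  With negated defects the lemma gives the equations of the approximants; for the exact solution it
  is used with e2 = 0 and an \<open>e1\<close> that turns out to vanish.\<close>

lemma transform_deriv:
  assumes \<tau>: "0 < \<tau>" and tame: "tame C (scale \<tau>)"
    and u: "(u has_real_derivative rhs1 (scale \<tau>) (P0 (scale \<tau>) + u \<tau>, Q0 (scale \<tau>) + v \<tau>) - dtau P0 (scale \<tau>) + e1) (at \<tau>)"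
    and v: "(v has_real_derivative rhs2 (scale \<tau>) (P0 (scale \<tau>) + u \<tau>, Q0 (scale \<tau>) + v \<tau>) - dtau Q0 (scale \<tau>) + e2) (at \<tau>)"
    and p: "\<And>\<tau>. p \<tau> = (cc (scale \<tau>) * u \<tau> - al (scale \<tau>) * v \<tau>) / del (scale \<tau>)"
  shows "(v has_real_derivative tr (scale \<tau>) * v \<tau> + del (scale \<tau>) * p \<tau> + (gv (scale \<tau>) (v \<tau>, p \<tau>) + e2)) (at \<tau>)"
    and "(p has_real_derivative tr (scale \<tau>) * p \<tau> + \<epsilon> * del (scale \<tau>) * v \<tau> +
      (gp (scale \<tau>) (v \<tau>, p \<tau>) + (cc (scale \<tau>) / del (scale \<tau>) * e1 - al (scale \<tau>) / del (scale \<tau>) * e2))) (at \<tau>)"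
proof -
  define z where "z = scale \<tau>"
  note t = tame_nonzero[OF tame, folded z_def]
  have lift: "lift z (v \<tau>) (p \<tau>) = u \<tau>"
    using lift_inverse(1)[OF tame, of "v \<tau>" "u \<tau>"] by (simp add: p z_def)
  define n1 n2 where "n1 = rem1 z (u \<tau>) (v \<tau>)" and "n2 = rem2 z (u \<tau>) (v \<tau>)"
  define u' v' where "u' = ca z * u \<tau> + cb z * v \<tau> + n1 + e1" and "v' = cc z * u \<tau> + cd z * v \<tau> + n2 + e2"
  have u': "(u has_real_derivative u') (at \<tau>)" using u by (simp add: u'_def n1_def rem1_def z_def)
  have v': "(v has_real_derivative v') (at \<tau>)" using v by (simp add: v'_def n2_def rem2_def z_def)
  have cu: "cc z * u \<tau> = del z * p \<tau> + al z * v \<tau>" using t by (simp add: p z_def[symmetric])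
  have tr_al: "tr z - al z = cd z" "tr z + al z = ca z" by (simp_all add: tr_def al_def field_simps)
  have "v' = tr z * v \<tau> + del z * p \<tau> + (gv z (v \<tau>, p \<tau>) + e2)"
    unfolding v'_def cu tr_al(1)[symmetric] by (simp add: gv_def lift n2_def algebra_simps)
  with v' show "(v has_real_derivative tr (scale \<tau>) * v \<tau> + del (scale \<tau>) * p \<tau> + (gv (scale \<tau>) (v \<tau>, p \<tau>) + e2)) (at \<tau>)"
    by (simp add: z_def)
  have D: "((\<lambda>\<tau>. cc (scale \<tau>) * u \<tau> - al (scale \<tau>) * v \<tau>) has_real_derivative
      (dtau cc z * u \<tau> + u' * cc z) - (dtau al z * v \<tau> + v' * al z)) (at \<tau>)"
    unfolding z_def
    by (intro DERIV_diff DERIV_mult scale_deriv smooth_coeffs smooth_derived \<tau> u'[unfolded z_def] v'[unfolded z_def])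
  have p': "(p has_real_derivative (((dtau cc z * u \<tau> + u' * cc z) - (dtau al z * v \<tau> + v' * al z)) * del z
      - (cc z * u \<tau> - al z * v \<tau>) * (del z * (dtau disc z / (2 * disc z)))) / (del z * del z)) (at \<tau>)"
    unfolding p[abs_def] using DERIV_divide[OF D del_scale_deriv[OF \<tau> tame]] t by (simp add: z_def)
  have eq1: "(((dtau cc z * u \<tau> + u' * cc z) - (dtau al z * v \<tau> + v' * al z)) * del z
      - (cc z * u \<tau> - al z * v \<tau>) * (del z * (dtau disc z / (2 * disc z)))) / (del z * del z)
    = dtau cc z * (u \<tau> / del z) + (u' * cc z - v' * al z) / del z - dtau al z / del z * v \<tau>
      - dtau disc z / (2 * disc z) * p \<tau>"
  proof -
    have "cc z * u \<tau> - al z * v \<tau> = del z * p \<tau>" using cu by simp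
    then show ?thesis using t by (simp add: field_simps)
  qed
  \<comment> \<open>\<open>u\<close> is eliminated in favour of \<open>v\<close> and
    \<open>p\<close>, which leaves only quotients controlled by \<open>tame\<close>.\<close>
  have eq2: "dtau cc z * (u \<tau> / del z) = dtau cc z / cc z * (p \<tau> + al z / del z * v \<tau>)"
  proof -
    have u: "u \<tau> = (del z * p \<tau> + al z * v \<tau>) / cc z" using cu t by (simp add: field_simps)
    show ?thesis unfolding u using t by (simp add: field_simps)
  qed
  \<comment> \<open>Both ca - al and cd + al equal \<open>tr\<close>, so the linear terms regroup
    into \<open>tr\<close> times the old combination plus \<open>disc\<close> times v; then
    \<open>disc\<close> is \<epsilon> times the square of \<open>del\<close>.\<close>
  have eq3: "(u' * cc z - v' * al z) / del z = tr z * p \<tau> + \<epsilon> * del z * v \<tau> + (cc z / del z * n1 - al z / del z * n2)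
      + (cc z / del z * e1 - al z / del z * e2)"
  proof -
    have "u' * cc z - v' * al z = tr z * (cc z * u \<tau> - al z * v \<tau>) + disc z * v \<tau> + (cc z * n1 - al z * n2) + (cc z * e1 - al z * e2)"
      unfolding u'_def v'_def disc_def tr_al[symmetric] by (simp add: algebra_simps power2_eq_square)
    also have "cc z * u \<tau> - al z * v \<tau> = del z * p \<tau>" using cu by simp
    also have "disc z = \<epsilon> * (del z * del z)"
      unfolding del_square[OF tame, folded z_def] using eps(2) by (simp flip: mult.assoc)
    finally have X: "u' * cc z - v' * al z = tr z * (del z * p \<tau>) + \<epsilon> * (del z * del z) * v \<tau> + (cc z * n1 - al z * n2) + (cc z * e1 - al z * e2)" .
    show ?thesis unfolding X using t by (simp add: field_simps)
  qed
  have gp: "gp z (v \<tau>, p \<tau>) = cc z / del z * n1 - al z / del z * n2 + dtau cc z / cc z * (p \<tau> + al z / del z * v \<tau>)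
      - dtau al z / del z * v \<tau> - dtau disc z / (2 * disc z) * p \<tau>"
    by (simp add: gp_def lift n1_def n2_def)
  have "(p has_real_derivative tr z * p \<tau> + \<epsilon> * del z * v \<tau> +
      (gp z (v \<tau>, p \<tau>) + (cc z / del z * e1 - al z / del z * e2))) (at \<tau>)"
    by (rule DERIV_cong[OF p']) (unfold gp eq1 eq2 eq3, linarith)
  then show "(p has_real_derivative tr (scale \<tau>) * p \<tau> + \<epsilon> * del (scale \<tau>) * v \<tau> +
      (gp (scale \<tau>) (v \<tau>, p \<tau>) + (cc (scale \<tau>) / del (scale \<tau>) * e1 - al (scale \<tau>) / del (scale \<tau>) * e2))) (at \<tau>)"
    by (simp add: z_def)
qed

lemma rem_lipschitz:
  "\<exists>C\<ge>0. \<forall>\<^sub>F z in at_right 0. \<forall>u v u' v'. \<bar>u\<bar> \<le> 1 \<longrightarrow> \<bar>v\<bar> \<le> 1 \<longrightarrow> \<bar>u'\<bar> \<le> 1 \<longrightarrow> \<bar>v'\<bar> \<le> 1 \<longrightarrow>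
    \<bar>rem1 z u v - rem1 z u' v'\<bar> \<le> C * z ^ M * (\<bar>u\<bar> + \<bar>v\<bar> + \<bar>u'\<bar> + \<bar>v'\<bar>) * (\<bar>u - u'\<bar> + \<bar>v - v'\<bar>)"
  "\<exists>C\<ge>0. \<forall>\<^sub>F z in at_right 0. \<forall>u v u' v'. \<bar>u\<bar> \<le> 1 \<longrightarrow> \<bar>v\<bar> \<le> 1 \<longrightarrow> \<bar>u'\<bar> \<le> 1 \<longrightarrow> \<bar>v'\<bar> \<le> 1 \<longrightarrow>
    \<bar>rem2 z u v - rem2 z u' v'\<bar> \<le> C * z ^ M * (\<bar>u\<bar> + \<bar>v\<bar> + \<bar>u'\<bar> + \<bar>v'\<bar>) * (\<bar>u - u'\<bar> + \<bar>v - v'\<bar>)"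
proof -
  have 1: "rhs1 z (P0 z + u, Q0 z + v) - rhs1 z (P0 z + u', Q0 z + v') - (ca z * (u - u') + cb z * (v - v'))
      = rem1 z u v - rem1 z u' v'" for z u v u' v'
    by (simp add: rem1_def algebra_simps)
  have 2: "rhs2 z (P0 z + u, Q0 z + v) - rhs2 z (P0 z + u', Q0 z + v') - (cc z * (u - u') + cd z * (v - v'))
      = rem2 z u v - rem2 z u' v'" for z u v u' v'
    by (simp add: rem2_def algebra_simps)
  show "\<exists>C\<ge>0. \<forall>\<^sub>F z in at_right 0. \<forall>u v u' v'. \<bar>u\<bar> \<le> 1 \<longrightarrow> \<bar>v\<bar> \<le> 1 \<longrightarrow> \<bar>u'\<bar> \<le> 1 \<longrightarrow> \<bar>v'\<bar> \<le> 1 \<longrightarrow>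
    \<bar>rem1 z u v - rem1 z u' v'\<bar> \<le> C * z ^ M * (\<bar>u\<bar> + \<bar>v\<bar> + \<bar>u'\<bar> + \<bar>v'\<bar>) * (\<bar>u - u'\<bar> + \<bar>v - v'\<bar>)"
    using sum_linearization[where f = lam and A = "{L..n}" and M = M, OF lam_smooth finite_atLeastAtMost
        smooth_bounded[OF smooth_base(1)] smooth_bounded[OF smooth_base(2)]]
    unfolding ca_def[symmetric] cb_def[symmetric] rhs1_def[symmetric] 1 .
  show "\<exists>C\<ge>0. \<forall>\<^sub>F z in at_right 0. \<forall>u v u' v'. \<bar>u\<bar> \<le> 1 \<longrightarrow> \<bar>v\<bar> \<le> 1 \<longrightarrow> \<bar>u'\<bar> \<le> 1 \<longrightarrow> \<bar>v'\<bar> \<le> 1 \<longrightarrow>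
    \<bar>rem2 z u v - rem2 z u' v'\<bar> \<le> C * z ^ M * (\<bar>u\<bar> + \<bar>v\<bar> + \<bar>u'\<bar> + \<bar>v'\<bar>) * (\<bar>u - u'\<bar> + \<bar>v - v'\<bar>)"
    using sum_linearization[where f = om and A = "{0..n}" and M = M, OF om_smooth finite_atLeastAtMost
        smooth_bounded[OF smooth_base(1)] smooth_bounded[OF smooth_base(2)]]
    unfolding cc_def[symmetric] cd_def[symmetric] rhs2_def[symmetric] 2 .
qed

text \<open>Deviations of size z^N give the quadratic remainders the Lipschitz constant z^M * z^N,
  and z^M pays for \<open>cc / del\<close>; the rates of the moving coordinates are O(z^N) by
  themselves. As z^N = 1/\<tau>, this is the rate required by the planar theorem.\<close>

lemma g_lipschitz:
  "\<exists>C\<ge>0. \<exists>D\<ge>0. \<forall>\<^sub>F z in at_right 0. tame C z \<and> (\<forall>v p v' p'. \<bar>v\<bar> \<le> 4 * z ^ N \<longrightarrow> \<bar>p\<bar> \<le> 4 * z ^ N \<longrightarrow>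
      \<bar>v'\<bar> \<le> 4 * z ^ N \<longrightarrow> \<bar>p'\<bar> \<le> 4 * z ^ N \<longrightarrow>
    \<bar>gv z (v, p) - gv z (v', p')\<bar> \<le> D * z ^ N * (\<bar>v - v'\<bar> + \<bar>p - p'\<bar>) \<and>
    \<bar>gp z (v, p) - gp z (v', p')\<bar> \<le> D * z ^ N * (\<bar>v - v'\<bar> + \<bar>p - p'\<bar>))"
proof -
  obtain C where C: "0 \<le> C" "\<forall>\<^sub>F z in at_right 0. tame C z" using eventually_tame by blast
  obtain C1 where C1: "0 \<le> C1" "\<forall>\<^sub>F z in at_right 0. \<forall>u v u' v'. \<bar>u\<bar> \<le> 1 \<longrightarrow> \<bar>v\<bar> \<le> 1 \<longrightarrow> \<bar>u'\<bar> \<le> 1 \<longrightarrow> \<bar>v'\<bar> \<le> 1 \<longrightarrow>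
    \<bar>rem1 z u v - rem1 z u' v'\<bar> \<le> C1 * z ^ M * (\<bar>u\<bar> + \<bar>v\<bar> + \<bar>u'\<bar> + \<bar>v'\<bar>) * (\<bar>u - u'\<bar> + \<bar>v - v'\<bar>)"
    using rem_lipschitz(1) by blast
  obtain C2 where C2: "0 \<le> C2" "\<forall>\<^sub>F z in at_right 0. \<forall>u v u' v'. \<bar>u\<bar> \<le> 1 \<longrightarrow> \<bar>v\<bar> \<le> 1 \<longrightarrow> \<bar>u'\<bar> \<le> 1 \<longrightarrow> \<bar>v'\<bar> \<le> 1 \<longrightarrow>
    \<bar>rem2 z u v - rem2 z u' v'\<bar> \<le> C2 * z ^ M * (\<bar>u\<bar> + \<bar>v\<bar> + \<bar>u'\<bar> + \<bar>v'\<bar>) * (\<bar>u - u'\<bar> + \<bar>v - v'\<bar>)"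
    using rem_lipschitz(2) by blast
  \<comment> \<open>\<open>E\<close> bounds the passage from (v, p) to (u, v). In \<open>D1\<close>
    and \<open>D2\<close> the factor 16 E comes from two pairs of deviations, 8 E z^N each, and the
    second E from their difference.\<close>
  define E where "E = C + 1"
  define D1 where "D1 = C1 * (16 * E) * E"
  define D2 where "D2 = C2 * (16 * E) * E"
  define D where "D = D2 + (C * D1 + C * D2 + C * (1 + C) + C + C)"
  have E: "1 \<le> E" "C \<le> E" using C(1) by (simp_all add: E_def)
  have D12: "0 \<le> D1" "0 \<le> D2" using C1(1) C2(1) E by (simp_all add: D1_def D2_def)
  \<comment> \<open>For small z the deviations thus lie in the unit cube of the linearization
    estimate.\<close>
  have lim: "((\<lambda>z::real. 8 * E * z ^ N) \<longlongrightarrow> 8 * E * 0 ^ N) (at_right 0)" by (intro tendsto_intros)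
  have sm: "\<forall>\<^sub>F z in at_right 0. 8 * E * z ^ N < 1"
    using order_tendstoD(2)[OF lim, of 1] N_pos by (simp add: power_0_left)
  have "\<forall>\<^sub>F z in at_right 0. tame C z \<and> (\<forall>v p v' p'. \<bar>v\<bar> \<le> 4 * z ^ N \<longrightarrow> \<bar>p\<bar> \<le> 4 * z ^ N \<longrightarrow>
      \<bar>v'\<bar> \<le> 4 * z ^ N \<longrightarrow> \<bar>p'\<bar> \<le> 4 * z ^ N \<longrightarrow>
    \<bar>gv z (v, p) - gv z (v', p')\<bar> \<le> D * z ^ N * (\<bar>v - v'\<bar> + \<bar>p - p'\<bar>) \<and>
    \<bar>gp z (v, p) - gp z (v', p')\<bar> \<le> D * z ^ N * (\<bar>v - v'\<bar> + \<bar>p - p'\<bar>))"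
    using C(2) C1(2) C2(2) sm
  proof eventually_elim
    case (elim z)
    note tame = elim(1)
    have z: "0 < z" "z < 1" using tame by (auto simp: tame_def)
    have lift_diff: "lift z v p - lift z v' p' = lift z (v - v') (p - p')" for v p v' p'
      by (simp add: lift_def algebra_simps diff_divide_distrib add_divide_distrib)
    have lift_le: "\<bar>lift z v p\<bar> \<le> C * (\<bar>v\<bar> + \<bar>p\<bar>)" for v p
    proof -
      have "lift z v p = del z / cc z * p + al z / cc z * v" by (simp add: lift_def add_divide_distrib)
      then have "\<bar>lift z v p\<bar> \<le> \<bar>del z / cc z\<bar> * \<bar>p\<bar> + \<bar>al z / cc z\<bar> * \<bar>v\<bar>"
        by (metis abs_mult abs_triangle_ineq)
      also have "\<dots> \<le> C * \<bar>p\<bar> + C * \<bar>v\<bar>"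
        using tame by (intro add_mono mult_right_mono) (auto simp: tame_def)
      finally show ?thesis by (simp add: algebra_simps)
    qed
    have lift_E: "\<bar>lift z v p\<bar> + \<bar>v\<bar> \<le> E * (\<bar>v\<bar> + \<bar>p\<bar>)" for v p
      using lift_le[of v p] by (simp add: E_def algebra_simps)
    show ?case
    proof (intro conjI tame allI impI)
      fix v p v' p' :: real
      assume le: "\<bar>v\<bar> \<le> 4 * z ^ N" "\<bar>p\<bar> \<le> 4 * z ^ N" "\<bar>v'\<bar> \<le> 4 * z ^ N" "\<bar>p'\<bar> \<le> 4 * z ^ N"
      define W where "W = \<bar>v - v'\<bar> + \<bar>p - p'\<bar>"
      define u u' where "u = lift z v p" and "u' = lift z v' p'"
      have W0: "0 \<le> W" by (simp add: W_def)
      have uv: "\<bar>u\<bar> + \<bar>v\<bar> \<le> 8 * E * z ^ N" "\<bar>u'\<bar> + \<bar>v'\<bar> \<le> 8 * E * z ^ N"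
      proof -
        have "E * (\<bar>v\<bar> + \<bar>p\<bar>) \<le> E * (4 * z ^ N + 4 * z ^ N)" "E * (\<bar>v'\<bar> + \<bar>p'\<bar>) \<le> E * (4 * z ^ N + 4 * z ^ N)"
          using le E by (intro mult_left_mono add_mono; simp)+
        then show "\<bar>u\<bar> + \<bar>v\<bar> \<le> 8 * E * z ^ N" "\<bar>u'\<bar> + \<bar>v'\<bar> \<le> 8 * E * z ^ N"
          using lift_E[of v p] lift_E[of v' p'] by (simp_all add: u_def u'_def)
      qed
      have le1: "\<bar>u\<bar> \<le> 1" "\<bar>v\<bar> \<le> 1" "\<bar>u'\<bar> \<le> 1" "\<bar>v'\<bar> \<le> 1"
        using uv elim(4) by simp_all
      have du: "\<bar>u - u'\<bar> + \<bar>v - v'\<bar> \<le> E * W"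
        unfolding u_def u'_def lift_diff W_def by (rule lift_E)
      have prod: "(\<bar>u\<bar> + \<bar>v\<bar> + \<bar>u'\<bar> + \<bar>v'\<bar>) * (\<bar>u - u'\<bar> + \<bar>v - v'\<bar>) \<le> (16 * E * z ^ N) * (E * W)"
        using uv du E z by (intro mult_mono) auto
      have r1: "\<bar>rem1 z u v - rem1 z u' v'\<bar> \<le> z ^ M * (D1 * z ^ N * W)"
      proof -
        have "\<bar>rem1 z u v - rem1 z u' v'\<bar> \<le> C1 * z ^ M * ((\<bar>u\<bar> + \<bar>v\<bar> + \<bar>u'\<bar> + \<bar>v'\<bar>) * (\<bar>u - u'\<bar> + \<bar>v - v'\<bar>))"
          using elim(2) le1 by (simp add: mult.assoc)
        also have "\<dots> \<le> C1 * z ^ M * ((16 * E * z ^ N) * (E * W))"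
          using C1(1) z by (intro mult_left_mono prod) simp
        finally show ?thesis by (simp add: D1_def mult_ac)
      qed
      have r2: "\<bar>rem2 z u v - rem2 z u' v'\<bar> \<le> z ^ M * (D2 * z ^ N * W)"
      proof -
        have "\<bar>rem2 z u v - rem2 z u' v'\<bar> \<le> C2 * z ^ M * ((\<bar>u\<bar> + \<bar>v\<bar> + \<bar>u'\<bar> + \<bar>v'\<bar>) * (\<bar>u - u'\<bar> + \<bar>v - v'\<bar>))"
          using elim(3) le1 by (simp add: mult.assoc)
        also have "\<dots> \<le> C2 * z ^ M * ((16 * E * z ^ N) * (E * W))"
          using C2(1) z by (intro mult_left_mono prod) simp
        finally show ?thesis by (simp add: D2_def mult_ac)
      qed
      have "z ^ M \<le> 1" using z by (intro power_le_one) auto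
      then have "z ^ M * (D2 * z ^ N * W) \<le> 1 * (D2 * z ^ N * W)"
        using D12 z W0 by (intro mult_right_mono) auto
      with r2 have r2': "\<bar>rem2 z u v - rem2 z u' v'\<bar> \<le> D2 * z ^ N * W" by linarith
      have "D2 \<le> D" unfolding D_def using C(1) D12 by simp
      then have "D2 * z ^ N * W \<le> D * z ^ N * W" using z W0 by (intro mult_right_mono) auto
      with r2' show "\<bar>gv z (v, p) - gv z (v', p')\<bar> \<le> D * z ^ N * (\<bar>v - v'\<bar> + \<bar>p - p'\<bar>)"
        unfolding W_def[symmetric] by (simp add: gv_def u_def u'_def)
      have t1: "\<bar>cc z / del z * (rem1 z u v - rem1 z u' v')\<bar> \<le> C * (D1 * z ^ N * W)"
      proof -
        have "\<bar>cc z / del z * (rem1 z u v - rem1 z u' v')\<bar> \<le> \<bar>cc z / del z\<bar> * (z ^ M * (D1 * z ^ N * W))"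
          unfolding abs_mult using r1 by (intro mult_left_mono) auto
        also have "\<dots> = (\<bar>cc z / del z\<bar> * z ^ M) * (D1 * z ^ N * W)" by (simp only: mult.assoc)
        also have "\<dots> \<le> C * (D1 * z ^ N * W)"
          using tame D12 z W0 by (intro mult_right_mono) (auto simp: tame_def)
        finally show ?thesis .
      qed
      have t2: "\<bar>al z / del z * (rem2 z u v - rem2 z u' v')\<bar> \<le> C * (D2 * z ^ N * W)"
        unfolding abs_mult using r2' tame C(1) by (intro mult_mono) (auto simp: tame_def)
      have pW: "\<bar>p - p'\<bar> \<le> W" "\<bar>v - v'\<bar> \<le> W" by (simp_all add: W_def)
      have t3: "\<bar>dtau cc z / cc z * ((p - p') + al z / del z * (v - v'))\<bar> \<le> (C * z ^ N) * ((1 + C) * W)"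
        unfolding abs_mult
      proof (rule mult_mono)
        have "\<bar>al z / del z * (v - v')\<bar> \<le> C * W"
          unfolding abs_mult using pW tame C(1) by (intro mult_mono) (auto simp: tame_def)
        then show "\<bar>(p - p') + al z / del z * (v - v')\<bar> \<le> (1 + C) * W"
          using pW abs_triangle_ineq[of "p - p'" "al z / del z * (v - v')"] unfolding distrib_right mult_1 by linarith
      qed (use tame C(1) z in \<open>auto simp: tame_def\<close>)
      have t4: "\<bar>dtau al z / del z * (v - v')\<bar> \<le> (C * z ^ N) * W"
        unfolding abs_mult using pW tame C(1) z by (intro mult_mono) (auto simp: tame_def)
      have t5: "\<bar>dtau disc z / (2 * disc z) * (p - p')\<bar> \<le> (C * z ^ N) * W"
        unfolding abs_mult[of _ "p - p'"] using pW tame C(1) z by (intro mult_mono) (auto simp: tame_def)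
      \<comment> \<open>The terms of \<open>gp\<close> in their order, except that the one with
        \<open>dtau cc\<close> keeps its two contributions together; each is at most a constant
        times z^N W.\<close>
      define T1 T2 T3 T4 T5 where "T1 = cc z / del z * (rem1 z u v - rem1 z u' v')"
        and "T2 = al z / del z * (rem2 z u v - rem2 z u' v')"
        and "T3 = dtau cc z / cc z * ((p - p') + al z / del z * (v - v'))"
        and "T4 = dtau al z / del z * (v - v')" and "T5 = dtau disc z / (2 * disc z) * (p - p')"
      have gp_diff: "gp z (v, p) - gp z (v', p') = T1 - T2 + T3 - T4 - T5"
        unfolding gp_def u_def u'_def fst_conv snd_conv right_diff_distrib distrib_left T1_def T2_def T3_def T4_def T5_def
        by simp
      define y where "y = z ^ N * W"
      have "\<bar>T1\<bar> \<le> C * D1 * y" "\<bar>T2\<bar> \<le> C * D2 * y" "\<bar>T3\<bar> \<le> C * (1 + C) * y" "\<bar>T4\<bar> \<le> C * y" "\<bar>T5\<bar> \<le> C * y"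
        using t1 t2 t3 t4 t5 unfolding T1_def T2_def T3_def T4_def T5_def y_def by (simp_all only: mult_ac)
      then have "\<bar>gp z (v, p) - gp z (v', p')\<bar> \<le> C * D1 * y + C * D2 * y + C * (1 + C) * y + C * y + C * y"
        unfolding gp_diff by linarith
      moreover have "C * D1 * y + C * D2 * y + C * (1 + C) * y + C * y + C * y = (C * D1 + C * D2 + C * (1 + C) + C + C) * y"
        by (simp only: distrib_right)
      moreover have "(C * D1 + C * D2 + C * (1 + C) + C + C) * y \<le> D * y"
        unfolding D_def y_def using D12 z W0 by (intro mult_right_mono) auto
      ultimately have "\<bar>gp z (v, p) - gp z (v', p')\<bar> \<le> D * y" by linarith
      then show "\<bar>gp z (v, p) - gp z (v', p')\<bar> \<le> D * z ^ N * (\<bar>v - v'\<bar> + \<bar>p - p'\<bar>)"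
        unfolding W_def y_def by (simp only: mult.assoc)
    qed
  qed
  moreover have "0 \<le> D" unfolding D_def using C(1) D12 by simp
  ultimately show ?thesis using C(1) by blast
qed

end

section \<open>Existence of the exact solution\<close>

context formal_approximation
begin

lemma bigo_scale_N:
  assumes "f \<in> O[at_right 0](\<lambda>z. z ^ m)" "N * j \<le> m"
  shows "(\<lambda>\<tau>. f (scale \<tau>)) \<in> O(\<lambda>\<tau>. \<tau> powr (- real j))"
proof -
  have "- real (N * j) / real N = - real j" using N_pos by simp
  then show ?thesis using bigo_scale[OF bigo_at_right_0_power_mono[OF assms]] by (simp only:)
qed

text \<open>The price of \<open>cc / del\<close> is at most z^M, the factor by which the amplitude
  series is ahead of the angle series.\<close>

lemma cc_del_bigo:
  assumes "f \<in> O[at_right 0](\<lambda>z. z ^ (M + k))"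
  shows "(\<lambda>z. cc z / del z * f z) \<in> O[at_right 0](\<lambda>z. z ^ k)"
proof -
  obtain C where C: "0 \<le> C" "\<forall>\<^sub>F z in at_right 0. tame C z" using eventually_tame by blast
  obtain B where B: "0 \<le> B" "\<forall>\<^sub>F z in at_right 0. \<bar>f z\<bar> \<le> B * z ^ (M + k)"
    using bigo_eventually_le[OF assms] by blast
  have "\<forall>\<^sub>F z in at_right 0. norm (cc z / del z * f z) \<le> (C * B) * norm (z ^ k)"
    using C(2) B(2)
  proof eventually_elim
    case (elim z)
    have z: "0 < z" using elim(1) by (simp add: tame_def)
    have "\<bar>cc z / del z * f z\<bar> \<le> \<bar>cc z / del z\<bar> * (B * z ^ (M + k))"
      unfolding abs_mult using elim(2) by (intro mult_left_mono) auto
    also have "\<dots> = (\<bar>cc z / del z\<bar> * z ^ M) * (B * z ^ k)" by (simp only: power_add mult_ac)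
    also have "\<dots> \<le> C * (B * z ^ k)"
      using elim(1) B(1) z by (intro mult_right_mono) (auto simp: tame_def)
    finally show ?case using z by simp
  qed
  then show ?thesis by (rule bigoI)
qed

lemma al_del_bigo:
  assumes "f \<in> O[at_right 0](\<lambda>z. z ^ k)"
  shows "(\<lambda>z. al z / del z * f z) \<in> O[at_right 0](\<lambda>z. z ^ k)"
proof -
  obtain C where C: "0 \<le> C" "\<forall>\<^sub>F z in at_right 0. tame C z" using eventually_tame by blast
  have "(\<lambda>z. al z / del z) \<in> O[at_right 0](\<lambda>z. z ^ 0)"
  proof (rule bigoI)
    show "\<forall>\<^sub>F z in at_right 0. norm (al z / del z) \<le> C * norm (z ^ 0 :: real)"
      using C(2) by eventually_elim (simp add: tame_def)
  qed
  from bigo_power_mult[OF this assms] show ?thesis by simp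
qed

text \<open>Compared in squares, where \<open>width\<close> becomes z^(2M+L): one spare power of z
  absorbs any constant.\<close>

lemma width_dominates:
  assumes "2 * M + L + 1 \<le> 2 * j"
  shows "\<forall>\<^sub>F z in at_right 0. A * z ^ j \<le> kap / 2 * width z"
proof -
  have lim: "((\<lambda>z::real. A ^ 2 * z) \<longlongrightarrow> A ^ 2 * 0) (at_right 0)" by (intro tendsto_intros)
  have "0 < (kap / 2) ^ 2" using kap_pos by simp
  then have ev: "\<forall>\<^sub>F z in at_right 0. A ^ 2 * z < (kap / 2) ^ 2"
    using order_tendstoD(2)[OF lim, of "(kap / 2) ^ 2"] by simp
  have z01: "\<forall>\<^sub>F z in at_right (0::real). z \<in> {0<..<1}" by (rule eventually_at_right_real) simp
  from ev z01 show ?thesis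
  proof eventually_elim
    case (elim z)
    then have z: "0 < z" "z < 1" by auto
    have w2: "width z ^ 2 = z ^ (2 * M + L)" using z by (simp add: width_def)
    show ?case
    proof (rule power2_le_imp_le)
      have "(A * z ^ j) ^ 2 = A ^ 2 * z ^ (2 * j)"
        by (simp add: power_mult_distrib mult.commute[of j] flip: power_mult)
      also have "\<dots> \<le> A ^ 2 * z ^ (2 * M + L + 1)"
        using z assms by (intro mult_left_mono power_decreasing) auto
      also have "\<dots> = (A ^ 2 * z) * width z ^ 2" by (simp add: w2)
      also have "\<dots> \<le> (kap / 2) ^ 2 * width z ^ 2" using elim by (intro mult_right_mono) auto
      finally show "(A * z ^ j) ^ 2 \<le> (kap / 2 * width z) ^ 2" by (simp only: power_mult_distrib)
      show "0 \<le> kap / 2 * width z" using kap_pos width_compare(1)[OF z] by simp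
    qed
  qed
qed

text \<open>\<open>del\<close> is at least kap * width while \<open>tr\<close> is of smaller order.
  So the sum is eventually nonnegative, and the difference lies below - kap/2 * width, which beats K
  z^N for every K because N exceeds M + L/2.\<close>

lemma saddle_dichotomic:
  "dichotomic (\<lambda>\<tau>. tr (scale \<tau>) + del (scale \<tau>))" "dichotomic (\<lambda>\<tau>. tr (scale \<tau>) - del (scale \<tau>))"
proof -
  obtain A where A: "\<forall>\<^sub>F z in at_right 0. \<bar>tr z\<bar> \<le> A * z ^ error_order"
    using bigo_eventually_le[OF tr_al_bigo(1)] by blast
  have tr_le: "\<forall>\<^sub>F z in at_right 0. \<bar>tr z\<bar> + kap / 2 * width z \<le> del z"
    using A width_dominates[OF error_order(1), of A] del_bounds
    by eventually_elim (simp add: field_simps)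
  have z01: "\<forall>\<^sub>F z in at_right (0::real). z \<in> {0<..<1}" by (rule eventually_at_right_real) simp
  have "\<forall>\<^sub>F z in at_right 0. 0 \<le> tr z + del z"
    using tr_le z01
  proof eventually_elim
    case (elim z)
    then have "0 \<le> kap / 2 * width z" using width_compare(1)[of z] kap_pos by simp
    then show ?case using elim by linarith
  qed
  then have "\<forall>\<^sub>F \<tau> in at_top. - 0 / \<tau> \<le> tr (scale \<tau>) + del (scale \<tau>)"
    using eventually_compose_filterlim[OF _ filterlim_scale] by simp
  then show "dichotomic (\<lambda>\<tau>. tr (scale \<tau>) + del (scale \<tau>))" unfolding dichotomic_def by blast
  have "\<forall>\<^sub>F \<tau> in at_top. tr (scale \<tau>) - del (scale \<tau>) \<le> - K / \<tau>" for K
  proof -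
    have "2 * M + L + 1 \<le> 2 * N" using M_add_L_le M2_le M_pos by linarith
    from width_dominates[OF this, of K] tr_le
    have "\<forall>\<^sub>F z in at_right 0. tr z - del z \<le> - K * z ^ N" by eventually_elim linarith
    then have "\<forall>\<^sub>F \<tau> in at_top. tr (scale \<tau>) - del (scale \<tau>) \<le> - K * scale \<tau> ^ N"
      by (rule eventually_compose_filterlim[OF _ filterlim_scale])
    then show ?thesis
      using eventually_gt_at_top[of 0] by eventually_elim (simp add: scale_power_N)
  qed
  then show "dichotomic (\<lambda>\<tau>. tr (scale \<tau>) - del (scale \<tau>))" unfolding dichotomic_def by blast
qed

lemma continuous_on_scale:
  assumes "smooth_real f" "0 \<le> b"
  shows "continuous_on {b<..} (\<lambda>\<tau>. f (scale \<tau>))"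
    and "continuous_on ({b<..} \<times> S) (\<lambda>x. f (scale (fst x)))"
proof -
  show *: "continuous_on {b<..} (\<lambda>\<tau>. f (scale \<tau>))"
    by (rule DERIV_continuous_on)
      (rule has_field_derivative_at_within[OF scale_deriv[OF assms(1)]], use assms(2) in simp)
  show "continuous_on ({b<..} \<times> S) (\<lambda>x. f (scale (fst x)))"
    by (rule continuous_on_compose2[OF *]) (auto intro!: continuous_intros)
qed

lemma continuous_on_g:
  assumes b: "0 \<le> b" and tame: "\<And>\<tau>. b < \<tau> \<Longrightarrow> tame C (scale \<tau>)"
  shows "continuous_on ({b<..} \<times> UNIV) (\<lambda>(x, y). gv (scale x) y)"
    and "continuous_on ({b<..} \<times> UNIV) (\<lambda>(x, y). gp (scale x) y)"
    and "continuous_on {b<..} (\<lambda>\<tau>. del (scale \<tau>))"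
proof -
  let ?X = "{b<..} \<times> (UNIV :: (real \<times> real) set)"
  note c = continuous_on_scale(2)[OF _ b, of _ "UNIV :: (real \<times> real) set"]
  have del: "continuous_on ?X (\<lambda>x. del (scale (fst x)))"
    unfolding del_def by (intro continuous_on_real_sqrt continuous_on_mult continuous_on_const c smooth_derived)
  show "continuous_on {b<..} (\<lambda>\<tau>. del (scale \<tau>))"
    unfolding del_def
    by (intro continuous_on_real_sqrt continuous_on_mult continuous_on_const continuous_on_scale(1)[OF _ b] smooth_derived)
  have nz: "\<forall>x\<in>?X. cc (scale (fst x)) \<noteq> 0" "\<forall>x\<in>?X. del (scale (fst x)) \<noteq> 0" "\<forall>x\<in>?X. 2 * disc (scale (fst x)) \<noteq> 0"
    using tame_nonzero[OF tame] by force+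
  note y = continuous_on_fst[OF continuous_on_snd[OF continuous_on_id]] continuous_on_snd[OF continuous_on_snd[OF continuous_on_id]]
  have lift: "continuous_on ?X (\<lambda>x. lift (scale (fst x)) (fst (snd x)) (snd (snd x)))"
    unfolding lift_def
    by (intro continuous_on_divide continuous_on_add continuous_on_mult del c smooth_coeffs smooth_derived y nz)
  have point: "continuous_on ?X (\<lambda>x. (P0 (scale (fst x)) + lift (scale (fst x)) (fst (snd x)) (snd (snd x)), Q0 (scale (fst x)) + fst (snd x)))"
    by (intro continuous_on_Pair continuous_on_add c smooth_base lift y)
  have lam: "continuous_on ?X (\<lambda>x. lam K (P0 (scale (fst x)) + lift (scale (fst x)) (fst (snd x)) (snd (snd x)), Q0 (scale (fst x)) + fst (snd x)))"
    and om: "continuous_on ?X (\<lambda>x. om K (P0 (scale (fst x)) + lift (scale (fst x)) (fst (snd x)) (snd (snd x)), Q0 (scale (fst x)) + fst (snd x)))" for K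
    by (rule continuous_on_compose2[OF smooth_on_imp_continuous_on[OF lam_smooth] point], simp,
        rule continuous_on_compose2[OF smooth_on_imp_continuous_on[OF om_smooth] point], simp)
  have pw: "continuous_on ?X (\<lambda>x. scale (fst x) ^ k)" for k
    by (rule c[OF smooth_real_power[OF smooth_real_ident]])
  have rem1: "continuous_on ?X (\<lambda>x. rem1 (scale (fst x)) (lift (scale (fst x)) (fst (snd x)) (snd (snd x))) (fst (snd x)))"
    unfolding rem1_def rhs1_def
    by (intro continuous_on_diff continuous_on_sum continuous_on_mult pw lam lift y c smooth_dtau smooth_base smooth_coeffs)
  have rem2: "continuous_on ?X (\<lambda>x. rem2 (scale (fst x)) (lift (scale (fst x)) (fst (snd x)) (snd (snd x))) (fst (snd x)))"
    unfolding rem2_def rhs2_def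
    by (intro continuous_on_diff continuous_on_sum continuous_on_mult pw om lift y c smooth_dtau smooth_base smooth_coeffs)
  show "continuous_on ?X (\<lambda>(x, y). gv (scale x) y)"
    unfolding case_prod_beta gv_def by (rule rem2)
  show "continuous_on ?X (\<lambda>(x, y). gp (scale x) y)"
    unfolding case_prod_beta gp_def
    by (intro continuous_on_diff continuous_on_add continuous_on_mult continuous_on_divide rem1 rem2 nz y del
        continuous_on_const c smooth_dtau smooth_derived smooth_coeffs)
qed

text \<open>Meets all demands on the k-th approximant at once: residual of order \<tau>^(-k-2),
  differences of order \<tau>^(-k-1), and agreement with \<open>P0\<close>, \<open>Q0\<close> up to
  \<tau>^(-2).\<close>

definition "approx_order k = N * (k + 4)"
definition "uz k z = approx1 rc (approx_order k) z - P0 z"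
definition "vz k z = approx2 pc (approx_order k) z - Q0 z"
definition "pz k z = cc z / del z * uz k z - al z / del z * vz k z"
definition "d1 k = defect1 (approx1 rc (approx_order k)) (approx2 pc (approx_order k))"
definition "d2 k = defect2 (approx1 rc (approx_order k)) (approx2 pc (approx_order k))"

lemma approx_order: "2 * N \<le> approx_order k" "k \<le> m \<Longrightarrow> approx_order k \<le> approx_order m" "N * (k + 2) \<le> approx_order k"
  by (auto simp: approx_order_def add_mult_distrib2)

lemma smooth_uz: "smooth_real (uz k)" "smooth_real (vz k)" "smooth_real (d1 k)" "smooth_real (d2 k)"
  unfolding uz_def[abs_def] vz_def[abs_def] d1_def d2_def
  by (intro smooth_real_diff smooth_approx smooth_base smooth_defects)+

text \<open>The base point has 2N coefficients so that all approximants are O(\<tau>^(-2)) away from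
  it, well inside the radius 4/\<tau> of the Lipschitz bounds. The surplus z^M in the amplitude is
  consumed by \<open>cc / del\<close>.\<close>

lemma uz_bigo:
  "k \<le> m \<Longrightarrow> (\<lambda>z. uz m z - uz k z) \<in> O[at_right 0](\<lambda>z. z ^ (M + approx_order k))"
  "k \<le> m \<Longrightarrow> (\<lambda>z. vz m z - vz k z) \<in> O[at_right 0](\<lambda>z. z ^ (approx_order k + 1))"
  "uz k \<in> O[at_right 0](\<lambda>z. z ^ (M + 2 * N))" "vz k \<in> O[at_right 0](\<lambda>z. z ^ (2 * N + 1))"
  using approx1_diff_bigo[OF approx_order(2)[of k m], of rc] approx2_diff_bigo[OF approx_order(2)[of k m], of pc]
    approx1_diff_bigo[OF approx_order(1)[of k], of rc] approx2_diff_bigo[OF approx_order(1)[of k], of pc]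
  by (simp_all add: uz_def[abs_def] vz_def[abs_def] P0_def Q0_def)

lemma pz_diff: "pz m z - pz k z = cc z / del z * (uz m z - uz k z) - al z / del z * (vz m z - vz k z)"
  unfolding pz_def right_diff_distrib by simp

text \<open>A partial sum solves the system up to its defect, which therefore reappears with
  opposite sign as forcing.\<close>

lemma approximants_deriv:
  assumes \<tau>: "0 < \<tau>" and tame: "tame C (scale \<tau>)"
  shows "((\<lambda>\<tau>. vz k (scale \<tau>)) has_real_derivative tr (scale \<tau>) * vz k (scale \<tau>) + del (scale \<tau>) * pz k (scale \<tau>)
      + (gv (scale \<tau>) (vz k (scale \<tau>), pz k (scale \<tau>)) + - d2 k (scale \<tau>))) (at \<tau>)"
    and "((\<lambda>\<tau>. pz k (scale \<tau>)) has_real_derivative tr (scale \<tau>) * pz k (scale \<tau>) + \<epsilon> * del (scale \<tau>) * vz k (scale \<tau>)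
      + (gp (scale \<tau>) (vz k (scale \<tau>), pz k (scale \<tau>)) +
         (cc (scale \<tau>) / del (scale \<tau>) * - d1 k (scale \<tau>) - al (scale \<tau>) / del (scale \<tau>) * - d2 k (scale \<tau>)))) (at \<tau>)"
proof -
  have u: "((\<lambda>\<tau>. uz k (scale \<tau>)) has_real_derivative
      rhs1 (scale \<tau>) (P0 (scale \<tau>) + uz k (scale \<tau>), Q0 (scale \<tau>) + vz k (scale \<tau>)) - dtau P0 (scale \<tau>) + - d1 k (scale \<tau>)) (at \<tau>)"
    using DERIV_diff[OF scale_deriv[OF smooth_approx(1) \<tau>] scale_deriv[OF smooth_base(1) \<tau>], of rc "approx_order k"]
    by (simp add: uz_def vz_def d1_def defect1_def dtau_def)
  have v: "((\<lambda>\<tau>. vz k (scale \<tau>)) has_real_derivative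
      rhs2 (scale \<tau>) (P0 (scale \<tau>) + uz k (scale \<tau>), Q0 (scale \<tau>) + vz k (scale \<tau>)) - dtau Q0 (scale \<tau>) + - d2 k (scale \<tau>)) (at \<tau>)"
    using DERIV_diff[OF scale_deriv[OF smooth_approx(2) \<tau>] scale_deriv[OF smooth_base(2) \<tau>], of pc "approx_order k"]
    by (simp add: uz_def vz_def d2_def defect2_def dtau_def)
  have p: "pz k (scale \<tau>) = (cc (scale \<tau>) * uz k (scale \<tau>) - al (scale \<tau>) * vz k (scale \<tau>)) / del (scale \<tau>)" for \<tau>
    by (simp add: pz_def diff_divide_distrib)
  show "((\<lambda>\<tau>. vz k (scale \<tau>)) has_real_derivative tr (scale \<tau>) * vz k (scale \<tau>) + del (scale \<tau>) * pz k (scale \<tau>)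
      + (gv (scale \<tau>) (vz k (scale \<tau>), pz k (scale \<tau>)) + - d2 k (scale \<tau>))) (at \<tau>)"
    by (rule transform_deriv(1)[where u = "\<lambda>\<tau>. uz k (scale \<tau>)" and v = "\<lambda>\<tau>. vz k (scale \<tau>)" and p = "\<lambda>\<tau>. pz k (scale \<tau>)",
          OF \<tau> tame u v p])
  show "((\<lambda>\<tau>. pz k (scale \<tau>)) has_real_derivative tr (scale \<tau>) * pz k (scale \<tau>) + \<epsilon> * del (scale \<tau>) * vz k (scale \<tau>)
      + (gp (scale \<tau>) (vz k (scale \<tau>), pz k (scale \<tau>)) +
         (cc (scale \<tau>) / del (scale \<tau>) * - d1 k (scale \<tau>) - al (scale \<tau>) / del (scale \<tau>) * - d2 k (scale \<tau>)))) (at \<tau>)"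
    by (rule transform_deriv(2)[where u = "\<lambda>\<tau>. uz k (scale \<tau>)" and v = "\<lambda>\<tau>. vz k (scale \<tau>)" and p = "\<lambda>\<tau>. pz k (scale \<tau>)",
          OF \<tau> tame u v p])
qed

text \<open>Only differentiability is recorded; the value of the derivative is identified later by
  uniqueness.\<close>

lemma lift_deriv:
  assumes "0 < \<tau>" "tame C (scale \<tau>)" "(v has_real_derivative v') (at \<tau>)" "(p has_real_derivative p') (at \<tau>)"
  shows "\<exists>u'. ((\<lambda>\<tau>. lift (scale \<tau>) (v \<tau>) (p \<tau>)) has_real_derivative u') (at \<tau>)"
  unfolding lift_def
  using DERIV_divide[OF DERIV_add[OF DERIV_mult[OF del_scale_deriv[OF assms(1,2)] assms(4)]
        DERIV_mult[OF scale_deriv[OF smooth_derived(2) assms(1)] assms(3)]] scale_deriv[OF smooth_coeffs(3) assms(1)]]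
    tame_nonzero[OF assms(2)] by blast

text \<open>The planar theorem controls the solution in integral powers of 1/\<tau>. The finer
  expansion in powers of \<tau>^(-1/N) follows by comparing each partial sum with a much longer one,
  to which the solution is close beyond the order in question.\<close>

theorem exact_solution:
  "\<exists>R \<Phi> a. 0 < a \<and> (\<forall>\<tau>>a. (R has_real_derivative rhs1 (scale \<tau>) (R \<tau>, \<Phi> \<tau>)) (at \<tau>) \<and>
      (\<Phi> has_real_derivative rhs2 (scale \<tau>) (R \<tau>, \<Phi> \<tau>)) (at \<tau>)) \<and>
    (\<forall>m. (\<lambda>\<tau>. R \<tau> - approx1 rc m (scale \<tau>)) \<in> O(\<lambda>\<tau>. \<tau> powr (- real (M + m) / real N)) \<and>
      (\<lambda>\<tau>. \<Phi> \<tau> - approx2 pc m (scale \<tau>)) \<in> O(\<lambda>\<tau>. \<tau> powr (- real (m + 1) / real N)))"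
proof -
  obtain C D where C: "0 \<le> C" and D: "0 \<le> D" and ev: "\<forall>\<^sub>F z in at_right 0. tame C z \<and>
    (\<forall>v p v' p'. \<bar>v\<bar> \<le> 4 * z ^ N \<longrightarrow> \<bar>p\<bar> \<le> 4 * z ^ N \<longrightarrow> \<bar>v'\<bar> \<le> 4 * z ^ N \<longrightarrow> \<bar>p'\<bar> \<le> 4 * z ^ N \<longrightarrow>
    \<bar>gv z (v, p) - gv z (v', p')\<bar> \<le> D * z ^ N * (\<bar>v - v'\<bar> + \<bar>p - p'\<bar>) \<and>
    \<bar>gp z (v, p) - gp z (v', p')\<bar> \<le> D * z ^ N * (\<bar>v - v'\<bar> + \<bar>p - p'\<bar>))"
    using g_lipschitz by blast
  from eventually_compose_filterlim[OF ev filterlim_scale] obtain b\<^sub>0 where b0: "\<And>\<tau>. b\<^sub>0 \<le> \<tau> \<Longrightarrow> tame C (scale \<tau>)"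
    "\<And>\<tau> v p v' p'. b\<^sub>0 \<le> \<tau> \<Longrightarrow> \<bar>v\<bar> \<le> 4 * scale \<tau> ^ N \<Longrightarrow> \<bar>p\<bar> \<le> 4 * scale \<tau> ^ N \<Longrightarrow> \<bar>v'\<bar> \<le> 4 * scale \<tau> ^ N \<Longrightarrow>
      \<bar>p'\<bar> \<le> 4 * scale \<tau> ^ N \<Longrightarrow>
    \<bar>gv (scale \<tau>) (v, p) - gv (scale \<tau>) (v', p')\<bar> \<le> D * scale \<tau> ^ N * (\<bar>v - v'\<bar> + \<bar>p - p'\<bar>) \<and>
    \<bar>gp (scale \<tau>) (v, p) - gp (scale \<tau>) (v', p')\<bar> \<le> D * scale \<tau> ^ N * (\<bar>v - v'\<bar> + \<bar>p - p'\<bar>)"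
    unfolding eventually_at_top_linorder by blast
  define b where "b = max 1 b\<^sub>0"
  have b: "1 \<le> b" "0 \<le> b" by (auto simp: b_def)
  have tame: "tame C (scale \<tau>)" if "b < \<tau>" for \<tau> using b0(1) that by (auto simp: b_def)
  have pos: "0 < \<tau>" if "b < \<tau>" for \<tau> using that b by linarith
  note g_cont = continuous_on_g[OF b(2) tame]
  have pz_cont: "continuous_on {b<..} (\<lambda>\<tau>. pz k (scale \<tau>))" for k
    by (rule DERIV_continuous_on) (rule has_field_derivative_at_within[OF approximants_deriv(2)[OF pos tame]], auto)
  note s_cont = continuous_on_scale(1)[OF _ b(2)]
  have point_cont: "continuous_on {b<..} (\<lambda>\<tau>. (\<tau>, vz k (scale \<tau>), pz k (scale \<tau>)))" for k
    by (intro continuous_on_Pair continuous_on_id s_cont smooth_uz pz_cont)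
  have gvk: "continuous_on {b<..} (\<lambda>\<tau>. gv (scale \<tau>) (vz k (scale \<tau>), pz k (scale \<tau>)))" for k
    using continuous_on_compose2[OF g_cont(1) point_cont, of k] by auto
  have gpk: "continuous_on {b<..} (\<lambda>\<tau>. gp (scale \<tau>) (vz k (scale \<tau>), pz k (scale \<tau>)))" for k
    using continuous_on_compose2[OF g_cont(2) point_cont, of k] by auto
  have del_nz: "\<forall>\<tau>\<in>{b<..}. del (scale \<tau>) \<noteq> 0" using tame_nonzero[OF tame] by force
  have d2: "d2 k \<in> O[at_right 0](\<lambda>z. z ^ approx_order k)" for k
    unfolding d2_def by (rule bigo_at_right_0_power_mono[OF formal2]) simp
  have d1: "d1 k \<in> O[at_right 0](\<lambda>z. z ^ (M + approx_order k))" for k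
    unfolding d1_def by (rule bigo_at_right_0_power_mono[OF formal1]) simp
  have "\<exists>v p a. b \<le> a \<and>
    (\<forall>\<tau>>a. (v has_real_derivative tr (scale \<tau>) * v \<tau> + del (scale \<tau>) * p \<tau> + gv (scale \<tau>) (v \<tau>, p \<tau>)) (at \<tau>) \<and>
      (p has_real_derivative tr (scale \<tau>) * p \<tau> + \<epsilon> * del (scale \<tau>) * v \<tau> + gp (scale \<tau>) (v \<tau>, p \<tau>)) (at \<tau>)) \<and>
    (\<forall>k. (\<lambda>\<tau>. v \<tau> - vz k (scale \<tau>)) \<in> O(\<lambda>\<tau>. \<tau> powr (- real k)) \<and>
         (\<lambda>\<tau>. p \<tau> - pz k (scale \<tau>)) \<in> O(\<lambda>\<tau>. \<tau> powr (- real k)))"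
  proof (rule planar_system_solution[where C = D and m = "\<lambda>\<tau>. tr (scale \<tau>)" and \<delta> = "\<lambda>\<tau>. del (scale \<tau>)"
        and V = "\<lambda>k \<tau>. vz k (scale \<tau>)" and P = "\<lambda>k \<tau>. pz k (scale \<tau>)"
        and gv = "\<lambda>\<tau>. gv (scale \<tau>)" and gp = "\<lambda>\<tau>. gp (scale \<tau>)"])
    show "1 \<le> b" "0 \<le> D" by (fact b D)+
    show "continuous_on {b<..} (\<lambda>\<tau>. tr (scale \<tau>))" by (intro s_cont smooth_derived)
    show "continuous_on {b<..} (\<lambda>\<tau>. del (scale \<tau>))" by (rule g_cont(3))
    show "\<epsilon> = 1 \<and> dichotomic (\<lambda>x. tr (scale x) + del (scale x)) \<and> dichotomic (\<lambda>x. tr (scale x) - del (scale x)) \<or>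
        \<epsilon> = - 1 \<and> dichotomic (\<lambda>\<tau>. tr (scale \<tau>))"
      using eps(1) saddle_dichotomic smooth_real_dichotomic[OF smooth_derived(1)] by blast
    show "continuous_on ({b<..} \<times> UNIV) (\<lambda>(x, y). gv (scale x) y)" by (rule g_cont(1))
    show "continuous_on ({b<..} \<times> UNIV) (\<lambda>(x, y). gp (scale x) y)" by (rule g_cont(2))
    show "\<bar>gv (scale x) (v, p) - gv (scale x) (v', p')\<bar> \<le> D / x * (\<bar>v - v'\<bar> + \<bar>p - p'\<bar>) \<and>
        \<bar>gp (scale x) (v, p) - gp (scale x) (v', p')\<bar> \<le> D / x * (\<bar>v - v'\<bar> + \<bar>p - p'\<bar>)"
      if "b < x" "\<bar>v\<bar> \<le> 4 / x" "\<bar>p\<bar> \<le> 4 / x" "\<bar>v'\<bar> \<le> 4 / x" "\<bar>p'\<bar> \<le> 4 / x" for x v p v' p'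
    proof -
      have "b\<^sub>0 \<le> x" using that(1) by (simp add: b_def)
      then show ?thesis using b0(2)[of x v p v' p'] that scale_power_N[OF pos[OF that(1)]] by simp
    qed
    show "((\<lambda>\<tau>. vz k (scale \<tau>)) has_real_derivative tr (scale x) * vz k (scale x) + del (scale x) * pz k (scale x)
      + (gv (scale x) (vz k (scale x), pz k (scale x)) + - d2 k (scale x))) (at x)" if "b < x" for k x
      by (rule approximants_deriv(1)[OF pos[OF that] tame[OF that]])
    show "((\<lambda>\<tau>. pz k (scale \<tau>)) has_real_derivative tr (scale x) * pz k (scale x) + \<epsilon> * del (scale x) * vz k (scale x)
      + (gp (scale x) (vz k (scale x), pz k (scale x)) +
         (cc (scale x) / del (scale x) * - d1 k (scale x) - al (scale x) / del (scale x) * - d2 k (scale x)))) (at x)"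
      if "b < x" for k x
      by (rule approximants_deriv(2)[OF pos[OF that] tame[OF that]])
    show "continuous_on {b<..} (\<lambda>x. gv (scale x) (vz k (scale x), pz k (scale x)) + - d2 k (scale x))" for k
      by (intro continuous_on_add continuous_on_minus gvk s_cont smooth_uz)
    show "continuous_on {b<..} (\<lambda>x. gp (scale x) (vz k (scale x), pz k (scale x)) +
         (cc (scale x) / del (scale x) * - d1 k (scale x) - al (scale x) / del (scale x) * - d2 k (scale x)))" for k
      by (intro continuous_on_add continuous_on_diff continuous_on_mult continuous_on_divide continuous_on_minus gpk s_cont
          smooth_uz smooth_coeffs smooth_derived g_cont(3) del_nz)
    show "(\<lambda>x. gv (scale x) (vz k (scale x), pz k (scale x)) - (gv (scale x) (vz k (scale x), pz k (scale x)) + - d2 k (scale x)))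
        \<in> O(\<lambda>x. x powr - real (Suc (Suc k)))" for k
      using bigo_scale_N[OF d2, of "Suc (Suc k)" k] approx_order(3)[of k] by simp
    show "(\<lambda>x. gp (scale x) (vz k (scale x), pz k (scale x)) - (gp (scale x) (vz k (scale x), pz k (scale x)) +
         (cc (scale x) / del (scale x) * - d1 k (scale x) - al (scale x) / del (scale x) * - d2 k (scale x))))
        \<in> O(\<lambda>x. x powr - real (Suc (Suc k)))" for k
    proof -
      have "(\<lambda>z. cc z / del z * d1 k z - al z / del z * d2 k z) \<in> O[at_right 0](\<lambda>z. z ^ approx_order k)"
        by (rule sum_in_bigo(2)[OF cc_del_bigo[OF d1] al_del_bigo[OF d2]])
      from bigo_scale_N[OF this, of "Suc (Suc k)"] approx_order(3)[of k] show ?thesis by simp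
    qed
    have vk: "vz k \<in> O[at_right 0](\<lambda>z. z ^ (N * 2))" for k
      by (rule bigo_at_right_0_power_mono[OF uz_bigo(4)]) simp
    show "(\<lambda>\<tau>. vz k (scale \<tau>)) \<in> O(\<lambda>x. x powr - real 2)" for k
      by (rule bigo_scale_N[OF vk]) simp
    have uk: "uz k \<in> O[at_right 0](\<lambda>z. z ^ (M + N * 2))" for k
      by (rule bigo_at_right_0_power_mono[OF uz_bigo(3)]) simp
    have pk: "pz k \<in> O[at_right 0](\<lambda>z. z ^ (N * 2))" for k
      unfolding pz_def[abs_def] by (rule sum_in_bigo(2)[OF cc_del_bigo[OF uk] al_del_bigo[OF vk]])
    show "(\<lambda>\<tau>. pz k (scale \<tau>)) \<in> O(\<lambda>x. x powr - real 2)" for k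
      by (rule bigo_scale_N[OF pk]) simp
    fix k m :: nat assume km: "k \<le> m"
    have i: "N * Suc k \<le> approx_order k" by (simp add: approx_order_def add_mult_distrib2)
    have dv: "(\<lambda>z. vz m z - vz k z) \<in> O[at_right 0](\<lambda>z. z ^ approx_order k)"
      by (rule bigo_at_right_0_power_mono[OF uz_bigo(2)[OF km]]) simp
    show "(\<lambda>x. vz m (scale x) - vz k (scale x)) \<in> O(\<lambda>x. x powr - real (Suc k))"
      by (rule bigo_scale_N[OF dv i])
    have dp: "(\<lambda>z. pz m z - pz k z) \<in> O[at_right 0](\<lambda>z. z ^ approx_order k)"
      unfolding pz_diff by (rule sum_in_bigo(2)[OF cc_del_bigo[OF uz_bigo(1)[OF km]] al_del_bigo[OF dv]])
    show "(\<lambda>x. pz m (scale x) - pz k (scale x)) \<in> O(\<lambda>x. x powr - real (Suc k))"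
      by (rule bigo_scale_N[OF dp i])
  qed
  then obtain v p a where a: "b \<le> a"
    and v: "\<And>\<tau>. a < \<tau> \<Longrightarrow> (v has_real_derivative tr (scale \<tau>) * v \<tau> + del (scale \<tau>) * p \<tau> + gv (scale \<tau>) (v \<tau>, p \<tau>)) (at \<tau>)"
    and p: "\<And>\<tau>. a < \<tau> \<Longrightarrow> (p has_real_derivative tr (scale \<tau>) * p \<tau> + \<epsilon> * del (scale \<tau>) * v \<tau> + gp (scale \<tau>) (v \<tau>, p \<tau>)) (at \<tau>)"
    and as: "\<And>k. (\<lambda>\<tau>. v \<tau> - vz k (scale \<tau>)) \<in> O(\<lambda>\<tau>. \<tau> powr (- real k))"
      "\<And>k. (\<lambda>\<tau>. p \<tau> - pz k (scale \<tau>)) \<in> O(\<lambda>\<tau>. \<tau> powr (- real k))"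
    by blast
  define u where "u \<tau> = lift (scale \<tau>) (v \<tau>) (p \<tau>)" for \<tau>
  define R \<Phi> where "R \<tau> = P0 (scale \<tau>) + u \<tau>" and "\<Phi> \<tau> = Q0 (scale \<tau>) + v \<tau>" for \<tau>
  define pp where "pp \<tau> = (cc (scale \<tau>) * u \<tau> - al (scale \<tau>) * v \<tau>) / del (scale \<tau>)" for \<tau>
  have sol: "(R has_real_derivative rhs1 (scale \<tau>) (R \<tau>, \<Phi> \<tau>)) (at \<tau>) \<and>
      (\<Phi> has_real_derivative rhs2 (scale \<tau>) (R \<tau>, \<Phi> \<tau>)) (at \<tau>)" if \<tau>: "a < \<tau>" for \<tau>
  proof -
    have \<tau>b: "b < \<tau>" using \<tau> a by linarith
    note \<tau>0 = pos[OF \<tau>b] and t = tame[OF \<tau>b]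
    note nz = tame_nonzero[OF t]
    have pp_eq: "pp \<tau> = p \<tau>" if "a < \<tau>" for \<tau>
      using lift_inverse(2)[OF tame, of \<tau>] that a by (simp add: pp_def u_def)
    have lift: "lift (scale \<tau>) (v \<tau>) (p \<tau>) = u \<tau>" by (simp add: u_def)
    have "tr (scale \<tau>) * v \<tau> + del (scale \<tau>) * p \<tau> + gv (scale \<tau>) (v \<tau>, p \<tau>)
        = rhs2 (scale \<tau>) (R \<tau>, \<Phi> \<tau>) - dtau Q0 (scale \<tau>)"
    proof -
      have "cc (scale \<tau>) * u \<tau> = del (scale \<tau>) * p \<tau> + al (scale \<tau>) * v \<tau>"
        using nz by (simp add: u_def lift_def)
      then show ?thesis
        by (simp add: gv_def lift rem2_def R_def \<Phi>_def tr_def al_def field_simps)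
    qed
    with v[OF \<tau>] have v': "(v has_real_derivative rhs2 (scale \<tau>) (R \<tau>, \<Phi> \<tau>) - dtau Q0 (scale \<tau>) + 0) (at \<tau>)"
      by simp
    obtain u' where u': "(u has_real_derivative u') (at \<tau>)"
      using lift_deriv[OF \<tau>0 t v[OF \<tau>] p[OF \<tau>]] unfolding u_def[abs_def] by blast
    \<comment> \<open>\<open>e\<close> is the unknown error in the equation for u. The forward
      transformation turns it into cc/del * e in the equation for p, which p already satisfies
      without such a term; as cc/del is nonzero, e = 0.\<close>
    define e where "e = u' - (rhs1 (scale \<tau>) (R \<tau>, \<Phi> \<tau>) - dtau P0 (scale \<tau>))"
    have u'': "(u has_real_derivative rhs1 (scale \<tau>) (R \<tau>, \<Phi> \<tau>) - dtau P0 (scale \<tau>) + e) (at \<tau>)"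
      using u' by (simp add: e_def)
    from transform_deriv(2)[OF \<tau>0 t u''[unfolded R_def \<Phi>_def] v'[unfolded R_def \<Phi>_def] pp_def]
    have "(pp has_real_derivative tr (scale \<tau>) * p \<tau> + \<epsilon> * del (scale \<tau>) * v \<tau> + (gp (scale \<tau>) (v \<tau>, p \<tau>) +
        cc (scale \<tau>) / del (scale \<tau>) * e)) (at \<tau>)"
      by (simp add: pp_eq[OF \<tau>])
    moreover have "(pp has_real_derivative tr (scale \<tau>) * p \<tau> + \<epsilon> * del (scale \<tau>) * v \<tau> + gp (scale \<tau>) (v \<tau>, p \<tau>)) (at \<tau>)"
      by (rule DERIV_cong_ev[THEN iffD2, OF refl _ refl p[OF \<tau>]])
        (use eventually_gt_at_top \<tau> pp_eq in \<open>auto intro: eventually_mono[OF eventually_nhds_in_open[of "{a<..}"]]\<close>)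
    ultimately have "cc (scale \<tau>) / del (scale \<tau>) * e = 0" using DERIV_unique by fastforce
    then have "e = 0" using nz by auto
    then have "(R has_real_derivative rhs1 (scale \<tau>) (R \<tau>, \<Phi> \<tau>)) (at \<tau>)"
      using DERIV_add[OF scale_deriv[OF smooth_base(1) \<tau>0] u''] unfolding R_def[abs_def] by simp
    moreover have "(\<Phi> has_real_derivative rhs2 (scale \<tau>) (R \<tau>, \<Phi> \<tau>)) (at \<tau>)"
      using DERIV_add[OF scale_deriv[OF smooth_base(2) \<tau>0] v'] unfolding \<Phi>_def[abs_def] by simp
    ultimately show ?thesis by blast
  qed
  have asym: "(\<lambda>\<tau>. R \<tau> - approx1 rc m (scale \<tau>)) \<in> O(\<lambda>\<tau>. \<tau> powr (- real (M + m) / real N)) \<and>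
      (\<lambda>\<tau>. \<Phi> \<tau> - approx2 pc m (scale \<tau>)) \<in> O(\<lambda>\<tau>. \<tau> powr (- real (m + 1) / real N))" for m
  proof -
    \<comment> \<open>Then \<tau>^(-k) lies below both required orders, (M + m)/N and (m +
      1)/N.\<close>
    define k where "k = M + m + 1"
    have powr_le: "(\<lambda>\<tau>::real. \<tau> powr (- real k)) \<in> O(\<lambda>\<tau>. \<tau> powr (- real j / real N))" if "j \<le> k" for j
    proof (rule bigoI[of _ 1])
      have "real j / real N \<le> real j / 1" using N_pos by (intro divide_left_mono) auto
      then have jk: "- real k \<le> - real j / real N" using that by simp
      show "\<forall>\<^sub>F \<tau> in at_top. norm (\<tau> powr (- real k)) \<le> 1 * norm (\<tau> powr (- real j / real N))"
        using eventually_ge_at_top[of 1]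
      proof eventually_elim
        case (elim \<tau>)
        then show ?case using powr_mono[OF jk elim] by simp
      qed
    qed
    have mk: "m \<le> approx_order k"
    proof -
      have "1 * m \<le> N * (k + 4)" using N_pos by (intro mult_mono) (auto simp: k_def)
      then show ?thesis by (simp add: approx_order_def)
    qed
    have "(\<lambda>\<tau>. approx2 pc (approx_order k) (scale \<tau>) - approx2 pc m (scale \<tau>)) \<in> O(\<lambda>\<tau>. \<tau> powr (- real (m + 1) / real N))"
      by (rule bigo_scale[OF approx2_diff_bigo[OF mk]])
    note d\<Phi> = sum_in_bigo(1)[OF landau_o.big_trans[OF as(1)[of k] powr_le[of "m + 1"]] this]
    have e2: "\<Phi> \<tau> - approx2 pc m (scale \<tau>) =
        (v \<tau> - vz k (scale \<tau>)) + (approx2 pc (approx_order k) (scale \<tau>) - approx2 pc m (scale \<tau>))" for \<tau>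
      by (simp add: \<Phi>_def vz_def)
    have 2: "(\<lambda>\<tau>. \<Phi> \<tau> - approx2 pc m (scale \<tau>)) \<in> O(\<lambda>\<tau>. \<tau> powr (- real (m + 1) / real N))"
      unfolding e2 by (rule d\<Phi>) (simp add: k_def)
    have "(\<lambda>\<tau>. u \<tau> - uz k (scale \<tau>)) \<in> O(\<lambda>\<tau>. \<tau> powr (- real k))"
    proof (rule bigo_const_cmult)
      show "\<forall>\<^sub>F \<tau> in at_top. \<bar>u \<tau> - uz k (scale \<tau>)\<bar> \<le> C * (\<bar>v \<tau> - vz k (scale \<tau>)\<bar> + \<bar>p \<tau> - pz k (scale \<tau>)\<bar>)"
        using eventually_gt_at_top[of b]
      proof eventually_elim
        case (elim \<tau>)
        note t = tame[OF elim]
        let ?z = "scale \<tau>" let ?dv = "v \<tau> - vz k (scale \<tau>)" let ?dp = "p \<tau> - pz k (scale \<tau>)"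
        have "uz k ?z = lift ?z (vz k ?z) (pz k ?z)"
          using lift_inverse(1)[OF t, of "vz k ?z" "uz k ?z"] by (simp add: pz_def diff_divide_distrib)
        then have e: "u \<tau> - uz k ?z = del ?z / cc ?z * ?dp + al ?z / cc ?z * ?dv"
          using tame_nonzero[OF t] by (simp add: u_def lift_def field_simps)
        have "\<bar>del ?z / cc ?z * ?dp\<bar> \<le> C * \<bar>?dp\<bar>" "\<bar>al ?z / cc ?z * ?dv\<bar> \<le> C * \<bar>?dv\<bar>"
          unfolding abs_mult using t by (intro mult_right_mono; simp add: tame_def)+
        then show ?case
          using abs_triangle_ineq[of "del ?z / cc ?z * ?dp" "al ?z / cc ?z * ?dv"] unfolding e distrib_left by linarith
      qed
    qed (rule as)+
    note du = landau_o.big_trans[OF this powr_le[of "M + m"]]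
    have "(\<lambda>\<tau>. approx1 rc (approx_order k) (scale \<tau>) - approx1 rc m (scale \<tau>)) \<in> O(\<lambda>\<tau>. \<tau> powr (- real (M + m) / real N))"
      by (rule bigo_scale[OF approx1_diff_bigo[OF mk]])
    note dR = sum_in_bigo(1)[OF du this]
    have e1: "R \<tau> - approx1 rc m (scale \<tau>) =
        (u \<tau> - uz k (scale \<tau>)) + (approx1 rc (approx_order k) (scale \<tau>) - approx1 rc m (scale \<tau>))" for \<tau>
      by (simp add: R_def uz_def)
    have 1: "(\<lambda>\<tau>. R \<tau> - approx1 rc m (scale \<tau>)) \<in> O(\<lambda>\<tau>. \<tau> powr (- real (M + m) / real N))"
      unfolding e1 by (rule dR) (simp add: k_def)
    from 1 2 show ?thesis by blast
  qed
  have "0 < a" using a b by linarith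
  then show ?thesis using sol asym by blast
qed

end

section \<open>The leading coefficients of the averaged system\<close>

lemma filterlim_powr_at_top: "filterlim (\<lambda>t. t powr c) at_top at_top" if "0 < c" for c :: real
proof (rule filterlim_cong[THEN iffD1, OF refl refl])
  show "filterlim (\<lambda>t. exp (c * ln t)) at_top at_top"
    by (intro filterlim_compose[OF exp_at_top] filterlim_tendsto_pos_mult_at_top[OF tendsto_const that] ln_at_top)
  show "\<forall>\<^sub>F t in at_top. exp (c * ln t) = t powr c"
    using eventually_gt_at_top[of 0] by eventually_elim (simp add: powr_def)
qed

lemma power_expansion_ratio_limit:
  assumes "power_expansion \<alpha> d F c" "0 < d"
  shows "((\<lambda>x. F x / x powr \<alpha>) \<longlongrightarrow> c 0) at_top"
proof -
  obtain C where C: "\<forall>\<^sub>F x in at_top. \<bar>F x - (\<Sum>k<1. c k * x powr (\<alpha> - real k / d))\<bar> \<le> C * x powr (\<alpha> - real 1 / d)"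
    using assms(1) unfolding power_expansion_def by blast
  have "((\<lambda>x. F x / x powr \<alpha> - c 0) \<longlongrightarrow> 0) at_top"
  proof (rule Lim_null_comparison)
    show "((\<lambda>x. C * x powr (- (1 / d))) \<longlongrightarrow> 0) at_top"
      using \<open>0 < d\<close> by (intro tendsto_mult_right_zero tendsto_neg_powr filterlim_ident) auto
    show "\<forall>\<^sub>F x in at_top. norm (F x / x powr \<alpha> - c 0) \<le> C * x powr (- (1 / d))"
      using C eventually_gt_at_top[of 0]
    proof eventually_elim
      case (elim x)
      have "F x / x powr \<alpha> - c 0 = (F x - c 0 * x powr \<alpha>) / x powr \<alpha>" using elim by (simp add: field_simps)
      then have "norm (F x / x powr \<alpha> - c 0) = \<bar>F x - c 0 * x powr \<alpha>\<bar> / x powr \<alpha>" by simp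
      also have "\<dots> \<le> C * x powr (\<alpha> - 1 / d) / x powr \<alpha>" using elim by (intro divide_right_mono) auto
      also have "\<dots> = C * x powr (- (1 / d))" using elim by (simp add: powr_diff powr_minus_divide)
      finally show ?case .
    qed
  qed
  then show ?thesis by (simp add: LIM_zero_iff)
qed

lemma power_expansion_limit:
  assumes "power_expansion 0 d F c" "0 < d"
  shows "(F \<longlongrightarrow> c 0) at_top"
proof (rule Lim_transform_eventually[OF power_expansion_ratio_limit[OF assms]])
  show "\<forall>\<^sub>F x in at_top. F x / x powr 0 = F x"
    using eventually_gt_at_top[of 0] by eventually_elim simp
qed

lemma uniform_power_expansionD:
  "uniform_power_expansion \<alpha> d P F c \<Longrightarrow> z \<in> P \<Longrightarrow> power_expansion \<alpha> d (F z) (\<lambda>k. c k z)"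
  unfolding uniform_power_expansion_def power_expansion_def
  by (elim all_forward ex_forward eventually_mono) blast

text \<open>A first nonzero coefficient of order k < m would dominate both the next remainder and F
  itself.\<close>

lemma power_expansion_coeff_zero:
  assumes exp: "power_expansion 0 d F c" "0 < d" and F: "F \<in> O(\<lambda>x. x powr (- real m / d))" and "k < m"
  shows "c k = 0"
  using \<open>k < m\<close>
proof (induction k rule: less_induct)
  case (less k)
  obtain C where C: "\<forall>\<^sub>F x in at_top. \<bar>F x - (\<Sum>i<Suc k. c i * x powr (0 - real i / d))\<bar> \<le> C * x powr (0 - real (Suc k) / d)"
    using exp(1) unfolding power_expansion_def by blast
  obtain B where B: "\<forall>\<^sub>F x in at_top. norm (F x) \<le> B * norm (x powr (- real m / d))"
    using F by (elim landau_o.bigE) auto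
  have s: "(\<Sum>i<Suc k. c i * x powr (0 - real i / d)) = c k * x powr (- real k / d)" for x
    using less by (simp add: sum.neutral)
  have "((\<lambda>x. (\<bar>B\<bar> + C) * x powr (- (1 / d))) \<longlongrightarrow> 0) at_top"
    using \<open>0 < d\<close> by (intro tendsto_mult_right_zero tendsto_neg_powr filterlim_ident) auto
  moreover have "\<forall>\<^sub>F x in at_top. \<bar>c k\<bar> \<le> (\<bar>B\<bar> + C) * x powr (- (1 / d))"
    using C B eventually_ge_at_top[of 1]
  proof eventually_elim
    case (elim x)
    have e: "- real m / d \<le> - real (Suc k) / d" using less.prems \<open>0 < d\<close> by (intro divide_right_mono) auto
    have "norm (F x) \<le> \<bar>B\<bar> * x powr (- real m / d)" 
      using elim(2) mult_right_mono[OF abs_ge_self[of B], of "x powr (- real m / d)"] by simp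
    also have "\<dots> \<le> \<bar>B\<bar> * x powr (- real (Suc k) / d)"
      using elim(3) e by (intro mult_left_mono powr_mono) auto
    finally have "\<bar>F x\<bar> \<le> \<bar>B\<bar> * x powr (- real (Suc k) / d)" by simp
    moreover have "\<bar>F x - c k * x powr (- real k / d)\<bar> \<le> C * x powr (- real (Suc k) / d)"
      using elim(1)[unfolded s] by (simp only: diff_0 minus_divide_left)
    ultimately have "\<bar>c k * x powr (- real k / d)\<bar> \<le> \<bar>B\<bar> * x powr (- real (Suc k) / d) + C * x powr (- real (Suc k) / d)"
      by linarith
    then have "\<bar>c k\<bar> * x powr (- real k / d) \<le> (\<bar>B\<bar> + C) * x powr (- real (Suc k) / d)"
      by (simp add: abs_mult distrib_right)
    also have "- real (Suc k) / d = - real k / d + - (1 / d)" by (simp add: add_divide_distrib diff_divide_distrib)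
    also have "(\<bar>B\<bar> + C) * x powr (- real k / d + - (1 / d)) = ((\<bar>B\<bar> + C) * x powr (- (1 / d))) * x powr (- real k / d)"
      by (simp only: powr_add mult_ac)
    finally show ?case using elim(3) by simp
  qed
  ultimately have "\<bar>c k\<bar> \<le> 0" by (intro tendsto_lowerbound[of _ 0]) auto
  then show ?case by simp
qed

text \<open>After factoring out the i-th power of x / D^\<alpha> and the j-th of y / D^\<beta>, a
  power of D with nonpositive exponent is left; hence the case distinction in the limit.\<close>

lemma monomial_limit:
  fixes D x y :: "real \<Rightarrow> real"
  assumes D: "filterlim D at_top at_top"
    and x: "((\<lambda>t. x t / D t powr \<alpha>) \<longlongrightarrow> x0) at_top" and y: "((\<lambda>t. y t / D t powr \<beta>) \<longlongrightarrow> y0) at_top"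
    and le: "real i * \<alpha> + real j * \<beta> \<le> e"
  shows "((\<lambda>t. x t ^ i * y t ^ j / D t powr e) \<longlongrightarrow> (if real i * \<alpha> + real j * \<beta> = e then x0 ^ i * y0 ^ j else 0)) at_top"
proof -
  define d where "d = real i * \<alpha> + real j * \<beta> - e"
  have "((\<lambda>t. (x t / D t powr \<alpha>) ^ i * (y t / D t powr \<beta>) ^ j * D t powr d) \<longlongrightarrow>
      x0 ^ i * y0 ^ j * (if d = 0 then 1 else 0)) at_top"
  proof (intro tendsto_mult tendsto_power x y)
    show "((\<lambda>t. D t powr d) \<longlongrightarrow> (if d = 0 then 1 else 0)) at_top"
    proof (cases "d = 0")
      case True
      have "\<forall>\<^sub>F t in at_top. 1 = D t powr d"
        using eventually_compose_filterlim[OF eventually_gt_at_top[of 0] D] by eventually_elim (simp add: True)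
      from Lim_transform_eventually[OF tendsto_const this] show ?thesis using True by simp
    next
      case False
      then have "d < 0" using le by (simp add: d_def)
      then show ?thesis using False by (auto intro!: tendsto_neg_powr D)
    qed
  qed
  moreover have "\<forall>\<^sub>F t in at_top. (x t / D t powr \<alpha>) ^ i * (y t / D t powr \<beta>) ^ j * D t powr d = x t ^ i * y t ^ j / D t powr e"
    using eventually_compose_filterlim[OF eventually_gt_at_top[of 0] D]
  proof eventually_elim
    case (elim t)
    have "(D t powr \<alpha>) ^ i = D t powr (real i * \<alpha>)" "(D t powr \<beta>) ^ j = D t powr (real j * \<beta>)"
      using elim by (simp_all add: powr_power mult.commute)
    moreover have "D t powr d = D t powr (real i * \<alpha>) * D t powr (real j * \<beta>) / D t powr e"
      by (simp add: d_def powr_diff powr_add)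
    ultimately show ?case using elim by (simp add: power_divide)
  qed
  ultimately have "((\<lambda>t. x t ^ i * y t ^ j / D t powr e) \<longlongrightarrow> x0 ^ i * y0 ^ j * (if d = 0 then 1 else 0)) at_top"
    by (rule Lim_transform_eventually)
  then show ?thesis by (simp add: d_def split: if_splits)
qed

text \<open>The expansion in t is evaluated where x and y grow, and its remainder carries the weight
  (1 + |x| + |y|)^m. It is taken so far that t^(-n/q) beats D^(m/2 - e). Of the finitely many terms
  before, those with k >= 1 lose a power of t, and in the term k = 0 only monomials of exponent
  exactly e survive.\<close>

lemma force_limit:
  fixes D x y :: "real \<Rightarrow> real" and A :: "nat \<Rightarrow> nat \<Rightarrow> nat \<Rightarrow> real \<Rightarrow> real"
  assumes exp: "force_expansion q f (\<lambda>k x y S. \<Sum>i\<le>p. \<Sum>j<J. A k i j S * x ^ i * y ^ j)"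
    and van: "\<And>k i j S. p < i + j \<Longrightarrow> A k i j S = 0" and q: "0 < q" and h: "1 \<le> h"
    and D: "filterlim D at_top at_top"
    and growth: "\<And>c. \<exists>n. ((\<lambda>t. t powr (- real n / real q) * D t powr c) \<longlongrightarrow> 0) at_top"
    and x: "((\<lambda>t. x t / D t powr (1 / (2 * real h))) \<longlongrightarrow> x0) at_top" and y: "((\<lambda>t. y t / D t powr (1 / 2)) \<longlongrightarrow> y0) at_top"
    and e: "\<And>i j. i + j \<le> p \<Longrightarrow> j < J \<Longrightarrow> real i * (1 / (2 * real h)) + real j * (1 / 2) \<le> e"
  shows "((\<lambda>t. f (x t) (y t) S t / D t powr e) \<longlongrightarrow>
    (\<Sum>i\<le>p. \<Sum>j<J. A 0 i j S * (if real i * (1 / (2 * real h)) + real j * (1 / 2) = e then x0 ^ i * y0 ^ j else 0))) at_top"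
proof -
  define c where "c k t = (\<Sum>i\<le>p. \<Sum>j<J. A k i j S * x t ^ i * y t ^ j)" for k t
  define l where "l k = (\<Sum>i\<le>p. \<Sum>j<J. A k i j S * (if real i * (1 / (2 * real h)) + real j * (1 / 2) = e then x0 ^ i * y0 ^ j else 0))" for k
  have cl: "((\<lambda>t. c k t / D t powr e) \<longlongrightarrow> l k) at_top" for k
  proof -
    have "((\<lambda>t. \<Sum>i\<le>p. \<Sum>j<J. A k i j S * (x t ^ i * y t ^ j / D t powr e)) \<longlongrightarrow> l k) at_top"
      unfolding l_def
    proof (intro tendsto_sum)
      fix i j assume "j \<in> {..<J}"
      show "((\<lambda>t. A k i j S * (x t ^ i * y t ^ j / D t powr e)) \<longlongrightarrow>
        A k i j S * (if real i * (1 / (2 * real h)) + real j * (1 / 2) = e then x0 ^ i * y0 ^ j else 0)) at_top"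
      proof (cases "i + j \<le> p")
        case True
        with \<open>j \<in> {..<J}\<close> show ?thesis by (intro tendsto_mult tendsto_const monomial_limit[OF D x y e]) auto
      next
        case False
        then show ?thesis using van[of i j k S] by simp
      qed
    qed
    then show ?thesis by (simp add: c_def sum_divide_distrib mult.assoc)
  qed
  obtain m where m: "uniform_power_expansion 0 (real q) UNIV (\<lambda>(x, y, S) t. f x y S t / (1 + \<bar>x\<bar> + \<bar>y\<bar>) ^ m)
        (\<lambda>k (x, y, S). (\<Sum>i\<le>p. \<Sum>j<J. A k i j S * x ^ i * y ^ j) / (1 + \<bar>x\<bar> + \<bar>y\<bar>) ^ m)"
    using exp unfolding force_expansion_def by blast
  obtain n where n: "((\<lambda>t. t powr (- real n / real q) * D t powr (real m / 2 - e)) \<longlongrightarrow> 0) at_top" using growth by blast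
  define w where "w t = 1 + \<bar>x t\<bar> + \<bar>y t\<bar>" for t
  obtain C where "\<forall>\<^sub>F t in at_top. \<forall>z\<in>UNIV. \<bar>(case z of (x, y, S) \<Rightarrow> \<lambda>t. f x y S t / (1 + \<bar>x\<bar> + \<bar>y\<bar>) ^ m) t -
      (\<Sum>k<Suc n. (case z of (x, y, S) \<Rightarrow> (\<Sum>i\<le>p. \<Sum>j<J. A k i j S * x ^ i * y ^ j) / (1 + \<bar>x\<bar> + \<bar>y\<bar>) ^ m) * t powr (0 - real k / real q))\<bar>
      \<le> C * t powr (0 - real (Suc n) / real q)"
    using m unfolding uniform_power_expansion_def by blast
  then have C: "\<forall>\<^sub>F t in at_top. \<bar>f (x t) (y t) S t / w t ^ m - (\<Sum>k<Suc n. c k t / w t ^ m * t powr (0 - real k / real q))\<bar>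
      \<le> C * t powr (0 - real (Suc n) / real q)"
  proof eventually_elim
    case (elim t)
    then show ?case unfolding w_def c_def by (elim ballE[of _ _ "(x t, y t, S)"]) auto
  qed
  define g where "g t = (\<Sum>k<Suc n. t powr (- real k / real q) * (c k t / D t powr e))" for t
  have g: "(g \<longlongrightarrow> l 0) at_top"
  proof -
    have "((\<lambda>t. \<Sum>k<Suc n. t powr (- real k / real q) * (c k t / D t powr e)) \<longlongrightarrow> (\<Sum>k<Suc n. (if k = 0 then 1 else 0) * l k)) at_top"
    proof (intro tendsto_sum tendsto_mult cl)
      fix k
      show "((\<lambda>t. t powr (- real k / real q)) \<longlongrightarrow> (if k = 0 then 1 else 0)) at_top"
      proof (cases "k = 0")
        case True
        have "\<forall>\<^sub>F t in at_top. 1 = t powr (- real k / real q)"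
          using eventually_gt_at_top[of 0] by eventually_elim (simp add: True)
        from Lim_transform_eventually[OF tendsto_const this] show ?thesis using True by simp
      next
        case False
        then show ?thesis using q by (auto intro!: tendsto_neg_powr filterlim_ident simp: divide_neg_pos)
      qed
    qed
    moreover have "(\<Sum>k<Suc n. (if k = 0 then 1 else 0) * l k) = l 0"
      by (subst sum.mono_neutral_right[of _ "{0}"]) auto
    ultimately show ?thesis by (simp only: g_def[abs_def])
  qed
  have Dpos: "\<forall>\<^sub>F t in at_top. 0 < D t" by (rule eventually_compose_filterlim[OF eventually_gt_at_top[of 0] D])
  \<comment> \<open>The weight has at most the size D^(1/2) of y, since h >= 1; in the borderline
    case h = 1 also x contributes.\<close>
  have w_lim: "((\<lambda>t. w t / D t powr (1 / 2)) \<longlongrightarrow> 0 + (if 1 / (2 * real h) = 1 / 2 then \<bar>x0\<bar> else 0) + \<bar>y0\<bar>) at_top"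
  proof -
    have "((\<lambda>t. D t powr (- (1 / 2))) \<longlongrightarrow> 0) at_top" by (intro tendsto_neg_powr D) simp
    moreover have "((\<lambda>t. \<bar>x t ^ 1 * y t ^ 0 / D t powr (1 / 2)\<bar>) \<longlongrightarrow> \<bar>if real 1 * (1 / (2 * real h)) + real 0 * (1 / 2) = 1 / 2 then x0 ^ 1 * y0 ^ 0 else 0\<bar>) at_top"
      using h by (intro tendsto_rabs monomial_limit[OF D x y]) (auto simp: field_simps)
    moreover have "((\<lambda>t. \<bar>y t / D t powr (1 / 2)\<bar>) \<longlongrightarrow> \<bar>y0\<bar>) at_top" by (intro tendsto_rabs y)
    ultimately have "((\<lambda>t. D t powr (- (1 / 2)) + \<bar>x t ^ 1 * y t ^ 0 / D t powr (1 / 2)\<bar> + \<bar>y t / D t powr (1 / 2)\<bar>) \<longlongrightarrow>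
       0 + \<bar>if real 1 * (1 / (2 * real h)) + real 0 * (1 / 2) = 1 / 2 then x0 ^ 1 * y0 ^ 0 else 0\<bar> + \<bar>y0\<bar>) at_top"
      by (intro tendsto_add)
    moreover have "D t powr (- (1 / 2)) + \<bar>x t ^ 1 * y t ^ 0 / D t powr (1 / 2)\<bar> + \<bar>y t / D t powr (1 / 2)\<bar> = w t / D t powr (1 / 2)" for t
      by (simp add: w_def add_divide_distrib powr_minus_divide)
    ultimately show ?thesis by (auto split: if_splits)
  qed
  have "((\<lambda>t. f (x t) (y t) S t / D t powr e - g t) \<longlongrightarrow> 0) at_top"
  proof (rule Lim_null_comparison)
    have "((\<lambda>t. C * (w t / D t powr (1 / 2)) ^ m * (t powr (- real n / real q) * D t powr (real m / 2 - e)) * t powr (- (1 / real q))) \<longlongrightarrow>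
       C * (0 + (if 1 / (2 * real h) = 1 / 2 then \<bar>x0\<bar> else 0) + \<bar>y0\<bar>) ^ m * 0 * 0) at_top"
      using q by (intro tendsto_mult tendsto_const tendsto_power w_lim n tendsto_neg_powr filterlim_ident) auto
    then show "((\<lambda>t. C * (w t / D t powr (1 / 2)) ^ m * (t powr (- real n / real q) * D t powr (real m / 2 - e)) * t powr (- (1 / real q))) \<longlongrightarrow> 0) at_top"
      by simp
    show "\<forall>\<^sub>F t in at_top. norm (f (x t) (y t) S t / D t powr e - g t) \<le>
      C * (w t / D t powr (1 / 2)) ^ m * (t powr (- real n / real q) * D t powr (real m / 2 - e)) * t powr (- (1 / real q))"
      using C Dpos eventually_gt_at_top[of 0]
    proof eventually_elim
      case (elim t)
      have w0: "0 < w t" by (simp add: w_def add_pos_nonneg)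
      define W where "W = w t ^ m / D t powr e"
      have W0: "0 < W" using w0 elim by (simp add: W_def)
      have "f (x t) (y t) S t / D t powr e - g t =
         W * (f (x t) (y t) S t / w t ^ m - (\<Sum>k<Suc n. c k t / w t ^ m * t powr (0 - real k / real q)))"
      proof -
        have "f (x t) (y t) S t / D t powr e = W * (f (x t) (y t) S t / w t ^ m)" using w0 by (simp add: W_def)
        moreover have "g t = W * (\<Sum>k<Suc n. c k t / w t ^ m * t powr (0 - real k / real q))"
          unfolding g_def sum_distrib_left using w0 by (intro sum.cong refl) (simp add: W_def)
        ultimately show ?thesis by (simp only: right_diff_distrib)
      qed
      then have "norm (f (x t) (y t) S t / D t powr e - g t) =
         W * \<bar>f (x t) (y t) S t / w t ^ m - (\<Sum>k<Suc n. c k t / w t ^ m * t powr (0 - real k / real q))\<bar>"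
        using W0 by (simp only: real_norm_def abs_mult abs_of_pos)
      moreover have "\<dots> \<le> W * (C * t powr (0 - real (Suc n) / real q))"
        using W0 elim(1) by (intro mult_left_mono) auto
      moreover have "W * (C * t powr (0 - real (Suc n) / real q)) =
        C * (w t / D t powr (1 / 2)) ^ m * (t powr (- real n / real q) * D t powr (real m / 2 - e)) * t powr (- (1 / real q))"
      proof -
        have 1: "t powr (0 - real (Suc n) / real q) = t powr (- real n / real q) * t powr (- (1 / real q))"
        proof -
          have "0 - real (Suc n) / real q = - real n / real q + - (1 / real q)" by (simp add: add_divide_distrib)
          then show ?thesis by (simp only: powr_add)
        qed
        have "(D t powr (1 / 2)) ^ m = D t powr (real m / 2)" using elim(2) by (simp add: powr_power)
        then have 2: "W = (w t / D t powr (1 / 2)) ^ m * D t powr (real m / 2 - e)"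
          using elim(2) by (simp add: W_def power_divide powr_diff)
        show ?thesis unfolding 1 2 by (simp only: mult_ac)
      qed
      ultimately show ?case by linarith
    qed
  qed
  from tendsto_add[OF this g] have "((\<lambda>t. f (x t) (y t) S t / D t powr e) \<longlongrightarrow> l 0) at_top" by simp
  then show ?thesis by (simp only: l_def)
qed

text \<open>Integrability has to be proved as well, because a divergent integral would have the
  value 0. The integrand is dominated by 1 / sqrt(1 - \<xi>^2), the derivative of arcsin, and lies
  above 1 - \<xi>^2, whose integral is 4/3. At \<plusminus>1 division by zero gives 0, and both
  comparisons still hold.\<close>

lemma frequency_integral_pos:
  assumes "1 \<le> h"
  shows "0 < integral {-1..1} (\<lambda>\<xi>::real. 1 / sqrt (1 - \<xi> ^ (2 * h)))"
proof -
  define F where "F \<xi> = 1 / sqrt (1 - \<xi> ^ (2 * h))" for \<xi> :: real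
  have pw: "\<xi> ^ (2 * h) \<le> \<xi>\<^sup>2" if "\<xi> \<in> {-1..1}" for \<xi> :: real
  proof -
    have "\<xi>\<^sup>2 \<le> 1" using that by (auto simp: abs_square_le_1 abs_le_iff)
    then have "(\<xi>\<^sup>2) ^ h \<le> (\<xi>\<^sup>2) ^ 1" using assms by (intro power_decreasing) auto
    then show ?thesis by (simp add: power_mult)
  qed
  have sq: "\<xi>\<^sup>2 < 1" if "\<xi> \<in> {-1<..<1}" for \<xi> :: real using that by (auto simp: abs_square_less_1)
  have F_ge: "1 - \<xi>\<^sup>2 \<le> F \<xi>" if \<xi>: "\<xi> \<in> {-1..1}" for \<xi>
  proof (cases "\<xi> \<in> {-1<..<1}")
    case True
    have "0 < 1 - \<xi> ^ (2 * h)" using pw[OF \<xi>] sq[OF True] by linarith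
    moreover have "0 \<le> \<xi> ^ (2 * h)" by (simp add: power_mult)
    ultimately have "sqrt (1 - \<xi> ^ (2 * h)) \<le> 1" "0 < sqrt (1 - \<xi> ^ (2 * h))" by auto
    then have "1 \<le> F \<xi>" by (simp add: F_def)
    then show ?thesis using zero_le_power2[of \<xi>] by linarith
  next
    case False
    then have "\<xi> = 1 \<or> \<xi> = -1" using \<xi> by auto
    then show ?thesis by (auto simp: F_def power_mult)
  qed
  have F_le: "norm (F \<xi>) \<le> 1 / sqrt (1 - \<xi>\<^sup>2)" if \<xi>: "\<xi> \<in> {-1..1}" for \<xi>
  proof (cases "\<xi> \<in> {-1<..<1}")
    case True
    have "0 < 1 - \<xi>\<^sup>2" "1 - \<xi>\<^sup>2 \<le> 1 - \<xi> ^ (2 * h)" using pw[OF \<xi>] sq[OF True] by auto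
    then have "1 / sqrt (1 - \<xi> ^ (2 * h)) \<le> 1 / sqrt (1 - \<xi>\<^sup>2)" by (intro divide_left_mono mult_pos_pos) auto
    moreover have "0 \<le> F \<xi>" using \<open>0 < 1 - \<xi>\<^sup>2\<close> \<open>1 - \<xi>\<^sup>2 \<le> 1 - \<xi> ^ (2 * h)\<close> by (simp add: F_def)
    ultimately show ?thesis by (simp add: F_def)
  next
    case False
    then have "\<xi> = 1 \<or> \<xi> = -1" using \<xi> by auto
    then show ?thesis by (auto simp: F_def power_mult)
  qed
  have arc: "((\<lambda>\<xi>. 1 / sqrt (1 - \<xi>\<^sup>2)) has_integral (arcsin 1 - arcsin (-1))) {-1..1}"
  proof (rule fundamental_theorem_of_calculus_interior)
    show "continuous_on {-1..1} arcsin" by (rule continuous_on_arcsin')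
    show "(arcsin has_vector_derivative 1 / sqrt (1 - \<xi>\<^sup>2)) (at \<xi>)" if "\<xi> \<in> {-1<..<1}" for \<xi>
      using DERIV_arcsin[of \<xi>] that by (simp add: has_real_derivative_iff_has_vector_derivative[symmetric] inverse_eq_divide)
  qed simp
  have "F integrable_on {-1..1}"
  proof (rule measurable_bounded_by_integrable_imp_integrable)
    have "F \<in> borel_measurable borel" unfolding F_def by measurable
    then show "F \<in> borel_measurable (lebesgue_on {-1..1})"
      by (intro measurable_restrict_space1 measurable_completion) simp
    show "(\<lambda>\<xi>. 1 / sqrt (1 - \<xi>\<^sup>2)) integrable_on {-1..1}" using arc by blast
  qed (use F_le in auto)
  moreover have low: "((\<lambda>\<xi>. 1 - \<xi>\<^sup>2) has_integral ((1 - 1 ^ 3 / 3) - (- 1 - (- 1) ^ 3 / 3))) {-1..1::real}"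
    by (rule fundamental_theorem_of_calculus)
      (auto intro!: derivative_eq_intros simp: has_real_derivative_iff_has_vector_derivative[symmetric])
  ultimately have "((1 - 1 ^ 3 / 3) - (- 1 - (- 1) ^ 3 / 3)) \<le> integral {-1..1} F"
    by (intro has_integral_le[OF low integrable_integral]) (use F_ge in auto)
  then show ?thesis by (simp add: F_def[abs_def])
qed

section \<open>Growth of the resonant energy\<close>

context resonant_energy
begin

text \<open>\<open>\<beta>\<close> is the growth exponent of the driving frequency in t,
  \<open>\<gamma>\<close> that of the oscillator frequency in the energy; resonance makes the energy
  grow like t^(\<beta>/\<gamma>).\<close>

definition "\<beta> = real b / real q"
definition "\<gamma> = (real h - 1) / (2 * real h)"

lemma q_pos: "0 < q" using b_bounds by linarith
lemma beta_pos: "0 < \<beta>" using b_bounds q_pos by (simp add: \<beta>_def)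
lemma gamma_pos: "0 < \<gamma>" using h_ge_2 by (simp add: \<gamma>_def)
lemma h_pos: "0 < real h" using h_ge_2 by simp
lemma nu_eq: "nu = 1 + \<beta>" by (simp add: nu_def mu_def \<beta>_def diff_divide_distrib)
lemma mu_eq: "2 * mu + 1 - nu = - \<sigma>" by (simp add: nu_def)
lemma vartheta_pos: "0 < vartheta" using s_pos beta_pos by (simp add: vartheta_def \<beta>_def add_pos_pos)

lemma omega_coeff_pos: "0 < \<omega>c 0"
proof -
  have "0 < integral {-1..1} (\<lambda>\<xi>::real. 1 / sqrt (1 - \<xi> ^ (2 * h)))"
    using h_ge_2 by (intro frequency_integral_pos) simp
  moreover have "0 < (2 * real h) powr (1 / (2 * real h))" using h_pos by simp
  ultimately show ?thesis unfolding omega_leading by simp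
qed

lemma deriv_phase: "0 < t \<Longrightarrow> deriv phase t = vartheta * t powr \<beta>"
  by (intro DERIV_imp_deriv)
    (auto simp: phase_def[abs_def] vartheta_def \<beta>_def intro!: derivative_eq_intros)

lemma omega_I: "t\<^sub>1 \<le> t \<Longrightarrow> omega (I\<^sub>r\<^sub>e\<^sub>s t) = vartheta / real \<kappa> * t powr \<beta>"
  using I_resonance deriv_phase t1_pos by simp

lemma omega_mono: 
  assumes "E\<^sub>1 \<le> E" "E\<^sub>0 < E" "E \<le> E'"
  shows "omega E \<le> omega E'"
proof (rule DERIV_nonneg_imp_nondecreasing[OF assms(3)])
  fix x assume x: "E \<le> x" "x \<le> E'"
  then have "0 < deriv omega x" using assms by (intro omega_deriv_pos) auto
  moreover have "omega field_differentiable at x"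
  proof -
    have "ck_on (Suc 0) {E\<^sub>0<..} T" using T_smooth unfolding smooth_on_def by blast
    then have "T differentiable (at x)" using x assms by auto
    then have "T field_differentiable at x"
      unfolding field_differentiable_def by (metis real_differentiableE)
    moreover have "T x \<noteq> 0" using T_pos[of x] x assms by auto
    ultimately show ?thesis
      unfolding omega_def[abs_def] by (intro field_differentiable_divide field_differentiable_const)
  qed
  ultimately show "\<exists>y. (omega has_real_derivative y) (at x) \<and> 0 \<le> y"
    by (auto simp: field_differentiable_derivI intro!: exI[of _ "deriv omega x"])
qed

text \<open>Below any level Z the frequency is bounded by monotonicity, while resonance makes it
  grow like t^\<beta>.\<close>

lemma filterlim_I: "filterlim I\<^sub>r\<^sub>e\<^sub>s at_top at_top"
  unfolding filterlim_at_top_gt[of _ _ "max E\<^sub>0 E\<^sub>1"]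
proof (intro allI impI)
  fix Z assume Z: "max E\<^sub>0 E\<^sub>1 < Z"
  have "filterlim (\<lambda>t. vartheta / real \<kappa> * t powr \<beta>) at_top at_top"
    using vartheta_pos kappa_pos
    by (intro filterlim_tendsto_pos_mult_at_top[OF tendsto_const] filterlim_powr_at_top beta_pos) auto
  \<comment> \<open>The value at \<open>E\<^sub>0\<close> is included for the case that the resonant
    energy equals \<open>E\<^sub>0\<close>, where monotonicity says nothing.\<close>
  then have "\<forall>\<^sub>F t in at_top. max (omega E\<^sub>0) (omega Z) < vartheta / real \<kappa> * t powr \<beta>"
    unfolding filterlim_at_top_dense by blast
  then show "\<forall>\<^sub>F t in at_top. Z \<le> I\<^sub>r\<^sub>e\<^sub>s t"
    using eventually_ge_at_top[of t\<^sub>1]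
  proof eventually_elim
    case (elim t)
    show ?case
    proof (rule ccontr)
      assume "\<not> Z \<le> I\<^sub>r\<^sub>e\<^sub>s t"
      then have lt: "I\<^sub>r\<^sub>e\<^sub>s t < Z" by simp
      have "omega (I\<^sub>r\<^sub>e\<^sub>s t) \<le> max (omega E\<^sub>0) (omega Z)"
      proof (cases "E\<^sub>0 < I\<^sub>r\<^sub>e\<^sub>s t")
        case True
        have "omega (I\<^sub>r\<^sub>e\<^sub>s t) \<le> omega Z" by (rule omega_mono) (use I_ge[OF elim(2)] True lt in auto)
        then show ?thesis by simp
      next
        case False
        then have "I\<^sub>r\<^sub>e\<^sub>s t = E\<^sub>0" using I_ge[OF elim(2)] E1_ge by simp
        then show ?thesis by simp
      qed
      then show False using elim(1) omega_I[OF elim(2)] by linarith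
    qed
  qed
qed

lemma I_eventually_pos: "\<forall>\<^sub>F t in at_top. 0 < I\<^sub>r\<^sub>e\<^sub>s t"
  by (rule eventually_compose_filterlim[OF eventually_gt_at_top[of 0] filterlim_I])

definition "cstar = vartheta / real \<kappa> / \<omega>c 0"

lemma cstar_pos: "0 < cstar"
  using vartheta_pos kappa_pos omega_coeff_pos by (simp add: cstar_def)

text \<open>Resonance gives omega(I) exactly; dividing by the law omega ~ \<open>\<omega>c 0\<close>
  * I^\<gamma> yields the growth of I without inverting the frequency.\<close>

lemma I_gamma_limit: "((\<lambda>t. I\<^sub>r\<^sub>e\<^sub>s t powr \<gamma> / t powr \<beta>) \<longlongrightarrow> cstar) at_top"
proof -
  have "((\<lambda>E. omega E / E powr \<gamma>) \<longlongrightarrow> \<omega>c 0) at_top"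
    using power_expansion_ratio_limit[OF omega_expansion] h_pos by (simp add: \<gamma>_def)
  from filterlim_compose[OF this filterlim_I]
  have "((\<lambda>t. vartheta / real \<kappa> / (omega (I\<^sub>r\<^sub>e\<^sub>s t) / I\<^sub>r\<^sub>e\<^sub>s t powr \<gamma>)) \<longlongrightarrow> cstar) at_top"
    unfolding cstar_def using omega_coeff_pos by (intro tendsto_divide tendsto_const) auto
  then show ?thesis
  proof (rule Lim_transform_eventually)
    show "\<forall>\<^sub>F t in at_top. vartheta / real \<kappa> / (omega (I\<^sub>r\<^sub>e\<^sub>s t) / I\<^sub>r\<^sub>e\<^sub>s t powr \<gamma>) = I\<^sub>r\<^sub>e\<^sub>s t powr \<gamma> / t powr \<beta>"
      using eventually_ge_at_top[of t\<^sub>1]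
      by eventually_elim (use vartheta_pos kappa_pos in \<open>simp add: omega_I field_simps\<close>)
  qed
qed

lemma I_powr_limit: "((\<lambda>t. I\<^sub>r\<^sub>e\<^sub>s t powr c * t powr (- (\<beta> * c / \<gamma>))) \<longlongrightarrow> cstar powr (c / \<gamma>)) at_top"
proof (rule Lim_transform_eventually)
  show "((\<lambda>t. (I\<^sub>r\<^sub>e\<^sub>s t powr \<gamma> / t powr \<beta>) powr (c / \<gamma>)) \<longlongrightarrow> cstar powr (c / \<gamma>)) at_top"
    using cstar_pos by (intro tendsto_powr I_gamma_limit tendsto_const) auto
  show "\<forall>\<^sub>F t in at_top. (I\<^sub>r\<^sub>e\<^sub>s t powr \<gamma> / t powr \<beta>) powr (c / \<gamma>) = I\<^sub>r\<^sub>e\<^sub>s t powr c * t powr (- (\<beta> * c / \<gamma>))"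
    using eventually_gt_at_top[of 0] I_eventually_pos
    by eventually_elim (use gamma_pos in \<open>simp add: powr_divide powr_powr powr_minus_divide\<close>)
qed

lemma I_powr_limit':
  assumes "e = \<beta> * c / \<gamma>"
  shows "((\<lambda>t. I\<^sub>r\<^sub>e\<^sub>s t powr c / t powr e) \<longlongrightarrow> cstar powr (c / \<gamma>)) at_top"
  using I_powr_limit[of c] by (simp add: assms powr_minus_divide)

lemma I_powr_small:
  assumes "\<beta> * c / \<gamma> < e"
  shows "((\<lambda>t. I\<^sub>r\<^sub>e\<^sub>s t powr c / t powr e) \<longlongrightarrow> 0) at_top"
proof -
  have "((\<lambda>t. I\<^sub>r\<^sub>e\<^sub>s t powr c * t powr (- (\<beta> * c / \<gamma>)) * t powr (\<beta> * c / \<gamma> - e)) \<longlongrightarrow> cstar powr (c / \<gamma>) * 0) at_top"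
    using assms by (intro tendsto_mult I_powr_limit tendsto_neg_powr filterlim_ident) auto
  moreover have "\<forall>\<^sub>F t in at_top. I\<^sub>r\<^sub>e\<^sub>s t powr c * t powr (- (\<beta> * c / \<gamma>)) * t powr (\<beta> * c / \<gamma> - e) = I\<^sub>r\<^sub>e\<^sub>s t powr c / t powr e"
    using eventually_gt_at_top[of 0] by eventually_elim (simp add: powr_diff powr_minus_divide)
  ultimately show ?thesis using Lim_transform_eventually by fastforce
qed

text \<open>I grows polynomially in t, so enough terms of a force expansion outweigh any power of
  it.\<close>

lemma I_growth: "\<exists>n. ((\<lambda>t. t powr (- real n / real q) * I\<^sub>r\<^sub>e\<^sub>s t powr c) \<longlongrightarrow> 0) at_top"
proof -
  obtain n where n: "\<beta> * c / \<gamma> * real q < real n" using reals_Archimedean2 by blast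
  then have "\<beta> * c / \<gamma> < real n / real q" using q_pos by (simp add: pos_less_divide_eq)
  from I_powr_small[OF this] show ?thesis by (intro exI[of _ n]) (simp add: powr_minus_divide)
qed

context
  fixes r :: real
begin

lemma ratio_limit: "((\<lambda>t. 1 + t powr (- mu) * r) \<longlongrightarrow> 1) at_top" if "0 < mu"
proof -
  have "((\<lambda>t. 1 + t powr (- mu) * r) \<longlongrightarrow> 1 + 0 * r) at_top"
    using that by (intro tendsto_intros tendsto_neg_powr filterlim_ident) auto
  then show ?thesis by simp
qed

lemma ratio_pos: "0 < mu \<Longrightarrow> \<forall>\<^sub>F t in at_top. 0 < 1 + t powr (- mu) * r"
  using order_tendstoD(1)[OF ratio_limit, of 0] by simp

lemma filterlim_energy: "0 < mu \<Longrightarrow> filterlim (energy r) at_top at_top"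
  unfolding energy_def[abs_def] using tendsto_power[OF ratio_limit, of "2 * h"]
  by (intro filterlim_at_top_mult_tendsto_pos[of _ "1 ^ (2 * h)"] filterlim_I) auto

lemma energy_powr:
  assumes "0 < mu"
  shows "\<forall>\<^sub>F t in at_top. energy r t powr c = I\<^sub>r\<^sub>e\<^sub>s t powr c * (1 + t powr (- mu) * r) powr (2 * real h * c)"
  using I_eventually_pos ratio_pos[OF assms]
  by eventually_elim (simp add: energy_def powr_mult powr_powr flip: powr_realpow)

lemma energy_powr_ratio:
  assumes "0 < mu"
  shows "((\<lambda>t. energy r t powr c / I\<^sub>r\<^sub>e\<^sub>s t powr c) \<longlongrightarrow> 1) at_top"
proof (rule Lim_transform_eventually)
  have "((\<lambda>t. (1 + t powr (- mu) * r) powr (2 * real h * c)) \<longlongrightarrow> 1 powr (2 * real h * c)) at_top"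
    by (intro tendsto_powr ratio_limit assms tendsto_const) simp
  then show "((\<lambda>t. (1 + t powr (- mu) * r) powr (2 * real h * c)) \<longlongrightarrow> 1) at_top" by simp
  show "\<forall>\<^sub>F t in at_top. (1 + t powr (- mu) * r) powr (2 * real h * c) = energy r t powr c / I\<^sub>r\<^sub>e\<^sub>s t powr c"
    using energy_powr[OF assms, of c] I_eventually_pos by eventually_elim simp
qed

text \<open>The ratio of \<open>energy r t\<close> to I tends to 1, so limits at the shifted energy
  may be normalized by powers of I. This is the source of the independence of r below.\<close>

lemma energy_compose_limit:
  fixes w0 :: real
  assumes mu: "0 < mu" and W: "((\<lambda>E. W E / E powr c :: real) \<longlongrightarrow> w0) at_top"
  shows "((\<lambda>t. W (energy r t) / I\<^sub>r\<^sub>e\<^sub>s t powr c) \<longlongrightarrow> w0) at_top"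
proof -
  have "((\<lambda>t. W (energy r t) / energy r t powr c * (energy r t powr c / I\<^sub>r\<^sub>e\<^sub>s t powr c)) \<longlongrightarrow> w0 * 1) at_top"
    by (intro tendsto_mult filterlim_compose[OF W filterlim_energy[OF mu]] energy_powr_ratio[OF mu])
  moreover have "\<forall>\<^sub>F t in at_top. W (energy r t) / energy r t powr c * (energy r t powr c / I\<^sub>r\<^sub>e\<^sub>s t powr c) = W (energy r t) / I\<^sub>r\<^sub>e\<^sub>s t powr c"
    using eventually_compose_filterlim[OF eventually_gt_at_top[of 0] filterlim_energy[OF mu]] by eventually_elim simp
  ultimately show ?thesis using Lim_transform_eventually by fastforce
qed

lemma X_limits:
  assumes mu: "0 < mu"
  shows "((\<lambda>t. X \<phi> (energy r t) / I\<^sub>r\<^sub>e\<^sub>s t powr (1 / (2 * real h))) \<longlongrightarrow> Xc 0 \<phi>) at_top"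
    and "((\<lambda>t. Y \<phi> (energy r t) / I\<^sub>r\<^sub>e\<^sub>s t powr (1 / 2)) \<longlongrightarrow> Yc 0 \<phi>) at_top"
    and "((\<lambda>t. deriv (\<lambda>E. X \<phi> E) (energy r t) / I\<^sub>r\<^sub>e\<^sub>s t powr (1 / (2 * real h) - 1)) \<longlongrightarrow> 1 / (2 * real h) * Xc 0 \<phi>) at_top"
    and "((\<lambda>t. deriv (\<lambda>E. Y \<phi> E) (energy r t) / I\<^sub>r\<^sub>e\<^sub>s t powr (1 / 2 - 1)) \<longlongrightarrow> 1 / 2 * Yc 0 \<phi>) at_top"
    and "((\<lambda>t. omega (energy r t) / I\<^sub>r\<^sub>e\<^sub>s t powr \<gamma>) \<longlongrightarrow> \<omega>c 0) at_top"
proof -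
  have h: "0 < 2 * real h" using h_pos by simp
  note ex = uniform_power_expansionD[OF X_expansion UNIV_I, of \<phi>] uniform_power_expansionD[OF Y_expansion UNIV_I, of \<phi>]
    uniform_power_expansionD[OF dX_expansion UNIV_I, of \<phi>] uniform_power_expansionD[OF dY_expansion UNIV_I, of \<phi>]
  note lim = ex[THEN power_expansion_ratio_limit[OF _ h]] power_expansion_ratio_limit[OF omega_expansion h]
  show "((\<lambda>t. X \<phi> (energy r t) / I\<^sub>r\<^sub>e\<^sub>s t powr (1 / (2 * real h))) \<longlongrightarrow> Xc 0 \<phi>) at_top"
    by (rule energy_compose_limit[OF mu lim(1)])
  show "((\<lambda>t. Y \<phi> (energy r t) / I\<^sub>r\<^sub>e\<^sub>s t powr (1 / 2)) \<longlongrightarrow> Yc 0 \<phi>) at_top"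
    by (rule energy_compose_limit[OF mu lim(2)])
  show "((\<lambda>t. deriv (\<lambda>E. X \<phi> E) (energy r t) / I\<^sub>r\<^sub>e\<^sub>s t powr (1 / (2 * real h) - 1)) \<longlongrightarrow> 1 / (2 * real h) * Xc 0 \<phi>) at_top"
    using energy_compose_limit[OF mu lim(3)] by simp
  show "((\<lambda>t. deriv (\<lambda>E. Y \<phi> E) (energy r t) / I\<^sub>r\<^sub>e\<^sub>s t powr (1 / 2 - 1)) \<longlongrightarrow> 1 / 2 * Yc 0 \<phi>) at_top"
    using energy_compose_limit[OF mu lim(4)] by simp
  show "((\<lambda>t. omega (energy r t) / I\<^sub>r\<^sub>e\<^sub>s t powr \<gamma>) \<longlongrightarrow> \<omega>c 0) at_top"
    unfolding \<gamma>_def by (rule energy_compose_limit[OF mu lim(5)])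
qed

end
end

section \<open>Limits of the perturbation terms along the resonance\<close>

context resonant_energy
begin

lemma deriv_potential:
  "deriv U x = x ^ (2 * h - 1) + (\<Sum>i = 1..2 * h - 1. u i * (real i * x ^ (i - 1)))"
proof (rule DERIV_imp_deriv)
  have "((\<lambda>x. x ^ (2 * h) / (2 * real h)) has_real_derivative x ^ (2 * h - 1)) (at x)"
    using h_pos by (auto intro!: derivative_eq_intros)
  moreover have "((\<lambda>x. \<Sum>i = 1..2 * h - 1. u i * x ^ i) has_real_derivative (\<Sum>i = 1..2 * h - 1. u i * (real i * x ^ (i - 1)))) (at x)"
    by (intro DERIV_sum) (auto intro!: derivative_eq_intros)
  ultimately show "(U has_real_derivative x ^ (2 * h - 1) + (\<Sum>i = 1..2 * h - 1. u i * (real i * x ^ (i - 1)))) (at x)"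
    unfolding potential_def[abs_def] by (rule DERIV_add)
qed

lemma deriv_potential_limit:
  assumes mu: "0 < mu"
  shows "((\<lambda>t. deriv U (X \<phi> (energy r t)) / I\<^sub>r\<^sub>e\<^sub>s t powr (1 - 1 / (2 * real h))) \<longlongrightarrow> Xc 0 \<phi> ^ (2 * h - 1)) at_top"
proof -
  note x = X_limits(1)[OF mu, of \<phi> r]
  have pow: "((\<lambda>t. X \<phi> (energy r t) ^ i / I\<^sub>r\<^sub>e\<^sub>s t powr (1 - 1 / (2 * real h))) \<longlongrightarrow> (if i = 2 * h - 1 then Xc 0 \<phi> ^ i else 0)) at_top"
    if "i \<le> 2 * h - 1" for i
  proof -
    have "real i \<le> 2 * real h - 1" using that h_ge_2 by (simp add: of_nat_diff flip: of_nat_mult)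
    then have "real i * (1 / (2 * real h)) + real 0 * 0 \<le> 1 - 1 / (2 * real h)"
      using h_pos by (simp add: field_simps)
    moreover have "((\<lambda>t. 0 / I\<^sub>r\<^sub>e\<^sub>s t powr 0) \<longlongrightarrow> 0) at_top" by simp
    ultimately have "((\<lambda>t. X \<phi> (energy r t) ^ i * 0 ^ 0 / I\<^sub>r\<^sub>e\<^sub>s t powr (1 - 1 / (2 * real h))) \<longlongrightarrow>
        (if real i * (1 / (2 * real h)) + real 0 * 0 = 1 - 1 / (2 * real h) then Xc 0 \<phi> ^ i * 0 ^ 0 else 0)) at_top"
      by (intro monomial_limit[OF filterlim_I x])
    moreover have "real i * (1 / (2 * real h)) + real 0 * 0 = 1 - 1 / (2 * real h) \<longleftrightarrow> real i + 1 = 2 * real h"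
      using h_pos by (simp add: field_simps)
    moreover have "real i + 1 = 2 * real h \<longleftrightarrow> i = 2 * h - 1" using h_ge_2 by linarith
    ultimately show ?thesis by (simp only: power_0 mult_1_right)
  qed
  have "((\<lambda>t. X \<phi> (energy r t) ^ (2 * h - 1) / I\<^sub>r\<^sub>e\<^sub>s t powr (1 - 1 / (2 * real h))
      + (\<Sum>i = 1..2 * h - 1. u i * (real i * (X \<phi> (energy r t) ^ (i - 1) / I\<^sub>r\<^sub>e\<^sub>s t powr (1 - 1 / (2 * real h)))))) \<longlongrightarrow>
      Xc 0 \<phi> ^ (2 * h - 1) + (\<Sum>i = 1..2 * h - 1. u i * (real i * 0))) at_top"
  proof (intro tendsto_add tendsto_sum tendsto_mult tendsto_const)
    show "((\<lambda>t. X \<phi> (energy r t) ^ (2 * h - 1) / I\<^sub>r\<^sub>e\<^sub>s t powr (1 - 1 / (2 * real h))) \<longlongrightarrow> Xc 0 \<phi> ^ (2 * h - 1)) at_top"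
      using pow[of "2 * h - 1"] by simp
    fix i assume "i \<in> {1..2 * h - 1}"
    then have "i - 1 \<le> 2 * h - 1" "i - 1 \<noteq> 2 * h - 1" by auto
    then show "((\<lambda>t. X \<phi> (energy r t) ^ (i - 1) / I\<^sub>r\<^sub>e\<^sub>s t powr (1 - 1 / (2 * real h))) \<longlongrightarrow> 0) at_top"
      using pow[of "i - 1"] by simp
  qed
  then show ?thesis
    by (simp add: deriv_potential add_divide_distrib sum_divide_distrib)
qed

text \<open>Top growth exponents of f and g in the energy, where x ~ E^(1/(2h)) and y ~ E^(1/2): the
  degree p is best spent on y first, up to degree l - 1 for f and l for g, and the rest on
  x.\<close>

definition "e_f = (real l - 1) / 2 + (real p - real l + 1) / (2 * real h)"
definition "e_g = real l / 2 + (real p - real l) / (2 * real h)"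

text \<open>Trading a factor x for a factor y raises the exponent, so the largest j is the worst.
  \<open>J\<close> is real because l - 1 is meant as -1 for l = 0, when f has no monomials at
  all.\<close>

lemma exponent_bound:
  assumes "i + j \<le> P" "real j \<le> J"
  shows "real i * (1 / (2 * real h)) + real j * (1 / 2) \<le> J / 2 + (real P - J) / (2 * real h)"
proof -
  have "(real h - 1) * real j \<le> (real h - 1) * J" using h_ge_2 assms(2) by (intro mult_left_mono) auto
  moreover have "real i + real j \<le> real P" using assms(1) by linarith
  ultimately have "real i + real j * real h \<le> J * real h + (real P - J)" by (simp add: algebra_simps)
  then have "(real i + real j * real h) / (2 * real h) \<le> (J * real h + (real P - J)) / (2 * real h)"
    using h_pos by (intro divide_right_mono) auto
  then show ?thesis using h_pos by (simp add: add_divide_distrib)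
qed

text \<open>The order of the quantifiers is the point: one limit \<open>c\<close> serves all
  r.\<close>

lemma f_limit:
  assumes mu: "0 < mu"
  shows "\<exists>c. \<forall>r. ((\<lambda>t. f (X \<phi> (energy r t)) (Y \<phi> (energy r t)) S t / I\<^sub>r\<^sub>e\<^sub>s t powr e_f) \<longlongrightarrow> c) at_top"
proof (intro exI allI)
  fix r
  show "((\<lambda>t. f (X \<phi> (energy r t)) (Y \<phi> (energy r t)) S t / I\<^sub>r\<^sub>e\<^sub>s t powr e_f) \<longlongrightarrow>
    (\<Sum>i\<le>p. \<Sum>j<l. A 0 i j S * (if real i * (1 / (2 * real h)) + real j * (1 / 2) = e_f then Xc 0 \<phi> ^ i * Yc 0 \<phi> ^ j else 0))) at_top"
  proof (rule force_limit[OF f_expansion A_vanish q_pos _ filterlim_I I_growth X_limits(1)[OF mu] X_limits(2)[OF mu]])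
    show "1 \<le> h" using h_ge_2 by simp
    show "real i * (1 / (2 * real h)) + real j * (1 / 2) \<le> e_f" if "i + j \<le> p" "j < l" for i j
      using exponent_bound[OF that(1), of "real l - 1"] that(2) by (simp add: e_f_def algebra_simps)
  qed
qed

lemma g_limit:
  assumes mu: "0 < mu"
  shows "\<exists>c. \<forall>r. ((\<lambda>t. g (X \<phi> (energy r t)) (Y \<phi> (energy r t)) S t / I\<^sub>r\<^sub>e\<^sub>s t powr e_g) \<longlongrightarrow> c) at_top"
proof (intro exI allI)
  fix r
  show "((\<lambda>t. g (X \<phi> (energy r t)) (Y \<phi> (energy r t)) S t / I\<^sub>r\<^sub>e\<^sub>s t powr e_g) \<longlongrightarrow>
    (\<Sum>i\<le>p. \<Sum>j<Suc l. B 0 i j S * (if real i * (1 / (2 * real h)) + real j * (1 / 2) = e_g then Xc 0 \<phi> ^ i * Yc 0 \<phi> ^ j else 0))) at_top"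
  proof (rule force_limit[OF g_expansion[unfolded lessThan_Suc_atMost[of l, symmetric]] B_vanish q_pos _ filterlim_I I_growth X_limits(1)[OF mu] X_limits(2)[OF mu]])
    show "1 \<le> h" using h_ge_2 by simp
    show "real i * (1 / (2 * real h)) + real j * (1 / 2) \<le> e_g" if "i + j \<le> p" "j < Suc l" for i j
      using exponent_bound[OF that(1), of "real l"] that(2) by (simp add: e_g_def)
  qed
qed

text \<open>The first two identities say that both summands of F, and both of G, have the same
  growth exponent. The other two explain the definition of \<sigma>: F divided by the energy, and G
  itself, grow like t^(\<sigma> + a/q).\<close>

lemma exponents:
  "e_f + (1 - 1 / (2 * real h)) = e_g + 1 / 2" "e_g + (1 / (2 * real h) - 1) = e_f - 1 / 2"
  "\<beta> * (e_g - 1 / 2) / \<gamma> = \<sigma> + real a / real q" "\<beta> * (\<gamma> + (e_f - 1 / 2)) / \<gamma> = \<sigma> + real a / real q"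
proof -
  have h: "real h \<noteq> 0" "real h - 1 \<noteq> 0" using h_ge_2 by auto
  show 1: "e_f + (1 - 1 / (2 * real h)) = e_g + 1 / 2" "e_g + (1 / (2 * real h) - 1) = e_f - 1 / 2"
    using h by (simp_all add: e_f_def e_g_def field_simps)
  have e: "(e_g - 1 / 2) / \<gamma> = real l - 1 + (real p - 1) / (real h - 1)"
    using h by (simp add: e_g_def \<gamma>_def field_simps)
  have "\<beta> * (e_g - 1 / 2) / \<gamma> = \<beta> * ((e_g - 1 / 2) / \<gamma>)" by simp
  also have "\<dots> = \<sigma> + real a / real q" unfolding e \<beta>_def sigma_eq by simp
  finally show 2: "\<beta> * (e_g - 1 / 2) / \<gamma> = \<sigma> + real a / real q" .
  have "\<gamma> + (e_f - 1 / 2) = e_g - 1 / 2"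
    using h by (simp add: e_f_def e_g_def \<gamma>_def field_simps)
  then show "\<beta> * (\<gamma> + (e_f - 1 / 2)) / \<gamma> = \<sigma> + real a / real q" using 2 by (simp only:)
qed

lemma powr_product_limit:
  fixes W V :: "real \<Rightarrow> real"
  assumes "((\<lambda>t. W t / I\<^sub>r\<^sub>e\<^sub>s t powr c) \<longlongrightarrow> w) at_top" "((\<lambda>t. V t / I\<^sub>r\<^sub>e\<^sub>s t powr d) \<longlongrightarrow> v) at_top" "e = c + d"
  shows "((\<lambda>t. W t * V t / I\<^sub>r\<^sub>e\<^sub>s t powr e) \<longlongrightarrow> w * v) at_top"
  using tendsto_mult[OF assms(1,2)] by (simp add: assms(3) powr_add)

lemma F_limit:
  assumes mu: "0 < mu"
  shows "\<exists>c. \<forall>r. ((\<lambda>t. F (energy r t) \<phi> S t / I\<^sub>r\<^sub>e\<^sub>s t powr (e_g + 1 / 2)) \<longlongrightarrow> c) at_top"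
proof -
  obtain cf where cf: "\<And>r. ((\<lambda>t. f (X \<phi> (energy r t)) (Y \<phi> (energy r t)) S t / I\<^sub>r\<^sub>e\<^sub>s t powr e_f) \<longlongrightarrow> cf) at_top"
    using f_limit[OF mu] by blast
  obtain cg where cg: "\<And>r. ((\<lambda>t. g (X \<phi> (energy r t)) (Y \<phi> (energy r t)) S t / I\<^sub>r\<^sub>e\<^sub>s t powr e_g) \<longlongrightarrow> cg) at_top"
    using g_limit[OF mu] by blast
  show ?thesis
  proof (intro exI allI)
    fix r
    show "((\<lambda>t. F (energy r t) \<phi> S t / I\<^sub>r\<^sub>e\<^sub>s t powr (e_g + 1 / 2)) \<longlongrightarrow> cf * Xc 0 \<phi> ^ (2 * h - 1) + cg * Yc 0 \<phi>) at_top"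
      unfolding F_def add_divide_distrib
      by (intro tendsto_add powr_product_limit[OF cf deriv_potential_limit[OF mu]] powr_product_limit[OF cg X_limits(2)[OF mu]])
        (use exponents in simp_all)
  qed
qed

lemma G_limit:
  assumes mu: "0 < mu"
  shows "\<exists>c. \<forall>r. ((\<lambda>t. G (energy r t) \<phi> S t / I\<^sub>r\<^sub>e\<^sub>s t powr (\<gamma> + (e_f - 1 / 2))) \<longlongrightarrow> c) at_top"
proof -
  obtain cf where cf: "\<And>r. ((\<lambda>t. f (X \<phi> (energy r t)) (Y \<phi> (energy r t)) S t / I\<^sub>r\<^sub>e\<^sub>s t powr e_f) \<longlongrightarrow> cf) at_top"
    using f_limit[OF mu] by blast
  obtain cg where cg: "\<And>r. ((\<lambda>t. g (X \<phi> (energy r t)) (Y \<phi> (energy r t)) S t / I\<^sub>r\<^sub>e\<^sub>s t powr e_g) \<longlongrightarrow> cg) at_top"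
    using g_limit[OF mu] by blast
  show ?thesis
  proof (intro exI allI)
    fix r
    have "((\<lambda>t. (f (X \<phi> (energy r t)) (Y \<phi> (energy r t)) S t * deriv (\<lambda>E. Y \<phi> E) (energy r t)
        - g (X \<phi> (energy r t)) (Y \<phi> (energy r t)) S t * deriv (\<lambda>E. X \<phi> E) (energy r t)) / I\<^sub>r\<^sub>e\<^sub>s t powr (e_f - 1 / 2)) \<longlongrightarrow>
        cf * (1 / 2 * Yc 0 \<phi>) - cg * (1 / (2 * real h) * Xc 0 \<phi>)) at_top"
      unfolding diff_divide_distrib
      by (intro tendsto_diff powr_product_limit[OF cf X_limits(4)[OF mu]] powr_product_limit[OF cg X_limits(3)[OF mu]])
        (use exponents in simp_all)
    from powr_product_limit[OF X_limits(5)[OF mu] this refl]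
    show "((\<lambda>t. G (energy r t) \<phi> S t / I\<^sub>r\<^sub>e\<^sub>s t powr (\<gamma> + (e_f - 1 / 2))) \<longlongrightarrow>
      \<omega>c 0 * (cf * (1 / 2 * Yc 0 \<phi>) - cg * (1 / (2 * real h) * Xc 0 \<phi>))) at_top"
      unfolding G_def .
  qed
qed

text \<open>t^(-\<sigma>) is what becomes of t^(1-\<nu>+\<mu>) after multiplication with
  \<tau>^(M/N), a multiple of t^\<mu>. It exactly cancels the growth of the force term.\<close>

lemma F_term_limit:
  assumes mu: "0 < mu"
  shows "\<exists>c. \<forall>r. ((\<lambda>t. t powr (- \<sigma>) * (t powr (- real a / real q) * F (energy r t) \<phi> S t /
        (2 * real h * I\<^sub>r\<^sub>e\<^sub>s t * (1 + t powr (- mu) * r) ^ (2 * h - 1)))) \<longlongrightarrow> c) at_top"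
proof -
  obtain c where c: "\<And>r. ((\<lambda>t. F (energy r t) \<phi> S t / I\<^sub>r\<^sub>e\<^sub>s t powr (e_g + 1 / 2)) \<longlongrightarrow> c) at_top"
    using F_limit[OF mu] by blast
  define k where "k = cstar powr ((e_g - 1 / 2) / \<gamma>)"
  have k: "((\<lambda>t. I\<^sub>r\<^sub>e\<^sub>s t powr (e_g - 1 / 2) / t powr (\<sigma> + real a / real q)) \<longlongrightarrow> k) at_top"
    unfolding k_def by (rule I_powr_limit') (use exponents(3) in simp)
  show ?thesis
  proof (intro exI allI)
    fix r
    have "((\<lambda>t. F (energy r t) \<phi> S t / I\<^sub>r\<^sub>e\<^sub>s t powr (e_g + 1 / 2) * (I\<^sub>r\<^sub>e\<^sub>s t powr (e_g - 1 / 2) / t powr (\<sigma> + real a / real q))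
       / (2 * real h * (1 + t powr (- mu) * r) ^ (2 * h - 1))) \<longlongrightarrow> c * k / (2 * real h * 1 ^ (2 * h - 1))) at_top"
      using h_pos by (intro tendsto_divide tendsto_mult c k tendsto_const tendsto_power ratio_limit mu) auto
    moreover have "\<forall>\<^sub>F t in at_top. F (energy r t) \<phi> S t / I\<^sub>r\<^sub>e\<^sub>s t powr (e_g + 1 / 2) * (I\<^sub>r\<^sub>e\<^sub>s t powr (e_g - 1 / 2) / t powr (\<sigma> + real a / real q))
       / (2 * real h * (1 + t powr (- mu) * r) ^ (2 * h - 1)) = t powr (- \<sigma>) * (t powr (- real a / real q) * F (energy r t) \<phi> S t /
        (2 * real h * I\<^sub>r\<^sub>e\<^sub>s t * (1 + t powr (- mu) * r) ^ (2 * h - 1)))"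
      using I_eventually_pos eventually_gt_at_top[of 0]
    proof eventually_elim
      case (elim t)
      have "I\<^sub>r\<^sub>e\<^sub>s t powr (e_g + 1 / 2) = I\<^sub>r\<^sub>e\<^sub>s t powr ((e_g - 1 / 2) + 1)" by (simp add: add.commute)
      also have "\<dots> = I\<^sub>r\<^sub>e\<^sub>s t powr (e_g - 1 / 2) * I\<^sub>r\<^sub>e\<^sub>s t" unfolding powr_add using elim by simp
      finally have 1: "I\<^sub>r\<^sub>e\<^sub>s t powr (e_g + 1 / 2) = I\<^sub>r\<^sub>e\<^sub>s t powr (e_g - 1 / 2) * I\<^sub>r\<^sub>e\<^sub>s t" .
      have 2: "1 / t powr (\<sigma> + real a / real q) = t powr (- \<sigma>) * t powr (- real a / real q)"
        unfolding powr_add[symmetric] by (simp add: powr_minus_divide[symmetric] add.commute)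
      have "F (energy r t) \<phi> S t / (I\<^sub>r\<^sub>e\<^sub>s t powr (e_g - 1 / 2) * I\<^sub>r\<^sub>e\<^sub>s t) * (I\<^sub>r\<^sub>e\<^sub>s t powr (e_g - 1 / 2) / t powr (\<sigma> + real a / real q)) =
        F (energy r t) \<phi> S t * (1 / t powr (\<sigma> + real a / real q)) / I\<^sub>r\<^sub>e\<^sub>s t" using elim by simp
      then show ?case unfolding 1 2 by (simp add: mult_ac)
    qed
    ultimately show "((\<lambda>t. t powr (- \<sigma>) * (t powr (- real a / real q) * F (energy r t) \<phi> S t /
        (2 * real h * I\<^sub>r\<^sub>e\<^sub>s t * (1 + t powr (- mu) * r) ^ (2 * h - 1)))) \<longlongrightarrow> c * k / (2 * real h * 1 ^ (2 * h - 1))) at_top"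
      by (rule Lim_transform_eventually)
  qed
qed

lemma G_term_limit:
  assumes mu: "0 < mu"
  shows "\<exists>c. \<forall>r. ((\<lambda>t. t powr (- \<sigma>) * (t powr (- real a / real q) * G (energy r t) \<phi> S t)) \<longlongrightarrow> c) at_top"
proof -
  obtain c where c: "\<And>r. ((\<lambda>t. G (energy r t) \<phi> S t / I\<^sub>r\<^sub>e\<^sub>s t powr (\<gamma> + (e_f - 1 / 2))) \<longlongrightarrow> c) at_top"
    using G_limit[OF mu] by blast
  define k where "k = cstar powr ((\<gamma> + (e_f - 1 / 2)) / \<gamma>)"
  have k: "((\<lambda>t. I\<^sub>r\<^sub>e\<^sub>s t powr (\<gamma> + (e_f - 1 / 2)) / t powr (\<sigma> + real a / real q)) \<longlongrightarrow> k) at_top"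
    unfolding k_def by (rule I_powr_limit') (use exponents(4) in simp)
  show ?thesis
  proof (intro exI allI)
    fix r
    have "((\<lambda>t. G (energy r t) \<phi> S t / I\<^sub>r\<^sub>e\<^sub>s t powr (\<gamma> + (e_f - 1 / 2)) * (I\<^sub>r\<^sub>e\<^sub>s t powr (\<gamma> + (e_f - 1 / 2)) / t powr (\<sigma> + real a / real q))) \<longlongrightarrow> c * k) at_top"
      by (intro tendsto_mult c k)
    moreover have "\<forall>\<^sub>F t in at_top. G (energy r t) \<phi> S t / I\<^sub>r\<^sub>e\<^sub>s t powr (\<gamma> + (e_f - 1 / 2)) * (I\<^sub>r\<^sub>e\<^sub>s t powr (\<gamma> + (e_f - 1 / 2)) / t powr (\<sigma> + real a / real q)) =
        t powr (- \<sigma>) * (t powr (- real a / real q) * G (energy r t) \<phi> S t)"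
      using I_eventually_pos eventually_gt_at_top[of 0]
    proof eventually_elim
      case (elim t)
      have 2: "1 / t powr (\<sigma> + real a / real q) = t powr (- \<sigma>) * t powr (- real a / real q)"
        unfolding powr_add[symmetric] by (simp add: powr_minus_divide[symmetric] add.commute)
      have "G (energy r t) \<phi> S t / I\<^sub>r\<^sub>e\<^sub>s t powr (\<gamma> + (e_f - 1 / 2)) * (I\<^sub>r\<^sub>e\<^sub>s t powr (\<gamma> + (e_f - 1 / 2)) / t powr (\<sigma> + real a / real q)) =
        G (energy r t) \<phi> S t * (1 / t powr (\<sigma> + real a / real q))" using elim by simp
      then show ?case unfolding 2 by (simp only: mult_ac)
    qed
    ultimately show "((\<lambda>t. t powr (- \<sigma>) * (t powr (- real a / real q) * G (energy r t) \<phi> S t)) \<longlongrightarrow> c * k) at_top"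
      by (rule Lim_transform_eventually)
  qed
qed

text \<open>A difference quotient of (1 + x r)^c at 0, taken along x = t^(-\<mu>).\<close>

lemma powr_increment_limit:
  assumes mu: "0 < mu"
  shows "((\<lambda>t. t powr mu * ((1 + t powr (- mu) * r) powr c - 1)) \<longlongrightarrow> c * r) at_top"
proof -
  have "((\<lambda>x. (1 + x * r) powr c) has_real_derivative c * r) (at 0)"
    by (auto intro!: derivative_eq_intros)
  then have d: "((\<lambda>x. ((1 + x * r) powr c - 1) / x) \<longlongrightarrow> c * r) (at 0)"
    by (simp add: DERIV_def)
  have "filterlim (\<lambda>t. t powr (- mu)) (at 0) at_top"
    unfolding filterlim_at using mu eventually_gt_at_top[of 0]
    by (auto intro!: tendsto_neg_powr filterlim_ident elim!: eventually_mono)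
  from filterlim_compose[OF d this]
  have "((\<lambda>t. ((1 + t powr (- mu) * r) powr c - 1) / t powr (- mu)) \<longlongrightarrow> c * r) at_top" .
  moreover have "((1 + t powr (- mu) * r) powr c - 1) / t powr (- mu) = t powr mu * ((1 + t powr (- mu) * r) powr c - 1)" for t
    by (simp add: powr_minus_divide)
  ultimately show ?thesis by simp
qed

text \<open>Both frequencies grow like t^\<beta>, but their difference has only size
  t^(\<beta>-\<mu>), so the expansion of omega must be carried to a remainder below that size. Of
  the explicit terms only j = 0 contributes, with coefficient
  \<open>\<omega>c 0 * cstar * (h - 1)\<close>, that is (h - 1) vartheta / \<kappa>.\<close>

lemma omega_increment_limit:
  assumes mu: "0 < mu"
  shows "((\<lambda>t. t powr (mu - \<beta>) * (omega (energy r t) - omega (I\<^sub>r\<^sub>e\<^sub>s t))) \<longlongrightarrow> (real h - 1) * vartheta / real \<kappa> * r) at_top"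
proof -
  \<comment> \<open>Each further term of the expansion loses E^(-1/(2h)), which is
    t^(-\<beta>/(h-1)); after n of them the loss exceeds t^(-\<mu>).\<close>
  obtain n where n0: "mu * (real h - 1) / \<beta> < real n" using reals_Archimedean2 by blast
  then have n: "mu * (real h - 1) < real n * \<beta>" using beta_pos by (simp add: pos_divide_less_eq)
  define e where "e j = \<gamma> - real j / (2 * real h)" for j
  define tail where "tail E = omega E - (\<Sum>j<Suc n. \<omega>c j * E powr e j)" for E
  obtain C where "\<forall>\<^sub>F E in at_top. \<bar>omega E - (\<Sum>j<Suc n. \<omega>c j * E powr ((real h - 1) / (2 * real h) - real j / (2 * real h)))\<bar>
      \<le> C * E powr ((real h - 1) / (2 * real h) - real (Suc n) / (2 * real h))"
    using omega_expansion unfolding power_expansion_def by blast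
  then have C: "\<forall>\<^sub>F E in at_top. \<bar>tail E\<bar> \<le> C * E powr e (Suc n)"
    by (simp only: tail_def e_def \<gamma>_def)
  have e_le: "\<beta> * e j / \<gamma> = \<beta> - \<beta> * real j / (real h - 1)" for j
    using h_ge_2 by (simp add: e_def \<gamma>_def field_simps)
  have main: "((\<lambda>t. t powr (mu - \<beta>) * (\<omega>c j * energy r t powr e j - \<omega>c j * I\<^sub>r\<^sub>e\<^sub>s t powr e j)) \<longlongrightarrow>
      (if j = 0 then \<omega>c 0 * (cstar * ((real h - 1) * r)) else 0)) at_top" for j
  proof -
    have I: "((\<lambda>t. I\<^sub>r\<^sub>e\<^sub>s t powr e j / t powr \<beta>) \<longlongrightarrow> (if j = 0 then cstar else 0)) at_top"
    proof (cases "j = 0")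
      case True
      then show ?thesis using I_gamma_limit by (simp add: e_def)
    next
      case False
      have "0 < \<beta> * real j / (real h - 1)" using beta_pos False h_ge_2 by simp
      then show ?thesis using False by (simp add: I_powr_small e_le)
    qed
    have "((\<lambda>t. \<omega>c j * (I\<^sub>r\<^sub>e\<^sub>s t powr e j / t powr \<beta> * (t powr mu * ((1 + t powr (- mu) * r) powr (2 * real h * e j) - 1)))) \<longlongrightarrow>
       \<omega>c j * ((if j = 0 then cstar else 0) * (2 * real h * e j * r))) at_top"
      by (intro tendsto_mult tendsto_const I powr_increment_limit[OF mu])
    moreover have "\<omega>c j * ((if j = 0 then cstar else 0) * (2 * real h * e j * r)) = (if j = 0 then \<omega>c 0 * (cstar * ((real h - 1) * r)) else 0)"
      using h_pos by (simp add: e_def \<gamma>_def)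
    moreover have "\<forall>\<^sub>F t in at_top. \<omega>c j * (I\<^sub>r\<^sub>e\<^sub>s t powr e j / t powr \<beta> * (t powr mu * ((1 + t powr (- mu) * r) powr (2 * real h * e j) - 1))) =
       t powr (mu - \<beta>) * (\<omega>c j * energy r t powr e j - \<omega>c j * I\<^sub>r\<^sub>e\<^sub>s t powr e j)"
      using energy_powr[OF mu, of r "e j"]
    proof eventually_elim
      case (elim t)
      show ?case unfolding elim powr_diff by (simp add: algebra_simps)
    qed
    ultimately show ?thesis by (auto elim: Lim_transform_eventually)
  qed
  have sum: "((\<lambda>t. \<Sum>j<Suc n. t powr (mu - \<beta>) * (\<omega>c j * energy r t powr e j - \<omega>c j * I\<^sub>r\<^sub>e\<^sub>s t powr e j)) \<longlongrightarrow>
      (\<Sum>j<Suc n. if j = 0 then \<omega>c 0 * (cstar * ((real h - 1) * r)) else 0)) at_top"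
    by (intro tendsto_sum main)
  have small: "((\<lambda>t. t powr (mu - \<beta>) * I\<^sub>r\<^sub>e\<^sub>s t powr e (Suc n)) \<longlongrightarrow> 0) at_top"
  proof -
    have "mu < \<beta> * real n / (real h - 1)" using n h_ge_2 by (simp add: pos_less_divide_eq mult.commute)
    also have "\<dots> \<le> \<beta> * real (Suc n) / (real h - 1)" using beta_pos h_ge_2 by (intro divide_right_mono mult_left_mono) auto
    finally have "\<beta> * e (Suc n) / \<gamma> < \<beta> - mu" unfolding e_le by linarith
    from I_powr_small[OF this] show ?thesis by (simp add: powr_diff mult.commute)
  qed
  have small': "((\<lambda>t. t powr (mu - \<beta>) * tail (energy x t)) \<longlongrightarrow> 0) at_top" for x
  proof (rule Lim_null_comparison)
    have "((\<lambda>t. C * (t powr (mu - \<beta>) * I\<^sub>r\<^sub>e\<^sub>s t powr e (Suc n) * (energy x t powr e (Suc n) / I\<^sub>r\<^sub>e\<^sub>s t powr e (Suc n)))) \<longlongrightarrow> C * (0 * 1)) at_top"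
      by (intro tendsto_mult tendsto_const small energy_powr_ratio[OF mu])
    then show "((\<lambda>t. C * (t powr (mu - \<beta>) * I\<^sub>r\<^sub>e\<^sub>s t powr e (Suc n) * (energy x t powr e (Suc n) / I\<^sub>r\<^sub>e\<^sub>s t powr e (Suc n)))) \<longlongrightarrow> 0) at_top"
      by simp
    show "\<forall>\<^sub>F t in at_top. norm (t powr (mu - \<beta>) * tail (energy x t)) \<le>
        C * (t powr (mu - \<beta>) * I\<^sub>r\<^sub>e\<^sub>s t powr e (Suc n) * (energy x t powr e (Suc n) / I\<^sub>r\<^sub>e\<^sub>s t powr e (Suc n)))"
      using eventually_compose_filterlim[OF C filterlim_energy[OF mu, of x]] I_eventually_pos
    proof eventually_elim
      case (elim t)
      have "norm (t powr (mu - \<beta>) * tail (energy x t)) = t powr (mu - \<beta>) * \<bar>tail (energy x t)\<bar>" by (simp add: abs_mult)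
      also have "\<dots> \<le> t powr (mu - \<beta>) * (C * energy x t powr e (Suc n))" using elim by (intro mult_left_mono) auto
      finally show ?case using elim by (simp add: mult_ac)
    qed
  qed
  \<comment> \<open>I is the energy at r = 0, so one tail estimate serves both frequencies.\<close>
  have energy_0: "energy 0 t = I\<^sub>r\<^sub>e\<^sub>s t" for t by (simp add: energy_def)
  have "((\<lambda>t. (\<Sum>j<Suc n. t powr (mu - \<beta>) * (\<omega>c j * energy r t powr e j - \<omega>c j * I\<^sub>r\<^sub>e\<^sub>s t powr e j))
      + (t powr (mu - \<beta>) * tail (energy r t) - t powr (mu - \<beta>) * tail (energy 0 t))) \<longlongrightarrow>
      (\<Sum>j<Suc n. if j = 0 then \<omega>c 0 * (cstar * ((real h - 1) * r)) else 0) + (0 - 0)) at_top"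
    by (intro tendsto_add tendsto_diff sum small')
  moreover have "(\<Sum>j<Suc n. t powr (mu - \<beta>) * (\<omega>c j * energy r t powr e j - \<omega>c j * I\<^sub>r\<^sub>e\<^sub>s t powr e j))
      + (t powr (mu - \<beta>) * tail (energy r t) - t powr (mu - \<beta>) * tail (energy 0 t))
      = t powr (mu - \<beta>) * (omega (energy r t) - omega (I\<^sub>r\<^sub>e\<^sub>s t))" for t
    unfolding energy_0 tail_def sum_distrib_left[symmetric] sum_subtractf by (simp add: algebra_simps)
  moreover have "(\<Sum>j<Suc n. if j = 0 then \<omega>c 0 * (cstar * ((real h - 1) * r)) else 0) + (0 - 0) = (real h - 1) * vartheta / real \<kappa> * r"
    using omega_coeff_pos by (subst sum.mono_neutral_right[of _ "{0}"]) (auto simp: cstar_def)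
  ultimately show ?thesis by simp
qed

end

section \<open>Leading coefficients of the rescaled rates\<close>

context rescaled_system
begin

lemma nu_pos: "0 < nu" using nu_eq beta_pos by simp

lemma N_pos: "0 < N"
proof -
  have "0 < real N" unfolding N_eq using nu_pos q_pos h_ge_2 by simp
  then show ?thesis by simp
qed

lemma M_pos: "0 < mu \<Longrightarrow> 1 \<le> M"
proof -
  assume "0 < mu"
  then have "0 < real M" unfolding M_eq using q_pos h_ge_2 by simp
  then show ?thesis by simp
qed

text \<open>\<nu> - 2 \<mu> = 1 + \<sigma>, so the hypothesis \<sigma> >= -1 is precisely what makes
  2M <= N.\<close>

lemma double_M_le:
  assumes "-1 \<le> \<sigma>"
  shows "2 * M \<le> N"
proof -
  have "2 * mu \<le> nu" using assms by (simp add: nu_def)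
  then have "2 * mu * (2 * real q * (real h - 1)) \<le> nu * (2 * real q * (real h - 1))"
    using h_ge_2 by (intro mult_right_mono) auto
  moreover have "2 * real M = 2 * mu * (2 * real q * (real h - 1))" unfolding M_eq by simp
  moreover have "real N = nu * (2 * real q * (real h - 1))" unfolding N_eq by simp
  ultimately have "2 * real M \<le> real N" by linarith
  then show ?thesis by linarith
qed

lemma M_div_N: "real M / real N = mu / nu"
  unfolding M_eq N_eq using q_pos h_ge_2 nu_pos by simp

lemma filterlim_time: "filterlim time at_top at_top"
  unfolding time_def[abs_def]
  by (rule filterlim_compose[OF filterlim_powr_at_top])
    (use nu_pos in \<open>auto intro!: filterlim_tendsto_pos_mult_at_top[OF tendsto_const] filterlim_ident\<close>)

lemma powr_via_time: "0 < \<tau> \<Longrightarrow> \<tau> powr c = nu powr (- c) * time \<tau> powr (nu * c)"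
  using nu_pos by (simp add: time_def powr_powr powr_mult powr_minus_divide)

lemma scaling_factor: "0 < \<tau> \<Longrightarrow> \<tau> powr (real M / real N) = nu powr (- (mu / nu)) * time \<tau> powr mu"
  using nu_pos powr_via_time[of \<tau> "mu / nu"] by (simp add: M_div_N)

text \<open>The frequency difference has just the size that is split off, whereas the G term is
  smaller by t^(-\<mu>). The resulting factor of r is the \<open>\<eta>\<close> of the truncated
  system.\<close>

lemma Bc_0:
  assumes mu: "0 < mu" and \<sigma>: "-1 \<le> \<sigma>"
  shows "\<B>c 0 r \<theta> \<zeta> = nu powr (- (mu / nu)) * ((real h - 1) * vartheta / real \<kappa>) * r"
proof -
  obtain c where c: "\<And>r. ((\<lambda>t. t powr (- \<sigma>) * (t powr (- real a / real q) * G (energy r t) (angle \<theta> \<zeta>) \<zeta> t)) \<longlongrightarrow> c) at_top"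
    using G_term_limit[OF mu] by blast
  have "((\<lambda>t. nu powr (- (mu / nu)) * (t powr (mu - \<beta>) * (omega (energy r t) - omega (I\<^sub>r\<^sub>e\<^sub>s t))
     + t powr (- mu) * (t powr (- \<sigma>) * (t powr (- real a / real q) * G (energy r t) (angle \<theta> \<zeta>) \<zeta> t)))) \<longlongrightarrow>
     nu powr (- (mu / nu)) * ((real h - 1) * vartheta / real \<kappa> * r + 0 * c)) at_top"
    by (intro tendsto_mult tendsto_add tendsto_const omega_increment_limit[OF mu] c tendsto_neg_powr filterlim_ident) (use mu in auto)
  from filterlim_compose[OF this filterlim_time]
  have "((\<lambda>\<tau>. \<tau> powr (real M / real N) * theta_rate r \<theta> \<zeta> \<tau>) \<longlongrightarrow>
     nu powr (- (mu / nu)) * ((real h - 1) * vartheta / real \<kappa> * r + 0 * c)) at_top"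
  proof (rule Lim_transform_eventually)
    show "\<forall>\<^sub>F \<tau> in at_top. nu powr (- (mu / nu)) * (time \<tau> powr (mu - \<beta>) * (omega (energy r (time \<tau>)) - omega (I\<^sub>r\<^sub>e\<^sub>s (time \<tau>)))
     + time \<tau> powr (- mu) * (time \<tau> powr (- \<sigma>) * (time \<tau> powr (- real a / real q) * G (energy r (time \<tau>)) (angle \<theta> \<zeta>) \<zeta> (time \<tau>))))
     = \<tau> powr (real M / real N) * theta_rate r \<theta> \<zeta> \<tau>"
      using eventually_gt_at_top[of 0]
    proof eventually_elim
      case (elim \<tau>)
      define t where "t = time \<tau>"
      have 1: "t powr (mu - \<beta>) = t powr mu * t powr (1 - nu)" by (simp add: nu_eq flip: powr_add)
      have "- mu + - \<sigma> = mu + (1 - nu)" using mu_eq by simp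
      then have "t powr (- mu) * t powr (- \<sigma>) = t powr mu * t powr (1 - nu)" by (simp only: powr_add[symmetric])
      then have 2: "t powr (- mu) * (t powr (- \<sigma>) * x) = t powr mu * t powr (1 - nu) * x" for x by (simp only: mult.assoc[symmetric])
      show ?case
        unfolding scaling_factor[OF elim] theta_rate_def Let_def t_def[symmetric] 1 2 by (simp only: distrib_left mult.assoc)
    qed
  qed
  moreover have "((\<lambda>\<tau>. \<tau> powr (real M / real N) * theta_rate r \<theta> \<zeta> \<tau>) \<longlongrightarrow> \<B>c 0 r \<theta> \<zeta>) at_top"
  proof (rule power_expansion_limit)
    show "power_expansion 0 (real N) (\<lambda>\<tau>. \<tau> powr (real M / real N) * theta_rate r \<theta> \<zeta> \<tau>) (\<lambda>K. \<B>c K r \<theta> \<zeta>)"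
      by (rule uniform_power_expansionD[OF B_expansion[of "\<bar>r\<bar> + 1"], of "(r, \<theta>, \<zeta>)", simplified]) linarith+
  qed (use N_pos in simp)
  ultimately have "\<B>c 0 r \<theta> \<zeta> = nu powr (- (mu / nu)) * ((real h - 1) * vartheta / real \<kappa> * r + 0 * c)"
    by (rule tendsto_unique[OF trivial_limit_at_top_linorder, rotated])
  then show ?thesis by simp
qed

text \<open>At r = 0 the energy is I itself and the frequency difference is identically zero; what
  remains is the G term, of order \<tau>^(-M/N) after the rescaling.\<close>

lemma Bc_low:
  assumes mu: "0 < mu" and \<sigma>: "-1 \<le> \<sigma>" and K: "K < M"
  shows "\<B>c K 0 \<theta> \<zeta> = 0"
proof (rule power_expansion_coeff_zero[OF _ _ _ K])
  show "power_expansion 0 (real N) (\<lambda>\<tau>. \<tau> powr (real M / real N) * theta_rate 0 \<theta> \<zeta> \<tau>) (\<lambda>K. \<B>c K 0 \<theta> \<zeta>)"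
    using uniform_power_expansionD[OF B_expansion[of 1], of "(0, \<theta>, \<zeta>)"] by auto
  show "0 < real N" using N_pos by simp
  obtain c where c: "\<And>r. ((\<lambda>t. t powr (- \<sigma>) * (t powr (- real a / real q) * G (energy r t) (angle \<theta> \<zeta>) \<zeta> t)) \<longlongrightarrow> c) at_top"
    using G_term_limit[OF mu] by blast
  have "((\<lambda>t. nu powr (- (2 * mu / nu)) * (t powr (- \<sigma>) * (t powr (- real a / real q) * G (energy 0 t) (angle \<theta> \<zeta>) \<zeta> t))) \<longlongrightarrow>
     nu powr (- (2 * mu / nu)) * c) at_top"
    by (intro tendsto_mult tendsto_const c)
  from filterlim_compose[OF this filterlim_time]
  have "((\<lambda>\<tau>. (\<tau> powr (real M / real N) * theta_rate 0 \<theta> \<zeta> \<tau>) / \<tau> powr (- real M / real N)) \<longlongrightarrow> nu powr (- (2 * mu / nu)) * c) at_top"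
  proof (rule Lim_transform_eventually)
    show "\<forall>\<^sub>F \<tau> in at_top. nu powr (- (2 * mu / nu)) * (time \<tau> powr (- \<sigma>) * (time \<tau> powr (- real a / real q) * G (energy 0 (time \<tau>)) (angle \<theta> \<zeta>) \<zeta> (time \<tau>)))
      = (\<tau> powr (real M / real N) * theta_rate 0 \<theta> \<zeta> \<tau>) / \<tau> powr (- real M / real N)"
      using eventually_gt_at_top[of 0]
    proof eventually_elim
      case (elim \<tau>)
      define t where "t = time \<tau>"
      define W where "W = t powr (- real a / real q) * G (energy 0 t) (angle \<theta> \<zeta>) \<zeta> t"
      have 0: "energy 0 t = I\<^sub>r\<^sub>e\<^sub>s t" by (simp add: energy_def)
      have rate: "theta_rate 0 \<theta> \<zeta> \<tau> = t powr (1 - nu) * W"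
        unfolding theta_rate_def Let_def t_def[symmetric] W_def 0 by simp
      have "1 / \<tau> powr (- real M / real N) = \<tau> powr (real M / real N)"
        using powr_minus_divide[of \<tau> "real M / real N"] by simp
      then have div: "y / \<tau> powr (- real M / real N) = \<tau> powr (real M / real N) * y" for y
        by (simp add: divide_inverse mult.commute)
      have "(\<tau> powr (real M / real N) * theta_rate 0 \<theta> \<zeta> \<tau>) / \<tau> powr (- real M / real N)
          = \<tau> powr (real M / real N) * \<tau> powr (real M / real N) * theta_rate 0 \<theta> \<zeta> \<tau>"
        unfolding div by (simp only: mult.assoc)
      also have "\<dots> = (nu powr (- (mu / nu)) * nu powr (- (mu / nu))) * (t powr mu * t powr mu * t powr (1 - nu)) * W"
        unfolding scaling_factor[OF elim] t_def[symmetric] rate by (simp only: mult_ac)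
      also have "nu powr (- (mu / nu)) * nu powr (- (mu / nu)) = nu powr (- (2 * mu / nu))"
        unfolding powr_add[symmetric] by simp
      also have "t powr mu * t powr mu * t powr (1 - nu) = t powr (- \<sigma>)"
        unfolding powr_add[symmetric] mu_eq[symmetric] by (simp add: algebra_simps)
      finally show ?case unfolding t_def[symmetric] W_def by (simp only: mult.assoc)
    qed
  qed
  then show "(\<lambda>\<tau>. \<tau> powr (real M / real N) * theta_rate 0 \<theta> \<zeta> \<tau>) \<in> O(\<lambda>\<tau>. \<tau> powr (- real M / real N))"
  proof (rule bigoI_tendsto)
    show "\<forall>\<^sub>F \<tau> in at_top. \<tau> powr (- real M / real N) \<noteq> 0"
      using eventually_gt_at_top[of 0] by eventually_elim simp
  qed
qed

text \<open>Of the three terms of the rate, the force term has a limit independent of r and the last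
  is of order t^(-\<sigma>-\<mu>-1), which tends to 0 as \<sigma> >= -1. In the middle term r comes
  with t^(-\<mu>), so it suffices that the cofactor \<open>V\<close> converges.\<close>

lemma Ac_0:
  assumes mu: "0 < mu" and \<sigma>: "-1 \<le> \<sigma>"
  shows "\<A>c 0 r \<theta> \<zeta> = \<A>c 0 0 \<theta> \<zeta>"
proof -
  define nc where "nc = nu powr (- (mu / nu))"
  obtain c where c: "\<And>r. ((\<lambda>t. t powr (- \<sigma>) * (t powr (- real a / real q) * F (energy r t) (angle \<theta> \<zeta>) \<zeta> t /
        (2 * real h * I\<^sub>r\<^sub>e\<^sub>s t * (1 + t powr (- mu) * r) ^ (2 * h - 1)))) \<longlongrightarrow> c) at_top"
    using F_term_limit[OF mu] by blast
  define W where "W r t = nc * (t powr (- \<sigma>) * (t powr (- real a / real q) * F (energy r t) (angle \<theta> \<zeta>) \<zeta> t /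
        (2 * real h * I\<^sub>r\<^sub>e\<^sub>s t * (1 + t powr (- mu) * r) ^ (2 * h - 1))))" for r t
  have W: "((\<lambda>\<tau>. W r (time \<tau>)) \<longlongrightarrow> nc * c) at_top" for r
    by (rule filterlim_compose[OF _ filterlim_time]) (unfold W_def, intro tendsto_mult tendsto_const c)
  define V where "V t = nc * (t powr (- \<sigma>) * (deriv I\<^sub>r\<^sub>e\<^sub>s t / (2 * real h * I\<^sub>r\<^sub>e\<^sub>s t)))" for t
  have rate: "\<tau> powr (real M / real N) * r_rate r \<theta> \<zeta> \<tau> =
      W r (time \<tau>) - V (time \<tau>) * (1 + time \<tau> powr (- mu) * r) + nc * (mu * r) * time \<tau> powr (- \<sigma> - mu - 1)" if "0 < \<tau>" for r \<tau>
  proof -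
    define t where "t = time \<tau>"
    have "\<tau> powr (real M / real N) * t powr (1 - nu + mu) = nc * (t powr mu * t powr (1 - nu + mu))"
      unfolding scaling_factor[OF that] t_def nc_def by (simp only: mult.assoc)
    also have "t powr mu * t powr (1 - nu + mu) = t powr (- \<sigma>)"
      unfolding powr_add[symmetric] mu_eq[symmetric] by (simp add: algebra_simps)
    finally have k: "\<tau> powr (real M / real N) * (t powr (1 - nu + mu) * x) = nc * (t powr (- \<sigma>) * x)" for x
      by (simp only: mult.assoc[symmetric])
    have "- \<sigma> - mu - 1 = - \<sigma> + (- mu - 1)" by simp
    then have z: "t powr (- \<sigma> - mu - 1) = t powr (- \<sigma>) * t powr (- mu - 1)" by (simp only: powr_add)
    have distrib: "nc * (x * (P - Q * y + mu * z * r)) = nc * (x * P) - nc * (x * Q) * y + nc * (mu * r) * (x * z)" for x y z P Q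
      by (simp add: algebra_simps)
    show ?thesis
      unfolding r_rate_def Let_def t_def[symmetric] k W_def V_def z by (rule distrib)
  qed
  have lim: "((\<lambda>\<tau>. \<tau> powr (real M / real N) * r_rate r \<theta> \<zeta> \<tau>) \<longlongrightarrow> \<A>c 0 r \<theta> \<zeta>) at_top" for r
  proof (rule power_expansion_limit)
    show "power_expansion 0 (real N) (\<lambda>\<tau>. \<tau> powr (real M / real N) * r_rate r \<theta> \<zeta> \<tau>) (\<lambda>K. \<A>c K r \<theta> \<zeta>)"
      by (rule uniform_power_expansionD[OF A_expansion[of "\<bar>r\<bar> + 1"], of "(r, \<theta>, \<zeta>)", simplified]) linarith+
  qed (use N_pos in simp)
  have neg: "((\<lambda>\<tau>. time \<tau> powr e) \<longlongrightarrow> 0) at_top" if "e < 0" for e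
    by (rule tendsto_neg_powr[OF that filterlim_time])
  have e: "- \<sigma> - mu - 1 < 0" using mu \<sigma> by simp
  \<comment> \<open>The derivative of I is controlled indirectly: the rate at r = 0 converges by its
    expansion, the force term converges too, and \<open>V\<close> is their difference.\<close>
  have V: "((\<lambda>\<tau>. V (time \<tau>)) \<longlongrightarrow> nc * c - \<A>c 0 0 \<theta> \<zeta>) at_top"
  proof (rule Lim_transform_eventually)
    show "((\<lambda>\<tau>. W 0 (time \<tau>) - \<tau> powr (real M / real N) * r_rate 0 \<theta> \<zeta> \<tau>) \<longlongrightarrow> nc * c - \<A>c 0 0 \<theta> \<zeta>) at_top"
      by (intro tendsto_diff W lim)
    show "\<forall>\<^sub>F \<tau> in at_top. W 0 (time \<tau>) - \<tau> powr (real M / real N) * r_rate 0 \<theta> \<zeta> \<tau> = V (time \<tau>)"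
      using eventually_gt_at_top[of 0] by eventually_elim (simp add: rate)
  qed
  have "((\<lambda>\<tau>. \<tau> powr (real M / real N) * r_rate r \<theta> \<zeta> \<tau>) \<longlongrightarrow>
     nc * c - (nc * c - \<A>c 0 0 \<theta> \<zeta>) * (1 + 0 * r) + nc * (mu * r) * 0) at_top"
  proof (rule Lim_transform_eventually)
    show "((\<lambda>\<tau>. W r (time \<tau>) - V (time \<tau>) * (1 + time \<tau> powr (- mu) * r) + nc * (mu * r) * time \<tau> powr (- \<sigma> - mu - 1)) \<longlongrightarrow>
      nc * c - (nc * c - \<A>c 0 0 \<theta> \<zeta>) * (1 + 0 * r) + nc * (mu * r) * 0) at_top"
      using mu by (intro tendsto_add tendsto_diff tendsto_mult tendsto_const W V neg e) simp
    show "\<forall>\<^sub>F \<tau> in at_top. W r (time \<tau>) - V (time \<tau>) * (1 + time \<tau> powr (- mu) * r) + nc * (mu * r) * time \<tau> powr (- \<sigma> - mu - 1)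
       = \<tau> powr (real M / real N) * r_rate r \<theta> \<zeta> \<tau>"
      using eventually_gt_at_top[of 0] by eventually_elim (simp only: rate)
  qed
  with lim[of r] have "\<A>c 0 r \<theta> \<zeta> = nc * c - (nc * c - \<A>c 0 0 \<theta> \<zeta>) * (1 + 0 * r) + nc * (mu * r) * 0"
    by (rule tendsto_unique[OF trivial_limit_at_top_linorder])
  then show ?thesis by simp
qed

end

section \<open>Low orders of the averaging equation\<close>

lemma periodic_constant_deriv:
  fixes w :: "real \<Rightarrow> real"
  assumes w: "\<And>x. w field_differentiable (at x)" and k: "\<And>x. c * deriv w x = k"
    and P: "w P = w 0" "0 < P" and c: "c \<noteq> 0"
  shows "k = 0"
proof -
  have "(w has_real_derivative k / c) (at x)" for x
  proof -
    have "deriv w x = k / c" using k[of x] c by (metis nonzero_mult_div_cancel_left)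
    then show ?thesis using w[of x] by (metis field_differentiable_derivI)
  qed
  then obtain z where "w P - w 0 = (P - 0) * (k / c)" using MVT2[of 0 P w "\<lambda>_. k / c"] P by auto
  then show ?thesis using P c by simp
qed

lemma fps_nth_X_power_mult_less: "n < m \<Longrightarrow> fps_nth (fps_X ^ m * c) n = (0::'a::comm_ring_1)"
  by (simp add: fps_X_power_mult_nth)

lemma taylor_fps_nth_0: "fps_nth (taylor_fps f r \<theta> v w) 0 = f r \<theta>"
  by (simp add: taylor_fps_def partial_derivative_def)

text \<open>Every nontrivial product of v and w is divisible by X^M, so the shift of the arguments
  is felt only from order M on.\<close>

lemma taylor_fps_nth_low:
  assumes "v = fps_X ^ M * v'" "w = fps_X ^ M * w'" "0 < m" "m < M"
  shows "fps_nth (taylor_fps f r \<theta> v w) m = 0"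
proof -
  have "fps_nth (v ^ i * w ^ j) m = 0" for i j
  proof (cases "i + j = 0")
    case True
    then show ?thesis using assms(3) by simp
  next
    case False
    have "v ^ i * w ^ j = fps_X ^ (M * (i + j)) * (v' ^ i * w' ^ j)"
      by (simp add: assms(1,2) power_mult_distrib power_mult power_add add_mult_distrib2 mult_ac)
    moreover have "m < M * (i + j)" using assms(4) False by (cases "i + j") auto
    ultimately show ?thesis by (simp only: fps_nth_X_power_mult_less)
  qed
  then show ?thesis by (simp add: taylor_fps_def)
qed

lemma smooth_on_last_field_differentiable:
  fixes f :: "real \<Rightarrow> real \<Rightarrow> real \<Rightarrow> real"
  assumes "smooth_on UNIV (\<lambda>(r, \<theta>, \<zeta>). f r \<theta> \<zeta>)"
  shows "(\<lambda>\<zeta>. f r \<theta> \<zeta>) field_differentiable (at \<zeta>)"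
proof -
  have "ck_on (Suc 0) UNIV (\<lambda>(r, \<theta>, \<zeta>). f r \<theta> \<zeta>)" using assms unfolding smooth_on_def by blast
  then obtain D where D: "((\<lambda>(r, \<theta>, \<zeta>). f r \<theta> \<zeta>) has_derivative D) (at (r, \<theta>, \<zeta>))"
    by (auto simp only: ck_on.simps differentiable_def)
  have i: "((\<lambda>\<zeta>::real. (r, \<theta>, \<zeta>)) has_derivative (\<lambda>z. (0, 0, z))) (at \<zeta>)"
    by (intro has_derivative_Pair has_derivative_const has_derivative_ident)
  from has_derivative_compose[OF i D]
  have "(\<lambda>\<zeta>. f r \<theta> \<zeta>) differentiable (at \<zeta>)" by (auto simp: differentiable_def)
  then show ?thesis unfolding field_differentiable_def by (metis real_differentiableE)
qed

context averaged_system
begin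

lemma shifted_series_nth: "fps_nth (shifted_series c) (M + K) = c K"
  by (simp add: shifted_series_def fps_X_power_mult_nth)

lemma shifted_series_product_nth:
  assumes "n < 2 * M"
  shows "fps_nth (shifted_series c * shifted_series d) n = 0"
proof -
  have "shifted_series c * shifted_series d = fps_X ^ (2 * M) * (Abs_fps c * Abs_fps d)"
    unfolding shifted_series_def mult_2 power_add by (simp only: mult_ac)
  then show ?thesis using assms by (simp only: fps_nth_X_power_mult_less)
qed

text \<open>Below order 2M the products of two shifted series vanish, and the \<tau>-derivative
  starts beyond N >= 2M; the \<zeta>-derivative is all that is left.\<close>

lemma drift_nth:
  assumes "K < M" "2 * M \<le> N"
  shows "fps_nth (drift c r \<theta> \<zeta>) (M + K) = vartheta * deriv (\<lambda>\<zeta>'. c K r \<theta> \<zeta>') \<zeta>"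
proof -
  have "fps_nth (fps_const (1 / real N) * fps_X ^ (N + 1) * fps_deriv (shifted_series (\<lambda>K. c K r \<theta> \<zeta>))) (M + K) = 0"
    unfolding mult.assoc using assms by (subst fps_mult_left_const_nth, subst fps_nth_X_power_mult_less) auto
  then show ?thesis
    unfolding drift_def fps_add_nth fps_sub_nth fps_mult_left_const_nth shifted_series_nth
    using assms by (simp add: shifted_series_product_nth)
qed

text \<open>A term J < K would need a correction of order K - J < M from the shifted arguments, and
  there is none; a term J > K starts too late.\<close>

lemma averaged_series_nth:
  assumes "K < M"
  shows "fps_nth (averaged_series \<Phi> r \<theta> (shifted_series c) (shifted_series d)) (M + K) = \<Phi> K r \<theta>"
proof -
  have "fps_nth (averaged_series \<Phi> r \<theta> (shifted_series c) (shifted_series d)) (M + K) =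
      (\<Sum>J\<le>M + K. if J = K then \<Phi> K r \<theta> else 0)"
    unfolding averaged_series_def fps_nth_Abs_fps
  proof (intro sum.cong refl)
    fix J assume "J \<in> {..M + K}"
    show "fps_nth (fps_X ^ (M + J) * taylor_fps (\<Phi> J) r \<theta> (shifted_series c) (shifted_series d)) (M + K)
      = (if J = K then \<Phi> K r \<theta> else 0)"
    proof (cases J K rule: linorder_cases)
      case less
      then have "fps_nth (taylor_fps (\<Phi> J) r \<theta> (shifted_series c) (shifted_series d)) (K - J) = 0"
        using assms by (intro taylor_fps_nth_low[OF shifted_series_def shifted_series_def]) auto
      then show ?thesis using less by (simp add: fps_X_power_mult_nth)
    next
      case equal
      then show ?thesis by (simp add: fps_X_power_mult_nth taylor_fps_nth_0)
    next
      case greater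
      then show ?thesis by (simp add: fps_X_power_mult_nth)
    qed
  qed
  also have "\<dots> = \<Phi> K r \<theta>" by simp
  finally show ?thesis .
qed

lemma averaging_low:
  assumes "K < M" "2 * M \<le> N"
  shows "\<A>c K r \<theta> \<zeta> + vartheta * deriv (\<lambda>\<zeta>'. \<rho> K r \<theta> \<zeta>') \<zeta> = \<Lambda> K r \<theta>"
    and "\<B>c K r \<theta> \<zeta> + vartheta * deriv (\<lambda>\<zeta>'. \<psi> K r \<theta> \<zeta>') \<zeta> = \<Omega> K r \<theta>"
  using arg_cong[OF averaging_r[of r \<theta> \<zeta>], of "\<lambda>x. fps_nth x (M + K)"]
    arg_cong[OF averaging_theta[of r \<theta> \<zeta>], of "\<lambda>x. fps_nth x (M + K)"]
  unfolding fps_add_nth drift_nth[OF assms] averaged_series_nth[OF assms(1)] shifted_series_nth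
  by simp_all

text \<open>With \<open>\<B>c\<close> constant in \<zeta>, the \<zeta>-derivative of the periodic
  \<open>\<psi>\<close> is constant as well, hence 0.\<close>

lemma Omega_eq_constant:
  assumes "K < M" "2 * M \<le> N" and B: "\<And>\<zeta>. \<B>c K r \<theta> \<zeta> = k"
  shows "\<Omega> K r \<theta> = k"
proof -
  have "\<Omega> K r \<theta> - k = 0"
  proof (rule periodic_constant_deriv)
    show "(\<lambda>\<zeta>. \<psi> K r \<theta> \<zeta>) field_differentiable (at \<zeta>)" for \<zeta>
      by (rule smooth_on_last_field_differentiable[OF psi_smooth])
    show "vartheta * deriv (\<lambda>\<zeta>. \<psi> K r \<theta> \<zeta>) \<zeta> = \<Omega> K r \<theta> - k" for \<zeta>
      using averaging_low(2)[OF assms(1,2), of r \<theta> \<zeta>] B[of \<zeta>] by simp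
    show "\<psi> K r \<theta> (2 * pi * real \<kappa>) = \<psi> K r \<theta> 0" using psi_periodic(2)[of K r \<theta> 0] by simp
    show "0 < 2 * pi * real \<kappa>" using kappa_pos by simp
    show "vartheta \<noteq> 0" using vartheta_pos by simp
  qed
  then show ?thesis by simp
qed

text \<open>The same argument for the difference of \<open>\<rho>\<close> at r and at 0:
  \<open>\<A>c\<close> itself may vary with \<zeta>, but it cancels in the difference.\<close>

lemma Lambda_0_independent:
  assumes "0 < M" "2 * M \<le> N" and A: "\<And>\<zeta>. \<A>c 0 r \<theta> \<zeta> = \<A>c 0 0 \<theta> \<zeta>"
  shows "\<Lambda> 0 r \<theta> = \<Lambda> 0 0 \<theta>"
proof -
  have diff: "(\<lambda>\<zeta>. \<rho> 0 r \<theta> \<zeta>) field_differentiable (at \<zeta>)" for r \<zeta>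
    by (rule smooth_on_last_field_differentiable[OF rho_smooth])
  have "\<Lambda> 0 r \<theta> - \<Lambda> 0 0 \<theta> = 0"
  proof (rule periodic_constant_deriv)
    show "(\<lambda>\<zeta>. \<rho> 0 r \<theta> \<zeta> - \<rho> 0 0 \<theta> \<zeta>) field_differentiable (at \<zeta>)" for \<zeta>
      by (intro field_differentiable_diff diff)
    show "vartheta * deriv (\<lambda>\<zeta>. \<rho> 0 r \<theta> \<zeta> - \<rho> 0 0 \<theta> \<zeta>) \<zeta> = \<Lambda> 0 r \<theta> - \<Lambda> 0 0 \<theta>" for \<zeta>
      unfolding deriv_diff[OF diff diff] right_diff_distrib
      using averaging_low(1)[OF assms(1,2), of r \<theta> \<zeta>] averaging_low(1)[OF assms(1,2), of 0 \<theta> \<zeta>] A[of \<zeta>] by simp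
    show "\<rho> 0 r \<theta> (2 * pi * real \<kappa>) - \<rho> 0 0 \<theta> (2 * pi * real \<kappa>) = \<rho> 0 r \<theta> 0 - \<rho> 0 0 \<theta> 0"
      using rho_periodic(2)[of 0 r \<theta> 0] rho_periodic(2)[of 0 0 \<theta> 0] by simp
    show "0 < 2 * pi * real \<kappa>" using kappa_pos by simp
    show "vartheta \<noteq> 0" using vartheta_pos by simp
  qed
  then show ?thesis by simp
qed

end

section \<open>Application to the averaged system\<close>

context averaged_system
begin

lemma truncated_averaged_system:
  assumes \<sigma>: "-1 \<le> \<sigma>" "\<sigma> < real b / real q" and L: "M + L \<le> N" "L < 2 * M" "L \<le> n"
    and phi0: "\<Lambda> L 0 \<phi>\<^sub>0 = 0" "deriv (\<lambda>\<phi>. \<Lambda> L 0 \<phi>) \<phi>\<^sub>0 \<noteq> 0"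
  shows "truncated_system (\<lambda>K (r, \<theta>). \<Lambda> K r \<theta>) (\<lambda>K (r, \<theta>). \<Omega> K r \<theta>) L M N n \<phi>\<^sub>0
    (nu powr (- (mu / nu)) * ((real h - 1) * vartheta / real \<kappa>))"
proof unfold_locales
  have mu: "0 < mu" using \<sigma> by (simp add: mu_def)
  show "1 \<le> M" by (rule M_pos[OF mu])
  show "2 * M \<le> N" by (rule double_M_le[OF \<sigma>(1)])
  \<comment> \<open>The chain rule along the line r = 0 turns the slope given by
    \<open>deriv\<close> into the partial derivative of the locale.\<close>
  have D: "((\<lambda>\<phi>. (\<lambda>(r, \<theta>). \<Lambda> L r \<theta>) (0, \<phi>)) has_real_derivative
      partial1 (\<lambda>(r, \<theta>). \<Lambda> L r \<theta>) (0, \<phi>\<^sub>0) * 0 + partial2 (\<lambda>(r, \<theta>). \<Lambda> L r \<theta>) (0, \<phi>\<^sub>0) * 1) (at \<phi>\<^sub>0)"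
    by (rule smooth_on_compose_deriv[OF Lambda_smooth]) (auto intro!: derivative_eq_intros)
  from DERIV_imp_deriv[OF D] phi0(2) show "partial2 (\<lambda>(r, \<theta>). \<Lambda> L r \<theta>) (0, \<phi>\<^sub>0) \<noteq> 0" by simp
  show "(\<lambda>(r, \<theta>). \<Omega> 0 r \<theta>) (r, \<phi>) = nu powr (- (mu / nu)) * ((real h - 1) * vartheta / real \<kappa>) * r" for r \<phi>
    using Omega_eq_constant[OF _ double_M_le[OF \<sigma>(1)] Bc_0[OF mu \<sigma>(1)]] M_pos[OF mu] by simp
  show "nu powr (- (mu / nu)) * ((real h - 1) * vartheta / real \<kappa>) \<noteq> 0"
    using nu_pos h_ge_2 vartheta_pos kappa_pos by simp
  show "(\<lambda>(r, \<theta>). \<Omega> K r \<theta>) (0, \<phi>) = 0" if "K < M" for K \<phi>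
    using Omega_eq_constant[OF that double_M_le[OF \<sigma>(1)] Bc_low[OF mu \<sigma>(1) that]] by simp
  show "(\<lambda>(r, \<theta>). \<Lambda> 0 r \<theta>) (r, \<phi>) = (\<lambda>(r, \<theta>). \<Lambda> 0 r \<theta>) (0, \<phi>)" for r \<phi>
    using Lambda_0_independent[OF _ double_M_le[OF \<sigma>(1)] Ac_0[OF mu \<sigma>(1)]] M_pos[OF mu] by simp
qed (use assms Lambda_smooth Omega_smooth in simp_all)

lemma truncated_solution:
  assumes \<sigma>: "-1 \<le> \<sigma>" "\<sigma> < real b / real q" and L: "M + L \<le> N" "L < 2 * M" "L \<le> n"
    and phi0: "\<Lambda> L 0 \<phi>\<^sub>0 = 0" "deriv (\<lambda>\<phi>. \<Lambda> L 0 \<phi>) \<phi>\<^sub>0 \<noteq> 0"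
  shows "\<exists>\<tau>\<^sub>0>0. \<exists>(R :: real \<Rightarrow> real) (\<Phi> :: real \<Rightarrow> real) (Rc :: nat \<Rightarrow> real) (\<Phi>c :: nat \<Rightarrow> real).
      (\<forall>\<tau>>\<tau>\<^sub>0.
         (R has_real_derivative
            (\<Sum>K = L..n. \<tau> powr (- real (M + K) / real N) * \<Lambda> K (R \<tau>) (\<Phi> \<tau>))) (at \<tau>) \<and>
         (\<Phi> has_real_derivative
            (\<Sum>K = 0..n. \<tau> powr (- real (M + K) / real N) * \<Omega> K (R \<tau>) (\<Phi> \<tau>))) (at \<tau>)) \<and>
      power_expansion (- real M / real N) (real N) R Rc \<and>
      power_expansion 0 (real N) \<Phi> \<Phi>c \<and> \<Phi>c 0 = \<phi>\<^sub>0"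
proof -
  interpret ts: truncated_system "\<lambda>K (r, \<theta>). \<Lambda> K r \<theta>" "\<lambda>K (r, \<theta>). \<Omega> K r \<theta>" L M N n \<phi>\<^sub>0
    "nu powr (- (mu / nu)) * ((real h - 1) * vartheta / real \<kappa>)"
    by (rule truncated_averaged_system[OF assms])
  obtain rc pc where formal:
    "\<And>m. ts.defect1 (ts.approx1 rc m) (ts.approx2 pc m) \<in> O[at_right 0](\<lambda>z. z ^ (M + L + m + 1))"
    "\<And>m. ts.defect2 (ts.approx1 rc m) (ts.approx2 pc m) \<in> O[at_right 0](\<lambda>z. z ^ (2 * M + m))"
    using ts.formal_solution by blast
  interpret fa: formal_approximation "\<lambda>K (r, \<theta>). \<Lambda> K r \<theta>" "\<lambda>K (r, \<theta>). \<Omega> K r \<theta>" L M N n \<phi>\<^sub>0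
    "nu powr (- (mu / nu)) * ((real h - 1) * vartheta / real \<kappa>)" rc pc
    by (intro formal_approximation.intro ts.truncated_system_axioms formal_approximation_axioms.intro formal)
  obtain R \<Phi> \<tau>\<^sub>0 where \<tau>\<^sub>0: "0 < \<tau>\<^sub>0"
    and ode: "\<And>\<tau>. \<tau>\<^sub>0 < \<tau> \<Longrightarrow> (R has_real_derivative ts.rhs1 (ts.scale \<tau>) (R \<tau>, \<Phi> \<tau>)) (at \<tau>)"
      "\<And>\<tau>. \<tau>\<^sub>0 < \<tau> \<Longrightarrow> (\<Phi> has_real_derivative ts.rhs2 (ts.scale \<tau>) (R \<tau>, \<Phi> \<tau>)) (at \<tau>)"
    and asymp: "\<And>m. (\<lambda>\<tau>. R \<tau> - ts.approx1 rc m (ts.scale \<tau>)) \<in> O(\<lambda>\<tau>. \<tau> powr (- real (M + m) / real N))"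
      "\<And>m. (\<lambda>\<tau>. \<Phi> \<tau> - ts.approx2 pc m (ts.scale \<tau>)) \<in> O(\<lambda>\<tau>. \<tau> powr (- real (m + 1) / real N))"
    using fa.exact_solution by blast
  \<comment> \<open>An index shift: \<open>pc 0\<close> belongs to the first power of z, while the
    expansion counts \<open>\<phi>\<^sub>0\<close> as its term 0.\<close>
  define \<Phi>c where "\<Phi>c k = (case k of 0 \<Rightarrow> \<phi>\<^sub>0 | Suc j \<Rightarrow> pc j)" for k
  show ?thesis
  proof (intro exI conjI allI impI)
    show "0 < \<tau>\<^sub>0" by (rule \<tau>\<^sub>0)
    fix \<tau> assume \<tau>: "\<tau>\<^sub>0 < \<tau>"
    then have pos: "0 < \<tau>" using \<tau>\<^sub>0 by simp
    show "(R has_real_derivative (\<Sum>K = L..n. \<tau> powr (- real (M + K) / real N) * \<Lambda> K (R \<tau>) (\<Phi> \<tau>))) (at \<tau>)"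
      using ode(1)[OF \<tau>] unfolding ts.rhs1_def ts.scale_power[OF pos] by simp
    show "(\<Phi> has_real_derivative (\<Sum>K = 0..n. \<tau> powr (- real (M + K) / real N) * \<Omega> K (R \<tau>) (\<Phi> \<tau>))) (at \<tau>)"
      using ode(2)[OF \<tau>] unfolding ts.rhs2_def ts.scale_power[OF pos] by simp
  next
    have e: "- real M / real N - real k / real N = - real (M + k) / real N" for k
      by (simp add: add_divide_distrib diff_divide_distrib)
    show "power_expansion (- real M / real N) (real N) R rc"
      unfolding power_expansion_def e
    proof
      fix m
      from asymp(1)[of m] obtain C where "\<forall>\<^sub>F \<tau> in at_top. norm (R \<tau> - ts.approx1 rc m (ts.scale \<tau>)) \<le> C * norm (\<tau> powr (- real (M + m) / real N))"
        by (elim landau_o.bigE) auto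
      then have "\<forall>\<^sub>F \<tau> in at_top. \<bar>R \<tau> - (\<Sum>k<m. rc k * \<tau> powr (- real (M + k) / real N))\<bar> \<le> C * \<tau> powr (- real (M + m) / real N)"
        using eventually_gt_at_top[of 0]
      proof eventually_elim
        case (elim \<tau>)
        show ?case using elim(1) unfolding ts.approx1_def ts.scale_power[OF elim(2)] by simp
      qed
      then show "\<exists>C. \<forall>\<^sub>F \<tau> in at_top. \<bar>R \<tau> - (\<Sum>k<m. rc k * \<tau> powr (- real (M + k) / real N))\<bar> \<le> C * \<tau> powr (- real (M + m) / real N)" ..
    qed
  next
    have e: "0 - real k / real N = - real k / real N" for k by simp
    have bound: "\<exists>C. \<forall>\<^sub>F \<tau> in at_top. \<bar>\<Phi> \<tau> - (\<Sum>k<Suc m. \<Phi>c k * \<tau> powr (- real k / real N))\<bar> \<le> C * \<tau> powr (- real (Suc m) / real N)" for m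
    proof -
      from asymp(2)[of m] obtain C where "\<forall>\<^sub>F \<tau> in at_top. norm (\<Phi> \<tau> - ts.approx2 pc m (ts.scale \<tau>)) \<le> C * norm (\<tau> powr (- real (m + 1) / real N))"
        by (elim landau_o.bigE) auto
      then have "\<forall>\<^sub>F \<tau> in at_top. \<bar>\<Phi> \<tau> - (\<Sum>k<Suc m. \<Phi>c k * \<tau> powr (- real k / real N))\<bar> \<le> C * \<tau> powr (- real (Suc m) / real N)"
        using eventually_gt_at_top[of 0]
      proof eventually_elim
        case (elim \<tau>)
        have "(\<Sum>k<Suc m. \<Phi>c k * \<tau> powr (- real k / real N)) = ts.approx2 pc m (ts.scale \<tau>)"
          unfolding ts.approx2_def ts.scale_power[OF elim(2)] sum.lessThan_Suc_shift using elim(2) by (simp add: \<Phi>c_def)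
        then show ?case using elim(1) by simp
      qed
      then show ?thesis ..
    qed
    show "power_expansion 0 (real N) \<Phi> \<Phi>c"
      unfolding power_expansion_def e
    proof
      fix m
      show "\<exists>C. \<forall>\<^sub>F \<tau> in at_top. \<bar>\<Phi> \<tau> - (\<Sum>k<m. \<Phi>c k * \<tau> powr (- real k / real N))\<bar> \<le> C * \<tau> powr (- real m / real N)"
      \<comment> \<open>The estimates of the solution start with one term. For the empty sum mere
        boundedness is asked, and the first of them gives it.\<close>
      proof (cases m)
        case 0
        obtain C where C: "\<forall>\<^sub>F \<tau> in at_top. \<bar>\<Phi> \<tau> - (\<Sum>k<Suc 0. \<Phi>c k * \<tau> powr (- real k / real N))\<bar> \<le> C * \<tau> powr (- real (Suc 0) / real N)"
          using bound by blast
        have "\<forall>\<^sub>F \<tau> in at_top. \<bar>\<Phi> \<tau>\<bar> \<le> \<bar>\<phi>\<^sub>0\<bar> + \<bar>C\<bar>"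
          using C eventually_ge_at_top[of 1]
        proof eventually_elim
          case (elim \<tau>)
          have "C * \<tau> powr (- real (Suc 0) / real N) \<le> \<bar>C\<bar> * 1"
            using elim(2) powr_mono[of "- real (Suc 0) / real N" 0 \<tau>] by (intro mult_mono) auto
          then show ?case using elim by (simp add: \<Phi>c_def)
        qed
        then have "\<forall>\<^sub>F \<tau> in at_top. \<bar>\<Phi> \<tau> - (\<Sum>k<m. \<Phi>c k * \<tau> powr (- real k / real N))\<bar> \<le> (\<bar>\<phi>\<^sub>0\<bar> + \<bar>C\<bar>) * \<tau> powr (- real m / real N)"
          using eventually_gt_at_top[of 0] by eventually_elim (simp add: 0)
        then show ?thesis ..
      next
        case (Suc j)
        show ?thesis unfolding Suc by (rule bound)
      qed
    qed
    show "\<Phi>c 0 = \<phi>\<^sub>0" by (simp add: \<Phi>c_def)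
  qed
qed

end

theorem lemma4:
  fixes h a b q l p \<kappa> M N L :: nat
    and s \<sigma> E\<^sub>0 E\<^sub>1 t\<^sub>1 \<phi>\<^sub>0 :: real
    and \<Lambda> \<Omega> :: "nat \<Rightarrow> real \<Rightarrow> real \<Rightarrow> real"
  assumes setting: "averaged_system h a b q l p s \<sigma> u f g A B E\<^sub>0 x\<^sub>0 y\<^sub>0 T Xc Yc \<omega>c
      \<kappa> E\<^sub>1 t\<^sub>1 I\<^sub>r\<^sub>e\<^sub>s M N \<A>c \<B>c \<Lambda> \<Omega> \<rho> \<psi>"
    and sigma: "\<sigma> = real b / real q * (real l - 1 + (real p - 1) / (real h - 1)) - real a / real q"
      "-1 \<le> \<sigma>" "\<sigma> < real b / real q"
    and L_le: "int L \<le> min (int N - int M) (2 * int M - 1)"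
    and Lambda_below: "\<forall>K<L. \<forall>r \<theta>. \<Lambda> K r \<theta> = 0"
    and Lambda_L: "\<exists>r \<theta>. \<Lambda> L r \<theta> \<noteq> 0"
    and phi0: "\<Lambda> L 0 \<phi>\<^sub>0 = 0" "deriv (\<lambda>\<phi>. \<Lambda> L 0 \<phi>) \<phi>\<^sub>0 \<noteq> 0"
  shows "\<exists>n\<^sub>0\<ge>L. \<forall>n\<ge>n\<^sub>0. \<exists>\<tau>\<^sub>0>0. \<exists>(R :: real \<Rightarrow> real) (\<Phi> :: real \<Rightarrow> real)
           (Rc :: nat \<Rightarrow> real) (\<Phi>c :: nat \<Rightarrow> real).
      (\<forall>\<tau>>\<tau>\<^sub>0.
         (R has_real_derivative
            (\<Sum>K = L..n. \<tau> powr (- real (M + K) / real N) * \<Lambda> K (R \<tau>) (\<Phi> \<tau>))) (at \<tau>) \<and>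
         (\<Phi> has_real_derivative
            (\<Sum>K = 0..n. \<tau> powr (- real (M + K) / real N) * \<Omega> K (R \<tau>) (\<Phi> \<tau>))) (at \<tau>)) \<and>
      power_expansion (- real M / real N) (real N) R Rc \<and>
      power_expansion 0 (real N) \<Phi> \<Phi>c \<and> \<Phi>c 0 = \<phi>\<^sub>0"
proof -
  interpret averaged_system h a b q l p s \<sigma> u f g A B E\<^sub>0 x\<^sub>0 y\<^sub>0 T Xc Yc \<omega>c
      \<kappa> E\<^sub>1 t\<^sub>1 I\<^sub>r\<^sub>e\<^sub>s M N \<A>c \<B>c \<Lambda> \<Omega> \<rho> \<psi>
    by (rule setting)
  have "M + L \<le> N" "L < 2 * M" using L_le by auto
  \<comment> \<open>The threshold is L itself: a longer truncation alters later coefficients, but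
    not the conditions under which they are solvable.\<close>
  from truncated_solution[OF sigma(2,3) this _ phi0] show ?thesis by (intro exI[of _ L]) auto
qed

end
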